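(* Let $n\in\mathbb{Z}_{>0}$, $p\in[1,\infty]$, $q\in[1,\infty]$, $\sigma\in\mathbb{R}_{>0}$, $j_0\in\mathbb{Z}$, $r_0\in\mathbb{R}_{>0}$ and $n/p<\sigma<r_0$. Let $\varphi^{[n]}$ be the scaling function of a compactly supported interpolating tensor product MRA of $C_u(\mathbb{R}^n)$ and suppose that $\varphi^{[n]}\in C^{r_0}(\mathbb{R}^n)$. Let $B$ be the normed space $B^\sigma_{p,q}(\mathbb{R}^n)\cap C_u(\mathbb{R}^n)$ equipped with some Besov space norm (i.e. some norm of $B^\sigma_{p,q}(\mathbb{R}^n)$). Then $\|\cdot\|^{(\mathrm{i})}$ and $\|\cdot\|^{(\mathrm{w})}$ are equivalent to the norm of $B$ and they characterize $B$ on $C_u(\mathbb{R}^n)$.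
   Context: $C_u(\mathbb{R}^n)$ is the Banach space of bounded uniformly continuous functions $\mathbb{R}^n\to\mathbb{C}$ with the supremum norm. Convention: $n/\infty=0$, $1/\infty=0$; $L^p$, $\ell^p$ and $\ell^q$ norms take the value $\infty$ when not finite. Interpolating MRA. $\varphi:\mathbb{R}\to\mathbb{C}$ is continuous and compactly supported with $\varphi(k)=\delta_{k,0}$ for all $k\in\mathbb{Z}$ and $\varphi(x)=\sum_{k\in\mathbb{Z}}\varphi(k/2)\varphi(2x-k)$ for all $x\in\mathbb{R}$. The scaling function of the tensor product MRA is $\varphi^{[n]}(x)=\prod_{i=1}^n\varphi(x_i)$, $x\in\mathbb{R}^n$. For $j\in\mathbb{Z}$ and $f\in C_u(\mathbb{R}^n)$ put $(P_jf)(x)=\sum_{k\in\mathbb{Z}^n}f(k/2^j)\,\varphi^{[n]}(2^jx-k)$ and $Q_jf=P_{j+1}f-P_jf$. Define $$\|f\|^{(\mathrm{i})}=\|P_{j_0}f\|_{L^p(\mathbb{R}^n)}+\Bigl\|\bigl(2^{j\sigma}\|Q_jf\|_{L^p(\mathbb{R}^n)}\bigr)_{j\ge j_0}\Bigr\|_{\ell^q}\in[0,\infty].$$ Dual functionals. Put $\tilde g_{0,l}=\delta_{l,0}$ and $\tilde g_{1,l}=(-1)^{l-1}\varphi\bigl(\tfrac{1-l}{2}\bigr)$ for $l\in\mathbb{Z}$, and for $s\in\{0,1\}^n$, $l\in\mathbb{Z}^n$ put $\tilde g^{[n]}_{s,l}=\prod_{i=1}^n\tilde g_{s_i,l_i}$.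 For $s\in\{0,1\}^n$, $j\in\mathbb{Z}$, $k\in\mathbb{Z}^n$ the dual wavelet $\tilde\psi^{[n]}_{s,j,k}$ is the functional $\langle\tilde\psi^{[n]}_{s,j,k},f\rangle=\sum_{l\in\mathbb{Z}^n}\tilde g^{[n]}_{s,l}\,f\bigl(\tfrac{2k+l}{2^{j+1}}\bigr)$ (a finite sum), and the dual scaling function is $\langle\tilde\varphi^{[n]}_{j,k},f\rangle=f(k/2^j)$. Let $J_+(n)=\{0,1\}^n\setminus\{(0,\dots,0)\}$ and $$\|f\|^{(\mathrm{w})}=\Bigl\|\bigl(\langle\tilde\varphi^{[n]}_{j_0,k},f\rangle\bigr)_{k\in\mathbb{Z}^n}\Bigr\|_{\ell^p}+\Bigl\|\Bigl(2^{(\sigma-\frac np)j}\bigl\|(\langle\tilde\psi^{[n]}_{s,j,k},f\rangle)_{s\in J_+(n),k\in\mathbb{Z}^n}\bigr\|_{\ell^p}\Bigr)_{j\ge j_0}\Bigr\|_{\ell^q}\in[0,\infty].$$ Function spaces. For $m\in\mathbb{Z}_{\ge0}$, $C^m(\mathbb{R}^n)$ is the space of functions with bounded uniformly continuous partial derivatives up to order $m$; for non-integer $r>0$, $C^r(\mathbb{R}^n)$ is the Hölder space of functions in $C^{\lfloor r\rfloor}(\mathbb{R}^n)$ whose derivatives of order $\lfloor r\rfloor$ are Hölder continuous with exponent $r-\lfloor r\rfloor$. With $(\Delta_hf)(x)=f(x+h)-f(x)$, $\Delta_h^m$ its $m$-th iterate, $\omega^m_p(f;t)=\sup_{|h|\le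 t}\|\Delta^m_hf\|_{L^p}$, and an integer $m>s>0$, the Besov space $B^s_{p,q}(\mathbb{R}^n)$ consists of the Borel functions $f$ with $\|f\|_{L^p(\mathbb{R}^n)}+\|t\mapsto t^{-s-1/q}\omega^m_p(f;t)\|_{L^q(]0,1[)}<\infty$, and this expression is one of its (equivalent) norms. A norm $\|\cdot\|$ with values in $[0,\infty]$ defined on a set $E$ containing a vector space $A$ characterizes $A$ on $E$ iff $\|x\|<\infty$ for all $x\in A$ and $\|y\|=\infty$ for all $y\in E\setminus A$. *)

theory Defs
  imports "HOL-Analysis.Analysis" "HOL-Probability.Essential_Supremum"
begin

section \<open>\<open>L\<^sup>p\<close> and \<open>\<ell>\<^sup>p\<close> norms with values in \<open>[0,\<infinity>]\<close>\<close>

text \<open>Exponents range over \<^typ>\<open>ennreal\<close>, so that \<open>p = \<infinity>\<close> is included and \<open>1/\<infinity> = 0\<close>.\<close>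

definition recip :: "ennreal \<Rightarrow> real" where
  "recip p = enn2real (1 / p)"

text \<open>Only meant for \<open>a > 0\<close>.\<close>

definition ennreal_powr :: "ennreal \<Rightarrow> real \<Rightarrow> ennreal" where
  "ennreal_powr x a = (if x = \<infinity> then \<infinity> else ennreal (enn2real x powr a))"

text \<open>The functions are allowed to take the value \<open>\<infinity>\<close>, as a modulus of smoothness may do.
  With \<^term>\<open>count_space A\<close> as the measure this is the \<open>\<ell>\<^sup>p\<close> norm over the index set \<open>A\<close>.\<close>

definition Lnorm :: "ennreal \<Rightarrow> 'a measure \<Rightarrow> ('a \<Rightarrow> ennreal) \<Rightarrow> ennreal" where
  "Lnorm p M g =
     (if p = \<infinity> then esssup M g
      else ennreal_powr (\<integral>\<^sup>+ x. ennreal_powr (g x) (enn2real p) \<partial>M) (recip p))"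

definition Lp_norm :: "ennreal \<Rightarrow> 'a measure \<Rightarrow> ('a \<Rightarrow> complex) \<Rightarrow> ennreal" where
  "Lp_norm p M f = Lnorm p M (\<lambda>x. ennreal (cmod (f x)))"


section \<open>Function spaces\<close>

definition C_u :: "(real ^ 'n \<Rightarrow> complex) set" where
  "C_u = {f. bounded (range f) \<and> uniformly_continuous_on UNIV f}"

definition has_partial :: "'n \<Rightarrow> (real ^ 'n \<Rightarrow> complex) \<Rightarrow> bool" where
  "has_partial i f \<longleftrightarrow> (\<forall>x. (\<lambda>t. f (x + t *\<^sub>R axis i 1)) differentiable (at (0::real)))"

definition partial :: "'n \<Rightarrow> (real ^ 'n \<Rightarrow> complex) \<Rightarrow> real ^ 'n \<Rightarrow> complex" where
  "partial i f x = vector_derivative (\<lambda>t. f (x + t *\<^sub>R axis i 1)) (at (0::real))"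

primrec C_int :: "nat \<Rightarrow> (real ^ 'n \<Rightarrow> complex) set" where
  "C_int 0 = C_u"
| "C_int (Suc m) = {f \<in> C_u. \<forall>i. has_partial i f \<and> partial i f \<in> C_int m}"

definition holder_continuous :: "real \<Rightarrow> (real ^ 'n \<Rightarrow> complex) \<Rightarrow> bool" where
  "holder_continuous a f \<longleftrightarrow> (\<exists>C. \<forall>x y. cmod (f x - f y) \<le> C * norm (x - y) powr a)"

text \<open>\<^term>\<open>foldr partial is f\<close> is the iterated partial derivative along the list of
  directions \<open>is\<close>.\<close>

definition C_real :: "real \<Rightarrow> (real ^ 'n \<Rightarrow> complex) set" where
  "C_real r =
     (if r \<in> \<int> then C_int (nat \<lfloor>r\<rfloor>)
      else {f \<in> C_int (nat \<lfloor>r\<rfloor>).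
              \<forall>is. length is = nat \<lfloor>r\<rfloor> \<longrightarrow> holder_continuous (frac r) (foldr partial is f)})"

definition fdiff :: "real ^ 'n \<Rightarrow> (real ^ 'n \<Rightarrow> complex) \<Rightarrow> real ^ 'n \<Rightarrow> complex" where
  "fdiff h f x = f (x + h) - f x"

definition modulus :: "nat \<Rightarrow> ennreal \<Rightarrow> (real ^ 'n \<Rightarrow> complex) \<Rightarrow> real \<Rightarrow> ennreal" where
  "modulus m p f t = (SUP h\<in>{h. norm h \<le> t}. Lp_norm p lborel ((fdiff h ^^ m) f))"

definition besov_expr ::
    "nat \<Rightarrow> real \<Rightarrow> ennreal \<Rightarrow> ennreal \<Rightarrow> (real ^ 'n \<Rightarrow> complex) \<Rightarrow> ennreal" where
  "besov_expr m s p q f =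
     Lp_norm p lborel f +
     Lnorm q (restrict_space lborel {0<..<1})
       (\<lambda>t. ennreal (t powr (- s - recip q)) * modulus m p f t)"

text \<open>The order \<open>m\<close> of the differences is any integer greater than \<open>s\<close>. The elements are
  functions, not classes of functions modulo equality almost everywhere.\<close>

definition besov_space ::
    "nat \<Rightarrow> real \<Rightarrow> ennreal \<Rightarrow> ennreal \<Rightarrow> (real ^ 'n \<Rightarrow> complex) set" where
  "besov_space m s p q = {f \<in> borel_measurable borel. besov_expr m s p q f < \<infinity>}"


section \<open>Norms with values in \<open>[0,\<infinity>]\<close>\<close>

definition fun_subspace :: "('a \<Rightarrow> complex) set \<Rightarrow> bool" where
  "fun_subspace A \<longleftrightarrow>
     (\<lambda>x. 0) \<in> A \<and> (\<forall>f\<in>A. \<forall>g\<in>A. (\<lambda>x. f x + g x) \<in> A) \<and> (\<forall>c. \<forall>f\<in>A. (\<lambda>x. c * f x) \<in> A)"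

definition ext_seminorm_on :: "('a \<Rightarrow> complex) set \<Rightarrow> (('a \<Rightarrow> complex) \<Rightarrow> ennreal) \<Rightarrow> bool" where
  "ext_seminorm_on E N \<longleftrightarrow>
     (\<forall>f\<in>E. \<forall>g\<in>E. N (\<lambda>x. f x + g x) \<le> N f + N g) \<and>
     (\<forall>c. \<forall>f\<in>E. N (\<lambda>x. c * f x) = ennreal (cmod c) * N f)"

definition ext_norm_on :: "('a \<Rightarrow> complex) set \<Rightarrow> (('a \<Rightarrow> complex) \<Rightarrow> ennreal) \<Rightarrow> bool" where
  "ext_norm_on E N \<longleftrightarrow> ext_seminorm_on E N \<and> (\<forall>f\<in>E. N f = 0 \<longrightarrow> f = (\<lambda>x. 0))"

definition equivalent_on ::
    "('a \<Rightarrow> complex) set \<Rightarrow> (('a \<Rightarrow> complex) \<Rightarrow> ennreal) \<Rightarrow> (('a \<Rightarrow> complex) \<Rightarrow> ennreal) \<Rightarrow> bool" where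
  "equivalent_on A N N' \<longleftrightarrow>
     (\<exists>c>0. \<exists>C>0. \<forall>f\<in>A. ennreal c * N f \<le> N' f \<and> N' f \<le> ennreal C * N f)"

definition characterizes ::
    "(('a \<Rightarrow> complex) \<Rightarrow> ennreal) \<Rightarrow> ('a \<Rightarrow> complex) set \<Rightarrow> ('a \<Rightarrow> complex) set \<Rightarrow> bool" where
  "characterizes N A E \<longleftrightarrow>
     ext_norm_on E N \<and> fun_subspace A \<and> A \<subseteq> E \<and>
     (\<forall>f\<in>A. N f < \<infinity>) \<and> (\<forall>f\<in>E - A. N f = \<infinity>)"

text \<open>On classes of functions modulo equality almost everywhere these are exactly the norms
  equivalent to \<^const>\<open>besov_expr\<close>; on functions they vanish on the null functions, which is why
  only a seminorm is asked for.\<close>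

definition is_besov_norm ::
    "nat \<Rightarrow> real \<Rightarrow> ennreal \<Rightarrow> ennreal \<Rightarrow> ((real ^ 'n \<Rightarrow> complex) \<Rightarrow> ennreal) \<Rightarrow> bool" where
  "is_besov_norm m s p q N \<longleftrightarrow>
     ext_seminorm_on (besov_space m s p q) N \<and>
     equivalent_on (besov_space m s p q) (besov_expr m s p q) N"


section \<open>Interpolating multiresolution analysis\<close>

text \<open>All sums over \<open>\<int>\<close> and \<open>\<int>\<^sup>n\<close> below have only finitely many nonzero terms when the scaling
  function has compact support.\<close>

definition interpolating_scaling :: "(real \<Rightarrow> complex) \<Rightarrow> bool" where
  "interpolating_scaling \<phi> \<longleftrightarrow>
     continuous_on UNIV \<phi> \<and>
     compact (closure {x. \<phi> x \<noteq> 0}) \<and>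
     (\<forall>k::int. \<phi> (of_int k) = (if k = 0 then 1 else 0)) \<and>
     (\<forall>x. \<phi> x = (\<Sum>\<^sub>\<infinity>k::int. \<phi> (of_int k / 2) * \<phi> (2 * x - of_int k)))"

definition tensor :: "(real \<Rightarrow> complex) \<Rightarrow> real ^ 'n \<Rightarrow> complex" where
  "tensor \<phi> x = (\<Prod>i\<in>UNIV. \<phi> (x $ i))"

definition dyadic :: "int \<Rightarrow> int ^ 'n \<Rightarrow> real ^ 'n" where
  "dyadic j k = (\<chi> i. of_int (k $ i) / 2 powi j)"

definition P_op ::
    "(real \<Rightarrow> complex) \<Rightarrow> int \<Rightarrow> (real ^ 'n \<Rightarrow> complex) \<Rightarrow> real ^ 'n \<Rightarrow> complex" where
  "P_op \<phi> j f x =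
     (\<Sum>\<^sub>\<infinity>k::int ^ 'n. f (dyadic j k) * tensor \<phi> (\<chi> i. 2 powi j * x $ i - of_int (k $ i)))"

definition Q_op ::
    "(real \<Rightarrow> complex) \<Rightarrow> int \<Rightarrow> (real ^ 'n \<Rightarrow> complex) \<Rightarrow> real ^ 'n \<Rightarrow> complex" where
  "Q_op \<phi> j f x = P_op \<phi> (j + 1) f x - P_op \<phi> j f x"

definition norm_i ::
    "(real \<Rightarrow> complex) \<Rightarrow> ennreal \<Rightarrow> ennreal \<Rightarrow> real \<Rightarrow> int \<Rightarrow> (real ^ 'n \<Rightarrow> complex) \<Rightarrow> ennreal" where
  "norm_i \<phi> p q \<sigma> j0 f =
     Lp_norm p lborel (P_op \<phi> j0 f) +
     Lnorm q (count_space {j0..})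
       (\<lambda>j. ennreal (2 powr (of_int j * \<sigma>)) * Lp_norm p lborel (Q_op \<phi> j f))"

text \<open>The filter index \<open>s \<in> {0,1}\<close> is a natural number.\<close>

definition dual_filter :: "(real \<Rightarrow> complex) \<Rightarrow> nat \<Rightarrow> int \<Rightarrow> complex" where
  "dual_filter \<phi> s l =
     (if s = 0 then (if l = 0 then 1 else 0)
      else (- 1) powi (l - 1) * \<phi> ((1 - of_int l) / 2))"

definition dual_filter_tensor :: "(real \<Rightarrow> complex) \<Rightarrow> nat ^ 'n \<Rightarrow> int ^ 'n \<Rightarrow> complex" where
  "dual_filter_tensor \<phi> s l = (\<Prod>i\<in>UNIV. dual_filter \<phi> (s $ i) (l $ i))"

definition dual_wavelet ::
    "(real \<Rightarrow> complex) \<Rightarrow> nat ^ 'n \<Rightarrow> int \<Rightarrow> int ^ 'n \<Rightarrow> (real ^ 'n \<Rightarrow> complex) \<Rightarrow> complex" where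
  "dual_wavelet \<phi> s j k f =
     (\<Sum>\<^sub>\<infinity>l::int ^ 'n. dual_filter_tensor \<phi> s l * f (dyadic (j + 1) (\<chi> i. 2 * k $ i + l $ i)))"

definition dual_scaling :: "int \<Rightarrow> int ^ 'n \<Rightarrow> (real ^ 'n \<Rightarrow> complex) \<Rightarrow> complex" where
  "dual_scaling j k f = f (dyadic j k)"

definition J_plus :: "(nat ^ 'n) set" where
  "J_plus = {s. (\<forall>i. s $ i \<in> {0, 1}) \<and> s \<noteq> 0}"

definition norm_w ::
    "(real \<Rightarrow> complex) \<Rightarrow> ennreal \<Rightarrow> ennreal \<Rightarrow> real \<Rightarrow> int \<Rightarrow> (real ^ 'n \<Rightarrow> complex) \<Rightarrow> ennreal" where
  "norm_w \<phi> p q \<sigma> j0 f =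
     Lp_norm p (count_space UNIV) (\<lambda>k. dual_scaling j0 k f) +
     Lnorm q (count_space {j0..})
       (\<lambda>j. ennreal (2 powr ((\<sigma> - real CARD('n) * recip p) * of_int j)) *
            Lp_norm p (count_space (J_plus \<times> UNIV)) (\<lambda>(s, k). dual_wavelet \<phi> s j k f))"

end

theory Submission
  imports Defs "HOL-Probability.Probability_Measure"
begin

text \<open>
  All three expressions, \<^const>\<open>besov_expr\<close>, \<^const>\<open>norm_i\<close> and \<^const>\<open>norm_w\<close>, take values in
  \<open>[0, \<infinity>]\<close>. The theorem follows from a cycle of inequalities between them, valid for every \<open>f\<close> in
  \<open>C\<^sub>u\<close> whether or not its members are finite:
  \<open>norm_w f \<le> C\<^sub>1 besov_expr f\<close>, \<open>norm_i f \<le> C\<^sub>2 norm_w f\<close> and \<open>besov_expr f \<le> C\<^sub>3 norm_i f\<close>.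
  Equivalence is then immediate, the sets on which the three are finite coincide, and definiteness
  comes from the \<open>L\<^sup>p\<close> part of the Besov expression, since elements of \<open>C\<^sub>u\<close> are continuous.

  Throughout, the Besov expression is discretised: its integral over \<open>t\<close> is comparable with the
  \<open>\<ell>\<^sup>q\<close> norm of \<open>2\<^sup>s\<^sup>i \<omega>\<^sup>m\<^sub>p(f; 2\<^sup>-\<^sup>i)\<close>, and by Marchaud's inequality the order \<open>m\<close> of the differences
  may be replaced by any other integer above \<open>s\<close> (\<open>mod_seq_le_besov_expr_any_order\<close>).

  \<^emph>\<open>Wavelet coefficients by moduli\<close> (\<open>norm_w_le_besov_expr\<close>). In one variable the dual wavelet filter,
  read as a polynomial, is divisible by \<open>(X - 1)\<^sup>N\<^sup>+\<^sup>1\<close> with \<open>N = \<lfloor>r\<^sub>0\<rfloor>\<close> (\<open>vanishing_moments\<close>): it annihilates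
  \<open>\<phi>\<close> on all dyadic grids, and a lower order of vanishing would force a derivative of \<open>\<phi>\<close> to be
  identically zero. Hence a dual wavelet evaluates \<open>(N + 1)\<close>-th differences of \<open>f\<close> at lattice points,
  where \<open>N + 1 > r\<^sub>0 > \<sigma>\<close>. Point values are not controlled by an \<open>L\<^sup>p\<close> norm; but the values of a
  continuous function \<open>g\<close> on a lattice of width \<open>\<delta>\<close> are controlled by its \<open>L\<^sup>p\<close> norm together with
  its moduli at the scales \<open>2\<^sup>-\<^sup>i \<delta>\<close>, with weights \<open>2\<^sup>i\<^sup>n\<^sup>/\<^sup>p\<close> (\<open>sampling\<close>). The hypothesis \<open>n/p < \<sigma>\<close> makes
  these weights summable against the decay that the Besov expression measures.

  \<^emph>\<open>Details by wavelet coefficients\<close> (\<open>norm_i_le_norm_w\<close>). The interpolating refinement equation gives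
  exact reconstruction: \<open>Q\<^sub>j f\<close> is the sum of the translates of the wavelets weighted with the dual
  wavelet coefficients (\<open>Q_op_wavelets\<close>), and such sums of compactly supported functions are bounded
  from \<open>\<ell>\<^sup>p\<close> to \<open>L\<^sup>p\<close> (\<open>synth_bound\<close>).

  \<^emph>\<open>Moduli by details\<close> (\<open>besov_expr_le_norm_i\<close>). As \<open>f = P\<^sub>j\<^sub>0 f + \<Sum> Q\<^sub>j f\<close> pointwise, it suffices to know
  the moduli of the summands. Here Bernstein's inequality (\<open>bernstein\<close>) applies: the differences of
  \<open>\<Sum> c\<^sub>k \<phi>(\<cdot> - k)\<close> are synthesised from the differences of \<open>\<phi>\<close>, which are small by regularity, and
  the \<open>\<ell>\<^sup>p\<close> norm of the coefficients is controlled by the \<open>L\<^sup>p\<close> norm of the sum (\<open>stability\<close>) since the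
  coefficients are its values at the integer points. The resulting double sum over scales has a kernel
  decaying geometrically off the diagonal because \<open>0 < \<sigma> < r\<^sub>0\<close>, and is bounded on \<open>\<ell>\<^sup>q\<close>
  (\<open>geom_convolution\<close>).
\<close>

section \<open>Lebesgue norms with values in \<open>[0,\<infinity>]\<close>\<close>

lemma ennreal_powr_0 [simp]: "ennreal_powr 0 a = 0"
  by (simp add: ennreal_powr_def)

lemma ennreal_powr_1 [simp]: "ennreal_powr x 1 = x"
  by (cases x) (auto simp: ennreal_powr_def)

lemma ennreal_powr_top [simp]: "ennreal_powr \<infinity> a = \<infinity>" "ennreal_powr top a = \<infinity>"
  by (auto simp: ennreal_powr_def)

lemma ennreal_powr_ennreal: "0 \<le> x \<Longrightarrow> ennreal_powr (ennreal x) a = ennreal (x powr a)"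
  by (auto simp: ennreal_powr_def)

lemma ennreal_powr_mono: "x \<le> y \<Longrightarrow> 0 \<le> a \<Longrightarrow> ennreal_powr x a \<le> ennreal_powr y a"
  by (cases x; cases y) (auto simp: ennreal_powr_ennreal intro!: powr_mono2 simp: top_unique)

lemma ennreal_powr_mult:
  assumes "0 < a" shows "ennreal_powr (x * y) a = ennreal_powr x a * ennreal_powr y a"
proof (cases x; cases y)
  fix r s :: real assume "x = ennreal r" "y = ennreal s" "0 \<le> r" "0 \<le> s"
  then show ?thesis
    by (simp add: ennreal_mult[symmetric] ennreal_powr_ennreal powr_mult)
next
  fix r assume "x = ennreal r" "0 \<le> r" "y = top"
  then show ?thesis using assms
    by (cases "r = 0") (auto simp: ennreal_mult_top ennreal_powr_ennreal ennreal_top_mult)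
next
  fix r assume "y = ennreal r" "0 \<le> r" "x = top"
  then show ?thesis using assms
    by (cases "r = 0") (auto simp: ennreal_mult_top ennreal_powr_ennreal ennreal_top_mult)
qed (auto simp: ennreal_mult_top)

lemma ennreal_powr_powr: "ennreal_powr (ennreal_powr x a) b = ennreal_powr x (a * b)"
  by (cases x) (auto simp: ennreal_powr_ennreal powr_powr)

lemma ennreal_powr_le_iff:
  assumes "0 < a" shows "ennreal_powr x a \<le> y \<longleftrightarrow> x \<le> ennreal_powr y (1/a)"
proof
  assume "ennreal_powr x a \<le> y"
  from ennreal_powr_mono[OF this, of "1/a"] assms show "x \<le> ennreal_powr y (1/a)"
    by (simp add: ennreal_powr_powr)
next
  assume "x \<le> ennreal_powr y (1/a)"
  from ennreal_powr_mono[OF this, of a] assms show "ennreal_powr x a \<le> y"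
    by (simp add: ennreal_powr_powr)
qed

lemma measurable_ennreal_powr [measurable (raw)]:
  "f \<in> borel_measurable M \<Longrightarrow> (\<lambda>x. ennreal_powr (f x) a) \<in> borel_measurable M"
proof -
  assume [measurable]: "f \<in> borel_measurable M"
  show ?thesis unfolding ennreal_powr_def by measurable
qed

lemma ennreal_powr_SUP:
  assumes "0 < a"
  shows "ennreal_powr (SUP i. f i) a = (SUP i::'i. ennreal_powr (f i) a)"
proof (rule antisym)
  show "ennreal_powr (SUP i. f i) a \<le> (SUP i. ennreal_powr (f i) a)"
    unfolding ennreal_powr_le_iff[OF assms]
    by (intro SUP_least) (auto simp: ennreal_powr_le_iff[OF assms, symmetric] intro: SUP_upper)
  show "(SUP i. ennreal_powr (f i) a) \<le> ennreal_powr (SUP i. f i) a"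
    using assms by (intro SUP_least ennreal_powr_mono) (auto intro: SUP_upper)
qed

lemma exponent_cases [consumes 1, case_names infinite finite]:
  assumes "1 \<le> (p::ennreal)"
  obtains "p = top" | r where "p = ennreal r" "1 \<le> r"
  using assms by (cases p) auto

lemma recip_infinity [simp]: "recip \<infinity> = 0" "recip top = 0"
  by (auto simp: recip_def)

lemma recip_finite: "1 \<le> r \<Longrightarrow> recip (ennreal r) = 1 / r"
  by (simp add: recip_def divide_ennreal flip: ennreal_1)

lemma recip_bounds: "1 \<le> p \<Longrightarrow> 0 \<le> recip p \<and> recip p \<le> 1"
  by (cases p rule: exponent_cases) (auto simp: recip_finite)

lemma Lnorm_infinity: "Lnorm top M f = esssup M f"
  by (simp add: Lnorm_def)

lemma Lnorm_finite:
  "1 \<le> r \<Longrightarrow> Lnorm (ennreal r) M f = ennreal_powr (\<integral>\<^sup>+x. ennreal_powr (f x) r \<partial>M) (1/r)"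
  by (simp add: Lnorm_def recip_finite)

lemma Lnorm_infinity_le_iff:
  "f \<in> borel_measurable M \<Longrightarrow> Lnorm top M f \<le> c \<longleftrightarrow> (AE x in M. f x \<le> c)"
  unfolding Lnorm_infinity using esssup_AE[of f M] by (auto intro: order_trans)

lemma Lnorm_finite_le_iff:
  "1 \<le> r \<Longrightarrow> Lnorm (ennreal r) M f \<le> c \<longleftrightarrow>
     (\<integral>\<^sup>+x. ennreal_powr (f x) r \<partial>M) \<le> ennreal_powr c r"
  by (simp add: Lnorm_finite ennreal_powr_le_iff)

lemma Lnorm_mono_AE:
  assumes "1 \<le> p" "f \<in> borel_measurable M" "AE x in M. f x \<le> g x"
  shows "Lnorm p M f \<le> Lnorm p M g"
  using assms(1)
proof (cases p rule: exponent_cases)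
  case infinite
  then show ?thesis using assms esssup_AE_mono by (auto simp: Lnorm_infinity)
next
  case (finite r)
  then show ?thesis using assms
    by (auto simp: Lnorm_finite elim!: eventually_mono
        intro!: ennreal_powr_mono nn_integral_mono_AE)
qed

lemma Lnorm_mono:
  assumes "1 \<le> p" "f \<in> borel_measurable M" "\<And>x. x \<in> space M \<Longrightarrow> f x \<le> g x"
  shows "Lnorm p M f \<le> Lnorm p M g"
  using assms by (intro Lnorm_mono_AE) auto

lemma Lnorm_cong: "(\<And>x. x \<in> space M \<Longrightarrow> f x = g x) \<Longrightarrow> 1 \<le> p \<Longrightarrow> g \<in> borel_measurable M \<Longrightarrow>
  Lnorm p M f = Lnorm p M g"
  by (rule antisym; rule Lnorm_mono)
    (auto simp: measurable_cong[of M f g])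

lemma Lnorm_cmult_le:
  assumes "1 \<le> p" "f \<in> borel_measurable M"
  shows "Lnorm p M (\<lambda>x. c * f x) \<le> c * Lnorm p M f"
  using assms(1)
proof (cases p rule: exponent_cases)
  case infinite
  have "AE x in M. c * f x \<le> c * esssup M f"
    using esssup_AE[of f M] by eventually_elim (rule mult_left_mono, auto)
  then show ?thesis using assms(2) infinite
    by (auto simp: Lnorm_infinity)
next
  case (finite r)
  then show ?thesis using assms(2)
    by (simp add: Lnorm_finite ennreal_powr_mult nn_integral_cmult ennreal_powr_powr)
qed

lemma Lnorm_cmult:
  assumes "1 \<le> p" "f \<in> borel_measurable M" "0 \<le> c"
  shows "Lnorm p M (\<lambda>x. ennreal c * f x) = ennreal c * Lnorm p M f"
proof (cases "c = 0")
  case True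
  have "Lnorm p M (\<lambda>x. 0) = 0"
    using Lnorm_cmult_le[of p "\<lambda>x. 0" M 0] assms by simp
  with True show ?thesis by simp
next
  case False
  have "Lnorm p M f \<le> ennreal (1/c) * Lnorm p M (\<lambda>x. ennreal c * f x)"
    using Lnorm_cmult_le[OF assms(1), of "\<lambda>x. ennreal c * f x" M "ennreal (1/c)"] assms False
    by (simp add: mult.assoc[symmetric] ennreal_mult[symmetric])
  then have "ennreal c * Lnorm p M f \<le> ennreal c * (ennreal (1/c) * Lnorm p M (\<lambda>x. ennreal c * f x))"
    by (rule mult_left_mono) simp
  also have "\<dots> = Lnorm p M (\<lambda>x. ennreal c * f x)"
    using assms False by (simp add: mult.assoc[symmetric] ennreal_mult[symmetric])
  finally show ?thesis using Lnorm_cmult_le[OF assms(1,2), of "ennreal c"] by simp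
qed

lemma Lnorm_0 [simp]: "1 \<le> p \<Longrightarrow> Lnorm p M (\<lambda>x. 0) = 0"
  using Lnorm_cmult[of p "\<lambda>x. 0" M 0] by simp

text \<open>Convexity of \<open>t \<mapsto> t\<^sup>r\<close> at \<open>x/a\<close> and \<open>y/b\<close> with weights \<open>a/(a + b)\<close> and \<open>b/(a + b)\<close>. Integrated with \<open>a\<close> and
  \<open>b\<close> the norms of two functions it gives Minkowski's inequality.\<close>
lemma powr_convex_ineq:
  fixes x y a b r :: real
  assumes "1 \<le> r" "0 \<le> x" "0 \<le> y" "0 < a" "0 < b"
  shows "(x + y) powr r \<le> (a + b) powr (r - 1) * (a powr (1 - r) * x powr r + b powr (1 - r) * y powr r)"
proof -
  have zero: "v powr r \<le> (s + t) powr (r - 1) * (s powr (1 - r) * v powr r)"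
    if "0 \<le> v" "0 < s" "0 < t" for v s t :: real
  proof -
    have "s powr (r - 1) \<le> (s + t) powr (r - 1)"
      using that assms by (intro powr_mono2) auto
    then have "1 \<le> (s + t) powr (r - 1) * s powr (1 - r)"
      using that by (simp add: powr_minus_divide[of _ "r - 1", simplified] field_simps)
    then have "1 * v powr r \<le> ((s + t) powr (r - 1) * s powr (1 - r)) * v powr r"
      by (intro mult_right_mono) auto
    then show ?thesis by (simp add: mult.assoc)
  qed
  consider "x = 0" | "y = 0" | "0 < x" "0 < y" using assms by linarith
  then show ?thesis
  proof cases
    case 1 then show ?thesis using zero[of y b a] assms by (simp add: add.commute)
  next
    case 2 then show ?thesis using zero[of x a b] assms by simp
  next
    case 3
    have *: "((1 - b/(a+b)) *\<^sub>R (x/a) + (b/(a+b)) *\<^sub>R (y/b)) powr r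
      \<le> (1 - b/(a+b)) * (x/a) powr r + (b/(a+b)) * (y/b) powr r"
      using 3 assms by (intro convex_onD[OF powr_convex[OF assms(1)]]) (auto simp: field_simps)
    have l: "1 - b/(a+b) = a/(a+b)" using assms by (simp add: field_simps)
    have "(1 - b/(a+b)) *\<^sub>R (x/a) + (b/(a+b)) *\<^sub>R (y/b) = (x+y)/(a+b)"
      unfolding l using assms by (simp add: add_divide_distrib)
    with * have "((x+y)/(a+b)) powr r \<le> a/(a+b) * (x/a) powr r + b/(a+b) * (y/b) powr r"
      unfolding l by simp
    then have "((x+y)/(a+b)) powr r * (a+b) powr r
       \<le> (a/(a+b) * (x/a) powr r + b/(a+b) * (y/b) powr r) * (a+b) powr r"
      by (intro mult_right_mono) auto
    moreover have "((x+y)/(a+b)) powr r * (a+b) powr r = (x+y) powr r"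
      using 3 assms by (simp add: powr_divide)
    moreover have "(a/(a+b) * (x/a) powr r + b/(a+b) * (y/b) powr r) * (a+b) powr r =
      (a + b) powr (r - 1) * (a powr (1 - r) * x powr r + b powr (1 - r) * y powr r)"
    proof -
      have e: "(a/(a+b) * (X/A) + b/(a+b) * (Y/B)) * S = (S / (a + b)) * (a / A * X + b / B * Y)" for X Y A B S
        by (simp add: divide_inverse distrib_left distrib_right mult.assoc mult.commute mult.left_commute)
      show ?thesis using e[of "x powr r" "a powr r" "y powr r" "b powr r" "(a + b) powr r"] 3 assms
        by (simp add: powr_divide powr_diff)
    qed
    ultimately show ?thesis by simp
  qed
qed

lemma ennreal_powr_convex_ineq:
  assumes "1 \<le> r" "0 < a" "0 < b"
  shows "ennreal_powr (x + y) r \<le> ennreal ((a + b) powr (r - 1)) *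
    (ennreal (a powr (1 - r)) * ennreal_powr x r + ennreal (b powr (1 - r)) * ennreal_powr y r)"
proof (cases "x = top \<or> y = top")
  case True
  have "a powr (1 - r) > 0" "b powr (1 - r) > 0" "(a + b) powr (r - 1) > 0" using assms by auto
  then show ?thesis using True assms
    by (auto simp: ennreal_mult_top)
next
  case False
  then obtain x' y' where "x = ennreal x'" "y = ennreal y'" "0 \<le> x'" "0 \<le> y'"
    by (cases x; cases y) auto
  then show ?thesis using powr_convex_ineq[OF assms(1), of x' y' a b] assms
    by (simp add: ennreal_powr_ennreal flip: ennreal_plus ennreal_mult)
qed

text \<open>Replaces two norms by arbitrary real numbers above them, so that neither a zero nor an infinite
  norm has to be divided by.\<close>
lemma ennreal_le_add_real:
  fixes A B X :: ennreal
  assumes "\<And>a b. A < ennreal a \<Longrightarrow> B < ennreal b \<Longrightarrow> 0 < a \<Longrightarrow> 0 < b \<Longrightarrow> X \<le> ennreal (a + b)"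
  shows "X \<le> A + B"
proof (cases "A = top \<or> B = top")
  case False
  then obtain a b where ab: "A = ennreal a" "B = ennreal b" "0 \<le> a" "0 \<le> b"
    by (cases A; cases B) auto
  have "X \<le> ennreal (a + b) + ennreal e" if "e > 0" for e
  proof -
    have "X \<le> ennreal ((a + e/2) + (b + e/2))"
      using ab that by (intro assms) (auto simp: ennreal_less_iff)
    also have "(a + e/2) + (b + e/2) = (a + b) + e" by simp
    also have "ennreal ((a + b) + e) = ennreal (a + b) + ennreal e"
      using ab that by (intro ennreal_plus) auto
    finally show ?thesis .
  qed
  then have "X \<le> ennreal (a + b)"
    by (rule ennreal_le_epsilon) auto
  also have "ennreal (a + b) = A + B" using ab by (simp add: ennreal_plus)
  finally show ?thesis .
qed auto

text \<open>Minkowski's inequality, by integrating the convexity inequality.\<close>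
lemma Lnorm_add:
  assumes "1 \<le> p" and [measurable]: "f \<in> borel_measurable M" "g \<in> borel_measurable M"
  shows "Lnorm p M (\<lambda>x. f x + g x) \<le> Lnorm p M f + Lnorm p M g"
  using assms(1)
proof (cases p rule: exponent_cases)
  case infinite
  have "AE x in M. f x + g x \<le> esssup M f + esssup M g"
    using esssup_AE[of f M] esssup_AE[of g M] by eventually_elim (rule add_mono)
  then show ?thesis using infinite by (auto simp: Lnorm_infinity)
next
  case (finite r)
  show ?thesis
  proof (rule ennreal_le_add_real)
    fix a b :: real assume ab: "Lnorm p M f < ennreal a" "Lnorm p M g < ennreal b" "0 < a" "0 < b"
    then have fg: "(\<integral>\<^sup>+x. ennreal_powr (f x) r \<partial>M) \<le> ennreal (a powr r)"
        "(\<integral>\<^sup>+x. ennreal_powr (g x) r \<partial>M) \<le> ennreal (b powr r)"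
      using finite Lnorm_finite_le_iff[of r M f "ennreal a"] Lnorm_finite_le_iff[of r M g "ennreal b"]
      by (auto simp: ennreal_powr_ennreal)
    have "(\<integral>\<^sup>+x. ennreal_powr (f x + g x) r \<partial>M) \<le> (\<integral>\<^sup>+x. ennreal ((a + b) powr (r - 1)) *
      (ennreal (a powr (1 - r)) * ennreal_powr (f x) r + ennreal (b powr (1 - r)) * ennreal_powr (g x) r) \<partial>M)"
      using finite ab by (intro nn_integral_mono ennreal_powr_convex_ineq) auto
    also have "\<dots> = ennreal ((a + b) powr (r - 1)) *
      (ennreal (a powr (1 - r)) * (\<integral>\<^sup>+x. ennreal_powr (f x) r \<partial>M)
        + ennreal (b powr (1 - r)) * (\<integral>\<^sup>+x. ennreal_powr (g x) r \<partial>M))"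
      by (simp add: nn_integral_cmult nn_integral_add)
    also have "\<dots> \<le> ennreal ((a + b) powr (r - 1)) *
      (ennreal (a powr (1 - r)) * ennreal (a powr r) + ennreal (b powr (1 - r)) * ennreal (b powr r))"
      using fg by (intro mult_left_mono add_mono) auto
    also have "\<dots> = ennreal ((a + b) powr (r - 1) * (a powr (1 - r + r) + b powr (1 - r + r)))"
      unfolding powr_add by (simp flip: ennreal_plus ennreal_mult)
    also have "\<dots> = ennreal ((a + b) powr r)"
      using ab by (simp add: powr_diff)
    finally show "Lnorm p M (\<lambda>x. f x + g x) \<le> ennreal (a + b)"
      using finite ab by (simp add: Lnorm_finite_le_iff ennreal_powr_ennreal del: ennreal_plus)
  qed
qed

lemma Lnorm_sum:
  assumes "1 \<le> p" "finite I" and [measurable]: "\<And>i. i \<in> I \<Longrightarrow> f i \<in> borel_measurable M"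
  shows "Lnorm p M (\<lambda>x. \<Sum>i\<in>I. f i x) \<le> (\<Sum>i\<in>I. Lnorm p M (f i))"
  using assms(2,3)
proof (induction I rule: finite_induct)
  case (insert i I)
  have "Lnorm p M (\<lambda>x. f i x + (\<Sum>i\<in>I. f i x)) \<le> Lnorm p M (f i) + Lnorm p M (\<lambda>x. \<Sum>i\<in>I. f i x)"
    using insert by (intro Lnorm_add assms(1) borel_measurable_sum) auto
  also have "\<dots> \<le> Lnorm p M (f i) + (\<Sum>i\<in>I. Lnorm p M (f i))"
    using insert by (intro add_left_mono) auto
  finally show ?case using insert by simp
qed (use assms in simp)

lemma Lnorm_suminf:
  assumes "1 \<le> p" and [measurable]: "\<And>i. f i \<in> borel_measurable M"
  shows "Lnorm p M (\<lambda>x. \<Sum>i. f i x) \<le> (\<Sum>i. Lnorm p M (f i))"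
proof -
  have fin: "Lnorm p M (\<lambda>x. \<Sum>i<n. f i x) \<le> (\<Sum>i. Lnorm p M (f i))" for n
  proof -
    have "Lnorm p M (\<lambda>x. \<Sum>i<n. f i x) \<le> (\<Sum>i<n. Lnorm p M (f i))"
      by (intro Lnorm_sum assms) auto
    also have "\<dots> \<le> (\<Sum>i. Lnorm p M (f i))"
      by (intro sum_le_suminf) auto
    finally show ?thesis .
  qed
  from assms(1) show ?thesis
  proof (cases p rule: exponent_cases)
    case infinite
    have "AE x in M. \<forall>n. (\<Sum>i<n. f i x) \<le> (\<Sum>i. Lnorm p M (f i))"
      using fin infinite by (subst AE_all_countable) (auto simp: Lnorm_infinity_le_iff[symmetric])
    then have "AE x in M. (\<Sum>i. f i x) \<le> (\<Sum>i. Lnorm p M (f i))"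
      by eventually_elim (auto simp: suminf_eq_SUP intro: SUP_least)
    then show ?thesis using infinite by (subst (1) infinite) (subst Lnorm_infinity_le_iff, auto)
  next
    case (finite r)
    have inc: "incseq (\<lambda>n x. ennreal_powr (\<Sum>i<n. f i x) r)"
      using finite by (auto simp: incseq_def le_fun_def intro!: ennreal_powr_mono sum_mono2)
    have "(\<integral>\<^sup>+x. ennreal_powr (\<Sum>i. f i x) r \<partial>M) = (\<integral>\<^sup>+x. (SUP n. ennreal_powr (\<Sum>i<n. f i x) r) \<partial>M)"
      using finite by (simp add: suminf_eq_SUP ennreal_powr_SUP)
    also have "\<dots> = (SUP n. \<integral>\<^sup>+x. ennreal_powr (\<Sum>i<n. f i x) r \<partial>M)"
      by (intro nn_integral_monotone_convergence_SUP inc) measurable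
    also have "\<dots> \<le> ennreal_powr (\<Sum>i. Lnorm p M (f i)) r"
      using fin finite by (intro SUP_least) (auto simp: Lnorm_finite_le_iff[symmetric])
    finally show ?thesis using finite by (simp add: Lnorm_finite_le_iff)
  qed
qed

text \<open>If \<open>T\<close> transports \<open>M\<close> to a measure below \<open>K N\<close>, the integrals grow at most by \<open>K\<close>; for \<open>p = \<infinity>\<close> the
  hypothesis says that preimages of null sets are null.\<close>
lemma Lnorm_comp_le:
  assumes "1 \<le> p" and [measurable]: "T \<in> measurable M N" "f \<in> borel_measurable N"
    and "0 < K" and le: "\<And>A. A \<in> sets N \<Longrightarrow> emeasure M (T -` A \<inter> space M) \<le> ennreal K * emeasure N A"
  shows "Lnorm p M (\<lambda>x. f (T x)) \<le> ennreal (K powr recip p) * Lnorm p N f"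
  using assms(1)
proof (cases p rule: exponent_cases)
  case infinite
  have "AE y in N. f y \<le> esssup N f" by (rule esssup_AE)
  then have "emeasure N {y \<in> space N. \<not> f y \<le> esssup N f} = 0"
    by (subst (asm) AE_iff_measurable[OF _ refl]) auto
  with le[of "{y \<in> space N. \<not> f y \<le> esssup N f}"]
  have "emeasure M (T -` {y \<in> space N. \<not> f y \<le> esssup N f} \<inter> space M) = 0" by simp
  moreover have "T -` {y \<in> space N. \<not> f y \<le> esssup N f} \<inter> space M = {x \<in> space M. \<not> f (T x) \<le> esssup N f}"
    using measurable_space[OF assms(2)] by auto
  ultimately have "AE x in M. f (T x) \<le> esssup N f"
    by (subst AE_iff_measurable[OF _ refl]) auto
  then show ?thesis using infinite \<open>0 < K\<close> by (auto simp: Lnorm_infinity)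
next
  case (finite r)
  have "distr M N T \<le> scale_measure (ennreal K) N"
    by (subst le_measure) (auto simp: emeasure_distr le)
  then have "(\<integral>\<^sup>+y. ennreal_powr (f y) r \<partial>distr M N T) \<le> (\<integral>\<^sup>+y. ennreal_powr (f y) r \<partial>scale_measure (ennreal K) N)"
    by (intro nn_integral_mono_measure) auto
  then have *: "(\<integral>\<^sup>+x. ennreal_powr (f (T x)) r \<partial>M) \<le> ennreal K * (\<integral>\<^sup>+y. ennreal_powr (f y) r \<partial>N)"
    by (simp add: nn_integral_distr nn_integral_scale_measure)
  have "Lnorm p M (\<lambda>x. f (T x)) \<le> ennreal_powr (ennreal K * (\<integral>\<^sup>+y. ennreal_powr (f y) r \<partial>N)) (1/r)"
    using finite * by (auto simp: Lnorm_finite intro!: ennreal_powr_mono)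
  also have "\<dots> = ennreal (K powr recip p) * Lnorm p N f"
    using finite \<open>0 < K\<close> by (simp add: ennreal_powr_mult Lnorm_finite recip_finite ennreal_powr_ennreal)
  finally show ?thesis .
qed

lemma Lnorm_count_inj_le:
  assumes "1 \<le> p" "inj_on T A" "T ` A \<subseteq> B"
  shows "Lnorm p (count_space A) (\<lambda>x. f (T x)) \<le> Lnorm p (count_space B) f"
proof -
  have "emeasure (count_space A) (T -` X \<inter> A) \<le> emeasure (count_space B) X" if "X \<subseteq> B" for X
  proof (cases "finite X")
    case True
    then have "finite (T -` X \<inter> A)" using assms by (intro finite_vimage_IntI)
    moreover have "card (T -` X \<inter> A) \<le> card X"
      using True assms by (intro card_inj_on_le[where f=T]) (auto intro: inj_on_subset)
    ultimately show ?thesis using True that by simp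
  qed (use that in simp)
  then show ?thesis
    using Lnorm_comp_le[OF assms(1), of T "count_space A" "count_space B" f 1] assms by auto
qed

text \<open>A term of a sequence is at most its \<open>\<ell>\<^sup>p\<close> norm: a null set of the counting measure is empty.\<close>
lemma Lnorm_count_ge:
  assumes "1 \<le> p" "x \<in> A"
  shows "f x \<le> Lnorm p (count_space A) f"
  using assms(1)
proof (cases p rule: exponent_cases)
  case infinite
  then show ?thesis using esssup_AE[of f "count_space A"] assms by (auto simp: Lnorm_infinity AE_count_space)
next
  case (finite r)
  have "ennreal_powr (f x) r = (\<integral>\<^sup>+y. ennreal_powr (f x) r * indicator {x} y \<partial>count_space A)"
    using assms by (simp add: nn_integral_cmult_indicator)
  also have "\<dots> \<le> (\<integral>\<^sup>+y. ennreal_powr (f y) r \<partial>count_space A)"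
    by (intro nn_integral_mono) (auto split: split_indicator)
  finally show ?thesis using finite by (simp add: Lnorm_finite ennreal_powr_le_iff)
qed

lemma Lnorm_count_indicator:
  assumes "1 \<le> p"
  shows "Lnorm p (count_space A) f = Lnorm p (count_space UNIV) (\<lambda>x. f x * indicator A x)"
  using assms
proof (cases p rule: exponent_cases)
  case infinite
  show ?thesis
  proof (rule antisym)
    show "Lnorm p (count_space A) f \<le> Lnorm p (count_space UNIV) (\<lambda>x. f x * indicator A x)"
      unfolding infinite
    proof (subst Lnorm_infinity_le_iff)
      have "f x \<le> Lnorm top (count_space UNIV) (\<lambda>x. f x * indicator A x)" if "x \<in> A" for x
        using Lnorm_count_ge[of top x UNIV "\<lambda>x. f x * indicator A x"] that by simp
      then show "AE x in count_space A. f x \<le> Lnorm top (count_space UNIV) (\<lambda>x. f x * indicator A x)"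
        by (simp add: AE_count_space)
    qed simp
    show "Lnorm p (count_space UNIV) (\<lambda>x. f x * indicator A x) \<le> Lnorm p (count_space A) f"
      unfolding infinite
      by (subst Lnorm_infinity_le_iff)
        (auto simp: AE_count_space split: split_indicator intro!: Lnorm_count_ge)
  qed
next
  case (finite r)
  have "(\<integral>\<^sup>+y. ennreal_powr (f y) r \<partial>count_space A) = (\<integral>\<^sup>+y. ennreal_powr (f y * indicator A y) r \<partial>count_space UNIV)"
    by (subst nn_integral_count_space_indicator) (auto intro!: nn_integral_cong split: split_indicator)
  then show ?thesis using finite by (simp add: Lnorm_finite)
qed

section \<open>Convolution with geometric sequences\<close>

lemma nn_integral_int_decode:
  "(\<integral>\<^sup>+j. f j \<partial>count_space (UNIV::int set)) = (\<Sum>n. f (int_decode n))"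
  by (subst nn_integral_bij_count_space[OF bij_int_decode, symmetric])
    (simp add: nn_integral_count_space_nat)

text \<open>Minkowski's inequality for series, with the integers enumerated.\<close>
lemma Lnorm_int_sum:
  assumes "1 \<le> p" "\<And>d::int. f d \<in> borel_measurable M"
  shows "Lnorm p M (\<lambda>x. \<integral>\<^sup>+d. f d x \<partial>count_space UNIV) \<le> (\<integral>\<^sup>+d. Lnorm p M (f d) \<partial>count_space UNIV)"
  unfolding nn_integral_int_decode using assms by (intro Lnorm_suminf) auto

definition geom_kernel :: "real \<Rightarrow> int \<Rightarrow> ennreal" where
  "geom_kernel \<gamma> d = ennreal (2 powr (- \<gamma> * \<bar>of_int d\<bar>))"

lemma geom_kernel_summable:
  assumes "0 < \<gamma>"
  shows "(\<integral>\<^sup>+d. geom_kernel \<gamma> d \<partial>count_space UNIV) < \<infinity>"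
proof -
  define \<theta> where "\<theta> = 2 powr (-\<gamma>)"
  have t: "0 < \<theta>" "\<theta> < 1" using assms by (auto simp: \<theta>_def powr_less_one)
  have nn: "(\<Sum>n. ennreal (\<theta> ^ n)) < top"
    using t by (simp add: suminf_ennreal2 summable_geometric ennreal_suminf_neq_top less_top[symmetric])
  have pw: "2 powr (- (\<gamma> * real n)) = \<theta> ^ n" for n
    by (simp add: \<theta>_def powr_realpow[symmetric] powr_powr)
  have "(\<integral>\<^sup>+d. geom_kernel \<gamma> d \<partial>count_space UNIV) \<le>
    (\<integral>\<^sup>+d. geom_kernel \<gamma> d * indicator {0..} d + geom_kernel \<gamma> d * indicator {..0} d \<partial>count_space UNIV)"
    by (intro nn_integral_mono) (auto split: split_indicator)
  also have "\<dots> = (\<integral>\<^sup>+d. geom_kernel \<gamma> d * indicator {0..} d \<partial>count_space UNIV) + (\<integral>\<^sup>+d. geom_kernel \<gamma> d * indicator {..0} d \<partial>count_space UNIV)"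
    by (intro nn_integral_add) auto
  also have "(\<integral>\<^sup>+d. geom_kernel \<gamma> d * indicator {0..} d \<partial>count_space UNIV) = (\<integral>\<^sup>+d. geom_kernel \<gamma> d \<partial>count_space {0..})"
    by (subst (2) nn_integral_count_space_indicator) auto
  also have "\<dots> = (\<integral>\<^sup>+n. geom_kernel \<gamma> (int n) \<partial>count_space UNIV)"
    by (intro nn_integral_bij_count_space[symmetric] bij_betwI[where g=nat]) auto
  also have "\<dots> = (\<Sum>n. ennreal (\<theta> ^ n))"
    by (simp add: nn_integral_count_space_nat geom_kernel_def pw)
  also have "(\<integral>\<^sup>+d. geom_kernel \<gamma> d * indicator {..0} d \<partial>count_space UNIV) = (\<integral>\<^sup>+d. geom_kernel \<gamma> d \<partial>count_space {..0})"
    by (subst (2) nn_integral_count_space_indicator) auto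
  also have "\<dots> = (\<integral>\<^sup>+n. geom_kernel \<gamma> (- int n) \<partial>count_space UNIV)"
    by (intro nn_integral_bij_count_space[symmetric] bij_betwI[where g="\<lambda>d. nat (- d)"]) auto
  also have "\<dots> = (\<Sum>n. ennreal (\<theta> ^ n))"
    by (simp add: nn_integral_count_space_nat geom_kernel_def pw)
  finally show ?thesis using nn by (auto simp: top.not_eq_extremum order_le_less_trans)
qed

text \<open>Young's inequality for a summable kernel: the convolution is a superposition of translates of \<open>b\<close>,
  all of which have the norm of \<open>b\<close>. The constant does not depend on \<open>q\<close>.\<close>
lemma geom_convolution:
  assumes "0 < \<gamma>"
  obtains C where "0 < C" "\<And>q b. 1 \<le> q \<Longrightarrow>
    Lnorm q (count_space UNIV) (\<lambda>i. \<integral>\<^sup>+j. geom_kernel \<gamma> (i - j) * b j \<partial>count_space UNIV)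
      \<le> ennreal C * Lnorm q (count_space (UNIV::int set)) b"
proof -
  obtain C where C: "(\<integral>\<^sup>+d. geom_kernel \<gamma> d \<partial>count_space UNIV) = ennreal C" "0 \<le> C"
    using geom_kernel_summable[OF assms] by (cases "(\<integral>\<^sup>+d. geom_kernel \<gamma> d \<partial>count_space UNIV)") auto
  have main: "Lnorm q (count_space UNIV) (\<lambda>i. \<integral>\<^sup>+j. geom_kernel \<gamma> (i - j) * b j \<partial>count_space UNIV)
      \<le> ennreal (C + 1) * Lnorm q (count_space (UNIV::int set)) b" if q: "1 \<le> q" for q b
  proof -
    have "(\<integral>\<^sup>+j. geom_kernel \<gamma> (i - j) * b j \<partial>count_space UNIV) =
      (\<integral>\<^sup>+d. geom_kernel \<gamma> d * b (i - d) \<partial>count_space UNIV)" for i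
      by (subst nn_integral_bij_count_space[of "\<lambda>d. i - d", symmetric])
        (auto intro!: bij_betwI[where g="\<lambda>d. i - d"])
    then have "Lnorm q (count_space UNIV) (\<lambda>i. \<integral>\<^sup>+j. geom_kernel \<gamma> (i - j) * b j \<partial>count_space UNIV)
      = Lnorm q (count_space UNIV) (\<lambda>i. \<integral>\<^sup>+d. geom_kernel \<gamma> d * b (i - d) \<partial>count_space UNIV)" by simp
    also have "\<dots> \<le> (\<integral>\<^sup>+d. Lnorm q (count_space UNIV) (\<lambda>i. geom_kernel \<gamma> d * b (i - d)) \<partial>count_space UNIV)"
      by (intro Lnorm_int_sum q) auto
    also have "\<dots> \<le> (\<integral>\<^sup>+d. geom_kernel \<gamma> d * Lnorm q (count_space UNIV) b \<partial>count_space UNIV)"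
    proof (intro nn_integral_mono)
      fix d :: int
      have "Lnorm q (count_space UNIV) (\<lambda>i. geom_kernel \<gamma> d * b (i - d))
        \<le> geom_kernel \<gamma> d * Lnorm q (count_space UNIV) (\<lambda>i. b (i - d))"
        by (intro Lnorm_cmult_le q) auto
      also have "\<dots> \<le> geom_kernel \<gamma> d * Lnorm q (count_space UNIV) b"
        by (intro mult_left_mono Lnorm_count_inj_le q) (auto simp: inj_on_def)
      finally show "Lnorm q (count_space UNIV) (\<lambda>i. geom_kernel \<gamma> d * b (i - d)) \<le> \<dots>" .
    qed
    also have "\<dots> = ennreal C * Lnorm q (count_space UNIV) b"
      by (subst nn_integral_multc) (auto simp: C)
    also have "\<dots> \<le> ennreal (C + 1) * Lnorm q (count_space UNIV) b"
      using C by (intro mult_right_mono ennreal_leI) auto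
    finally show ?thesis .
  qed
  then show thesis using C by (intro that[of "C+1"]) auto
qed

section \<open>Polynomials in the translation operator\<close>

text \<open>The polynomial \<open>p\<close> in the translation operator \<open>T\<^sub>h f = f(\<cdot> + h)\<close>, applied to \<open>f\<close>. Identities between
  polynomials thereby become identities between difference operators.\<close>
definition shift_op :: "complex poly \<Rightarrow> 'a::real_vector \<Rightarrow> ('a \<Rightarrow> complex) \<Rightarrow> 'a \<Rightarrow> complex" where
  "shift_op p h f x = (\<Sum>l\<le>degree p. coeff p l * f (x + real l *\<^sub>R h))"

text \<open>A bound for the norm of \<open>p(T\<^sub>h)\<close> on every translation invariant function space.\<close>
definition coeff_sum :: "complex poly \<Rightarrow> real" where
  "coeff_sum p = (\<Sum>l\<le>degree p. cmod (coeff p l))"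

abbreviation diff_op :: "nat \<Rightarrow> 'a::real_vector \<Rightarrow> ('a \<Rightarrow> complex) \<Rightarrow> 'a \<Rightarrow> complex" where
  "diff_op m \<equiv> shift_op ([:-1, 1:] ^ m)"

lemma coeff_sum_nonneg: "0 \<le> coeff_sum p"
  by (simp add: coeff_sum_def sum_nonneg)

lemma shift_op_eq:
  "degree p \<le> N \<Longrightarrow> shift_op p h f x = (\<Sum>l\<le>N. coeff p l * f (x + real l *\<^sub>R h))"
  unfolding shift_op_def by (intro sum.mono_neutral_left) (auto simp: coeff_eq_0)

lemma shift_op_0 [simp]: "shift_op 0 h f x = 0"
  by (simp add: shift_op_def)

lemma shift_op_pCons: "shift_op (pCons a p) h f x = a * f x + shift_op p h f (x + h)"
proof -
  have "shift_op (pCons a p) h f x = (\<Sum>l\<le>Suc (degree p). coeff (pCons a p) l * f (x + real l *\<^sub>R h))"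
    by (intro shift_op_eq) (simp add: degree_pCons_le)
  also have "\<dots> = a * f x + (\<Sum>l\<le>degree p. coeff p l * f (x + (1 + real l) *\<^sub>R h))"
    by (subst sum.atMost_Suc_shift) simp
  also have "\<dots> = a * f x + shift_op p h f (x + h)"
    by (simp add: shift_op_def scaleR_add_left add.assoc)
  finally show ?thesis .
qed

lemma shift_op_1 [simp]: "shift_op 1 h f = f"
  by (auto simp: one_pCons shift_op_pCons)

lemma shift_op_add: "shift_op (p + q) h f x = shift_op p h f x + shift_op q h f x"
proof -
  define N where "N = max (degree p) (degree q)"
  have "degree (p + q) \<le> N" "degree p \<le> N" "degree q \<le> N"
    by (auto simp: N_def degree_add_le_max)
  then show ?thesis by (simp add: shift_op_eq[of _ N] sum.distrib distrib_right)
qed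

lemma shift_op_smult: "shift_op (smult c p) h f x = c * shift_op p h f x"
  by (simp add: shift_op_eq[of _ "degree p"] sum_distrib_left mult.assoc)

lemma shift_op_diff: "shift_op (p - q) h f x = shift_op p h f x - shift_op q h f x"
  using shift_op_add[of p "smult (-1) q" h f x] shift_op_smult[of "-1" q h f x] by simp

lemma shift_op_mult: "shift_op (p * q) h f x = shift_op p h (shift_op q h f) x"
  by (induction p arbitrary: x) (simp_all add: shift_op_add shift_op_smult shift_op_pCons)

lemma shift_op_fadd: "shift_op p h (\<lambda>x. f x + g x) x = shift_op p h f x + shift_op p h g x"
  by (simp add: shift_op_def sum.distrib distrib_left)

lemma shift_op_fdiff: "shift_op p h (\<lambda>x. f x - g x) x = shift_op p h f x - shift_op p h g x"
  by (simp add: shift_op_def sum_subtractf right_diff_distrib)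

lemma shift_op_translate: "shift_op p h (\<lambda>x. f (x + a)) x = shift_op p h f (x + a)"
  by (simp add: shift_op_def add_ac)

lemma shift_op_scale: "shift_op p h (\<lambda>x. f (c *\<^sub>R x)) x = shift_op p (c *\<^sub>R h) f (c *\<^sub>R x)"
  by (simp add: shift_op_def scaleR_add_right mult.commute)

lemma shift_op_commute: "shift_op p h (shift_op q k f) x = shift_op q k (shift_op p h f) x"
  unfolding shift_op_def sum_distrib_left
  by (subst sum.swap) (simp add: mult_ac add_ac)

lemma shift_op_double: "shift_op [:-1, 0, 1:] h f = shift_op [:-1, 1:] (2 *\<^sub>R h) f"
  by (auto simp: shift_op_pCons scaleR_2 add.assoc)

lemma shift_op_power_double: "shift_op ([:-1, 0, 1:] ^ m) h f = diff_op m (2 *\<^sub>R h) f"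
proof (induction m arbitrary: f)
  case (Suc m)
  show ?case
    by (rule ext) (simp only: power_Suc shift_op_mult Suc shift_op_double)
qed auto

lemma diff_op_Suc: "diff_op (Suc m) h f x = diff_op m h (\<lambda>x. f (x + h) - f x) x"
proof -
  have e: "shift_op [:-1, 1:] h f = (\<lambda>x. f (x + h) - f x)" by (auto simp: shift_op_pCons)
  show ?thesis unfolding power_Suc2 shift_op_mult e ..
qed

lemma diff_op_Suc': "diff_op (Suc m) h f x = diff_op m h f (x + h) - diff_op m h f x"
  by (simp only: power_Suc shift_op_mult) (simp add: shift_op_pCons)

lemma fdiff_power_eq: "(fdiff h ^^ m) f = diff_op m h f"
  by (induction m) (auto simp: fun_eq_iff fdiff_def diff_op_Suc' simp del: power_Suc)

lemma shift_op_norm_le: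
  assumes "\<And>l. l \<le> degree p \<Longrightarrow> cmod (f (x + real l *\<^sub>R h)) \<le> B"
  shows "cmod (shift_op p h f x) \<le> coeff_sum p * B"
proof -
  have "cmod (shift_op p h f x) \<le> (\<Sum>l\<le>degree p. cmod (coeff p l) * cmod (f (x + real l *\<^sub>R h)))"
    unfolding shift_op_def by (rule order_trans[OF norm_sum]) (simp add: norm_mult)
  also have "\<dots> \<le> (\<Sum>l\<le>degree p. cmod (coeff p l) * B)"
    using assms by (intro sum_mono mult_left_mono) auto
  finally show ?thesis by (simp add: coeff_sum_def sum_distrib_right)
qed

lemma degree_diff_poly: "degree ([:-1, 1::complex:] ^ m) = m"
  by (simp add: degree_power_eq)

lemma shift_op_measurable [measurable (raw)]:
  fixes f :: "'a::euclidean_space \<Rightarrow> complex"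
  shows "f \<in> borel_measurable borel \<Longrightarrow> shift_op p h f \<in> borel_measurable borel"
proof -
  assume [measurable]: "f \<in> borel_measurable borel"
  show ?thesis unfolding shift_op_def[abs_def] by measurable
qed

lemma shift_op_continuous:
  fixes f :: "'a::real_normed_vector \<Rightarrow> complex"
  shows "continuous_on UNIV f \<Longrightarrow> continuous_on UNIV (shift_op p h f)"
  unfolding shift_op_def[abs_def]
  by (intro continuous_intros) (auto intro!: continuous_on_compose2[of UNIV f] continuous_intros)

text \<open>An iterated difference is close to the derivative: each application of the mean value inequality
  trades one difference for one derivative.\<close>
lemma diff_op_derivative:
  fixes u :: "nat \<Rightarrow> real \<Rightarrow> complex"
  assumes "\<And>b z. b < a \<Longrightarrow> (u b has_vector_derivative u (Suc b) z) (at z)"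
    and "\<And>z. \<bar>z - y\<bar> \<le> real a * \<bar>\<delta>\<bar> \<Longrightarrow> cmod (u a z - c) \<le> e"
  shows "cmod (diff_op a \<delta> (u 0) y - of_real \<delta> ^ a * c) \<le> e * \<bar>\<delta>\<bar> ^ a"
  using assms
proof (induction a arbitrary: u c e)
  case 0
  then show ?case by simp
next
  case (Suc a)
  define w where "w b z = u b (z + \<delta>) - u b z" for b z
  have "cmod (diff_op a \<delta> (w 0) y - of_real \<delta> ^ a * (of_real \<delta> * c)) \<le> (e * \<bar>\<delta>\<bar>) * \<bar>\<delta>\<bar> ^ a"
  proof (rule Suc.IH)
    fix b z assume b: "b < a"
    have "((\<lambda>z. u b (z + \<delta>)) has_vector_derivative u (Suc b) (z + \<delta>)) (at z)"
    proof -
      have "((u b \<circ> (\<lambda>z. z + \<delta>)) has_vector_derivative 1 *\<^sub>R u (Suc b) (z + \<delta>)) (at z)"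
        using Suc.prems(1)[of b] b
        by (intro vector_diff_chain_at) (auto intro!: derivative_eq_intros)
      then show ?thesis by (simp add: o_def)
    qed
    then show "(w b has_vector_derivative w (Suc b) z) (at z)"
      unfolding w_def using Suc.prems(1)[of b] b by (intro has_vector_derivative_diff) auto
  next
    fix z assume z: "\<bar>z - y\<bar> \<le> real a * \<bar>\<delta>\<bar>"
    define v where "v s = u a s - of_real s * c" for s
    have d: "(v has_vector_derivative u (Suc a) s - c) (at s)" for s
      unfolding v_def using Suc.prems(1)[of a]
      by (auto intro!: derivative_eq_intros has_vector_derivative_of_real simp: has_real_derivative_iff_has_vector_derivative[symmetric])
    have "cmod (v (z + \<delta>) - v z) \<le> e * norm ((z + \<delta>) - z)"
    proof (rule differentiable_bound[where S="closed_segment z (z + \<delta>)" and f'="\<lambda>s t. t *\<^sub>R (u (Suc a) s - c)"])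
      fix s assume s: "s \<in> closed_segment z (z + \<delta>)"
      show "(v has_derivative (\<lambda>t. t *\<^sub>R (u (Suc a) s - c))) (at s within closed_segment z (z + \<delta>))"
        using d[of s] by (auto simp: has_vector_derivative_def intro: has_derivative_at_withinI)
      have "\<bar>s - y\<bar> \<le> real (Suc a) * \<bar>\<delta>\<bar>"
        using s z by (auto simp: closed_segment_eq_real_ivl algebra_simps split: if_splits)
      then have "cmod (u (Suc a) s - c) \<le> e" by (rule Suc.prems(2))
      then show "onorm (\<lambda>t. t *\<^sub>R (u (Suc a) s - c)) \<le> e"
        by (intro onorm_le) (simp add: mult.commute[of e] mult_left_mono)
    qed auto
    then show "cmod (w a z - of_real \<delta> * c) \<le> e * \<bar>\<delta>\<bar>"
      by (simp add: v_def w_def algebra_simps)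
  qed
  moreover have "diff_op (Suc a) \<delta> (u 0) y = diff_op a \<delta> (w 0) y"
    unfolding diff_op_Suc w_def by simp
  ultimately show ?case by (simp add: mult_ac)
qed

section \<open>Norms of functions and moduli of smoothness\<close>

lemma Lp_norm_cmult:
  assumes "1 \<le> p" "f \<in> borel_measurable M"
  shows "Lp_norm p M (\<lambda>x. c * f x) = ennreal (cmod c) * Lp_norm p M f"
  unfolding Lp_norm_def using assms by (subst Lnorm_cmult[symmetric]) (auto simp: norm_mult ennreal_mult)

lemma Lp_norm_add:
  assumes "1 \<le> p" and [measurable]: "f \<in> borel_measurable M" "g \<in> borel_measurable M"
  shows "Lp_norm p M (\<lambda>x. f x + g x) \<le> Lp_norm p M f + Lp_norm p M g"
proof -
  have "Lp_norm p M (\<lambda>x. f x + g x) \<le> Lnorm p M (\<lambda>x. ennreal (cmod (f x)) + ennreal (cmod (g x)))"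
    unfolding Lp_norm_def
    by (intro Lnorm_mono assms) (auto simp: norm_triangle_ineq simp flip: ennreal_plus)
  also have "\<dots> \<le> Lp_norm p M f + Lp_norm p M g"
    unfolding Lp_norm_def by (intro Lnorm_add assms) auto
  finally show ?thesis .
qed

lemma Lp_norm_sum:
  assumes "1 \<le> p" "finite I" and [measurable]: "\<And>i. i \<in> I \<Longrightarrow> f i \<in> borel_measurable M"
  shows "Lp_norm p M (\<lambda>x. \<Sum>i\<in>I. f i x) \<le> (\<Sum>i\<in>I. Lp_norm p M (f i))"
proof -
  have "Lp_norm p M (\<lambda>x. \<Sum>i\<in>I. f i x) \<le> Lnorm p M (\<lambda>x. \<Sum>i\<in>I. ennreal (cmod (f i x)))"
    unfolding Lp_norm_def
    by (intro Lnorm_mono assms) (auto simp: norm_sum intro!: ennreal_leI)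
  also have "\<dots> \<le> (\<Sum>i\<in>I. Lp_norm p M (f i))"
    unfolding Lp_norm_def by (intro Lnorm_sum assms) auto
  finally show ?thesis .
qed

lemma Lp_norm_translate:
  fixes f :: "'a::euclidean_space \<Rightarrow> complex"
  assumes "1 \<le> p" and [measurable]: "f \<in> borel_measurable borel"
  shows "Lp_norm p lborel (\<lambda>x. f (x + h)) \<le> Lp_norm p lborel f"
proof -
  have "Lnorm p lborel (\<lambda>x. ennreal (cmod (f (h + x)))) \<le> ennreal (1 powr recip p) * Lnorm p lborel (\<lambda>x. ennreal (cmod (f x)))"
  proof (rule Lnorm_comp_le[where T="\<lambda>x. h + x"])
    fix A :: "'a set" assume A: "A \<in> sets lborel"
    have "emeasure lborel ((+) h -` A \<inter> space lborel) = emeasure (distr lborel borel ((+) h)) A"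
      using A by (subst emeasure_distr) auto
    then show "emeasure lborel ((+) h -` A \<inter> space lborel) \<le> ennreal 1 * emeasure lborel A"
      by (simp add: lborel_distr_plus)
  qed (use assms in auto)
  then show ?thesis by (simp add: Lp_norm_def add.commute)
qed

lemma Lp_norm_scale:
  fixes f :: "real ^ 'n \<Rightarrow> complex"
  assumes "1 \<le> p" and [measurable]: "f \<in> borel_measurable borel" and "0 < c"
  shows "Lp_norm p lborel (\<lambda>x. f (c *\<^sub>R x)) = ennreal (c powr (- (CARD('n) * recip p))) * Lp_norm p lborel f"
proof -
  have *: "Lp_norm p lborel (\<lambda>x. f (c *\<^sub>R x)) \<le> ennreal (c powr (- (CARD('n) * recip p))) * Lp_norm p lborel f"
    if c: "0 < c" and [measurable]: "f \<in> borel_measurable borel" for c and f :: "real ^ 'n \<Rightarrow> complex"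
  proof -
    have "Lnorm p lborel (\<lambda>x. ennreal (cmod (f (c *\<^sub>R x)))) \<le>
      ennreal ((inverse c ^ CARD('n)) powr recip p) * Lnorm p lborel (\<lambda>x. ennreal (cmod (f x)))"
    proof (rule Lnorm_comp_le[where T="\<lambda>x. c *\<^sub>R x"])
      fix A :: "(real ^ 'n) set" assume A: "A \<in> sets lborel"
      have "emeasure lborel A = (\<integral>\<^sup>+x. ennreal (\<bar>c\<bar> ^ DIM(real^'n)) * indicator A x \<partial>distr lborel borel (\<lambda>x. 0 + c *\<^sub>R x))"
        using A c by (subst lborel_affine[of c "0::real^'n"]) (auto simp: emeasure_density)
      also have "\<dots> = ennreal (c ^ CARD('n)) * emeasure (distr lborel borel (\<lambda>x. 0 + c *\<^sub>R x)) A"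
        using A c by (subst nn_integral_cmult_indicator) auto
      also have "emeasure (distr lborel borel (\<lambda>x. 0 + c *\<^sub>R x)) A = emeasure lborel ((\<lambda>x. c *\<^sub>R x) -` A \<inter> space lborel)"
        using A by (subst emeasure_distr) auto
      finally have "ennreal (inverse c ^ CARD('n)) * emeasure lborel A =
          (ennreal (inverse c ^ CARD('n)) * ennreal (c ^ CARD('n))) * emeasure lborel ((\<lambda>x. c *\<^sub>R x) -` A \<inter> space lborel)"
        by (simp add: mult.assoc)
      also have "ennreal (inverse c ^ CARD('n)) * ennreal (c ^ CARD('n)) = 1"
        using c by (simp add: ennreal_mult[symmetric] power_mult_distrib[symmetric])
      finally show "emeasure lborel ((\<lambda>x. c *\<^sub>R x) -` A \<inter> space lborel) \<le> ennreal (inverse c ^ CARD('n)) * emeasure lborel A"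
        by simp
    qed (use assms c in auto)
    also have "(inverse c ^ CARD('n)) powr recip p = c powr (- (CARD('n) * recip p))"
    proof -
      have "inverse c ^ CARD('n) = c powr (- real CARD('n))"
        using c by (simp add: powr_minus powr_realpow power_inverse)
      then show ?thesis by (simp add: powr_powr)
    qed
    finally show ?thesis by (simp add: Lp_norm_def)
  qed
  have "Lp_norm p lborel f \<le> ennreal (inverse c powr (- (CARD('n) * recip p))) * Lp_norm p lborel (\<lambda>x. f (c *\<^sub>R x))"
    using *[of "inverse c" "\<lambda>x. f (c *\<^sub>R x)"] assms by simp
  then have "ennreal (c powr (- (CARD('n) * recip p))) * Lp_norm p lborel f \<le>
     ennreal (c powr (- (CARD('n) * recip p))) * (ennreal (inverse c powr (- (CARD('n) * recip p))) * Lp_norm p lborel (\<lambda>x. f (c *\<^sub>R x)))"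
    by (rule mult_left_mono) simp
  also have "\<dots> = (ennreal (c powr (- (CARD('n) * recip p))) * ennreal (inverse c powr (- (CARD('n) * recip p)))) * Lp_norm p lborel (\<lambda>x. f (c *\<^sub>R x))"
    by (simp only: mult.assoc)
  also have "ennreal (c powr (- (CARD('n) * recip p))) * ennreal (inverse c powr (- (CARD('n) * recip p))) = 1"
    using assms by (simp add: ennreal_mult[symmetric] powr_mult[symmetric])
  finally show ?thesis using *[of c f] assms by (intro antisym) simp_all
qed

lemma Lp_norm_shift_op_le:
  fixes f :: "'a::euclidean_space \<Rightarrow> complex"
  assumes "1 \<le> p" and [measurable]: "f \<in> borel_measurable borel"
  shows "Lp_norm p lborel (shift_op P h f) \<le> ennreal (coeff_sum P) * Lp_norm p lborel f"
proof -
  have "Lp_norm p lborel (shift_op P h f) \<le> (\<Sum>l\<le>degree P. Lp_norm p lborel (\<lambda>x. coeff P l * f (x + real l *\<^sub>R h)))"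
    unfolding shift_op_def[abs_def] by (intro Lp_norm_sum assms) auto
  also have "\<dots> \<le> (\<Sum>l\<le>degree P. ennreal (cmod (coeff P l)) * Lp_norm p lborel f)"
    using assms by (intro sum_mono) (auto simp: Lp_norm_cmult intro!: mult_left_mono Lp_norm_translate)
  also have "\<dots> = ennreal (coeff_sum P) * Lp_norm p lborel f"
    by (simp add: coeff_sum_def sum_distrib_right[symmetric])
  finally show ?thesis .
qed

lemma modulus_eq: "modulus m p f t = (SUP h\<in>{h. norm h \<le> t}. Lp_norm p lborel (diff_op m h f))"
  by (simp add: modulus_def fdiff_power_eq)

lemma modulus_ge: "norm h \<le> t \<Longrightarrow> Lp_norm p lborel (diff_op m h f) \<le> modulus m p f t"
  unfolding modulus_eq by (rule SUP_upper) simp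

lemma modulus_leI: "(\<And>h. norm h \<le> t \<Longrightarrow> Lp_norm p lborel (diff_op m h f) \<le> c) \<Longrightarrow> modulus m p f t \<le> c"
  unfolding modulus_eq by (rule SUP_least) simp

lemma modulus_mono: "s \<le> t \<Longrightarrow> modulus m p f s \<le> modulus m p f t"
  by (rule modulus_leI, rule modulus_ge) simp

lemma modulus_le_norm:
  assumes "1 \<le> p" "f \<in> borel_measurable borel"
  shows "modulus m p f t \<le> ennreal (coeff_sum ([:-1, 1:] ^ m)) * Lp_norm p lborel f"
  by (intro modulus_leI Lp_norm_shift_op_le assms)

lemma modulus_add_order:
  assumes "1 \<le> p" "f \<in> borel_measurable borel"
  shows "modulus (k + m) p f t \<le> ennreal (coeff_sum ([:-1, 1:] ^ k)) * modulus m p f t"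
proof (rule modulus_leI)
  fix h :: "real ^ 'a" assume h: "norm h \<le> t"
  have "diff_op (k + m) h f = shift_op ([:-1, 1:] ^ k) h (diff_op m h f)"
    by (auto simp: power_add shift_op_mult)
  then have "Lp_norm p lborel (diff_op (k + m) h f) \<le> ennreal (coeff_sum ([:-1, 1:] ^ k)) * Lp_norm p lborel (diff_op m h f)"
    using assms by (simp add: Lp_norm_shift_op_le shift_op_measurable)
  also have "\<dots> \<le> ennreal (coeff_sum ([:-1, 1:] ^ k)) * modulus m p f t"
    using h by (intro mult_left_mono modulus_ge) auto
  finally show "Lp_norm p lborel (diff_op (k + m) h f) \<le> \<dots>" .
qed

lemma modulus_shift_op:
  assumes "1 \<le> p" "f \<in> borel_measurable borel"
  shows "modulus m p (shift_op P k f) t \<le> ennreal (coeff_sum P) * modulus m p f t"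
proof (rule modulus_leI)
  fix h :: "real ^ 'a" assume h: "norm h \<le> t"
  have "diff_op m h (shift_op P k f) = shift_op P k (diff_op m h f)"
    by (auto simp: shift_op_commute)
  then have "Lp_norm p lborel (diff_op m h (shift_op P k f)) \<le> ennreal (coeff_sum P) * Lp_norm p lborel (diff_op m h f)"
    using assms by (simp add: Lp_norm_shift_op_le shift_op_measurable)
  also have "\<dots> \<le> ennreal (coeff_sum P) * modulus m p f t"
    using h by (intro mult_left_mono modulus_ge) auto
  finally show "Lp_norm p lborel (diff_op m h (shift_op P k f)) \<le> \<dots>" .
qed

text \<open>With \<open>T\<close> the translation by \<open>h\<close>, \<open>(T\<^sup>2 - 1)\<^sup>m = (T - 1)\<^sup>m (T + 1)\<^sup>m\<close>, and \<open>(T + 1)\<^sup>m\<close> is \<open>2\<^sup>m\<close> up to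
  a multiple of \<open>T - 1\<close>. So an \<open>m\<close>-th difference is \<open>2\<^sup>-\<^sup>m\<close> times the one with doubled step, up to
  differences of order \<open>m + 1\<close>.\<close>
lemma modulus_marchaud:
  obtains C where "0 \<le> C" "\<And>p (f :: real ^ 'n \<Rightarrow> complex) t. 1 \<le> p \<Longrightarrow> f \<in> borel_measurable borel \<Longrightarrow>
    modulus m p f t \<le> ennreal (2 powr (- real m)) * modulus m p f (2 * t) + ennreal C * modulus (Suc m) p f t"
proof -
  have "poly ([:1, 1:] ^ m - [:2 ^ m::complex:]) 1 = 0" by (simp add: poly_power)
  then have "[:- 1, 1:] dvd [:1, 1:] ^ m - [:2 ^ m::complex:]"
    unfolding poly_eq_0_iff_dvd .
  then obtain R :: "complex poly" where R: "[:1, 1:] ^ m - [:2 ^ m:] = [:-1, 1:] * R" by (elim dvdE)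
  have sq: "[:-1, 0, 1:] = [:-1, 1:] * [:1, 1::complex:]" by simp
  have pol: "[:-1, 0, 1:] ^ m = smult (2 ^ m) ([:-1, 1::complex:] ^ m) + R * [:-1, 1:] ^ Suc m"
  proof -
    have "[:1, 1:] ^ m = [:2 ^ m:] + [:-1, 1:] * R" using R by (simp add: algebra_simps)
    moreover have "A ^ m * ([:c:] + A * S) = smult c (A ^ m) + S * A ^ Suc m" for A S :: "complex poly" and c
      by (simp add: distrib_left mult_ac)
    ultimately show ?thesis unfolding sq power_mult_distrib by metis
  qed
  define K where "K = smult (- 1 / 2 ^ m) R"
  have key: "diff_op m h f x = 1 / 2 ^ m * diff_op m (2 *\<^sub>R h) f x + shift_op K h (diff_op (Suc m) h f) x"
    for h x :: "real ^ 'n" and f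
  proof -
    have "diff_op m (2 *\<^sub>R h) f x = 2 ^ m * diff_op m h f x + shift_op R h (diff_op (Suc m) h f) x"
      unfolding shift_op_power_double[symmetric] pol by (simp only: shift_op_add shift_op_smult shift_op_mult)
    then show ?thesis unfolding K_def by (simp only: shift_op_smult) (simp add: field_simps)
  qed
  have "modulus m p f t \<le> ennreal (2 powr (- real m)) * modulus m p f (2 * t) + ennreal (coeff_sum K) * modulus (Suc m) p f t"
    if p: "1 \<le> p" and [measurable]: "f \<in> borel_measurable borel" for p and f :: "real ^ 'n \<Rightarrow> complex" and t
  proof (rule modulus_leI)
    fix h :: "real ^ 'n" assume h: "norm h \<le> t"
    have "Lp_norm p lborel (diff_op m h f) = Lp_norm p lborel (\<lambda>x. 1 / 2 ^ m * diff_op m (2 *\<^sub>R h) f x + shift_op K h (diff_op (Suc m) h f) x)"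
      by (intro arg_cong[where f="Lp_norm p lborel"] ext key)
    also have "\<dots> \<le> Lp_norm p lborel (\<lambda>x. 1 / 2 ^ m * diff_op m (2 *\<^sub>R h) f x) + Lp_norm p lborel (shift_op K h (diff_op (Suc m) h f))"
      using p by (intro Lp_norm_add) (auto simp del: power_Suc)
    also have "Lp_norm p lborel (\<lambda>x. 1 / 2 ^ m * diff_op m (2 *\<^sub>R h) f x) = ennreal (2 powr (- real m)) * Lp_norm p lborel (diff_op m (2 *\<^sub>R h) f)"
      using p by (subst Lp_norm_cmult) (auto simp: norm_divide norm_power powr_minus powr_realpow inverse_eq_divide)
    also have "Lp_norm p lborel (diff_op m (2 *\<^sub>R h) f) \<le> modulus m p f (2 * t)"
      using h by (intro modulus_ge) auto
    also have "Lp_norm p lborel (shift_op K h (diff_op (Suc m) h f)) \<le> ennreal (coeff_sum K) * Lp_norm p lborel (diff_op (Suc m) h f)"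
      using p by (intro Lp_norm_shift_op_le) (auto simp del: power_Suc)
    also have "Lp_norm p lborel (diff_op (Suc m) h f) \<le> modulus (Suc m) p f t"
      using h by (rule modulus_ge)
    finally show "Lp_norm p lborel (diff_op m h f) \<le> ennreal (2 powr (- real m)) * modulus m p f (2 * t) + ennreal (coeff_sum K) * modulus (Suc m) p f t"
      by (auto simp: add_mono mult_left_mono)
  qed
  then show thesis using coeff_sum_nonneg by (intro that[of "coeff_sum K"]) auto
qed

section \<open>Finite sums over lattices\<close>

lemma infsum_finite_support:
  assumes "finite F" "\<And>x. x \<notin> F \<Longrightarrow> f x = 0"
  shows "infsum f UNIV = sum f F"
  using assms infsum_cong_neutral[of F UNIV f f] by (simp add: infsum_finite)

lemma summable_on_finite_support:
  assumes "finite F" "\<And>x. x \<notin> F \<Longrightarrow> f x = 0"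
  shows "f summable_on A"
proof -
  have "f summable_on (A \<inter> F)" using assms by (intro summable_on_finite) auto
  then show ?thesis using assms summable_on_cong_neutral[of "A \<inter> F" A f f] by auto
qed

lemma infsum_diff_finite_support:
  fixes f g :: "'a \<Rightarrow> complex"
  assumes "finite F" "\<And>x. x \<notin> F \<Longrightarrow> f x = 0" "\<And>x. x \<notin> F \<Longrightarrow> g x = 0"
  shows "(\<Sum>\<^sub>\<infinity>x. f x - g x) = (\<Sum>\<^sub>\<infinity>x. f x) - (\<Sum>\<^sub>\<infinity>x. g x)"
  using assms by (simp add: infsum_finite_support[of F] sum_subtractf)

lemma infsum_swap_finite_support:
  fixes f :: "'a \<Rightarrow> 'b \<Rightarrow> complex"
  assumes "finite F" "\<And>x y. (x, y) \<notin> F \<Longrightarrow> f x y = 0"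
  shows "(\<Sum>\<^sub>\<infinity>x. \<Sum>\<^sub>\<infinity>y. f x y) = (\<Sum>\<^sub>\<infinity>y. \<Sum>\<^sub>\<infinity>x. f x y)"
  using assms
  by (intro infsum_swap_banach summable_on_finite_support[of F]) auto

lemma infsum_translate_int: "(\<Sum>\<^sub>\<infinity>k::int. f (k + c)) = (\<Sum>\<^sub>\<infinity>k. f k)"
  by (rule infsum_reindex_bij_witness[of UNIV "\<lambda>k. k - c" "\<lambda>k. k + c"]) auto

lemma finite_int_near: "finite {k::int. \<bar>x - of_int k\<bar> \<le> (r::real)}"
proof (rule finite_subset)
  show "{k::int. \<bar>x - of_int k\<bar> \<le> r} \<subseteq> {\<lfloor>x - r\<rfloor>..\<lceil>x + r\<rceil>}"
    by (auto simp: floor_le_iff le_ceiling_iff)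
qed simp

text \<open>A product of sets whose elements are vectors; sums over it factorise coordinatewise.\<close>
definition vec_box :: "('n \<Rightarrow> 'a set) \<Rightarrow> ('a ^ 'n) set" where
  "vec_box A = {k. \<forall>i. k $ i \<in> A i}"

lemma vec_box_bij: "bij_betw (\<lambda>g. \<chi> i. g i) (PiE UNIV A) (vec_box A)"
  by (rule bij_betwI[where g="\<lambda>k i. k $ i"]) (auto simp: vec_box_def)

lemma finite_vec_box: "(\<And>i::'n::finite. finite (A i)) \<Longrightarrow> finite (vec_box A)"
  using bij_betw_finite[OF vec_box_bij, of A] by (auto intro: finite_PiE)

lemma sum_vec_box:
  fixes f :: "'n::finite \<Rightarrow> 'a \<Rightarrow> complex"
  assumes "\<And>i. finite (A i)"
  shows "(\<Sum>k\<in>vec_box A. \<Prod>i\<in>UNIV. f i (k $ i)) = (\<Prod>i\<in>UNIV. \<Sum>a\<in>A i. f i a)"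
proof -
  have "(\<Prod>i\<in>UNIV. \<Sum>a\<in>A i. f i a) = (\<Sum>g\<in>PiE UNIV A. \<Prod>i\<in>UNIV. f i (g i))"
    using assms by (intro prod_sum_PiE) auto
  also have "\<dots> = (\<Sum>k\<in>vec_box A. \<Prod>i\<in>UNIV. f i (k $ i))"
    by (rule sum.reindex_bij_betw[OF vec_box_bij, of "\<lambda>k. \<Prod>i\<in>UNIV. f i (k $ i)" A, simplified])
  finally show ?thesis ..
qed

lemma infsum_vec_prod:
  fixes f :: "'n::finite \<Rightarrow> 'a \<Rightarrow> complex"
  assumes "\<And>i. finite {a. f i a \<noteq> 0}"
  shows "(\<Sum>\<^sub>\<infinity>k. \<Prod>i\<in>UNIV. f i (k $ i)) = (\<Prod>i\<in>UNIV. \<Sum>\<^sub>\<infinity>a. f i a)"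
proof -
  have "(\<Sum>\<^sub>\<infinity>k. \<Prod>i\<in>UNIV. f i (k $ i)) = (\<Sum>k\<in>vec_box (\<lambda>i. {a. f i a \<noteq> 0}). \<Prod>i\<in>UNIV. f i (k $ i))"
    using assms by (intro infsum_finite_support finite_vec_box) (auto simp: vec_box_def)
  also have "\<dots> = (\<Prod>i\<in>UNIV. \<Sum>a\<in>{a. f i a \<noteq> 0}. f i a)"
    using assms by (rule sum_vec_box)
  also have "\<dots> = (\<Prod>i\<in>UNIV. \<Sum>\<^sub>\<infinity>a. f i a)"
    using assms by (intro prod.cong refl infsum_finite_support[symmetric]) auto
  finally show ?thesis .
qed

section \<open>Dyadic points\<close>

lemma dyadic_approx:
  fixes x :: real
  shows "(\<lambda>j. of_int \<lfloor>2 ^ j * x\<rfloor> / 2 ^ j) \<longlonglongrightarrow> x"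
proof (rule tendsto_sandwich[of "\<lambda>j. x - 1 / 2 ^ j" _ _ "\<lambda>j. x"])
  have e: "real_of_int \<lfloor>2 ^ j * x\<rfloor> \<le> 2 ^ j * x" "2 ^ j * x - 1 \<le> real_of_int \<lfloor>2 ^ j * x\<rfloor>" for j
    by linarith+
  show "\<forall>\<^sub>F j in sequentially. x - 1 / 2 ^ j \<le> of_int \<lfloor>2 ^ j * x\<rfloor> / 2 ^ j"
  proof (intro always_eventually allI)
    fix j
    have "x - 1 / 2 ^ j = (2 ^ j * x - 1) / 2 ^ j" by (simp add: diff_divide_distrib)
    also have "\<dots> \<le> of_int \<lfloor>2 ^ j * x\<rfloor> / 2 ^ j" using e by (intro divide_right_mono) auto
    finally show "x - 1 / 2 ^ j \<le> of_int \<lfloor>2 ^ j * x\<rfloor> / 2 ^ j" .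
  qed
  show "\<forall>\<^sub>F j in sequentially. of_int \<lfloor>2 ^ j * x\<rfloor> / 2 ^ j \<le> x"
    using e by (intro always_eventually) (auto simp: field_simps)
  have "(\<lambda>j. (1/2::real) ^ j) \<longlonglongrightarrow> 0" by (rule LIMSEQ_realpow_zero) auto
  then have "(\<lambda>j. x - (1/2) ^ j) \<longlonglongrightarrow> x - 0" by (rule tendsto_diff[OF tendsto_const])
  then show "(\<lambda>j. x - 1 / 2 ^ j) \<longlonglongrightarrow> x" by (simp add: power_divide)
qed simp

text \<open>The dyadic numbers are dense.\<close>
lemma continuous_eq_on_dyadics:
  fixes f :: "real \<Rightarrow> complex"
  assumes "continuous_on UNIV f" "\<And>j k. f (of_int k / 2 ^ j) = c"
  shows "f x = c"
proof -
  have "isCont f x" using assms(1) by (simp add: continuous_on_eq_continuous_at)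
  then have "(\<lambda>j. f (of_int \<lfloor>2 ^ j * x\<rfloor> / 2 ^ j)) \<longlonglongrightarrow> f x"
    using dyadic_approx isCont_tendsto_compose by blast
  then show ?thesis unfolding assms(2) by (simp add: LIMSEQ_const_iff)
qed

section \<open>The one-dimensional scaling function\<close>

locale scaling =
  fixes \<phi> :: "real \<Rightarrow> complex" and R :: nat
  assumes interp: "interpolating_scaling \<phi>" and supp: "\<And>x. \<phi> x \<noteq> 0 \<Longrightarrow> \<bar>x\<bar> < real R"
begin

lemma cont: "continuous_on UNIV \<phi>"
  using interp unfolding interpolating_scaling_def by blast

lemma int_values: "\<phi> (of_int k) = (if k = 0 then 1 else 0)"
  using interp unfolding interpolating_scaling_def by blast

lemma zero_value: "\<phi> 0 = 1" using int_values[of 0] by simp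

lemma R_pos: "0 < R" using supp[of 0] zero_value by simp

lemma refinement: "\<phi> x = (\<Sum>\<^sub>\<infinity>k::int. \<phi> (of_int k / 2) * \<phi> (2 * x - of_int k))"
  using interp unfolding interpolating_scaling_def by blast

lemma finite_near: "finite {k::int. \<phi> (x - of_int k) \<noteq> 0}"
  by (rule finite_subset[OF _ finite_int_near[of x R]]) (auto dest: supp)

lemma bounded_phi: "\<exists>B>0. \<forall>x. cmod (\<phi> x) \<le> B"
proof -
  have "compact (\<phi> ` {-real R..real R})"
    by (intro compact_continuous_image continuous_on_subset[OF cont]) auto
  then obtain B where B: "0 < B" "\<And>y. y \<in> \<phi> ` {-real R..real R} \<Longrightarrow> cmod y \<le> B"
    using compact_imp_bounded bounded_pos by metis
  have "cmod (\<phi> x) \<le> B" for x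
  proof (cases "\<phi> x = 0")
    case False
    then have "x \<in> {-real R..real R}" using supp[of x] by auto
    then show ?thesis by (intro B(2) imageI)
  qed (use B in simp)
  then show ?thesis using B(1) by auto
qed

text \<open>That is, \<open>P\<^sub>j \<phi> = \<phi>\<close> for \<open>j \<ge> 0\<close>: insert the refinement equation into itself.\<close>
lemma refinement_iterated:
  "\<phi> x = (\<Sum>\<^sub>\<infinity>k::int. \<phi> (of_int k / 2 ^ j) * \<phi> (2 ^ j * x - of_int k))"
proof (induction j arbitrary: x)
  case 0
  have "(\<Sum>\<^sub>\<infinity>k::int. \<phi> (of_int k / 2 ^ 0) * \<phi> (2 ^ 0 * x - of_int k)) = (\<Sum>k\<in>{0::int}. \<phi> (of_int k / 2 ^ 0) * \<phi> (2 ^ 0 * x - of_int k))"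
    by (rule infsum_finite_support) (auto simp: int_values)
  then show ?case by (simp add: zero_value)
next
  case (Suc j)
  have "\<phi> x = (\<Sum>\<^sub>\<infinity>k::int. \<phi> (of_int k / 2) * \<phi> (2 * x - of_int k))" by (rule refinement)
  also have "\<dots> = (\<Sum>\<^sub>\<infinity>k::int. \<Sum>\<^sub>\<infinity>L::int. \<phi> (of_int k / 2) * (\<phi> (of_int L / 2 ^ j - of_int k) * \<phi> (2 ^ Suc j * x - of_int L)))"
  proof (rule infsum_cong)
    fix k :: int
    have "\<phi> (2 * x - of_int k) = (\<Sum>\<^sub>\<infinity>l::int. \<phi> (of_int l / 2 ^ j) * \<phi> (2 ^ j * (2 * x - of_int k) - of_int l))"
      by (rule Suc)
    also have "\<dots> = (\<Sum>\<^sub>\<infinity>L::int. \<phi> (of_int (L + - (2 ^ j * k)) / 2 ^ j) * \<phi> (2 ^ j * (2 * x - of_int k) - of_int (L + - (2 ^ j * k))))"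
      by (rule infsum_translate_int[symmetric])
    also have "\<dots> = (\<Sum>\<^sub>\<infinity>L::int. \<phi> (of_int L / 2 ^ j - of_int k) * \<phi> (2 ^ Suc j * x - of_int L))"
      by (intro infsum_cong) (simp add: field_simps)
    finally show "\<phi> (of_int k / 2) * \<phi> (2 * x - of_int k) = (\<Sum>\<^sub>\<infinity>L::int. \<phi> (of_int k / 2) * (\<phi> (of_int L / 2 ^ j - of_int k) * \<phi> (2 ^ Suc j * x - of_int L)))"
      by (simp add: infsum_cmult_right')
  qed
  also have "\<dots> = (\<Sum>\<^sub>\<infinity>L::int. \<Sum>\<^sub>\<infinity>k::int. \<phi> (of_int k / 2) * (\<phi> (of_int L / 2 ^ j - of_int k) * \<phi> (2 ^ Suc j * x - of_int L)))"
  proof (rule infsum_swap_finite_support)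
    show "finite ({k::int. \<bar>0 - of_int k\<bar> \<le> real (2 * R)} \<times> {L::int. \<phi> (2 ^ Suc j * x - of_int L) \<noteq> 0})"
      by (intro finite_cartesian_product finite_int_near finite_near)
    fix k L :: int
    assume "(k, L) \<notin> {k::int. \<bar>0 - of_int k\<bar> \<le> real (2 * R)} \<times> {L::int. \<phi> (2 ^ Suc j * x - of_int L) \<noteq> 0}"
    then show "\<phi> (of_int k / 2) * (\<phi> (of_int L / 2 ^ j - of_int k) * \<phi> (2 ^ Suc j * x - of_int L)) = 0"
      using supp[of "of_int k / 2"] by force
  qed
  also have "\<dots> = (\<Sum>\<^sub>\<infinity>L::int. (\<Sum>\<^sub>\<infinity>k::int. \<phi> (of_int k / 2) * \<phi> (2 * (of_int L / 2 ^ Suc j) - of_int k)) * \<phi> (2 ^ Suc j * x - of_int L))"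
    by (simp add: infsum_cmult_left'[symmetric] mult.assoc)
  also have "\<dots> = (\<Sum>\<^sub>\<infinity>L::int. \<phi> (of_int L / 2 ^ Suc j) * \<phi> (2 ^ Suc j * x - of_int L))"
    by (subst refinement[symmetric]) rule
  finally show ?case .
qed

lemma dual_filter_0: "dual_filter \<phi> 0 l = (if l = 0 then 1 else 0)"
  by (simp add: dual_filter_def)

lemma dual_filter_1: "dual_filter \<phi> 1 l = (if l = 1 then 1 else if even l then - \<phi> (1/2 - of_int l / 2) else 0)"
proof (cases "even l")
  case True
  then have "odd (l - 1)" by simp
  then have "(- 1 :: complex) powi (l - 1) = - 1" by (simp add: power_int_minus_one_minus)
  then show ?thesis using True by (auto simp: dual_filter_def diff_divide_distrib)
next
  case False
  then obtain m where m: "l = 2 * m + 1" by (elim oddE)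
  have "\<phi> ((1 - of_int l) / 2) = \<phi> (of_int (- m))" by (simp add: m)
  then have "\<phi> ((1 - of_int l) / 2) = (if m = 0 then 1 else 0)"
    unfolding int_values by simp
  then show ?thesis using False m by (auto simp: dual_filter_def)
qed

lemma dual_filter_support: "dual_filter \<phi> s l \<noteq> 0 \<Longrightarrow> \<bar>l\<bar> \<le> 2 * int R"
  using supp[of "(1 - of_int l) / 2"] R_pos by (auto simp: dual_filter_def split: if_splits)

lemma dual_filter_zero: "2 * int R < \<bar>l\<bar> \<Longrightarrow> dual_filter \<phi> s l = 0"
  using dual_filter_support[of s l] by linarith

lemma finite_dual_filter: "finite {l. dual_filter \<phi> s l \<noteq> 0}"
proof (rule finite_subset[of _ "{-2 * int R..2 * int R}"])
  show "{l. dual_filter \<phi> s l \<noteq> 0} \<subseteq> {-2 * int R..2 * int R}"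
    using dual_filter_support by (simp add: abs_le_iff subset_eq) (metis minus_le_iff)
qed simp

lemma infsum_dual_filter_1:
  "(\<Sum>\<^sub>\<infinity>l. dual_filter \<phi> 1 l * g l) = g 1 - (\<Sum>\<^sub>\<infinity>i::int. \<phi> (1/2 - of_int i) * g (2 * i))"
proof -
  have "(\<Sum>\<^sub>\<infinity>l. dual_filter \<phi> 1 l * g l) =
      (\<Sum>\<^sub>\<infinity>l. (if l = 1 then g 1 else 0) - (if even l then \<phi> (1/2 - of_int l / 2) * g l else 0))"
    unfolding dual_filter_1 by (intro infsum_cong) auto
  also have "\<dots> = (\<Sum>\<^sub>\<infinity>l. (if l = (1::int) then g 1 else 0)) - (\<Sum>\<^sub>\<infinity>l. (if even l then \<phi> (1/2 - of_int l / 2) * g l else 0))"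
  proof (rule infsum_diff_finite_support[of "{- 2 * int R - 1..2 * int R + 1}"])
    fix l :: int assume l: "l \<notin> {- 2 * int R - 1..2 * int R + 1}"
    then have "\<not> \<bar>1/2 - of_int l / 2\<bar> < real R" by (simp add: abs_less_iff) linarith
    then show "(if even l then \<phi> (1/2 - of_int l / 2) * g l else 0) = 0"
      using supp[of "1/2 - of_int l / 2"] by auto
    show "(if l = 1 then g 1 else 0) = 0" using l by auto
  qed simp
  also have "(\<Sum>\<^sub>\<infinity>l. (if l = (1::int) then g 1 else 0)) = g 1"
    by (subst infsum_finite_support[of "{1}"]) auto
  also have "(\<Sum>\<^sub>\<infinity>l. (if even l then \<phi> (1/2 - of_int l / 2) * g l else 0)) = (\<Sum>\<^sub>\<infinity>l\<in>range (\<lambda>i. 2 * i). \<phi> (1/2 - of_int l / 2) * g l)"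
    by (rule infsum_cong_neutral) auto
  also have "\<dots> = (\<Sum>\<^sub>\<infinity>i. \<phi> (1/2 - of_int i) * g (2 * i))"
    by (subst infsum_reindex) (auto simp: inj_on_def o_def)
  finally show ?thesis .
qed

text \<open>The filter compares the value at the odd grid point \<open>2k + 1\<close> with the prediction from the even ones,
  and for \<open>\<phi>\<close> this prediction is exact on every grid \<open>2\<^sup>-\<^sup>j\<^sup>-\<^sup>1 \<int>\<close>.\<close>
lemma dual_filter_kills_phi:
  "(\<Sum>\<^sub>\<infinity>l. dual_filter \<phi> 1 l * \<phi> (of_int (2 * k + l) / 2 ^ Suc j)) = 0"
proof -
  have "\<phi> (of_int (2 * k + 1) / 2 ^ Suc j) = (\<Sum>\<^sub>\<infinity>i::int. \<phi> (of_int i / 2 ^ j) * \<phi> (2 ^ j * (of_int (2 * k + 1) / 2 ^ Suc j) - of_int i))"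
    by (rule refinement_iterated)
  also have "\<dots> = (\<Sum>\<^sub>\<infinity>i::int. \<phi> (of_int (i + k) / 2 ^ j) * \<phi> (2 ^ j * (of_int (2 * k + 1) / 2 ^ Suc j) - of_int (i + k)))"
    by (rule infsum_translate_int[symmetric])
  also have "\<dots> = (\<Sum>\<^sub>\<infinity>i::int. \<phi> (1/2 - of_int i) * \<phi> (of_int (2 * k + 2 * i) / 2 ^ Suc j))"
  proof (rule infsum_cong)
    fix i :: int
    have e: "2 ^ j * (of_int (2 * k + 1) / 2 ^ Suc j) - of_int (i + k) = 1/2 - (of_int i :: real)"
      "of_int (i + k) / 2 ^ j = (of_int (2 * k + 2 * i) / 2 ^ Suc j :: real)"
      by (simp_all add: field_simps)
    show "\<phi> (of_int (i + k) / 2 ^ j) * \<phi> (2 ^ j * (of_int (2 * k + 1) / 2 ^ Suc j) - of_int (i + k)) =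
        \<phi> (1/2 - of_int i) * \<phi> (of_int (2 * k + 2 * i) / 2 ^ Suc j)"
      unfolding e by (rule mult.commute)
  qed
  finally show ?thesis unfolding infsum_dual_filter_1 by simp
qed

text \<open>The filter \<^term>\<open>dual_filter \<phi> 1\<close> as a polynomial in the translation; the shift of the indices by
  \<open>2 R\<close> makes the exponents nonnegative.\<close>
definition filter_poly :: "complex poly" where
  "filter_poly = (\<Sum>n\<le>4 * R. monom (dual_filter \<phi> 1 (int n - 2 * int R)) n)"

lemma coeff_filter_poly: "coeff filter_poly n = dual_filter \<phi> 1 (int n - 2 * int R)"
proof -
  have "coeff filter_poly n = (if n \<le> 4 * R then dual_filter \<phi> 1 (int n - 2 * int R) else 0)"
    by (simp add: filter_poly_def coeff_sum)
  moreover have "dual_filter \<phi> 1 (int n - 2 * int R) = 0" if "\<not> n \<le> 4 * R"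
    using that by (intro dual_filter_zero) auto
  ultimately show ?thesis by auto
qed

lemma filter_poly_nz: "filter_poly \<noteq> 0"
  using coeff_filter_poly[of "2 * R + 1"] dual_filter_1[of 1] by force

lemma shift_op_filter_poly:
  "shift_op filter_poly h f x = (\<Sum>\<^sub>\<infinity>l. dual_filter \<phi> 1 l * f (x + of_int (l + 2 * int R) *\<^sub>R h))"
proof -
  have "degree filter_poly \<le> 4 * R"
    by (rule degree_le) (auto simp: coeff_filter_poly intro!: dual_filter_zero)
  then have "shift_op filter_poly h f x = (\<Sum>n\<le>4 * R. dual_filter \<phi> 1 (int n - 2 * int R) * f (x + real n *\<^sub>R h))"
    by (simp add: shift_op_eq coeff_filter_poly)
  also have "\<dots> = (\<Sum>l\<in>{- 2 * int R..2 * int R}. dual_filter \<phi> 1 l * f (x + of_int (l + 2 * int R) *\<^sub>R h))"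
    by (rule sum.reindex_bij_witness[of _ "\<lambda>l. nat (l + 2 * int R)" "\<lambda>n. int n - 2 * int R"]) auto
  also have "\<dots> = (\<Sum>\<^sub>\<infinity>l. dual_filter \<phi> 1 l * f (x + of_int (l + 2 * int R) *\<^sub>R h))"
    by (rule infsum_finite_support[symmetric]) (auto simp: dual_filter_zero)
  finally show ?thesis .
qed

text \<open>Near a dyadic point \<open>x\<close>, the filter applied to \<open>\<phi>\<close> at a fine dyadic scale \<open>h\<close> behaves like
  \<open>h\<^sup>a r(1) \<phi>\<^sup>(\<^sup>a\<^sup>)(x)\<close>, where \<open>a\<close> is the order of the zero at \<open>1\<close>; as it vanishes, so would
  \<open>\<phi>\<^sup>(\<^sup>a\<^sup>)\<close>, contradicting \<open>\<phi>(0) = 1\<close> and \<open>\<phi>(k) = 0\<close> for the other integers.\<close>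
lemma vanishing_moments:
  fixes u :: "nat \<Rightarrow> real \<Rightarrow> complex"
  assumes u0: "u 0 = \<phi>" and der: "\<And>b z. b < N \<Longrightarrow> (u b has_vector_derivative u (Suc b) z) (at z)"
    and contN: "continuous_on UNIV (u N)"
  obtains r where "filter_poly = [:-1, 1:] ^ Suc N * r"
proof -
  obtain r where r: "filter_poly = [:-1, 1:] ^ order 1 filter_poly * r" "\<not> [:-1, 1:] dvd r"
    using order_decomp[OF filter_poly_nz, of 1] by auto
  define a where "a = order 1 filter_poly"
  have r1: "poly r 1 \<noteq> 0" using r(2) poly_eq_0_iff_dvd[of r 1] by simp
  have "Suc N \<le> a"
  proof (rule ccontr)
    assume "\<not> Suc N \<le> a"
    then have a: "a \<le> N" by simp
    have conta: "continuous_on UNIV (u a)"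
    proof (cases "a = N")
      case False
      then show ?thesis using a der[of a]
        by (auto intro!: continuous_at_imp_continuous_on has_vector_derivative_continuous)
    qed (use contN in simp)
    have dy: "u a (of_int k0 / 2 ^ J) = 0" for k0 :: int and J
    proof (rule ccontr)
      define x where "x = of_int k0 / (2 ^ J :: real)"
      assume "u a (of_int k0 / 2 ^ J) \<noteq> 0"
      then have nz: "u a x \<noteq> 0" by (simp add: x_def)
      \<comment> \<open>Small enough for the error of the expansion not to outweigh its main term.\<close>
      define e where "e = cmod (poly r 1 * u a x) / (coeff_sum r + 1)"
      have epos: "0 < e" using nz r1 coeff_sum_nonneg[of r] by (simp add: e_def)
      obtain d where d: "0 < d" "\<And>z. \<bar>z - x\<bar> < d \<Longrightarrow> cmod (u a z - u a x) < e"
        using conta epos unfolding continuous_on_iff dist_norm real_norm_def by (meson UNIV_I)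
      \<comment> \<open>All the points that enter the expansion lie within \<open>W h\<close> of \<open>x\<close>.\<close>
      define W where "W = real a + real (degree r) + 2 * real R + 1"
      obtain j0 where j0: "W / d < 2 ^ j0" using real_arch_pow[of 2 "W / d"] by auto
      define j where "j = max J j0"
      define h where "h = 1 / (2 ^ Suc j :: real)"
      have h: "0 < h" "W * h < d"
      proof -
        show "0 < h" by (simp add: h_def)
        have "W / d < 2 ^ Suc j"
        proof -
          have "(2::real) ^ j0 \<le> 2 ^ Suc j" by (intro power_increasing) (auto simp: j_def)
          with j0 show ?thesis by linarith
        qed
        then show "W * h < d" using d by (simp add: h_def field_simps)
      qed
      \<comment> \<open>On the chosen grid \<open>x\<close> is an even point, where the filter annihilates \<open>\<phi>\<close>.\<close>
      define k where "k = k0 * 2 ^ (j - J)"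
      have xk: "x = of_int (2 * k) * h"
      proof -
        have "(2::real) ^ j = 2 ^ (j - J) * 2 ^ J" by (simp add: j_def power_add[symmetric])
        then show ?thesis by (simp add: x_def k_def h_def field_simps)
      qed
      have "shift_op filter_poly h \<phi> (x - 2 * real R * h) = (\<Sum>\<^sub>\<infinity>l. dual_filter \<phi> 1 l * \<phi> (of_int (2 * k + l) / 2 ^ Suc j))"
        unfolding shift_op_filter_poly xk by (intro infsum_cong) (simp add: h_def field_simps)
      then have "shift_op filter_poly h \<phi> (x - 2 * real R * h) = 0"
        unfolding dual_filter_kills_phi .
      then have z: "shift_op r h (diff_op a h \<phi>) (x - 2 * real R * h) = 0"
        by (subst (asm) r(1)) (simp add: shift_op_mult a_def mult.commute[of _ r])
      have near: "cmod (diff_op a h \<phi> (x - 2 * real R * h + real l *\<^sub>R h) - of_real h ^ a * u a x) \<le> e * h ^ a"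
        if l: "l \<le> degree r" for l
      proof -
        have "cmod (diff_op a h (u 0) (x - 2 * real R * h + real l *\<^sub>R h) - of_real h ^ a * u a x) \<le> e * \<bar>h\<bar> ^ a"
        proof (rule diff_op_derivative)
          fix b z assume "b < a"
          then show "(u b has_vector_derivative u (Suc b) z) (at z)" using der a by simp
        next
          fix z assume z: "\<bar>z - (x - 2 * real R * h + real l *\<^sub>R h)\<bar> \<le> real a * \<bar>h\<bar>"
          have "real l * h \<le> real (degree r) * h" using l h by (intro mult_right_mono) auto
          moreover have "0 \<le> real l * h" "0 \<le> real R * h" using h by auto
          ultimately have "\<bar>z - x\<bar> \<le> real a * h + real (degree r) * h + 2 * real R * h"
            using z h by (simp only: abs_le_iff abs_of_pos real_scaleR_def) linarith
          also have "\<dots> < W * h" using h by (simp add: W_def algebra_simps)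
          finally show "cmod (u a z - u a x) \<le> e" using d(2)[of z] h by simp
        qed
        then show ?thesis using h u0 by simp
      qed
      have "cmod (shift_op r h (\<lambda>y. diff_op a h \<phi> y - of_real h ^ a * u a x) (x - 2 * real R * h)) \<le> coeff_sum r * (e * h ^ a)"
        by (rule shift_op_norm_le) (rule near)
      also have "shift_op r h (\<lambda>y. diff_op a h \<phi> y - of_real h ^ a * u a x) (x - 2 * real R * h)
         = shift_op r h (diff_op a h \<phi>) (x - 2 * real R * h) - shift_op r h (\<lambda>y. of_real h ^ a * u a x) (x - 2 * real R * h)"
        by (rule shift_op_fdiff)
      also have "shift_op r h (\<lambda>y. of_real h ^ a * u a x) (x - 2 * real R * h) = poly r 1 * (of_real h ^ a * u a x)"
        by (simp add: shift_op_def poly_altdef sum_distrib_right)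
      finally have "cmod (poly r 1 * u a x) * h ^ a \<le> coeff_sum r * e * h ^ a"
        using z h by (simp add: norm_mult norm_power mult_ac)
      then have "cmod (poly r 1 * u a x) \<le> coeff_sum r * e" using h by simp
      also have "\<dots> < (coeff_sum r + 1) * e" using epos by simp
      also have "\<dots> = cmod (poly r 1 * u a x)" using coeff_sum_nonneg[of r] by (simp add: e_def)
      finally show False by simp
    qed
    have ua: "u a x = 0" for x by (rule continuous_eq_on_dyadics[OF conta dy])
    \<comment> \<open>With \<open>\<phi>\<^sup>(\<^sup>a\<^sup>) = 0\<close> every \<open>a\<close>-th difference of \<open>\<phi>\<close> vanishes, but the one that uses the points
      \<open>- a, \<dots>, 0\<close> equals \<open>\<phi>(0) = 1\<close>.\<close>
    have "cmod (diff_op a 1 (u 0) (- real a) - of_real 1 ^ a * 0) \<le> 0 * \<bar>1\<bar> ^ a"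
      by (rule diff_op_derivative) (use der a ua in auto)
    then have "diff_op a 1 \<phi> (- real a) = 0" by (simp add: u0)
    moreover have "diff_op a 1 \<phi> (- real a) = (\<Sum>l\<le>a. coeff ([:-1, 1:] ^ a) l * (if l = a then 1 else 0))"
      unfolding shift_op_def degree_diff_poly
    proof (intro sum.cong refl arg_cong2[where f="(*)"])
      fix l
      have "- real a + real l *\<^sub>R 1 = of_int (int l - int a)" by simp
      then show "\<phi> (- real a + real l *\<^sub>R 1) = (if l = a then 1 else 0)"
        by (simp only: int_values) simp
    qed
    moreover have "\<dots> = coeff ([:-1, 1:] ^ a) a"
      by (simp add: if_distrib[of "\<lambda>x. _ * x"] sum.delta cong: if_cong)
    moreover have "coeff ([:-1, 1::complex:] ^ a) a = 1"
      using lead_coeff_power[of "[:-1, 1::complex:]" a] by (simp add: degree_diff_poly)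
    ultimately show False by simp
  qed
  then have "[:-1, 1:] ^ a = [:-1, 1:] ^ Suc N * [:-1, 1::complex:] ^ (a - Suc N)"
    by (simp only: power_add[symmetric]) simp
  then have "filter_poly = [:-1, 1:] ^ Suc N * ([:-1, 1:] ^ (a - Suc N) * r)"
    using r(1) unfolding a_def[symmetric] by (simp only: mult.assoc)
  then show thesis by (rule that)
qed

text \<open>Let \<open>S\<close> be the sum of the integer translates. The zero of the filter at \<open>1\<close> gives \<open>S(1/2) = 1\<close>, so
  \<open>S = 1\<close> on the half integers; the refinement equation then gives \<open>S(x) = S(2x)\<close>, hence \<open>S = 1\<close> on
  the dyadic numbers.\<close>
lemma partition_of_unity: "(\<Sum>\<^sub>\<infinity>k::int. \<phi> (x - of_int k)) = 1"
proof -
  define S where "S x = (\<Sum>\<^sub>\<infinity>k::int. \<phi> (x - of_int k))" for x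
  have shift: "S (x + of_int m) = S x" for x m
    unfolding S_def by (subst infsum_translate_int[symmetric, of _ m]) simp
  have S0: "S (of_int m) = 1" for m
  proof -
    have "S 0 = (\<Sum>k\<in>{0::int}. \<phi> (0 - of_int k))" unfolding S_def
      by (rule infsum_finite_support) (use int_values[of "- k" for k] in auto)
    then show ?thesis using shift[of 0 m] zero_value by simp
  qed
  obtain r where r: "filter_poly = [:-1, 1:] ^ Suc 0 * r"
    by (rule vanishing_moments[of "\<lambda>_. \<phi>" 0]) (use cont in auto)
  have "shift_op filter_poly 0 (\<lambda>_. 1) (0::real) = 0"
    unfolding r shift_op_mult by (simp add: mult.commute[of _ r] shift_op_mult) (simp add: shift_op_def shift_op_pCons)
  then have "(\<Sum>\<^sub>\<infinity>i::int. \<phi> (1/2 - of_int i)) = 1"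
    unfolding shift_op_filter_poly using infsum_dual_filter_1[of "\<lambda>_. 1"] by simp
  then have half: "S (of_int L / 2) = 1" for L
  proof (cases "even L")
    case True
    then obtain m where "L = 2 * m" by (elim evenE)
    then show ?thesis using S0[of m] by simp
  next
    case False
    then obtain m where "L = 2 * m + 1" by (elim oddE)
    then have e: "of_int L / 2 = 1/2 + real_of_int m" by simp
    have "S (1/2) = 1" using \<open>(\<Sum>\<^sub>\<infinity>i::int. \<phi> (1/2 - of_int i)) = 1\<close> by (simp add: S_def)
    then show ?thesis unfolding e using shift[of "1/2" m] by simp
  qed
  have dbl: "S x = S (2 * x)" for x
  proof -
    have "S x = (\<Sum>\<^sub>\<infinity>k::int. \<Sum>\<^sub>\<infinity>L::int. \<phi> (of_int L / 2 - of_int k) * \<phi> (2 * x - of_int L))"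
      unfolding S_def
    proof (rule infsum_cong)
      fix k :: int
      have "\<phi> (x - of_int k) = (\<Sum>\<^sub>\<infinity>l::int. \<phi> (of_int l / 2) * \<phi> (2 * (x - of_int k) - of_int l))"
        by (rule refinement)
      also have "\<dots> = (\<Sum>\<^sub>\<infinity>l::int. \<phi> (of_int (l + - (2 * k)) / 2) * \<phi> (2 * (x - of_int k) - of_int (l + - (2 * k))))"
        by (rule infsum_translate_int[symmetric])
      also have "\<dots> = (\<Sum>\<^sub>\<infinity>L::int. \<phi> (of_int L / 2 - of_int k) * \<phi> (2 * x - of_int L))"
        by (intro infsum_cong) (simp add: field_simps)
      finally show "\<phi> (x - of_int k) = \<dots>" .
    qed
    also have "\<dots> = (\<Sum>\<^sub>\<infinity>L::int. \<Sum>\<^sub>\<infinity>k::int. \<phi> (of_int L / 2 - of_int k) * \<phi> (2 * x - of_int L))"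
    proof (rule infsum_swap_finite_support)
      let ?F = "{L::int. \<phi> (2 * x - of_int L) \<noteq> 0}"
      show "finite ((\<Union>L\<in>?F. {k::int. \<phi> (of_int L / 2 - of_int k) \<noteq> 0}) \<times> ?F)"
        by (intro finite_cartesian_product finite_UN_I finite_near)
    qed auto
    also have "\<dots> = (\<Sum>\<^sub>\<infinity>L::int. S (of_int L / 2) * \<phi> (2 * x - of_int L))"
      by (simp add: S_def infsum_cmult_left')
    also have "\<dots> = S (2 * x)" unfolding half by (simp add: S_def)
    finally show ?thesis .
  qed
  have dy: "S (of_int k / 2 ^ j) = 1" for k j
  proof (induction j)
    case 0 then show ?case using S0 by simp
  next
    case (Suc j) then show ?case using dbl[of "of_int k / 2 ^ Suc j"] by simp
  qed
  have "isCont S x" for x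
  proof -
    let ?F = "{k::int. \<bar>x - of_int k\<bar> \<le> real R + 1}"
    have "S y = (\<Sum>k\<in>?F. \<phi> (y - of_int k))" if "y \<in> ball x 1" for y
      unfolding S_def
    proof (rule infsum_finite_support[OF finite_int_near])
      fix k assume k: "k \<notin> ?F"
      show "\<phi> (y - of_int k) = 0"
        using supp[of "y - of_int k"] k that by (fastforce simp: dist_real_def)
    qed
    moreover have "continuous_on (ball x 1) (\<lambda>y. \<Sum>k\<in>?F. \<phi> (y - of_int k))"
      by (intro continuous_intros continuous_on_compose2[OF cont]) auto
    ultimately have "continuous_on (ball x 1) S"
      using continuous_on_cong[of "ball x 1" "ball x 1" S] by auto
    then show ?thesis by (simp add: continuous_on_eq_continuous_at)
  qed
  then have "continuous_on UNIV S" by (simp add: continuous_on_eq_continuous_at)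
  from continuous_eq_on_dyadics[OF this dy, of x] show ?thesis by (simp add: S_def)
qed

end

section \<open>Regularity of the scaling function\<close>

lemma C_int_subset_C_u: "f \<in> C_int m \<Longrightarrow> f \<in> C_u"
  by (cases m) auto

lemma C_int_iterated_partial:
  "f \<in> C_int N \<Longrightarrow> b \<le> N \<Longrightarrow> foldr partial (replicate b i) f \<in> C_int (N - b)"
proof (induction b)
  case (Suc b)
  then have "foldr partial (replicate b i) f \<in> C_int (Suc (N - Suc b))" by (simp add: Suc_diff_Suc)
  then show ?case by simp
qed simp

lemma has_partial_derivative_along_axis:
  assumes "has_partial i g"
  shows "((\<lambda>t. g (t *\<^sub>R axis i 1)) has_vector_derivative partial i g (z *\<^sub>R axis i 1)) (at z)"
proof -
  let ?f = "\<lambda>t. g (z *\<^sub>R axis i 1 + t *\<^sub>R axis i 1)"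
  have d: "(?f has_vector_derivative partial i g (z *\<^sub>R axis i 1)) (at (z - z))"
    using assms unfolding has_partial_def partial_def
    by (simp add: vector_derivative_works)
  have "((?f \<circ> (\<lambda>t. t - z)) has_vector_derivative 1 *\<^sub>R partial i g (z *\<^sub>R axis i 1)) (at z)"
    by (rule vector_diff_chain_at[where g="?f" and f="\<lambda>t. t - z", OF _ d]) (auto intro!: derivative_eq_intros)
  then show ?thesis by (simp add: o_def scaleR_add_left[symmetric])
qed

text \<open>Restricting to an axis recovers \<open>\<phi>\<close> from the tensor product, since \<open>\<phi>(0) = 1\<close>.\<close>
lemma (in scaling) tensor_axis: "tensor \<phi> (t *\<^sub>R axis i 1 :: real ^ 'n) = \<phi> t"
proof -
  have "tensor \<phi> (t *\<^sub>R axis i 1 :: real ^ 'n) = (\<Prod>k\<in>UNIV. if k = i then \<phi> t else 1)"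
    unfolding tensor_def by (intro prod.cong) (auto simp: axis_def zero_value)
  then show ?thesis by (simp add: prod.delta)
qed

text \<open>The smoothness of the tensor product is inherited by \<open>\<phi>\<close>: \<open>u b\<close> is a \<open>b\<close>-fold partial derivative
  restricted to its axis. For integer \<open>r\<^sub>0\<close> the exponent in the last estimate is zero and the estimate
  just says that \<open>u N\<close> is bounded.\<close>
lemma (in scaling) regularity:
  assumes C: "(tensor \<phi> :: real ^ 'n \<Rightarrow> complex) \<in> C_real r0" and "0 < r0" and N: "N = nat \<lfloor>r0\<rfloor>"
  obtains u H where "u 0 = \<phi>" "\<And>b z. b < N \<Longrightarrow> (u b has_vector_derivative u (Suc b) z) (at z)"
    "\<And>b. b \<le> N \<Longrightarrow> continuous_on UNIV (u b)" "\<And>b. b \<le> N \<Longrightarrow> bounded (range (u b))"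
    "0 \<le> H" "\<And>x y. cmod (u N x - u N y) \<le> H * \<bar>x - y\<bar> powr (r0 - real N)"
proof -
  fix i :: 'n
  define F where "F b = foldr partial (replicate b i) (tensor \<phi> :: real ^ 'n \<Rightarrow> complex)" for b
  define u where "u b t = F b (t *\<^sub>R axis i 1)" for b t
  have CN: "(tensor \<phi> :: real ^ 'n \<Rightarrow> complex) \<in> C_int N"
    using C N by (auto simp: C_real_def split: if_splits)
  have u0: "u 0 = \<phi>" by (auto simp: u_def F_def tensor_axis)
  have Fb: "F b \<in> C_int (N - b)" if "b \<le> N" for b
    unfolding F_def using CN that by (rule C_int_iterated_partial)
  have der: "(u b has_vector_derivative u (Suc b) z) (at z)" if "b < N" for b z
  proof -
    have "F b \<in> C_int (Suc (N - Suc b))" using Fb[of b] that by (simp add: Suc_diff_Suc)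
    then have "has_partial i (F b)" by simp
    from has_partial_derivative_along_axis[OF this, of z] show ?thesis
      unfolding u_def[abs_def] F_def by simp
  qed
  have Fu: "bounded (range (F b))" "uniformly_continuous_on UNIV (F b)" if "b \<le> N" for b
    using C_int_subset_C_u[OF Fb[OF that]] by (auto simp: C_u_def)
  have c: "continuous_on UNIV (u b)" if "b \<le> N" for b
    unfolding u_def using uniformly_continuous_imp_continuous[OF Fu(2)[OF that]]
    by (rule continuous_on_compose2) (auto intro!: continuous_intros)
  have b: "bounded (range (u b))" if "b \<le> N" for b
    by (rule bounded_subset[OF Fu(1)[OF that]]) (auto simp: u_def)
  have NZ: "real N = of_int \<lfloor>r0\<rfloor>" using N assms(2) by simp
  have "\<exists>H\<ge>0. \<forall>x y. cmod (u N x - u N y) \<le> H * \<bar>x - y\<bar> powr (r0 - real N)"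
  proof (cases "r0 \<in> \<int>")
    case True
    obtain B where B: "0 < B" "\<And>x. cmod (u N x) \<le> B" using b[of N] by (auto simp: bounded_pos)
    have "cmod (u N x - u N y) \<le> (2 * B) * \<bar>x - y\<bar> powr (r0 - real N)" for x y
    proof (cases "x = y")
      case False
      have "r0 - real N = 0" using True NZ by (metis Ints_cases diff_self floor_of_int)
      moreover have "cmod (u N x - u N y) \<le> B + B" using B by (intro norm_triangle_le_diff add_mono) auto
      ultimately show ?thesis using False by simp
    qed simp
    then show ?thesis using B by (intro exI[of _ "2 * B"]) auto
  next
    case False
    then have "\<forall>is. length is = N \<longrightarrow> holder_continuous (frac r0) (foldr partial is (tensor \<phi> :: real ^ 'n \<Rightarrow> complex))"
      using C N by (simp add: C_real_def)
    then have "holder_continuous (frac r0) (F N)" unfolding F_def by (metis length_replicate)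
    then obtain K where K: "\<And>x y. cmod (F N x - F N y) \<le> K * norm (x - y) powr frac r0"
      by (auto simp: holder_continuous_def)
    have "cmod (u N x - u N y) \<le> max K 0 * \<bar>x - y\<bar> powr (r0 - real N)" for x y
    proof -
      have "cmod (u N x - u N y) \<le> K * norm (x *\<^sub>R axis i 1 - y *\<^sub>R axis i 1 :: real ^ 'n) powr frac r0"
        unfolding u_def by (rule K)
      also have "norm (x *\<^sub>R axis i 1 - y *\<^sub>R axis i 1 :: real ^ 'n) = \<bar>x - y\<bar>"
        by (simp add: scaleR_diff_left[symmetric])
      also have "frac r0 = r0 - real N" by (simp add: frac_def NZ)
      also have "K * \<bar>x - y\<bar> powr (r0 - real N) \<le> max K 0 * \<bar>x - y\<bar> powr (r0 - real N)"
        by (intro mult_right_mono) auto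
      finally show ?thesis .
    qed
    then show ?thesis by (intro exI[of _ "max K 0"]) auto
  qed
  then show thesis using that[of u] u0 der c b by blast
qed

text \<open>Smoothness of order \<open>r\<close> in terms of differences of all orders. The bounds are stated for all steps
  of norm at most \<open>\<tau> > 0\<close>, so that they make sense for step zero, too.\<close>
definition difference_bound :: "real \<Rightarrow> ('a::real_normed_vector \<Rightarrow> complex) \<Rightarrow> bool" where
  "difference_bound r f \<longleftrightarrow> (\<forall>a::nat. \<exists>C\<ge>0. \<forall>\<tau> h x. 0 < \<tau> \<longrightarrow> \<tau> \<le> 1 \<longrightarrow> norm h \<le> \<tau> \<longrightarrow>
     cmod (diff_op a h f x) \<le> C * \<tau> powr min (real a) r)"

text \<open>Up to order \<open>N = \<lfloor>r\<^sub>0\<rfloor>\<close> differences are bounded by derivatives. In order \<open>N + 1\<close> the last difference is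
  spent on the Hoelder condition for the \<open>N\<close>-th derivative, and differences beyond that are merely
  bounded operators.\<close>
lemma (in scaling) difference_bound_phi:
  assumes "(tensor \<phi> :: real ^ 'n \<Rightarrow> complex) \<in> C_real r0" and "0 < r0"
  shows "difference_bound r0 \<phi>"
  unfolding difference_bound_def
proof
  fix a :: nat
  define N where "N = nat \<lfloor>r0\<rfloor>"
  obtain u H where u: "u 0 = \<phi>" "\<And>b z. b < N \<Longrightarrow> (u b has_vector_derivative u (Suc b) z) (at z)"
    "\<And>b. b \<le> N \<Longrightarrow> continuous_on UNIV (u b)" "\<And>b. b \<le> N \<Longrightarrow> bounded (range (u b))"
    and H: "0 \<le> H" "\<And>x y. cmod (u N x - u N y) \<le> H * \<bar>x - y\<bar> powr (r0 - real N)"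
    using regularity[OF assms N_def] by metis
  have N: "real N \<le> r0" "r0 < real N + 1" using assms(2) by (auto simp: N_def)
  show "\<exists>C\<ge>0. \<forall>\<tau> h x. 0 < \<tau> \<longrightarrow> \<tau> \<le> 1 \<longrightarrow> norm h \<le> \<tau> \<longrightarrow> cmod (diff_op a h \<phi> x) \<le> C * \<tau> powr min (real a) r0"
  proof (cases "a \<le> N")
    case True
    obtain B where B: "0 < B" "\<And>x. cmod (u a x) \<le> B" using u(4)[OF True] by (auto simp: bounded_pos)
    have "cmod (diff_op a h \<phi> x) \<le> B * \<tau> powr min (real a) r0" if "0 < \<tau>" "norm h \<le> \<tau>" for \<tau> h x
    proof -
      have "cmod (diff_op a h (u 0) x - of_real h ^ a * 0) \<le> B * \<bar>h\<bar> ^ a"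
        by (rule diff_op_derivative) (use u(2) B True in auto)
      also have "\<dots> \<le> B * \<tau> ^ a" using that B by (intro mult_left_mono power_mono) auto
      also have "min (real a) r0 = real a" using True N by simp
      then have "\<tau> ^ a = \<tau> powr min (real a) r0" using that by (simp add: powr_realpow)
      finally show ?thesis by (simp add: u)
    qed
    then show ?thesis using B by (intro exI[of _ B]) auto
  next
    case False
    define k where "k = a - Suc N"
    have a: "a = k + Suc N" using False by (simp add: k_def)
    have "cmod (diff_op a h \<phi> x) \<le> coeff_sum ([:-1, 1:] ^ k) * H * \<tau> powr min (real a) r0"
      if \<tau>: "0 < \<tau>" "norm h \<le> \<tau>" for \<tau> h x
    proof -
      define w where "w b z = u b (z + h) - u b z" for b z
      have "cmod (diff_op N h (w 0) y - of_real h ^ N * 0) \<le> (H * \<tau> powr (r0 - real N)) * \<bar>h\<bar> ^ N" for y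
      proof (rule diff_op_derivative)
        fix b z assume b: "b < N"
        have "((u b \<circ> (\<lambda>z. z + h)) has_vector_derivative 1 *\<^sub>R u (Suc b) (z + h)) (at z)"
          using u(2)[OF b] by (intro vector_diff_chain_at) (auto intro!: derivative_eq_intros)
        then show "(w b has_vector_derivative w (Suc b) z) (at z)"
          unfolding w_def using u(2)[OF b] by (intro has_vector_derivative_diff) (auto simp: o_def)
      next
        fix z
        have "cmod (u N (z + h) - u N z) \<le> H * \<bar>h\<bar> powr (r0 - real N)" using H(2)[of "z + h" z] by simp
        also have "\<dots> \<le> H * \<tau> powr (r0 - real N)" using \<tau> N H by (intro mult_left_mono powr_mono2) auto
        finally show "cmod (w N z - 0) \<le> H * \<tau> powr (r0 - real N)" by (simp add: w_def)
      qed
      then have A: "cmod (diff_op N h (w 0) y) \<le> H * \<tau> powr (r0 - real N) * \<bar>h\<bar> ^ N" for y by simp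
      have B: "H * \<tau> powr (r0 - real N) * \<bar>h\<bar> ^ N \<le> H * \<tau> powr r0"
      proof -
        have "H * \<tau> powr (r0 - real N) * \<bar>h\<bar> ^ N \<le> H * \<tau> powr (r0 - real N) * \<tau> ^ N"
          using \<tau> H by (intro mult_left_mono power_mono) auto
        also have "\<dots> = H * \<tau> powr r0" using \<tau> by (simp add: powr_diff powr_realpow)
        finally show ?thesis .
      qed
      have e: "diff_op N h (w 0) = diff_op (Suc N) h \<phi>"
      proof -
        have e: "w 0 = (\<lambda>z. \<phi> (z + h) - \<phi> z)" by (auto simp: w_def u(1))
        show ?thesis by (rule ext) (simp only: diff_op_Suc e)
      qed
      have *: "cmod (diff_op (Suc N) h \<phi> y) \<le> H * \<tau> powr r0" for y
        unfolding e[symmetric] by (rule order_trans[OF A B])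
      have "diff_op a h \<phi> x = shift_op ([:-1, 1:] ^ k) h (diff_op (Suc N) h \<phi>) x"
        unfolding a power_add shift_op_mult ..
      also have "cmod \<dots> \<le> coeff_sum ([:-1, 1:] ^ k) * (H * \<tau> powr r0)"
        by (rule shift_op_norm_le) (rule *)
      also have "min (real a) r0 = r0" using a N by auto
      then have "coeff_sum ([:-1, 1:] ^ k) * (H * \<tau> powr r0) = coeff_sum ([:-1, 1:] ^ k) * H * \<tau> powr min (real a) r0"
        by simp
      finally show ?thesis .
    qed
    then show ?thesis using H coeff_sum_nonneg
      by (intro exI[of _ "coeff_sum ([:-1, 1:] ^ k) * H"]) auto
  qed
qed

text \<open>The Leibniz rule for differences,
  \<open>\<Delta>(f g)(x) = \<Delta>f(x) g(x + h) + f(x) \<Delta>g(x)\<close>, iterated.\<close>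
lemma diff_op_mult_le:
  assumes "\<And>b x. b \<le> a \<Longrightarrow> cmod (diff_op b h f x) \<le> ef b" "\<And>b x. b \<le> a \<Longrightarrow> cmod (diff_op b h g x) \<le> eg b"
    and "\<And>b. b \<le> a \<Longrightarrow> ef b * eg (a - b) \<le> E"
  shows "cmod (diff_op a h (\<lambda>x. f x * g x) x) \<le> 2 ^ a * E"
  using assms
proof (induction a arbitrary: f g ef eg)
  case 0
  have "cmod (f x) * cmod (g x) \<le> ef 0 * eg 0"
    using 0(1)[of 0 x] 0(2)[of 0 x] by (intro mult_mono') auto
  then show ?case using 0(3)[of 0] by (simp add: norm_mult)
next
  case (Suc a)
  have e: "(\<lambda>x. f (x + h) * g (x + h) - f x * g x) =
      (\<lambda>x. (f (x + h) - f x) * g (x + h) + f x * (g (x + h) - g x))"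
    by (auto simp: algebra_simps)
  have 1: "cmod (diff_op a h (\<lambda>x. (f (x + h) - f x) * g (x + h)) x) \<le> 2 ^ a * E"
  proof (rule Suc.IH[where ef="\<lambda>b. ef (Suc b)" and eg=eg])
    fix b x assume "b \<le> a"
    then show "cmod (diff_op b h (\<lambda>x. f (x + h) - f x) x) \<le> ef (Suc b)"
      using Suc.prems(1)[of "Suc b" x] unfolding diff_op_Suc by simp
    show "cmod (diff_op b h (\<lambda>x. g (x + h)) x) \<le> eg b"
      using Suc.prems(2)[of b "x + h"] \<open>b \<le> a\<close> by (simp add: shift_op_translate[where f=g and a=h])
    show "ef (Suc b) * eg (a - b) \<le> E" using Suc.prems(3)[of "Suc b"] \<open>b \<le> a\<close> by simp
  qed
  have 2: "cmod (diff_op a h (\<lambda>x. f x * (g (x + h) - g x)) x) \<le> 2 ^ a * E"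
  proof (rule Suc.IH[where ef=ef and eg="\<lambda>b. eg (Suc b)"])
    fix b x assume b: "b \<le> a"
    then show "cmod (diff_op b h (\<lambda>x. g (x + h) - g x) x) \<le> eg (Suc b)"
      using Suc.prems(2)[of "Suc b" x] unfolding diff_op_Suc by simp
    show "cmod (diff_op b h f x) \<le> ef b" using Suc.prems(1)[of b x] b by simp
    show "ef b * eg (Suc (a - b)) \<le> E" using Suc.prems(3)[of b] b by (simp add: Suc_diff_le)
  qed
  have 3: "diff_op (Suc a) h (\<lambda>x. f x * g x) x = diff_op a h (\<lambda>x. (f (x + h) - f x) * g (x + h)) x
      + diff_op a h (\<lambda>x. f x * (g (x + h) - g x)) x"
    unfolding diff_op_Suc e shift_op_fadd ..
  have "cmod (diff_op (Suc a) h (\<lambda>x. f x * g x) x) \<le> 2 ^ a * E + 2 ^ a * E"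
    unfolding 3 using 1 2 by (rule norm_triangle_mono)
  also have "2 ^ a * E + 2 ^ a * E = 2 ^ Suc a * E" by simp
  finally show ?case .
qed

text \<open>In the Leibniz rule \<open>\<tau>\<close> occurs with the exponent \<open>min b r + min (a - b) r \<ge> min a r\<close>.\<close>
lemma difference_bound_mult:
  assumes f: "difference_bound r f" and g: "difference_bound r g" and "0 < r"
  shows "difference_bound r (\<lambda>x. f x * g x)"
  unfolding difference_bound_def
proof
  fix a :: nat
  obtain Cf where Cf: "\<And>b. 0 \<le> Cf b" "\<And>b \<tau> h x. 0 < \<tau> \<Longrightarrow> \<tau> \<le> 1 \<Longrightarrow> norm h \<le> \<tau> \<Longrightarrow>
     cmod (diff_op b h f x) \<le> Cf b * \<tau> powr min (real b) r"
    using f unfolding difference_bound_def by metis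
  obtain Cg where Cg: "\<And>b. 0 \<le> Cg b" "\<And>b \<tau> h x. 0 < \<tau> \<Longrightarrow> \<tau> \<le> 1 \<Longrightarrow> norm h \<le> \<tau> \<Longrightarrow>
     cmod (diff_op b h g x) \<le> Cg b * \<tau> powr min (real b) r"
    using g unfolding difference_bound_def by metis
  define K where "K = (\<Sum>b\<le>a. Cf b * Cg (a - b))"
  have "cmod (diff_op a h (\<lambda>x. f x * g x) x) \<le> 2 ^ a * (K * \<tau> powr min (real a) r)"
    if \<tau>: "0 < \<tau>" "\<tau> \<le> 1" "norm h \<le> \<tau>" for \<tau> h x
  proof (rule diff_op_mult_le[where ef="\<lambda>b. Cf b * \<tau> powr min (real b) r" and eg="\<lambda>b. Cg b * \<tau> powr min (real b) r"])
    fix b assume b: "b \<le> a"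
    have "\<tau> powr min (real b) r * \<tau> powr min (real (a - b)) r = \<tau> powr (min (real b) r + min (real (a - b)) r)"
      by (simp add: powr_add)
    also have "\<dots> \<le> \<tau> powr min (real a) r"
      using \<tau> b \<open>0 < r\<close> by (intro powr_mono') auto
    finally have "Cf b * Cg (a - b) * (\<tau> powr min (real b) r * \<tau> powr min (real (a - b)) r) \<le> Cf b * Cg (a - b) * \<tau> powr min (real a) r"
      using Cf Cg by (intro mult_left_mono) auto
    also have "\<dots> \<le> K * \<tau> powr min (real a) r"
      unfolding K_def using b Cf Cg by (intro mult_right_mono member_le_sum) auto
    finally show "Cf b * \<tau> powr min (real b) r * (Cg (a - b) * \<tau> powr min (real (a - b)) r) \<le> K * \<tau> powr min (real a) r"
      by (simp add: mult_ac)
  qed (use Cf Cg \<tau> in auto)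
  moreover have "0 \<le> K" unfolding K_def using Cf Cg by (intro sum_nonneg) auto
  ultimately show "\<exists>C\<ge>0. \<forall>\<tau> h x. 0 < \<tau> \<longrightarrow> \<tau> \<le> 1 \<longrightarrow> norm h \<le> \<tau> \<longrightarrow>
     cmod (diff_op a h (\<lambda>x. f x * g x) x) \<le> C * \<tau> powr min (real a) r"
    by (intro exI[of _ "2 ^ a * K"]) (auto simp: mult.assoc)
qed

lemma difference_bound_const: "0 < r \<Longrightarrow> difference_bound r (\<lambda>x. c)"
  unfolding difference_bound_def
proof
  fix a :: nat
  show "\<exists>C\<ge>0. \<forall>\<tau> h x. 0 < \<tau> \<longrightarrow> \<tau> \<le> 1 \<longrightarrow> norm h \<le> \<tau> \<longrightarrow>
     cmod (diff_op a h (\<lambda>x. c) x) \<le> C * \<tau> powr min (real a) r" if "0 < r"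
  proof (cases a)
    case 0
    then show ?thesis by (intro exI[of _ "cmod c"]) (use that in auto)
  next
    case (Suc b)
    have "diff_op a h (\<lambda>x. c) x = 0" for h x
      unfolding Suc diff_op_Suc by (simp add: shift_op_def)
    then show ?thesis by (intro exI[of _ 0]) auto
  qed
qed

lemma difference_bound_coordinate:
  assumes "difference_bound r f"
  shows "difference_bound r (\<lambda>x :: real ^ 'n. f (x $ i))"
  unfolding difference_bound_def
proof
  fix a :: nat
  obtain C where C: "0 \<le> C" "\<And>\<tau> h x. 0 < \<tau> \<Longrightarrow> \<tau> \<le> 1 \<Longrightarrow> norm h \<le> \<tau> \<Longrightarrow>
     cmod (diff_op a h f x) \<le> C * \<tau> powr min (real a) r"
    using assms unfolding difference_bound_def by metis
  have "diff_op a h (\<lambda>x :: real ^ 'n. f (x $ i)) x = diff_op a (h $ i) f (x $ i)" for h x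
    by (simp add: shift_op_def)
  moreover have "norm (h $ i) \<le> \<tau>" if "norm h \<le> \<tau>" for h :: "real ^ 'n" and \<tau>
    using that Finite_Cartesian_Product.norm_nth_le[of h i] by simp
  ultimately show "\<exists>C\<ge>0. \<forall>\<tau> h x. 0 < \<tau> \<longrightarrow> \<tau> \<le> 1 \<longrightarrow> norm h \<le> \<tau> \<longrightarrow>
     cmod (diff_op a h (\<lambda>x :: real ^ 'n. f (x $ i)) x) \<le> C * \<tau> powr min (real a) r"
    using C by (intro exI[of _ C]) auto
qed

lemma (in scaling) difference_bound_tensor:
  assumes "(tensor \<phi> :: real ^ 'n \<Rightarrow> complex) \<in> C_real r0" and "0 < r0"
  shows "difference_bound r0 (tensor \<phi> :: real ^ 'n \<Rightarrow> complex)"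
proof -
  have "difference_bound r0 (\<lambda>x :: real ^ 'n. \<Prod>i\<in>I. \<phi> (x $ i))" if "finite I" for I
    using that
  proof (induction I rule: finite_induct)
    case (insert i I)
    then show ?case
      using difference_bound_mult[OF difference_bound_coordinate[OF difference_bound_phi[OF assms]] insert.IH assms(2)]
      by simp
  qed (use difference_bound_const[OF assms(2)] in simp)
  then show ?thesis by (simp add: tensor_def[abs_def])
qed

section \<open>Lattice translates of a compactly supported function\<close>

lemma infsum_sum_finite_support:
  fixes f :: "'i \<Rightarrow> 'a \<Rightarrow> complex"
  assumes "finite F" "\<And>i x. i \<in> I \<Longrightarrow> x \<notin> F \<Longrightarrow> f i x = 0"
  shows "(\<Sum>\<^sub>\<infinity>x. \<Sum>i\<in>I. f i x) = (\<Sum>i\<in>I. \<Sum>\<^sub>\<infinity>x. f i x)"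
proof -
  have "(\<Sum>\<^sub>\<infinity>x. \<Sum>i\<in>I. f i x) = (\<Sum>x\<in>F. \<Sum>i\<in>I. f i x)"
    using assms by (intro infsum_finite_support) (auto intro!: sum.neutral)
  also have "\<dots> = (\<Sum>i\<in>I. \<Sum>x\<in>F. f i x)" by (rule sum.swap)
  also have "\<dots> = (\<Sum>i\<in>I. \<Sum>\<^sub>\<infinity>x. f i x)"
    using assms by (intro sum.cong refl infsum_finite_support[symmetric]) auto
  finally show ?thesis .
qed

lemma infsum_translate_vec: "(\<Sum>\<^sub>\<infinity>k::int ^ 'n. f (k + c)) = (\<Sum>\<^sub>\<infinity>k. f k)"
  by (rule infsum_reindex_bij_witness[of UNIV "\<lambda>k. k - c" "\<lambda>k. k + c"]) auto

definition ivec :: "int ^ 'n \<Rightarrow> real ^ 'n" where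
  "ivec k = (\<chi> i. of_int (k $ i))"

definition vfloor :: "real ^ 'n \<Rightarrow> int ^ 'n" where
  "vfloor y = (\<chi> i. \<lfloor>y $ i\<rfloor>)"

text \<open>The function with coefficients \<open>c\<close> with respect to the integer translates of \<open>\<Psi>\<close>.\<close>
definition synth :: "(real ^ 'n \<Rightarrow> complex) \<Rightarrow> (int ^ 'n \<Rightarrow> complex) \<Rightarrow> real ^ 'n \<Rightarrow> complex" where
  "synth \<Psi> c y = (\<Sum>\<^sub>\<infinity>k. c k * \<Psi> (y - ivec k))"

definition box_supp :: "nat \<Rightarrow> (real ^ 'n \<Rightarrow> complex) \<Rightarrow> bool" where
  "box_supp r \<Psi> \<longleftrightarrow> (\<forall>y. \<Psi> y \<noteq> 0 \<longrightarrow> (\<forall>i. \<bar>y $ i\<bar> \<le> real r))"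

text \<open>The indices of the translates that can be nonzero at a point of the unit cube; the extra \<open>1\<close> is for
  the fractional part that \<^const>\<open>vfloor\<close> removes.\<close>
definition near_zero :: "nat \<Rightarrow> (int ^ 'n) set" where
  "near_zero r = vec_box (\<lambda>_. {- int r - 1..int r + 1})"

lemma ivec_nth [simp]: "ivec k $ i = of_int (k $ i)"
  by (simp add: ivec_def)

lemma ivec_0 [simp]: "ivec 0 = 0"
  by (simp add: vec_eq_iff)

lemma ivec_add: "ivec (k + l) = ivec k + ivec l"
  by (simp add: vec_eq_iff)

lemma finite_near_zero: "finite (near_zero r)"
  unfolding near_zero_def by (intro finite_vec_box) auto

lemma box_supp_near:
  assumes "box_supp r \<Psi>" "\<Psi> (y - ivec k) \<noteq> 0"
  shows "k - vfloor y \<in> near_zero r"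
proof -
  have "\<bar>y $ i - of_int (k $ i)\<bar> \<le> real r" for i
    using assms unfolding box_supp_def by (metis ivec_nth vector_minus_component)
  moreover have "k $ i - \<lfloor>y $ i\<rfloor> \<le> int r + 1 \<and> - int r - 1 \<le> k $ i - \<lfloor>y $ i\<rfloor>"
    if "\<bar>y $ i - of_int (k $ i)\<bar> \<le> real r" for i
    using that by linarith
  ultimately show ?thesis by (simp add: near_zero_def vec_box_def vfloor_def)
qed

lemma box_supp_outside:
  assumes "box_supp r \<Psi>" "k \<notin> (\<lambda>d. vfloor y + d) ` near_zero r"
  shows "\<Psi> (y - ivec k) = 0"
proof (rule ccontr)
  assume "\<Psi> (y - ivec k) \<noteq> 0"
  from box_supp_near[OF assms(1) this] have "vfloor y + (k - vfloor y) \<in> (\<lambda>d. vfloor y + d) ` near_zero r"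
    by (rule imageI)
  then show False using assms(2) by simp
qed

text \<open>The range of summation relative to \<^term>\<open>vfloor y\<close> does not depend on \<open>y\<close>, so the triangle
  inequality applies to these finitely many terms.\<close>
lemma synth_eq_sum:
  assumes "box_supp r \<Psi>"
  shows "synth \<Psi> c y = (\<Sum>d\<in>near_zero r. c (vfloor y + d) * \<Psi> (y - ivec (vfloor y + d)))"
proof -
  have "synth \<Psi> c y = (\<Sum>k\<in>(\<lambda>d. vfloor y + d) ` near_zero r. c k * \<Psi> (y - ivec k))"
    unfolding synth_def
    by (rule infsum_finite_support) (auto simp: finite_near_zero box_supp_outside[OF assms])
  also have "\<dots> = (\<Sum>d\<in>near_zero r. c (vfloor y + d) * \<Psi> (y - ivec (vfloor y + d)))"
    by (subst sum.reindex) (auto simp: inj_on_def)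
  finally show ?thesis .
qed

lemma finite_translates: "box_supp r \<Psi> \<Longrightarrow> finite {k. \<Psi> (y - ivec k) \<noteq> 0}"
  by (rule finite_subset[of _ "(\<lambda>d. vfloor y + d) ` near_zero r"])
    (use box_supp_outside[of r \<Psi>] in \<open>auto simp: finite_near_zero\<close>)

lemma synth_add: "box_supp r \<Psi> \<Longrightarrow> synth \<Psi> (\<lambda>k. a k + b k) y = synth \<Psi> a y + synth \<Psi> b y"
  by (simp add: synth_eq_sum sum.distrib distrib_right)

lemma synth_diff: "box_supp r \<Psi> \<Longrightarrow> synth \<Psi> (\<lambda>k. a k - b k) y = synth \<Psi> a y - synth \<Psi> b y"
  by (simp add: synth_eq_sum sum_subtractf left_diff_distrib)

lemma synth_cmult: "synth \<Psi> (\<lambda>k. a * c k) y = a * synth \<Psi> c y"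
  by (simp add: synth_def mult.assoc infsum_cmult_right')

lemma shift_op_synth:
  assumes "box_supp r \<Psi>"
  shows "shift_op p h (synth \<Psi> c) y = synth (shift_op p h \<Psi>) c y"
proof -
  let ?F = "\<Union>l\<le>degree p. {k. \<Psi> (y + real l *\<^sub>R h - ivec k) \<noteq> 0}"
  have "shift_op p h (synth \<Psi> c) y = (\<Sum>l\<le>degree p. \<Sum>\<^sub>\<infinity>k. coeff p l * (c k * \<Psi> (y + real l *\<^sub>R h - ivec k)))"
    by (simp add: shift_op_def synth_def infsum_cmult_right')
  also have "\<dots> = (\<Sum>\<^sub>\<infinity>k. \<Sum>l\<le>degree p. coeff p l * (c k * \<Psi> (y + real l *\<^sub>R h - ivec k)))"
    by (rule infsum_sum_finite_support[symmetric, of ?F]) (auto simp: finite_translates[OF assms])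
  also have "\<dots> = synth (shift_op p h \<Psi>) c y"
    unfolding synth_def
    by (intro infsum_cong) (simp add: shift_op_def sum_distrib_left mult_ac algebra_simps)
  finally show ?thesis .
qed

lemma box_supp_shift_op:
  assumes "box_supp r \<Psi>" "norm h \<le> 1"
  shows "box_supp (r + degree p) (shift_op p h \<Psi>)"
  unfolding box_supp_def
proof (intro allI impI)
  fix y i assume "shift_op p h \<Psi> y \<noteq> 0"
  then obtain l where l: "l \<le> degree p" "\<Psi> (y + real l *\<^sub>R h) \<noteq> 0"
    unfolding shift_op_def by (metis (no_types, lifting) atMost_iff mult_zero_right sum.neutral)
  then have "\<bar>(y + real l *\<^sub>R h) $ i\<bar> \<le> real r" using assms(1) unfolding box_supp_def by blast
  moreover have "\<bar>real l * h $ i\<bar> \<le> real (degree p)"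
  proof -
    have "\<bar>h $ i\<bar> \<le> 1" using assms(2) component_le_norm_cart[of h i] by linarith
    then have "real l * \<bar>h $ i\<bar> \<le> real (degree p) * 1" using l by (intro mult_mono) auto
    then show ?thesis by (simp add: abs_mult)
  qed
  ultimately show "\<bar>y $ i\<bar> \<le> real (r + degree p)" by simp
qed

lemma measurable_vfloor [measurable]: "(vfloor :: real ^ 'n \<Rightarrow> _) \<in> measurable borel (count_space UNIV)"
proof -
  have "vfloor -` {k} \<in> sets (borel :: (real ^ 'n) measure)" for k :: "int ^ 'n"
  proof -
    have "vfloor -` {k} = (\<Inter>i\<in>UNIV. {y::real ^ 'n. \<lfloor>y $ i\<rfloor> = k $ i})"
      by (auto simp: vfloor_def vec_eq_iff)
    also have "\<dots> \<in> sets borel"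
    proof (rule sets.finite_INT)
      fix i :: 'n
      have [measurable]: "(\<lambda>y::real ^ 'n. y $ i) \<in> borel_measurable borel"
        by (intro borel_measurable_continuous_onI continuous_intros)
      have "{y \<in> space borel. \<lfloor>(y::real ^ 'n) $ i\<rfloor> = k $ i} \<in> sets borel" by measurable
      then show "{y::real ^ 'n. \<lfloor>y $ i\<rfloor> = k $ i} \<in> sets borel" by simp
    qed auto
    finally show ?thesis .
  qed
  then show ?thesis by (simp add: measurable_count_space_eq2_countable)
qed

lemma measurable_ivec [measurable]: "ivec \<in> measurable (count_space UNIV) borel"
  by simp

lemma synth_measurable:
  assumes "box_supp r \<Psi>" and [measurable]: "\<Psi> \<in> borel_measurable borel"
  shows "synth \<Psi> c \<in> borel_measurable borel"
proof -
  have [measurable]: "(\<lambda>y. c (vfloor y + d)) \<in> borel_measurable borel" for d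
    by (rule measurable_compose[OF measurable_vfloor, of "\<lambda>k. c (k + d)"]) simp
  have [measurable]: "(\<lambda>y. ivec (vfloor y + d)) \<in> borel_measurable borel" for d
    by (rule measurable_compose[OF measurable_vfloor, of "\<lambda>k. ivec (k + d)"]) simp
  show ?thesis unfolding synth_eq_sum[OF assms(1), abs_def] by measurable
qed

section \<open>The multiresolution analysis in several variables\<close>

lemma dyadic_eq: "dyadic j k = (1 / 2 powi j) *\<^sub>R ivec k"
  by (simp add: dyadic_def vec_eq_iff)

lemma dyadic_add: "dyadic j (k + l) = dyadic j k + dyadic j l"
  by (simp add: dyadic_eq ivec_add scaleR_add_right)

lemma power_int_Suc: "(2::real) powi (j + 1) = 2 * 2 powi j"
  by (simp add: power_int_add)

lemma dyadic_double: "dyadic (j + 1) (\<chi> i. 2 * k $ i) = dyadic j k"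
  by (simp add: dyadic_def vec_eq_iff power_int_Suc)

lemma infsum_even_odd:
  fixes f :: "int \<Rightarrow> complex"
  assumes "finite F" "\<And>x. x \<notin> F \<Longrightarrow> f x = 0"
  shows "(\<Sum>\<^sub>\<infinity>m. f m) = (\<Sum>\<^sub>\<infinity>k. f (2 * k)) + (\<Sum>\<^sub>\<infinity>k. f (2 * k + 1))"
proof -
  have "(\<Sum>\<^sub>\<infinity>m\<in>{m. even m} \<union> {m. odd m}. f m) = (\<Sum>\<^sub>\<infinity>m\<in>{m. even m}. f m) + (\<Sum>\<^sub>\<infinity>m\<in>{m. odd m}. f m)"
    using assms by (intro infsum_Un_disjoint summable_on_finite_support[of F]) auto
  moreover have "{m::int. even m} \<union> {m. odd m} = UNIV" by auto
  moreover have "(\<Sum>\<^sub>\<infinity>m\<in>{m. even m}. f m) = (\<Sum>\<^sub>\<infinity>k. f (2 * k))"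
    by (rule infsum_reindex_bij_witness[of _ "\<lambda>k. 2 * k" "\<lambda>m. m div 2"]) auto
  moreover have "(\<Sum>\<^sub>\<infinity>m\<in>{m. odd m}. f m) = (\<Sum>\<^sub>\<infinity>k. f (2 * k + 1))"
    by (rule infsum_reindex_bij_witness[of _ "\<lambda>k. 2 * k + 1" "\<lambda>m. m div 2"]) auto
  ultimately show ?thesis by simp
qed

context scaling
begin

text \<open>The scaling function and the wavelet \<open>\<phi>(2t - 1)\<close> of the interpolating multiresolution analysis.\<close>
definition psi :: "nat \<Rightarrow> real \<Rightarrow> complex" where
  "psi s t = (if s = 0 then \<phi> t else \<phi> (2 * t - 1))"

definition Psi :: "nat ^ 'n \<Rightarrow> real ^ 'n \<Rightarrow> complex" where
  "Psi s y = (\<Prod>i\<in>UNIV. psi (s $ i) (y $ i))"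

lemma psi_supp: "psi s t \<noteq> 0 \<Longrightarrow> \<bar>t\<bar> \<le> real R"
proof -
  assume "psi s t \<noteq> 0"
  then have "\<bar>t\<bar> < real R \<or> \<bar>2 * t - 1\<bar> < real R" using supp by (auto simp: psi_def split: if_splits)
  moreover have "1 \<le> real R" using R_pos by simp
  ultimately show ?thesis by linarith
qed

lemma box_supp_Psi: "box_supp R (Psi s)"
  unfolding box_supp_def Psi_def using psi_supp by (auto simp: prod_zero_iff)

lemma Psi_0: "Psi 0 = tensor \<phi>"
  by (auto simp: Psi_def psi_def tensor_def)

lemma box_supp_tensor: "box_supp R (tensor \<phi>)"
  using box_supp_Psi[of 0] by (simp add: Psi_0)

lemma continuous_Psi: "continuous_on UNIV (Psi s)"
proof -
  have "continuous_on UNIV (\<lambda>x :: real ^ 'a. psi k (x $ i))" for k i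
    unfolding psi_def by (cases "k = 0") (auto intro!: continuous_on_compose2[OF cont] continuous_intros)
  then show ?thesis unfolding Psi_def[abs_def] by (intro continuous_intros)
qed

lemma continuous_tensor: "continuous_on UNIV (tensor \<phi>)"
  using continuous_Psi[of 0] by (simp add: Psi_0)

lemma measurable_Psi [measurable]: "Psi s \<in> borel_measurable borel"
  by (rule borel_measurable_continuous_onI[OF continuous_Psi])

lemma measurable_tensor [measurable]: "tensor \<phi> \<in> borel_measurable borel"
  by (rule borel_measurable_continuous_onI[OF continuous_tensor])

lemma bounded_Psi: "\<exists>B>0. \<forall>s. \<forall>y :: real ^ 'n. cmod (Psi s y) \<le> B"
proof -
  obtain B where B: "0 < B" "\<And>x. cmod (\<phi> x) \<le> B" using bounded_phi by auto
  have "cmod (Psi s (y :: real ^ 'n)) \<le> B ^ CARD('n)" for s y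
  proof -
    have "cmod (Psi s y) = (\<Prod>i\<in>UNIV. cmod (psi (s $ i) (y $ i)))" by (simp add: Psi_def prod_norm)
    also have "\<dots> \<le> (\<Prod>i\<in>(UNIV::'n set). B)" using B by (intro prod_mono) (auto simp: psi_def)
    finally show ?thesis by simp
  qed
  then show ?thesis using B by (intro exI[of _ "B ^ CARD('n)"]) auto
qed

lemma P_op_eq_synth: "P_op \<phi> j f x = synth (tensor \<phi>) (\<lambda>k. f (dyadic j k)) (2 powi j *\<^sub>R x)"
  unfolding P_op_def synth_def
  by (intro infsum_cong arg_cong2[where f="(*)"] arg_cong[where f="tensor \<phi>"]) (auto simp: vec_eq_iff)

lemma tensor_partition: "synth (tensor \<phi>) (\<lambda>k. 1) y = 1"
proof -
  have "synth (tensor \<phi>) (\<lambda>k. 1) y = (\<Sum>\<^sub>\<infinity>k. \<Prod>i\<in>UNIV. \<phi> (y $ i - of_int (k $ i)))"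
    by (simp add: synth_def tensor_def)
  also have "\<dots> = (\<Prod>i\<in>UNIV. \<Sum>\<^sub>\<infinity>a. \<phi> (y $ i - of_int a))"
    using finite_near by (intro infsum_vec_prod[where f="\<lambda>i a. \<phi> (y $ i - of_int a)"])
  also have "\<dots> = 1" by (simp add: partition_of_unity)
  finally show ?thesis .
qed

lemma finite_half_near: "finite {a::int. \<phi> (of_int a / 2) * g a \<noteq> 0}"
proof (rule finite_subset)
  show "{a::int. \<phi> (of_int a / 2) * g a \<noteq> 0} \<subseteq> {a. \<bar>0 - of_int a\<bar> \<le> real (2 * R)}"
    using supp[of "of_int a / 2" for a :: int] by fastforce
qed (rule finite_int_near)

lemma tensor_refinement:
  "tensor \<phi> y = (\<Sum>\<^sub>\<infinity>k. tensor \<phi> ((1/2) *\<^sub>R ivec k) * tensor \<phi> (2 *\<^sub>R y - ivec k))"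
proof -
  have "tensor \<phi> y = (\<Prod>i\<in>UNIV. \<Sum>\<^sub>\<infinity>a::int. \<phi> (of_int a / 2) * \<phi> (2 * y $ i - of_int a))"
    unfolding tensor_def by (subst refinement) rule
  also have "\<dots> = (\<Sum>\<^sub>\<infinity>k::int ^ 'a. \<Prod>i\<in>UNIV. \<phi> (of_int (k $ i) / 2) * \<phi> (2 * y $ i - of_int (k $ i)))"
    by (intro infsum_vec_prod[where f="\<lambda>i a. \<phi> (of_int a / 2) * \<phi> (2 * y $ i - of_int a)", symmetric] finite_half_near)
  also have "\<dots> = (\<Sum>\<^sub>\<infinity>k. tensor \<phi> ((1/2) *\<^sub>R ivec k) * tensor \<phi> (2 *\<^sub>R y - ivec k))"
    by (simp add: tensor_def prod.distrib)
  finally show ?thesis .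
qed

lemma tensor_ivec: "tensor \<phi> (ivec k) = (if k = 0 then 1 else 0)"
proof (cases "k = 0")
  case False
  then obtain i where "k $ i \<noteq> 0" by (auto simp: vec_eq_iff)
  then show ?thesis using False by (auto simp: tensor_def int_values prod_zero_iff)
qed (simp add: tensor_def zero_value)

lemma synth_tensor_ivec: "synth (tensor \<phi>) c (ivec k) = c k"
proof -
  have e: "ivec k - ivec l = ivec (k - l)" for l by (simp add: vec_eq_iff)
  have "synth (tensor \<phi>) c (ivec k) = (\<Sum>l\<in>{k}. c l * tensor \<phi> (ivec k - ivec l))"
    unfolding synth_def by (rule infsum_finite_support) (auto simp: e tensor_ivec)
  then show ?thesis by (simp add: tensor_ivec[of 0, simplified])
qed

text \<open>The refinement equation puts \<open>V\<^sub>0\<close>, the span of the integer translates, into \<open>V\<^sub>1\<close>; by interpolation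
  the new coefficients are values at half integers.\<close>
lemma synth_refine:
  "synth (tensor \<phi>) c y = synth (tensor \<phi>) (\<lambda>K. synth (tensor \<phi>) c ((1/2) *\<^sub>R ivec K)) (2 *\<^sub>R y)"
proof -
  let ?t = "tensor \<phi> :: real ^ 'a \<Rightarrow> complex"
  let ?F = "{k. ?t (y - ivec k) \<noteq> 0}"
  let ?G = "{K. ?t (2 *\<^sub>R y - ivec K) \<noteq> 0}"
  have fin: "finite ?G" by (rule finite_translates[OF box_supp_tensor])
  have "synth ?t c y = (\<Sum>\<^sub>\<infinity>k. \<Sum>\<^sub>\<infinity>K. c k * (?t ((1/2) *\<^sub>R ivec K - ivec k) * ?t (2 *\<^sub>R y - ivec K)))"
    unfolding synth_def
  proof (rule infsum_cong)
    fix k :: "int ^ 'a"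
    have "?t (y - ivec k) = (\<Sum>\<^sub>\<infinity>l. ?t ((1/2) *\<^sub>R ivec l) * ?t (2 *\<^sub>R (y - ivec k) - ivec l))"
      by (rule tensor_refinement)
    also have "\<dots> = (\<Sum>\<^sub>\<infinity>K. ?t ((1/2) *\<^sub>R ivec (K + - (k + k))) * ?t (2 *\<^sub>R (y - ivec k) - ivec (K + - (k + k))))"
      by (rule infsum_translate_vec[symmetric])
    also have "\<dots> = (\<Sum>\<^sub>\<infinity>K. ?t ((1/2) *\<^sub>R ivec K - ivec k) * ?t (2 *\<^sub>R y - ivec K))"
      by (intro infsum_cong arg_cong2[where f="(*)"] arg_cong[where f="tensor \<phi>"])
        (auto simp: vec_eq_iff field_simps)
    finally show "c k * ?t (y - ivec k) = (\<Sum>\<^sub>\<infinity>K. c k * (?t ((1/2) *\<^sub>R ivec K - ivec k) * ?t (2 *\<^sub>R y - ivec K)))"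
      by (simp add: infsum_cmult_right')
  qed
  also have "\<dots> = (\<Sum>\<^sub>\<infinity>K. \<Sum>\<^sub>\<infinity>k. c k * (?t ((1/2) *\<^sub>R ivec K - ivec k) * ?t (2 *\<^sub>R y - ivec K)))"
  proof (rule infsum_swap_finite_support)
    show "finite ((\<Union>K\<in>?G. {k. ?t ((1/2) *\<^sub>R ivec K - ivec k) \<noteq> 0}) \<times> ?G)"
      by (intro finite_cartesian_product finite_UN_I fin finite_translates[OF box_supp_tensor])
  qed auto
  also have "\<dots> = (\<Sum>\<^sub>\<infinity>K. synth ?t c ((1/2) *\<^sub>R ivec K) * ?t (2 *\<^sub>R y - ivec K))"
    by (simp add: synth_def infsum_cmult_left'[symmetric] mult.assoc)
  finally show ?thesis by (simp add: synth_def[of ?t "\<lambda>K. synth ?t c ((1/2) *\<^sub>R ivec K)"])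
qed

text \<open>The detail \<open>Q\<^sub>j f\<close> belongs to \<open>V\<^sub>j\<^sub>+\<^sub>1\<close>, which is what Bernstein's inequality needs.\<close>
lemma Q_op_eq_synth:
  "Q_op \<phi> j f x = synth (tensor \<phi>) (\<lambda>K. f (dyadic (j + 1) K) - P_op \<phi> j f (dyadic (j + 1) K)) (2 powi (j + 1) *\<^sub>R x)"
proof -
  have "P_op \<phi> j f x = synth (tensor \<phi>) (\<lambda>K. synth (tensor \<phi>) (\<lambda>k. f (dyadic j k)) ((1/2) *\<^sub>R ivec K)) (2 *\<^sub>R 2 powi j *\<^sub>R x)"
    unfolding P_op_eq_synth by (rule synth_refine)
  also have "(\<lambda>K. synth (tensor \<phi>) (\<lambda>k. f (dyadic j k)) ((1/2) *\<^sub>R ivec K)) = (\<lambda>K. P_op \<phi> j f (dyadic (j + 1) K))"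
    unfolding P_op_eq_synth by (simp add: dyadic_eq power_int_Suc)
  finally have "P_op \<phi> j f x = synth (tensor \<phi>) (\<lambda>K. P_op \<phi> j f (dyadic (j + 1) K)) (2 powi (j + 1) *\<^sub>R x)"
    by (simp add: power_int_Suc)
  then show ?thesis
    unfolding Q_op_def P_op_eq_synth[of "j + 1"] by (simp add: synth_diff[OF box_supp_tensor])
qed

text \<open>For odd \<open>L\<close> the left-hand side is itself a translate of the wavelet. For even \<open>L\<close> this is the refinement
  equation of a translate of \<open>\<phi>\<close>, solved for its only term with an even index.\<close>
lemma decomposition_1:
  "\<phi> (2 * t - of_int L) = (\<Sum>s\<in>{0, 1}. \<Sum>\<^sub>\<infinity>k::int. psi s (t - of_int k) * dual_filter \<phi> s (L - 2 * k))"
proof -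
  have p0: "(\<Sum>\<^sub>\<infinity>k::int. psi 0 (t - of_int k) * dual_filter \<phi> 0 (L - 2 * k)) = (if even L then \<phi> (t - of_int (L div 2)) else 0)"
  proof (cases "even L")
    case True
    have "(\<Sum>\<^sub>\<infinity>k::int. psi 0 (t - of_int k) * dual_filter \<phi> 0 (L - 2 * k)) =
      (\<Sum>k\<in>{L div 2}. psi 0 (t - of_int k) * dual_filter \<phi> 0 (L - 2 * k))"
      by (rule infsum_finite_support) (auto simp: dual_filter_0)
    then show ?thesis using True by (auto simp: dual_filter_0 psi_def)
  next
    case False
    then have "dual_filter \<phi> 0 (L - 2 * k) = 0" for k by (auto simp: dual_filter_0)
    then show ?thesis using False by simp
  qed
  show ?thesis
  proof (cases "even L")
    case False
    then obtain l where l: "L = 2 * l + 1" by (elim oddE)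
    have "(\<Sum>\<^sub>\<infinity>k::int. psi 1 (t - of_int k) * dual_filter \<phi> 1 (L - 2 * k)) =
      (\<Sum>k\<in>{l}. psi 1 (t - of_int k) * dual_filter \<phi> 1 (L - 2 * k))"
      by (rule infsum_finite_support) (auto simp: dual_filter_1[unfolded One_nat_def] l)
    also have "\<dots> = \<phi> (2 * t - of_int L)"
      by (simp add: dual_filter_1[unfolded One_nat_def] l psi_def algebra_simps)
    finally show ?thesis using False p0 by simp
  next
    case True
    then obtain l where l: "L = 2 * l" by (elim evenE)
    have "\<phi> (t - of_int l) = (\<Sum>\<^sub>\<infinity>m::int. \<phi> (of_int m / 2) * \<phi> (2 * (t - of_int l) - of_int m))"
      by (rule refinement)
    also have "\<dots> = (\<Sum>\<^sub>\<infinity>k::int. \<phi> (of_int (2 * k) / 2) * \<phi> (2 * (t - of_int l) - of_int (2 * k))) +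
      (\<Sum>\<^sub>\<infinity>k::int. \<phi> (of_int (2 * k + 1) / 2) * \<phi> (2 * (t - of_int l) - of_int (2 * k + 1)))"
      by (rule infsum_even_odd[OF finite_half_near[of "\<lambda>m. \<phi> (2 * (t - of_int l) - of_int m)"]]) auto
    also have "(\<Sum>\<^sub>\<infinity>k::int. \<phi> (of_int (2 * k) / 2) * \<phi> (2 * (t - of_int l) - of_int (2 * k))) =
      (\<Sum>k\<in>{0::int}. \<phi> (of_int (2 * k) / 2) * \<phi> (2 * (t - of_int l) - of_int (2 * k)))"
      by (rule infsum_finite_support) (auto simp: int_values)
    also have "\<dots> = \<phi> (2 * t - of_int L)" by (simp add: zero_value l algebra_simps)
    also have "(\<Sum>\<^sub>\<infinity>k::int. \<phi> (of_int (2 * k + 1) / 2) * \<phi> (2 * (t - of_int l) - of_int (2 * k + 1))) =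
      (\<Sum>\<^sub>\<infinity>k::int. \<phi> (of_int (2 * (k + - l) + 1) / 2) * \<phi> (2 * (t - of_int l) - of_int (2 * (k + - l) + 1)))"
      by (rule infsum_translate_int[symmetric])
    also have "\<dots> = (\<Sum>\<^sub>\<infinity>k::int. - (psi 1 (t - of_int k) * dual_filter \<phi> 1 (L - 2 * k)))"
    proof (rule infsum_cong)
      fix k :: int
      have e: "dual_filter \<phi> 1 (L - 2 * k) = - \<phi> (1/2 - of_int (L - 2 * k) / 2)"
      proof -
        have "even (L - 2 * k)" using True by simp
        moreover from this have "L - 2 * k \<noteq> 1" by (metis odd_one)
        ultimately show ?thesis unfolding dual_filter_1 by simp
      qed
      have e2: "of_int (2 * (k + - l) + 1) / 2 = 1/2 - (of_int (L - 2 * k) / 2 :: real)"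
        "2 * (t - of_int l) - of_int (2 * (k + - l) + 1) = 2 * (t - of_int k) - 1"
        by (simp_all add: l field_simps)
      show "\<phi> (of_int (2 * (k + - l) + 1) / 2) * \<phi> (2 * (t - of_int l) - of_int (2 * (k + - l) + 1))
         = - (psi 1 (t - of_int k) * dual_filter \<phi> 1 (L - 2 * k))"
        unfolding e e2 psi_def by (simp add: mult.commute)
    qed
    finally have "\<phi> (t - of_int l) = \<phi> (2 * t - of_int L) - (\<Sum>\<^sub>\<infinity>k::int. psi 1 (t - of_int k) * dual_filter \<phi> 1 (L - 2 * k))"
      by (simp add: infsum_uminus)
    then show ?thesis using p0 True l by simp
  qed
qed

lemma finite_psi_near: "finite {k::int. psi s (t - of_int k) * g k \<noteq> 0}"
  by (rule finite_subset[OF _ finite_int_near[of t R]]) (auto dest: psi_supp)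

lemma J_plus_box: "vec_box (\<lambda>_. {0, 1}) = insert 0 (J_plus :: (nat ^ 'n) set)"
  by (auto simp: vec_box_def J_plus_def)

lemma zero_notin_J_plus: "0 \<notin> J_plus" by (simp add: J_plus_def)

lemma finite_J_plus: "finite (J_plus :: (nat ^ 'n) set)"
proof -
  have "finite (vec_box (\<lambda>_. {0, 1}) :: (nat ^ 'n) set)" by (rule finite_vec_box) simp
  then show ?thesis unfolding J_plus_box by simp
qed

text \<open>The product over the coordinates of the one-dimensional decompositions.\<close>
lemma decomposition_n:
  "tensor \<phi> (2 *\<^sub>R y - ivec L) = (\<Sum>s\<in>insert 0 J_plus. \<Sum>\<^sub>\<infinity>k. Psi s (y - ivec k) * dual_filter_tensor \<phi> s (\<chi> i. L $ i - 2 * k $ i))"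
proof -
  have "tensor \<phi> (2 *\<^sub>R y - ivec L) = (\<Prod>i\<in>UNIV. \<phi> (2 * y $ i - of_int (L $ i)))"
    by (simp add: tensor_def)
  also have "\<dots> = (\<Prod>i\<in>UNIV. \<Sum>s\<in>{0, 1}. \<Sum>\<^sub>\<infinity>k::int. psi s (y $ i - of_int k) * dual_filter \<phi> s (L $ i - 2 * k))"
    unfolding decomposition_1 ..
  also have "\<dots> = (\<Sum>s\<in>vec_box (\<lambda>_. {0, 1}). \<Prod>i\<in>UNIV. \<Sum>\<^sub>\<infinity>k::int. psi (s $ i) (y $ i - of_int k) * dual_filter \<phi> (s $ i) (L $ i - 2 * k))"
    by (rule sum_vec_box[symmetric, where f="\<lambda>i s. \<Sum>\<^sub>\<infinity>k::int. psi s (y $ i - of_int k) * dual_filter \<phi> s (L $ i - 2 * k)"]) simp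
  also have "\<dots> = (\<Sum>s\<in>insert 0 J_plus. \<Sum>\<^sub>\<infinity>k. Psi s (y - ivec k) * dual_filter_tensor \<phi> s (\<chi> i. L $ i - 2 * k $ i))"
    unfolding J_plus_box
  proof (rule sum.cong[OF refl])
    fix s :: "nat ^ 'a"
    have "(\<Prod>i\<in>UNIV. \<Sum>\<^sub>\<infinity>k::int. psi (s $ i) (y $ i - of_int k) * dual_filter \<phi> (s $ i) (L $ i - 2 * k)) =
      (\<Sum>\<^sub>\<infinity>k::int ^ 'a. \<Prod>i\<in>UNIV. psi (s $ i) (y $ i - of_int (k $ i)) * dual_filter \<phi> (s $ i) (L $ i - 2 * k $ i))"
      by (rule infsum_vec_prod[symmetric, where f="\<lambda>i k. psi (s $ i) (y $ i - of_int k) * dual_filter \<phi> (s $ i) (L $ i - 2 * k)"])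
        (rule finite_psi_near)
    then show "(\<Prod>i\<in>UNIV. \<Sum>\<^sub>\<infinity>k::int. psi (s $ i) (y $ i - of_int k) * dual_filter \<phi> (s $ i) (L $ i - 2 * k)) =
      (\<Sum>\<^sub>\<infinity>k. Psi s (y - ivec k) * dual_filter_tensor \<phi> s (\<chi> i. L $ i - 2 * k $ i))"
      by (simp add: Psi_def dual_filter_tensor_def prod.distrib)
  qed
  finally show ?thesis .
qed

lemma finite_dual_filter_tensor: "finite {l. dual_filter_tensor \<phi> s l \<noteq> 0}"
proof (rule finite_subset)
  show "{l. dual_filter_tensor \<phi> s l \<noteq> 0} \<subseteq> vec_box (\<lambda>i. {l. dual_filter \<phi> (s $ i) l \<noteq> 0})"
    by (auto simp: dual_filter_tensor_def vec_box_def)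
qed (intro finite_vec_box finite_dual_filter)

lemma dual_wavelet_0: "dual_wavelet \<phi> 0 j k f = f (dyadic j k)"
proof -
  have z: "dual_filter_tensor \<phi> 0 l = (if l = 0 then 1 else 0)" for l :: "int ^ 'a"
  proof (cases "l = 0")
    case False
    then obtain i where "l $ i \<noteq> 0" by (auto simp: vec_eq_iff)
    then show ?thesis using False by (auto simp: dual_filter_tensor_def dual_filter_0 prod_zero_iff)
  qed (simp add: dual_filter_tensor_def dual_filter_0)
  have "dual_wavelet \<phi> 0 j k f = (\<Sum>l\<in>{0}. dual_filter_tensor \<phi> 0 l * f (dyadic (j + 1) (\<chi> i. 2 * k $ i + l $ i)))"
    unfolding dual_wavelet_def by (rule infsum_finite_support) (auto simp: z)
  then show ?thesis by (simp add: z dyadic_double)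
qed

text \<open>Insert the two-scale decomposition into \<open>P\<^sub>j\<^sub>+\<^sub>1 f\<close> and collect the coefficient of each translate: it is
  the dual wavelet coefficient, and the terms with \<open>s = 0\<close> make up \<open>P\<^sub>j f\<close>.\<close>
lemma Q_op_wavelets:
  "Q_op \<phi> j f x = (\<Sum>s\<in>J_plus. synth (Psi s) (\<lambda>k. dual_wavelet \<phi> s j k f) (2 powi j *\<^sub>R x))"
proof -
  define y where "y = 2 powi j *\<^sub>R x"
  define a where "a L = f (dyadic (j + 1) L)" for L
  let ?df = "\<lambda>s L k. dual_filter_tensor \<phi> s (\<chi> i. L $ i - 2 * k $ i)"
  let ?J = "insert 0 J_plus :: (nat ^ 'a) set"
  define G where "G s = {k. Psi s (y - ivec k) \<noteq> 0}" for s :: "nat ^ 'a"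
  have finG: "finite (G s)" for s unfolding G_def by (rule finite_translates[OF box_supp_Psi])
  have fin_df: "finite {L. ?df s L k \<noteq> 0}" for s k
  proof -
    have "{L. ?df s L k \<noteq> 0} \<subseteq> (\<lambda>l. \<chi> i. l $ i + 2 * k $ i) ` {l. dual_filter_tensor \<phi> s l \<noteq> 0}"
    proof
      fix L assume L: "L \<in> {L. ?df s L k \<noteq> 0}"
      have "L = (\<lambda>l. \<chi> i. l $ i + 2 * k $ i) (\<chi> i. L $ i - 2 * k $ i)" by (simp add: vec_eq_iff)
      then show "L \<in> (\<lambda>l. \<chi> i. l $ i + 2 * k $ i) ` {l. dual_filter_tensor \<phi> s l \<noteq> 0}" using L by blast
    qed
    then show ?thesis by (rule finite_subset) (intro finite_imageI finite_dual_filter_tensor)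
  qed
  have w: "(\<Sum>\<^sub>\<infinity>L. ?df s L k * a L) = dual_wavelet \<phi> s j k f" for s k
  proof -
    have "(\<Sum>\<^sub>\<infinity>L. ?df s L k * a L) = (\<Sum>\<^sub>\<infinity>l. ?df s (l + (\<chi> i. 2 * k $ i)) k * a (l + (\<chi> i. 2 * k $ i)))"
      by (rule infsum_translate_vec[symmetric])
    also have "\<dots> = dual_wavelet \<phi> s j k f"
      unfolding dual_wavelet_def a_def
      by (intro infsum_cong arg_cong2[where f="(*)"] arg_cong[where f=f] arg_cong[where f="dual_filter_tensor \<phi> s"] arg_cong[where f="dyadic (j + 1)"])
        (auto simp: vec_eq_iff)
    finally show ?thesis .
  qed
  have "P_op \<phi> (j + 1) f x = (\<Sum>\<^sub>\<infinity>L. a L * tensor \<phi> (2 *\<^sub>R y - ivec L))"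
    unfolding P_op_eq_synth synth_def y_def a_def by (simp add: power_int_Suc)
  also have "\<dots> = (\<Sum>\<^sub>\<infinity>L. \<Sum>s\<in>?J. \<Sum>\<^sub>\<infinity>k. a L * (Psi s (y - ivec k) * ?df s L k))"
    unfolding decomposition_n by (simp add: sum_distrib_left infsum_cmult_right')
  also have "\<dots> = (\<Sum>s\<in>?J. \<Sum>\<^sub>\<infinity>L. \<Sum>\<^sub>\<infinity>k. a L * (Psi s (y - ivec k) * ?df s L k))"
  proof (rule infsum_sum_finite_support)
    show "finite (\<Union>s\<in>?J. \<Union>k\<in>G s. {L. ?df s L k \<noteq> 0})"
      using finite_J_plus by (intro finite_UN_I finG fin_df) auto
    fix s L assume s: "s \<in> ?J" and L: "L \<notin> (\<Union>s\<in>?J. \<Union>k\<in>G s. {L. ?df s L k \<noteq> 0})"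
    show "(\<Sum>\<^sub>\<infinity>k. a L * (Psi s (y - ivec k) * ?df s L k)) = 0"
    proof (rule infsum_0)
      fix k
      show "a L * (Psi s (y - ivec k) * ?df s L k) = 0"
        using s L by (cases "k \<in> G s") (auto simp: G_def)
    qed
  qed
  also have "\<dots> = (\<Sum>s\<in>?J. \<Sum>\<^sub>\<infinity>k. \<Sum>\<^sub>\<infinity>L. a L * (Psi s (y - ivec k) * ?df s L k))"
  proof (rule sum.cong[OF refl], rule infsum_swap_finite_support)
    fix s :: "nat ^ 'a"
    show "finite ((\<Union>k\<in>G s. {L. ?df s L k \<noteq> 0}) \<times> G s)"
      by (intro finite_cartesian_product finite_UN_I finG fin_df)
    fix L k assume "(L, k) \<notin> (\<Union>k\<in>G s. {L. ?df s L k \<noteq> 0}) \<times> G s"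
    then show "a L * (Psi s (y - ivec k) * ?df s L k) = 0"
      by (cases "k \<in> G s") (auto simp: G_def)
  qed
  also have "\<dots> = (\<Sum>s\<in>?J. \<Sum>\<^sub>\<infinity>k. (\<Sum>\<^sub>\<infinity>L. ?df s L k * a L) * Psi s (y - ivec k))"
  proof (intro sum.cong refl infsum_cong)
    fix s :: "nat ^ 'a" and k
    show "(\<Sum>\<^sub>\<infinity>L. a L * (Psi s (y - ivec k) * ?df s L k)) = (\<Sum>\<^sub>\<infinity>L. ?df s L k * a L) * Psi s (y - ivec k)"
      unfolding infsum_cmult_left'[symmetric] by (intro infsum_cong) (simp only: mult_ac)
  qed
  also have "\<dots> = (\<Sum>s\<in>?J. synth (Psi s) (\<lambda>k. dual_wavelet \<phi> s j k f) y)"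
    unfolding w synth_def ..
  also have "\<dots> = P_op \<phi> j f x + (\<Sum>s\<in>J_plus. synth (Psi s) (\<lambda>k. dual_wavelet \<phi> s j k f) y)"
    by (subst sum.insert[OF finite_J_plus zero_notin_J_plus]) (simp add: P_op_eq_synth Psi_0 dual_wavelet_0 y_def)
  finally show ?thesis by (simp add: Q_op_def y_def)
qed

text \<open>In a coordinate with \<open>s\<^sub>i = 1\<close> the filter is \<open>(T - 1)\<^sup>M\<close> times a remainder, so the functional only sees
  \<open>M\<close>-th differences of \<open>f\<close> in that coordinate direction.\<close>
lemma dual_wavelet_differences:
  assumes fac: "filter_poly = [:-1, 1:] ^ M * rr" and s: "s \<in> J_plus"
  obtains F c i where "finite F" "\<And>j k f. dual_wavelet \<phi> s j k f =
    (\<Sum>L\<in>F. c L * diff_op M (dyadic (j + 1) (axis i 1)) f (dyadic (j + 1) (\<chi> i. 2 * k $ i + L $ i)))"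
proof -
  obtain i where "s $ i \<noteq> 0" "\<forall>i. s $ i \<in> {0, 1}" using s by (auto simp: J_plus_def vec_eq_iff)
  then have i: "s $ i = 1" by (metis insertE singletonD)
  define \<rho> where "\<rho> t = (if 0 \<le> t + 2 * int R then coeff rr (nat (t + 2 * int R)) else 0)" for t
  let ?\<beta> = "coeff ([:-1, 1::complex:] ^ M)"
  have fin_\<rho>: "finite {t. \<rho> t \<noteq> 0}"
    by (rule finite_subset[of _ "{- 2 * int R..int (degree rr)}"])
      (auto simp: \<rho>_def split: if_splits dest!: le_degree)
  \<comment> \<open>The filter is the convolution of the coefficients of \<open>(X - 1)\<^sup>M\<close> with those of the cofactor, the
    latter being re-indexed like the filter.\<close>
  have conv: "dual_filter \<phi> 1 l = (\<Sum>b\<le>M. ?\<beta> b * \<rho> (l - int b))" for l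
  proof (cases "0 \<le> l + 2 * int R")
    case False
    then have "\<rho> (l - int b) = 0" for b by (simp add: \<rho>_def)
    then show ?thesis using False by (simp add: dual_filter_zero)
  next
    case True
    define n where "n = nat (l + 2 * int R)"
    have l: "l = int n - 2 * int R" using True by (simp add: n_def)
    have "dual_filter \<phi> 1 l = (\<Sum>b\<le>n. ?\<beta> b * coeff rr (n - b))"
      unfolding l coeff_filter_poly[symmetric] fac by (simp add: coeff_mult)
    also have "\<dots> = (\<Sum>b\<le>n. ?\<beta> b * \<rho> (l - int b))"
      by (intro sum.cong) (auto simp: \<rho>_def l nat_diff_distrib)
    also have "\<dots> = (\<Sum>b\<le>max n M. ?\<beta> b * \<rho> (l - int b))"
      by (intro sum.mono_neutral_left) (auto simp: \<rho>_def l)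
    also have "\<dots> = (\<Sum>b\<le>M. ?\<beta> b * \<rho> (l - int b))"
      by (intro sum.mono_neutral_right) (auto simp: coeff_eq_0 degree_diff_poly)
    finally show ?thesis .
  qed
  define c where "c L = \<rho> (L $ i) * (\<Prod>i'\<in>UNIV - {i}. dual_filter \<phi> (s $ i') (L $ i'))" for L
  define F where "F = {L. c L \<noteq> 0}"
  have finF: "finite F"
  proof (rule finite_subset)
    show "F \<subseteq> vec_box (\<lambda>i'. if i' = i then {t. \<rho> t \<noteq> 0} else {l. dual_filter \<phi> (s $ i') l \<noteq> 0})"
      by (auto simp: F_def c_def vec_box_def)
  qed (intro finite_vec_box, simp add: fin_\<rho> finite_dual_filter)
  have tens: "dual_filter_tensor \<phi> s l = (\<Sum>b\<le>M. ?\<beta> b * c (l - of_nat b * axis i 1))" for l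
  proof -
    have "dual_filter_tensor \<phi> s l = dual_filter \<phi> 1 (l $ i) * (\<Prod>i'\<in>UNIV - {i}. dual_filter \<phi> (s $ i') (l $ i'))"
      unfolding dual_filter_tensor_def by (subst prod.remove[of _ i]) (auto simp: i)
    also have "\<dots> = (\<Sum>b\<le>M. ?\<beta> b * (\<rho> (l $ i - int b) * (\<Prod>i'\<in>UNIV - {i}. dual_filter \<phi> (s $ i') (l $ i'))))"
      unfolding conv sum_distrib_right mult.assoc ..
    also have "\<dots> = (\<Sum>b\<le>M. ?\<beta> b * c (l - of_nat b * axis i 1))"
      unfolding c_def by (intro sum.cong refl arg_cong2[where f="(*)"] prod.cong) (auto simp: axis_def of_nat_index)
    finally show ?thesis .
  qed
  have "dual_wavelet \<phi> s j k f =
    (\<Sum>L\<in>F. c L * diff_op M (dyadic (j + 1) (axis i 1)) f (dyadic (j + 1) (\<chi> i. 2 * k $ i + L $ i)))" for j k f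
  proof -
    define g where "g l = f (dyadic (j + 1) ((\<chi> i. 2 * k $ i) + l))" for l
    have dy: "dyadic (j + 1) (\<chi> i. 2 * k $ i + L $ i) = dyadic (j + 1) ((\<chi> i. 2 * k $ i) + L)" for L
      by (rule arg_cong[where f="dyadic (j + 1)"]) (simp add: vec_eq_iff)
    have "dual_wavelet \<phi> s j k f = (\<Sum>\<^sub>\<infinity>l. \<Sum>b\<le>M. ?\<beta> b * c (l - of_nat b * axis i 1) * g l)"
      unfolding dual_wavelet_def tens dy g_def sum_distrib_right ..
    also have "\<dots> = (\<Sum>b\<le>M. \<Sum>\<^sub>\<infinity>l. ?\<beta> b * c (l - of_nat b * axis i 1) * g l)"
    proof (rule infsum_sum_finite_support)
      show "finite (\<Union>b\<le>M. (\<lambda>L. L + of_nat b * axis i 1) ` F)" using finF by auto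
      fix b l assume b: "b \<in> {..M}" and l: "l \<notin> (\<Union>b\<le>M. (\<lambda>L. L + of_nat b * axis i 1) ` F)"
      have "l - of_nat b * axis i 1 \<notin> F"
      proof
        assume "l - of_nat b * axis i 1 \<in> F"
        then have "(l - of_nat b * axis i 1) + of_nat b * axis i 1 \<in> (\<lambda>L. L + of_nat b * axis i 1) ` F" by (rule imageI)
        with b l show False by auto
      qed
      then show "?\<beta> b * c (l - of_nat b * axis i 1) * g l = 0" by (simp add: F_def)
    qed
    also have "\<dots> = (\<Sum>b\<le>M. \<Sum>L\<in>F. ?\<beta> b * (c L * g (L + of_nat b * axis i 1)))"
    proof (rule sum.cong[OF refl])
      fix b
      have "(\<Sum>\<^sub>\<infinity>l. ?\<beta> b * c (l - of_nat b * axis i 1) * g l) =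
        (\<Sum>\<^sub>\<infinity>L. ?\<beta> b * c ((L + of_nat b * axis i 1) - of_nat b * axis i 1) * g (L + of_nat b * axis i 1))"
        by (rule infsum_translate_vec[symmetric])
      also have "\<dots> = (\<Sum>L\<in>F. ?\<beta> b * (c L * g (L + of_nat b * axis i 1)))"
        unfolding add_diff_cancel_right' mult.assoc
        by (rule infsum_finite_support[OF finF]) (simp add: F_def)
      finally show "(\<Sum>\<^sub>\<infinity>l. ?\<beta> b * c (l - of_nat b * axis i 1) * g l) = \<dots>" .
    qed
    also have "\<dots> = (\<Sum>L\<in>F. \<Sum>b\<le>M. ?\<beta> b * (c L * g (L + of_nat b * axis i 1)))"
      by (rule sum.swap)
    also have "\<dots> = (\<Sum>L\<in>F. c L * diff_op M (dyadic (j + 1) (axis i 1)) f (dyadic (j + 1) (\<chi> i. 2 * k $ i + L $ i)))"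
    proof (rule sum.cong[OF refl])
      fix L
      have "g (L + of_nat b * axis i 1) = f (dyadic (j + 1) (\<chi> i. 2 * k $ i + L $ i) + real b *\<^sub>R dyadic (j + 1) (axis i 1))" for b
      proof -
        have "dyadic (j + 1) ((\<chi> i. 2 * k $ i) + (L + of_nat b * axis i 1)) = dyadic (j + 1) (\<chi> i. 2 * k $ i + L $ i) + real b *\<^sub>R dyadic (j + 1) (axis i 1)"
          unfolding dy dyadic_add by (simp add: dyadic_def vec_eq_iff axis_def of_nat_index)
        then show ?thesis by (simp add: g_def)
      qed
      then show "(\<Sum>b\<le>M. ?\<beta> b * (c L * g (L + of_nat b * axis i 1))) =
        c L * diff_op M (dyadic (j + 1) (axis i 1)) f (dyadic (j + 1) (\<chi> i. 2 * k $ i + L $ i))"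
        by (simp add: shift_op_def degree_diff_poly sum_distrib_left mult_ac)
    qed
    finally show ?thesis .
  qed
  then show thesis using finF by (intro that)
qed

text \<open>By the partition of unity, \<open>P\<^sub>j f(x) - f(x)\<close> is a combination, with bounded weights, of boundedly many
  increments of \<open>f\<close> between \<open>x\<close> and points within \<open>O(2\<^sup>-\<^sup>j)\<close> of it.\<close>
lemma P_op_tendsto:
  fixes f :: "real ^ 'n \<Rightarrow> complex"
  assumes "continuous_on UNIV f"
  shows "(\<lambda>l. P_op \<phi> (j0 + int l) f x) \<longlonglongrightarrow> f x"
proof -
  obtain B where B: "0 < B" "\<And>s y. cmod (Psi s (y :: real ^ 'n)) \<le> B" using bounded_Psi by auto
  define y where "y l = 2 powi (j0 + int l) *\<^sub>R x" for l
  define pt where "pt l d = dyadic (j0 + int l) (vfloor (y l) + d)" for l d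
  have tend0: "(\<lambda>l. 1 / 2 powi (j0 + int l)) \<longlonglongrightarrow> (0::real)"
  proof -
    have "(\<lambda>l. (1 / 2 powi j0) * (1 / 2) ^ l) \<longlonglongrightarrow> (1 / 2 powi j0) * (0::real)"
      by (rule tendsto_mult_left, rule LIMSEQ_realpow_zero) auto
    then show ?thesis by (simp add: power_int_add power_divide)
  qed
  have pt: "(\<lambda>l. pt l d) \<longlonglongrightarrow> x" for d
  proof (rule vec_tendstoI)
    fix i
    have "\<bar>pt l d $ i - x $ i\<bar> \<le> (1 + \<bar>of_int (d $ i)\<bar>) * (1 / 2 powi (j0 + int l))" for l
    proof -
      define q where "q = (2::real) powi (j0 + int l)"
      have q: "0 < q" by (simp add: q_def)
      have "pt l d $ i - x $ i = (of_int \<lfloor>q * x $ i\<rfloor> - q * x $ i + of_int (d $ i)) / q"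
        using q by (simp add: pt_def dyadic_def y_def vfloor_def q_def[symmetric] field_simps)
      moreover have "\<bar>of_int \<lfloor>q * x $ i\<rfloor> - q * x $ i + of_int (d $ i)\<bar> \<le> 1 + \<bar>real_of_int (d $ i)\<bar>"
        by linarith
      ultimately show ?thesis using q by (simp add: abs_divide divide_right_mono q_def[symmetric])
    qed
    then have *: "\<forall>\<^sub>F l in sequentially. norm (pt l d $ i - x $ i) \<le> (1 + \<bar>of_int (d $ i)\<bar>) * (1 / 2 powi (j0 + int l))"
      by simp
    have "(\<lambda>l. pt l d $ i - x $ i) \<longlonglongrightarrow> 0"
      by (rule Lim_null_comparison[OF *]) (use tendsto_mult_left[OF tend0] in simp)
    then show "(\<lambda>l. pt l d $ i) \<longlonglongrightarrow> x $ i" by (simp add: LIM_zero_iff)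
  qed
  have fpt: "(\<lambda>l. f (pt l d)) \<longlonglongrightarrow> f x" for d
    by (rule isCont_tendsto_compose[OF _ pt]) (use assms in \<open>auto simp: continuous_on_eq_continuous_at\<close>)
  have term0: "(\<lambda>l. (f (pt l d) - f x) * tensor \<phi> (y l - ivec (vfloor (y l) + d))) \<longlonglongrightarrow> 0" for d
  proof (rule Lim_null_comparison)
    show "\<forall>\<^sub>F l in sequentially. norm ((f (pt l d) - f x) * tensor \<phi> (y l - ivec (vfloor (y l) + d))) \<le> norm (f (pt l d) - f x) * B"
      using B(2)[of 0] by (intro always_eventually allI) (auto simp: norm_mult Psi_0 intro!: mult_left_mono)
    have "(\<lambda>l. norm (f (pt l d) - f x) * B) \<longlonglongrightarrow> norm (f x - f x) * B"
      by (intro tendsto_intros fpt)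
    then show "(\<lambda>l. norm (f (pt l d) - f x) * B) \<longlonglongrightarrow> 0" by simp
  qed
  have eq: "P_op \<phi> (j0 + int l) f x - f x = (\<Sum>d\<in>near_zero R. (f (pt l d) - f x) * tensor \<phi> (y l - ivec (vfloor (y l) + d)))" for l
  proof -
    have "P_op \<phi> (j0 + int l) f x - f x = synth (tensor \<phi>) (\<lambda>k. f (dyadic (j0 + int l) k)) (y l) - f x * synth (tensor \<phi>) (\<lambda>k. 1) (y l)"
      by (simp add: P_op_eq_synth y_def tensor_partition)
    also have "\<dots> = (\<Sum>d\<in>near_zero R. (f (pt l d) - f x) * tensor \<phi> (y l - ivec (vfloor (y l) + d)))"
      unfolding synth_eq_sum[OF box_supp_tensor] pt_def sum_distrib_left sum_subtractf[symmetric]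
      by (simp add: left_diff_distrib)
    finally show ?thesis .
  qed
  have lim: "(\<lambda>l. \<Sum>d\<in>near_zero R. (f (pt l d) - f x) * tensor \<phi> (y l - ivec (vfloor (y l) + d))) \<longlonglongrightarrow> 0"
    by (rule tendsto_null_sum) (rule term0)
  show ?thesis by (rule LIM_zero_cancel) (simp only: eq lim)
qed

end

section \<open>Lattice sums and integrals\<close>

lemma nn_integral_lborel_affine:
  fixes f :: "real ^ 'n \<Rightarrow> ennreal"
  assumes [measurable]: "f \<in> borel_measurable borel" and "0 < c"
  shows "(\<integral>\<^sup>+x. f x \<partial>lborel) = ennreal (c ^ CARD('n)) * (\<integral>\<^sup>+v. f (a + c *\<^sub>R v) \<partial>lborel)"
proof -
  have "(\<integral>\<^sup>+x. f x \<partial>lborel) = (\<integral>\<^sup>+x. f x \<partial>density (distr lborel borel (\<lambda>x. a + c *\<^sub>R x)) (\<lambda>_. ennreal (\<bar>c\<bar> ^ DIM(real ^ 'n))))"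
    using assms by (subst lborel_affine[of c a]) auto
  also have "\<dots> = ennreal (c ^ CARD('n)) * (\<integral>\<^sup>+v. f (a + c *\<^sub>R v) \<partial>lborel)"
    using assms by (simp add: nn_integral_density nn_integral_cmult nn_integral_distr)
  finally show ?thesis .
qed

definition cube :: "real \<Rightarrow> (real ^ 'n) set" where
  "cube \<epsilon> = cbox 0 (\<chi> i. \<epsilon>)"

text \<open>Small displacements are averaged over this probability measure; it turns estimates that hold for each
  displacement into estimates by integrals.\<close>
definition unif :: "real \<Rightarrow> (real ^ 'n) measure" where
  "unif \<epsilon> = uniform_measure lborel (cube \<epsilon>)"

lemma mem_cube: "x \<in> cube \<epsilon> \<longleftrightarrow> (\<forall>i. 0 \<le> x $ i \<and> x $ i \<le> \<epsilon>)"
  by (auto simp: cube_def mem_box_cart)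

lemma emeasure_cube: "0 \<le> \<epsilon> \<Longrightarrow> emeasure lborel (cube \<epsilon> :: (real ^ 'n) set) = ennreal (\<epsilon> ^ CARD('n))"
proof -
  assume e: "0 \<le> \<epsilon>"
  have "(\<chi> i. \<epsilon>) \<bullet> b = \<epsilon>" if "b \<in> Basis" for b :: "real ^ 'n"
    using that by (auto simp: Basis_vec_def inner_axis)
  then show ?thesis using e unfolding cube_def
    by (subst emeasure_lborel_cbox_eq) simp
qed

lemma cube_measurable [measurable]: "cube \<epsilon> \<in> sets borel"
  by (simp add: cube_def)

lemma prob_space_unif: "0 < \<epsilon> \<Longrightarrow> prob_space (unif \<epsilon>)"
  unfolding unif_def by (intro prob_space_uniform_measure) (auto simp: emeasure_cube)

lemma sets_unif [simp, measurable_cong]: "sets (unif \<epsilon>) = sets borel"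
  by (simp add: unif_def)

lemma space_unif [simp]: "space (unif \<epsilon>) = UNIV"
  by (simp add: unif_def)

lemma AE_unif: "0 < \<epsilon> \<Longrightarrow> AE y in unif \<epsilon>. y \<in> cube \<epsilon>"
  unfolding unif_def by (rule AE_uniform_measureI) auto

lemma pair_sigma_finite_unif:
  "0 < \<epsilon> \<Longrightarrow> sigma_finite_measure N \<Longrightarrow> pair_sigma_finite (unif \<epsilon>) N"
  using prob_space_unif prob_space_imp_sigma_finite unfolding pair_sigma_finite_def by blast

lemma sigma_finite_count_vec: "sigma_finite_measure (count_space (UNIV :: (int ^ 'n) set))"
  by (rule sigma_finite_measure_count_space_countable) simp

lemma Lnorm_pair_ge:
  assumes "0 < \<epsilon>" "1 \<le> p" "sigma_finite_measure N" and [measurable]: "F \<in> borel_measurable (unif \<epsilon> \<Otimes>\<^sub>M N)"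
    and C: "\<And>y. y \<in> cube \<epsilon> \<Longrightarrow> C \<le> Lnorm p N (\<lambda>k. F (y, k))"
  shows "C \<le> Lnorm p (unif \<epsilon> \<Otimes>\<^sub>M N) F"
proof -
  interpret pair_sigma_finite "unif \<epsilon> :: (real ^ 'b) measure" N by (rule pair_sigma_finite_unif) fact+
  interpret M1: prob_space "unif \<epsilon> :: (real ^ 'b) measure" by (rule prob_space_unif) fact
  from assms(2) show ?thesis
  proof (cases p rule: exponent_cases)
    case infinite
    have "AE x in unif \<epsilon> \<Otimes>\<^sub>M N. F x \<le> Lnorm p (unif \<epsilon> \<Otimes>\<^sub>M N) F"
      by (simp add: infinite Lnorm_infinity esssup_AE)
    from AE_pair[OF this] AE_unif[OF assms(1)]
    have "AE y in (unif \<epsilon> :: (real ^ 'b) measure). C \<le> Lnorm p (unif \<epsilon> \<Otimes>\<^sub>M N) F"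
    proof eventually_elim
      case (elim y)
      then have "Lnorm p N (\<lambda>k. F (y, k)) \<le> Lnorm p (unif \<epsilon> \<Otimes>\<^sub>M N) F"
        unfolding infinite by (subst Lnorm_infinity_le_iff) auto
      with C[OF elim(2)] show ?case by (rule order_trans)
    qed
    then show ?thesis by simp
  next
    case (finite r)
    have "ennreal_powr C r = (\<integral>\<^sup>+y. ennreal_powr C r \<partial>(unif \<epsilon> :: (real ^ 'b) measure))"
      using M1.emeasure_space_1 by simp
    also have "\<dots> \<le> (\<integral>\<^sup>+y. (\<integral>\<^sup>+k. ennreal_powr (F (y, k)) r \<partial>N) \<partial>unif \<epsilon>)"
    proof (rule nn_integral_mono_AE)
      show "AE y in unif \<epsilon>. ennreal_powr C r \<le> (\<integral>\<^sup>+k. ennreal_powr (F (y, k)) r \<partial>N)"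
        using AE_unif[OF assms(1)]
      proof eventually_elim
        case (elim y)
        from C[OF this] finite show ?case
          by (simp add: Lnorm_finite ennreal_powr_le_iff)
      qed
    qed
    also have "\<dots> = (\<integral>\<^sup>+x. ennreal_powr (F x) r \<partial>(unif \<epsilon> \<Otimes>\<^sub>M N))"
      by (rule M2.nn_integral_fst) measurable
    finally show ?thesis using finite by (simp add: Lnorm_finite ennreal_powr_le_iff)
  qed
qed

lemma Lnorm_pair_le:
  assumes "0 < \<epsilon>" "1 \<le> r" "sigma_finite_measure N" and [measurable]: "F \<in> borel_measurable (unif \<epsilon> \<Otimes>\<^sub>M N)"
    and C: "\<And>y. y \<in> cube \<epsilon> \<Longrightarrow> Lnorm (ennreal r) N (\<lambda>k. F (y, k)) \<le> C"
  shows "Lnorm (ennreal r) (unif \<epsilon> \<Otimes>\<^sub>M N) F \<le> C"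
proof -
  interpret pair_sigma_finite "unif \<epsilon> :: (real ^ 'b) measure" N by (rule pair_sigma_finite_unif) fact+
  interpret M1: prob_space "unif \<epsilon> :: (real ^ 'b) measure" by (rule prob_space_unif) fact
  have "(\<integral>\<^sup>+x. ennreal_powr (F x) r \<partial>(unif \<epsilon> \<Otimes>\<^sub>M N)) = (\<integral>\<^sup>+y. (\<integral>\<^sup>+k. ennreal_powr (F (y, k)) r \<partial>N) \<partial>unif \<epsilon>)"
    by (rule M2.nn_integral_fst[symmetric]) measurable
  also have "\<dots> \<le> (\<integral>\<^sup>+y. ennreal_powr C r \<partial>(unif \<epsilon> :: (real ^ 'b) measure))"
  proof (rule nn_integral_mono_AE)
    show "AE y in unif \<epsilon>. (\<integral>\<^sup>+k. ennreal_powr (F (y, k)) r \<partial>N) \<le> ennreal_powr C r"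
      using AE_unif[OF assms(1)]
    proof eventually_elim
      case (elim y)
      from C[OF this] assms show ?case by (simp add: Lnorm_finite_le_iff)
    qed
  qed
  also have "\<dots> = ennreal_powr C r" using M1.emeasure_space_1 by simp
  finally show ?thesis using assms by (simp add: Lnorm_finite_le_iff)
qed

lemma Lnorm_pair_le_swapped:
  assumes "0 < \<epsilon>" "1 \<le> r" and sf: "sigma_finite_measure N"
    and [measurable]: "F \<in> borel_measurable (unif \<epsilon> \<Otimes>\<^sub>M (unif \<epsilon> \<Otimes>\<^sub>M N))"
    and C: "\<And>v. v \<in> cube \<epsilon> \<Longrightarrow> Lnorm (ennreal r) (unif \<epsilon> \<Otimes>\<^sub>M N) (\<lambda>(u, k). F (u, v, k)) \<le> C"
  shows "Lnorm (ennreal r) (unif \<epsilon> \<Otimes>\<^sub>M (unif \<epsilon> \<Otimes>\<^sub>M N)) F \<le> C"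
proof -
  interpret A: pair_sigma_finite "unif \<epsilon> :: (real ^ 'b) measure" N by (rule pair_sigma_finite_unif) fact+
  interpret B: pair_sigma_finite "unif \<epsilon> :: (real ^ 'c) measure" N by (rule pair_sigma_finite_unif) fact+
  interpret D: pair_sigma_finite "unif \<epsilon> :: (real ^ 'b) measure" "unif \<epsilon> :: (real ^ 'c) measure"
    by (rule pair_sigma_finite_unif[OF assms(1) prob_space_imp_sigma_finite[OF prob_space_unif[OF assms(1)]]])
  interpret E: pair_sigma_finite "unif \<epsilon> :: (real ^ 'b) measure" "(unif \<epsilon> :: (real ^ 'c) measure) \<Otimes>\<^sub>M N"
    by (rule pair_sigma_finite_unif) (use assms B.sigma_finite_measure_axioms in auto)
  interpret M1: prob_space "unif \<epsilon> :: (real ^ 'c) measure" by (rule prob_space_unif) fact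
  have "(\<integral>\<^sup>+x. ennreal_powr (F x) r \<partial>(unif \<epsilon> \<Otimes>\<^sub>M (unif \<epsilon> \<Otimes>\<^sub>M N))) =
     (\<integral>\<^sup>+u. (\<integral>\<^sup>+z. ennreal_powr (F (u, z)) r \<partial>(unif \<epsilon> \<Otimes>\<^sub>M N)) \<partial>unif \<epsilon>)"
    by (rule sigma_finite_measure.nn_integral_fst[OF B.sigma_finite_measure_axioms, symmetric]) measurable
  also have "\<dots> = (\<integral>\<^sup>+u. (\<integral>\<^sup>+v. (\<integral>\<^sup>+k. ennreal_powr (F (u, v, k)) r \<partial>N) \<partial>unif \<epsilon>) \<partial>unif \<epsilon>)"
    by (intro nn_integral_cong sigma_finite_measure.nn_integral_fst[OF sf, symmetric]) measurable
  also have "\<dots> = (\<integral>\<^sup>+v. (\<integral>\<^sup>+u. (\<integral>\<^sup>+k. ennreal_powr (F (u, v, k)) r \<partial>N) \<partial>unif \<epsilon>) \<partial>unif \<epsilon>)"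
    by (rule D.Fubini'[symmetric]) measurable
  also have "\<dots> = (\<integral>\<^sup>+v. (\<integral>\<^sup>+z. ennreal_powr (case z of (u, k) \<Rightarrow> F (u, v, k)) r \<partial>(unif \<epsilon> \<Otimes>\<^sub>M N)) \<partial>unif \<epsilon>)"
    by (intro nn_integral_cong) (subst sigma_finite_measure.nn_integral_fst[OF sf, symmetric], auto)
  also have "\<dots> \<le> (\<integral>\<^sup>+v. ennreal_powr C r \<partial>(unif \<epsilon> :: (real ^ 'c) measure))"
  proof (rule nn_integral_mono_AE)
    show "AE v in unif \<epsilon>. (\<integral>\<^sup>+z. ennreal_powr (case z of (u, k) \<Rightarrow> F (u, v, k)) r \<partial>(unif \<epsilon> \<Otimes>\<^sub>M N)) \<le> ennreal_powr C r"
      using AE_unif[OF assms(1)]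
    proof eventually_elim
      case (elim v)
      from C[OF this] assms show ?case by (simp add: Lnorm_finite_le_iff)
    qed
  qed
  also have "\<dots> = ennreal_powr C r" using M1.emeasure_space_1 by simp
  finally show ?thesis using assms by (simp add: Lnorm_finite_le_iff)
qed

lemma measurable_lattice_map:
  "(\<lambda>(v, k). a + \<delta> *\<^sub>R ivec k + \<kappa> *\<^sub>R v) \<in> measurable (unif \<epsilon> \<Otimes>\<^sub>M count_space UNIV) borel"
proof -
  have "(\<lambda>x. a + \<delta> *\<^sub>R ivec (snd x) + \<kappa> *\<^sub>R fst x) \<in> measurable (unif \<epsilon> \<Otimes>\<^sub>M count_space UNIV) borel"
    by (rule measurable_compose_countable[where g=snd and f="\<lambda>k x. a + \<delta> *\<^sub>R ivec k + \<kappa> *\<^sub>R fst x"]) measurable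
  then show ?thesis by (simp add: case_prod_beta')
qed

text \<open>The cubes \<open>a + \<delta> k + \<kappa> [0, \<epsilon>]\<^sup>n\<close> are disjoint when \<open>\<kappa> \<epsilon> < \<delta>\<close>, so the map that parametrises them
  transports the product measure to at most \<open>(\<kappa> \<epsilon>)\<^sup>-\<^sup>n\<close> times Lebesgue measure.\<close>
lemma Lnorm_lattice_cubes:
  fixes G :: "real ^ 'n \<Rightarrow> ennreal"
  assumes "1 \<le> p" "0 < \<epsilon>" "0 < \<kappa>" "\<kappa> * \<epsilon> < \<delta>" and [measurable]: "G \<in> borel_measurable borel"
  shows "Lnorm p (unif \<epsilon> \<Otimes>\<^sub>M count_space UNIV) (\<lambda>(v, k). G (a + \<delta> *\<^sub>R ivec k + \<kappa> *\<^sub>R v))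
    \<le> ennreal ((\<kappa> * \<epsilon>) powr (- (CARD('n) * recip p))) * Lnorm p lborel G"
proof -
  let ?T = "\<lambda>(v, k). a + \<delta> *\<^sub>R ivec k + \<kappa> *\<^sub>R v :: real ^ 'n"
  let ?M = "(unif \<epsilon> :: (real ^ 'n) measure) \<Otimes>\<^sub>M count_space (UNIV :: (int ^ 'n) set)"
  interpret pair_sigma_finite "unif \<epsilon> :: (real ^ 'n) measure" "count_space (UNIV :: (int ^ 'n) set)"
    by (rule pair_sigma_finite_unif) (fact sigma_finite_count_vec assms)+
  have meas: "?T \<in> measurable ?M lborel" using measurable_lattice_map[of a \<delta> \<kappa> \<epsilon>] by simp
  have le: "emeasure ?M (?T -` A \<inter> space ?M) \<le> ennreal ((\<kappa> * \<epsilon>) powr (- real CARD('n))) * emeasure lborel A"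
    if A: "A \<in> sets lborel" for A
  proof -
    have Ab [measurable]: "A \<in> sets borel" using A by simp
    let ?I = "\<lambda>k x. indicator A x * indicator (cube \<epsilon>) ((1 / \<kappa>) *\<^sub>R (x - (a + \<delta> *\<^sub>R ivec k))) :: ennreal"
    have slice: "emeasure (unif \<epsilon>) ((\<lambda>v. (v, k)) -` (?T -` A \<inter> space ?M)) =
        ennreal ((\<kappa> * \<epsilon>) powr (- real CARD('n))) * (\<integral>\<^sup>+x. ?I k x \<partial>lborel)" for k :: "int ^ 'n"
    proof -
      let ?S = "(\<lambda>v. a + \<delta> *\<^sub>R ivec k + \<kappa> *\<^sub>R v) -` A"
      have S [measurable]: "?S \<in> sets borel"
        using measurable_sets[of "\<lambda>v. a + \<delta> *\<^sub>R ivec k + \<kappa> *\<^sub>R v" borel borel A] by simp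
      have "(\<lambda>v. (v, k)) -` (?T -` A \<inter> space ?M) = ?S" by (auto simp: space_pair_measure)
      moreover have "emeasure (unif \<epsilon>) ?S = emeasure lborel (cube \<epsilon> \<inter> ?S) / emeasure lborel (cube \<epsilon> :: (real ^ 'n) set)"
        unfolding unif_def by (rule emeasure_uniform_measure) auto
      moreover have "emeasure lborel (cube \<epsilon> \<inter> ?S) = (\<integral>\<^sup>+v. ?I k ((a + \<delta> *\<^sub>R ivec k) + \<kappa> *\<^sub>R v) \<partial>lborel)"
      proof -
        have "emeasure lborel (cube \<epsilon> \<inter> ?S) = (\<integral>\<^sup>+v. indicator (cube \<epsilon> \<inter> ?S) v \<partial>lborel)" by simp
        also have "\<dots> = (\<integral>\<^sup>+v. ?I k ((a + \<delta> *\<^sub>R ivec k) + \<kappa> *\<^sub>R v) \<partial>lborel)"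
          using assms by (intro nn_integral_cong) (auto split: split_indicator)
        finally show ?thesis .
      qed
      moreover have "(\<integral>\<^sup>+x. ?I k x \<partial>lborel) = ennreal (\<kappa> ^ CARD('n)) * (\<integral>\<^sup>+v. ?I k ((a + \<delta> *\<^sub>R ivec k) + \<kappa> *\<^sub>R v) \<partial>lborel)"
        using assms by (intro nn_integral_lborel_affine) auto
      ultimately have "ennreal ((\<kappa> * \<epsilon>) powr (- real CARD('n))) * (\<integral>\<^sup>+x. ?I k x \<partial>lborel)
          = (ennreal ((\<kappa> * \<epsilon>) powr (- real CARD('n))) * ennreal (\<kappa> ^ CARD('n))) * emeasure lborel (cube \<epsilon> \<inter> ?S)"
        and e: "emeasure (unif \<epsilon>) ((\<lambda>v. (v, k)) -` (?T -` A \<inter> space ?M)) = emeasure lborel (cube \<epsilon> \<inter> ?S) / ennreal (\<epsilon> ^ CARD('n))"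
        using assms by (simp_all add: mult.assoc emeasure_cube)
      moreover have "ennreal ((\<kappa> * \<epsilon>) powr (- real CARD('n))) * ennreal (\<kappa> ^ CARD('n)) = ennreal (1 / \<epsilon> ^ CARD('n))"
        using assms by (simp add: ennreal_mult[symmetric] powr_minus powr_realpow power_mult_distrib field_simps)
      moreover have "ennreal (1 / \<epsilon> ^ CARD('n)) * X = X / ennreal (\<epsilon> ^ CARD('n))" for X
        using assms by (simp add: divide_ennreal_def inverse_ennreal mult.commute inverse_eq_divide)
      ultimately show ?thesis by simp
    qed
    have card: "(\<integral>\<^sup>+k. ?I k x \<partial>count_space UNIV) \<le> indicator A x" for x
    proof -
      have "k = k'" if "(1 / \<kappa>) *\<^sub>R (x - (a + \<delta> *\<^sub>R ivec k)) \<in> cube \<epsilon>" "(1 / \<kappa>) *\<^sub>R (x - (a + \<delta> *\<^sub>R ivec k')) \<in> cube \<epsilon>" for k k'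
      proof -
        have b: "0 \<le> x $ i - (a $ i + \<delta> * of_int (l $ i)) \<and> x $ i - (a $ i + \<delta> * of_int (l $ i)) \<le> \<kappa> * \<epsilon>"
          if "(1 / \<kappa>) *\<^sub>R (x - (a + \<delta> *\<^sub>R ivec l)) \<in> cube \<epsilon>" for l i
          using that assms by (auto simp: mem_cube field_simps)
        have "k $ i = k' $ i" for i
        proof -
          have "\<bar>\<delta> * (of_int (k $ i) - of_int (k' $ i))\<bar> < \<delta>"
            using b[OF that(1), of i] b[OF that(2), of i] assms by (auto simp: algebra_simps abs_less_iff)
          moreover have d: "0 < \<delta>" using assms by (meson less_trans mult_pos_pos)
          ultimately have "\<bar>real_of_int (k $ i) - of_int (k' $ i)\<bar> < 1" by (simp add: abs_mult)
          then show ?thesis by linarith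
        qed
        then show ?thesis by (simp add: vec_eq_iff)
      qed
      then have sub: "\<exists>k0. {k. (1 / \<kappa>) *\<^sub>R (x - (a + \<delta> *\<^sub>R ivec k)) \<in> cube \<epsilon>} \<subseteq> {k0}" by blast
      then obtain k0 where k0: "{k. (1 / \<kappa>) *\<^sub>R (x - (a + \<delta> *\<^sub>R ivec k)) \<in> cube \<epsilon>} \<subseteq> {k0}" ..
      have "(\<integral>\<^sup>+k. ?I k x \<partial>count_space UNIV) \<le> (\<integral>\<^sup>+k. indicator A x * indicator {k0} k \<partial>count_space UNIV)"
        using k0 by (intro nn_integral_mono) (auto split: split_indicator)
      also have "\<dots> = indicator A x" by (subst nn_integral_cmult_indicator) auto
      finally show ?thesis .
    qed
    have "emeasure ?M (?T -` A \<inter> space ?M) = (\<integral>\<^sup>+k. emeasure (unif \<epsilon>) ((\<lambda>v. (v, k)) -` (?T -` A \<inter> space ?M)) \<partial>count_space UNIV)"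
      using measurable_sets[OF meas A] by (rule emeasure_pair_measure_alt2)
    also have "\<dots> = ennreal ((\<kappa> * \<epsilon>) powr (- real CARD('n))) * (\<integral>\<^sup>+k. (\<integral>\<^sup>+x. ?I k x \<partial>lborel) \<partial>count_space UNIV)"
      unfolding slice by (intro nn_integral_cmult) auto
    also have "(\<integral>\<^sup>+k. (\<integral>\<^sup>+x. ?I k x \<partial>lborel) \<partial>count_space UNIV) = (\<integral>\<^sup>+x. (\<integral>\<^sup>+k. ?I k x \<partial>count_space UNIV) \<partial>lborel)"
      by (rule nn_integral_count_space_nn_integral[symmetric]) auto
    also have "\<dots> \<le> (\<integral>\<^sup>+x. indicator A x \<partial>lborel)" by (intro nn_integral_mono card)
    also have "\<dots> = emeasure lborel A" by simp
    finally show ?thesis by (simp add: mult_left_mono)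
  qed
  have "Lnorm p ?M (\<lambda>x. G (?T x)) \<le> ennreal (((\<kappa> * \<epsilon>) powr (- real CARD('n))) powr recip p) * Lnorm p lborel G"
    by (rule Lnorm_comp_le[OF assms(1) meas _ _ le]) (use assms in auto)
  then show ?thesis by (simp add: powr_powr case_prod_beta')
qed

section \<open>Synthesis, stability and Bernstein's inequality\<close>

text \<open>The preimage of a lattice point is a unit cube.\<close>
lemma Lnorm_vfloor_le:
  assumes "1 \<le> p"
  shows "Lnorm p lborel (\<lambda>y :: real ^ 'n. g (vfloor y + d)) \<le> Lnorm p (count_space UNIV) g"
proof -
  let ?T = "\<lambda>y :: real ^ 'n. vfloor y + d"
  have meas: "?T \<in> measurable lborel (count_space UNIV)"
  proof -
    have "vfloor \<in> measurable (lborel :: (real ^ 'n) measure) (count_space UNIV)" using measurable_vfloor by simp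
    then show ?thesis by (rule measurable_compose) simp
  qed
  have single: "emeasure lborel (?T -` {k}) \<le> 1" for k
  proof -
    have "?T -` {k} \<subseteq> cbox (ivec (k - d)) (ivec (k - d) + (\<chi> i. 1))"
    proof
      fix y assume "y \<in> ?T -` {k}"
      then have "\<forall>i. \<lfloor>y $ i\<rfloor> + d $ i = k $ i" by (auto simp: vfloor_def vec_eq_iff)
      then have "\<lfloor>y $ i\<rfloor> = k $ i - d $ i" for i by (simp add: eq_diff_eq)
      then have "of_int (k $ i - d $ i) \<le> y $ i \<and> y $ i \<le> of_int (k $ i - d $ i) + 1" for i
        by (metis floor_correct less_imp_le of_int_add of_int_1)
      then show "y \<in> cbox (ivec (k - d)) (ivec (k - d) + (\<chi> i. 1))" by (simp add: mem_box_cart)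
    qed
    then have "emeasure lborel (?T -` {k}) \<le> emeasure lborel (cbox (ivec (k - d)) (ivec (k - d) + (\<chi> i. 1)))"
      by (intro emeasure_mono) auto
    also have "\<dots> \<le> 1"
    proof -
      have "(\<chi> i. 1) \<bullet> b = 1" if "b \<in> Basis" for b :: "real ^ 'n"
        using that by (auto simp: Basis_vec_def inner_axis)
      then show ?thesis by (subst emeasure_lborel_cbox_eq) auto
    qed
    finally show ?thesis .
  qed
  have le: "emeasure lborel (?T -` A \<inter> space lborel) \<le> ennreal 1 * emeasure (count_space UNIV) A" for A
  proof (cases "finite A")
    case True
    have "emeasure lborel (?T -` A) = emeasure lborel (\<Union>k\<in>A. ?T -` {k})"
      by (intro arg_cong[where f="emeasure lborel"]) auto
    also have "\<dots> \<le> (\<Sum>k\<in>A. emeasure lborel (?T -` {k}))"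
      using True measurable_sets[OF meas] by (intro emeasure_subadditive_finite) auto
    also have "\<dots> \<le> (\<Sum>k\<in>A. 1)" by (intro sum_mono single)
    finally show ?thesis using True by (simp add: ennreal_of_nat_eq_real_of_nat)
  qed simp
  show ?thesis using Lnorm_comp_le[OF assms meas, of g 1] le by simp
qed

text \<open>Boundedly many translates overlap, and \<open>L\<^sup>p\<close> norms of functions constant on the lattice cubes are
  \<open>\<ell>\<^sup>p\<close> norms.\<close>
lemma synth_bound:
  fixes \<Psi> :: "real ^ 'n \<Rightarrow> complex"
  assumes "1 \<le> p" "box_supp r \<Psi>" and [measurable]: "\<Psi> \<in> borel_measurable borel"
    and B: "0 \<le> B" "\<And>y. cmod (\<Psi> y) \<le> B"
  shows "Lp_norm p lborel (synth \<Psi> c) \<le> ennreal (B * card (near_zero r :: (int ^ 'n) set)) * Lp_norm p (count_space UNIV) c"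
proof -
  have [measurable]: "(\<lambda>y. ennreal (cmod (c (vfloor y + d)))) \<in> borel_measurable borel" for d
    by (rule measurable_compose[OF measurable_vfloor, of "\<lambda>k. ennreal (cmod (c (k + d)))"]) simp
  have [measurable]: "synth \<Psi> c \<in> borel_measurable borel" by (rule synth_measurable[OF assms(2,3)])
  have "Lp_norm p lborel (synth \<Psi> c) \<le> Lnorm p lborel (\<lambda>y. \<Sum>d\<in>near_zero r. ennreal B * ennreal (cmod (c (vfloor y + d))))"
    unfolding Lp_norm_def
  proof (rule Lnorm_mono[OF assms(1)])
    fix y
    have "cmod (synth \<Psi> c y) \<le> (\<Sum>d\<in>near_zero r. B * cmod (c (vfloor y + d)))"
      unfolding synth_eq_sum[OF assms(2)] using B
      by (intro sum_norm_le) (auto simp: norm_mult mult.commute[of B] intro!: mult_left_mono)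
    also have "ennreal \<dots> = (\<Sum>d\<in>near_zero r. ennreal B * ennreal (cmod (c (vfloor y + d))))"
      using B by (simp add: sum_ennreal[symmetric] ennreal_mult)
    finally show "ennreal (cmod (synth \<Psi> c y)) \<le> \<dots>" by (simp add: ennreal_leI)
  qed simp
  also have "\<dots> \<le> (\<Sum>d\<in>near_zero r. Lnorm p lborel (\<lambda>y. ennreal B * ennreal (cmod (c (vfloor y + d)))))"
    by (intro Lnorm_sum assms finite_near_zero) measurable
  also have "\<dots> \<le> (\<Sum>d\<in>(near_zero r :: (int ^ 'n) set). ennreal B * Lp_norm p (count_space UNIV) c)"
  proof (rule sum_mono)
    fix d
    have "Lnorm p lborel (\<lambda>y :: real ^ 'n. ennreal B * ennreal (cmod (c (vfloor y + d)))) \<le> ennreal B * Lnorm p lborel (\<lambda>y :: real ^ 'n. ennreal (cmod (c (vfloor y + d))))"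
      by (intro Lnorm_cmult_le assms) measurable
    also have "\<dots> \<le> ennreal B * Lp_norm p (count_space UNIV) c"
      unfolding Lp_norm_def by (intro mult_left_mono Lnorm_vfloor_le[where g="\<lambda>k. ennreal (cmod (c k))"] assms) simp
    finally show "Lnorm p lborel (\<lambda>y :: real ^ 'n. ennreal B * ennreal (cmod (c (vfloor y + d)))) \<le> \<dots>" .
  qed
  also have "\<dots> = ennreal (B * card (near_zero r :: (int ^ 'n) set)) * Lp_norm p (count_space UNIV) c"
    using B by (simp add: ennreal_mult mult_ac ennreal_of_nat_eq_real_of_nat)
  finally show ?thesis .
qed

lemma ennreal_mult_mult: "0 \<le> a \<Longrightarrow> 0 \<le> b \<Longrightarrow> ennreal a * (ennreal b * x) = ennreal (a * b) * x"
  by (simp add: ennreal_mult mult.assoc)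

lemma ennreal_half_double: "ennreal (1/2) * 2 = 1" "2 * ennreal (1/2) = 1"
proof -
  have "ennreal (1/2) * ennreal 2 = ennreal (1/2 * 2)" by (rule ennreal_mult[symmetric]) auto
  also have "ennreal (1/2 * 2) = 1" by simp
  finally show "ennreal (1/2) * 2 = 1" unfolding ennreal_numeral .
  then show "2 * ennreal (1/2) = 1" by (simp only: mult.commute)
qed

context scaling
begin

text \<open>Iterating \<open>|c| \<le> a + E |c|\<close>, with \<open>E\<close> of norm at most \<open>1/2\<close>, gives a Neumann series in \<open>a\<close>. Boundedness of
  \<open>c\<close> is enough for this, whereas subtracting the \<open>\<ell>\<^sup>p\<close> norm of \<open>E |c|\<close> might mean \<open>\<infinity> - \<infinity>\<close>.\<close>
lemma Lnorm_neumann: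
  fixes c :: "int ^ 'n \<Rightarrow> complex" and a :: "int ^ 'n \<Rightarrow> ennreal" and D :: "(int ^ 'n) set"
    and \<tau> S :: real
  assumes "1 \<le> p" "finite D" "0 \<le> \<tau>" "\<tau> * card D \<le> 1 / 2" "\<And>k. cmod (c k) \<le> S"
    and rec: "\<And>k. ennreal (cmod (c k)) \<le> a k + ennreal \<tau> * (\<Sum>d\<in>D. ennreal (cmod (c (k + d))))"
  shows "Lp_norm p (count_space UNIV) c \<le> 2 * Lnorm p (count_space UNIV) a"
proof -
  define E where "E F k = ennreal \<tau> * (\<Sum>d\<in>D. F (k + d))" for F :: "int ^ 'n \<Rightarrow> ennreal" and k
  have S: "0 \<le> S" using assms(5)[of 0] norm_ge_zero order_trans by blast
  have fin: "ennreal (cmod (c k)) \<le> (\<Sum>r<N. (E ^^ r) a k) + ennreal ((1/2) ^ N * S)" for N k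
  proof (induction N arbitrary: k)
    case 0
    show ?case using assms(5)[of k] by (simp add: ennreal_leI)
  next
    case (Suc N)
    have "ennreal (cmod (c k)) \<le> a k + ennreal \<tau> * (\<Sum>d\<in>D. ennreal (cmod (c (k + d))))" by (rule rec)
    also have "\<dots> \<le> a k + ennreal \<tau> * (\<Sum>d\<in>D. (\<Sum>r<N. (E ^^ r) a (k + d)) + ennreal ((1/2) ^ N * S))"
      by (intro add_left_mono mult_left_mono sum_mono Suc) auto
    also have "\<dots> = a k + (ennreal \<tau> * (\<Sum>d\<in>D. \<Sum>r<N. (E ^^ r) a (k + d)) + ennreal (\<tau> * card D * ((1/2) ^ N * S)))"
      using assms S by (simp add: sum.distrib distrib_left ennreal_mult mult.assoc ennreal_of_nat_eq_real_of_nat)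
    also have "ennreal \<tau> * (\<Sum>d\<in>D. \<Sum>r<N. (E ^^ r) a (k + d)) = (\<Sum>r<N. (E ^^ Suc r) a k)"
      by (subst sum.swap) (simp add: E_def sum_distrib_left)
    also have "ennreal (\<tau> * card D * ((1/2) ^ N * S)) \<le> ennreal ((1/2) ^ Suc N * S)"
    proof (rule ennreal_leI)
      have "\<tau> * card D * ((1/2) ^ N * S) \<le> 1/2 * ((1/2) ^ N * S)"
        using assms S by (intro mult_right_mono) auto
      then show "\<tau> * card D * ((1/2) ^ N * S) \<le> (1/2) ^ Suc N * S" by simp
    qed
    also have "a k + ((\<Sum>r<N. (E ^^ Suc r) a k) + ennreal ((1/2) ^ Suc N * S)) = (\<Sum>r<Suc N. (E ^^ r) a k) + ennreal ((1/2) ^ Suc N * S)"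
      by (subst sum.lessThan_Suc_shift) (simp add: add.assoc)
    finally show ?case by (simp add: add_left_mono)
  qed
  \<comment> \<open>Boundedness of \<open>c\<close> makes the remainder tend to zero pointwise.\<close>
  have lim: "ennreal (cmod (c k)) \<le> (\<Sum>r. (E ^^ r) a k)" for k
  proof (rule ennreal_le_epsilon)
    fix e :: real assume e: "0 < e"
    obtain N where N: "(1/2::real) ^ N < e / (S + 1)"
      using real_arch_pow_inv[of "e / (S + 1)" "1/2"] e S by auto
    have "(1/2) ^ N * S \<le> (1/2) ^ N * (S + 1)" by (intro mult_left_mono) auto
    also have "\<dots> \<le> e" using N S by (simp add: field_simps)
    finally have "ennreal (cmod (c k)) \<le> (\<Sum>r<N. (E ^^ r) a k) + ennreal e"
      by (intro order_trans[OF fin[of k N] add_left_mono] ennreal_leI)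
    also have "\<dots> \<le> (\<Sum>r. (E ^^ r) a k) + ennreal e" by (intro add_right_mono sum_le_suminf) auto
    finally show "ennreal (cmod (c k)) \<le> (\<Sum>r. (E ^^ r) a k) + ennreal e" .
  qed
  have E: "Lnorm p (count_space UNIV) (E F) \<le> ennreal (1/2) * Lnorm p (count_space UNIV) F" for F
  proof -
    have "Lnorm p (count_space UNIV) (E F) \<le> ennreal \<tau> * Lnorm p (count_space UNIV) (\<lambda>k. \<Sum>d\<in>D. F (k + d))"
      unfolding E_def by (intro Lnorm_cmult_le assms) simp
    also have "\<dots> \<le> ennreal \<tau> * (\<Sum>d\<in>D. Lnorm p (count_space UNIV) (\<lambda>k. F (k + d)))"
      by (intro mult_left_mono Lnorm_sum assms) simp_all
    also have "\<dots> \<le> ennreal \<tau> * (\<Sum>d\<in>D. Lnorm p (count_space UNIV) F)"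
      by (intro mult_left_mono sum_mono Lnorm_count_inj_le assms) (auto simp: inj_on_def)
    also have "\<dots> = ennreal (\<tau> * card D) * Lnorm p (count_space UNIV) F"
      using assms by (simp add: ennreal_mult mult.assoc ennreal_of_nat_eq_real_of_nat)
    also have "\<dots> \<le> ennreal (1/2) * Lnorm p (count_space UNIV) F"
      using assms by (intro mult_right_mono ennreal_leI) auto
    finally show ?thesis .
  qed
  have Er: "Lnorm p (count_space UNIV) ((E ^^ r) a) \<le> ennreal ((1/2) ^ r) * Lnorm p (count_space UNIV) a" for r
  proof (induction r)
    case (Suc r)
    have "Lnorm p (count_space UNIV) ((E ^^ Suc r) a) \<le> ennreal (1/2) * Lnorm p (count_space UNIV) ((E ^^ r) a)"
      using E by simp
    also have "\<dots> \<le> ennreal (1/2) * (ennreal ((1/2) ^ r) * Lnorm p (count_space UNIV) a)"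
      by (intro mult_left_mono Suc) auto
    also have "\<dots> = ennreal ((1/2) ^ Suc r) * Lnorm p (count_space UNIV) a"
    proof -
      have "ennreal (1/2) * ennreal ((1/2) ^ r) = ennreal ((1/2) ^ Suc r)"
        by (subst ennreal_mult[symmetric]) auto
      then show ?thesis by (simp only: mult.assoc[symmetric])
    qed
    finally show ?case .
  qed simp
  have "Lp_norm p (count_space UNIV) c \<le> Lnorm p (count_space UNIV) (\<lambda>k. \<Sum>r. (E ^^ r) a k)"
    unfolding Lp_norm_def by (intro Lnorm_mono assms lim) simp
  also have "\<dots> \<le> (\<Sum>r. Lnorm p (count_space UNIV) ((E ^^ r) a))"
    by (intro Lnorm_suminf assms) simp
  also have "\<dots> \<le> (\<Sum>r. ennreal ((1/2) ^ r) * Lnorm p (count_space UNIV) a)"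
    by (intro suminf_le Er) auto
  also have "\<dots> = (\<Sum>r. ennreal ((1/2) ^ r)) * Lnorm p (count_space UNIV) a" by simp
  also have "(\<Sum>r. ennreal ((1/2) ^ r)) = 2"
    by (simp add: suminf_ennreal2 summable_geometric suminf_geometric)
  finally show ?thesis .
qed

lemma vfloor_add_small: "(\<And>i. 0 \<le> y $ i \<and> y $ i < 1) \<Longrightarrow> vfloor (ivec k + y) = k"
  unfolding vfloor_def vec_eq_iff by (simp add: floor_eq_iff)

text \<open>The coefficients are the values at the integer points, and for small \<open>y\<close> they differ little from the
  values at distance \<open>y\<close>; averaging over \<open>y\<close> turns these values into an \<open>L\<^sup>p\<close> norm.\<close>
lemma stability:
  assumes p: "1 \<le> p"
  shows "\<exists>C>0. \<forall>c. bounded (range c) \<longrightarrow>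
    Lp_norm p (count_space UNIV) c \<le> ennreal C * Lp_norm p lborel (synth (tensor \<phi> :: real ^ 'n \<Rightarrow> complex) c)"
proof -
  let ?t = "tensor \<phi> :: real ^ 'n \<Rightarrow> complex"
  let ?D = "near_zero R :: (int ^ 'n) set"
  define \<tau> where "\<tau> = 1 / (2 * (real (card ?D) + 1))"
  have \<tau>: "0 < \<tau>" "\<tau> * card ?D \<le> 1/2" by (auto simp: \<tau>_def field_simps)
  have "\<forall>d. \<exists>e>0. \<forall>y. norm y < e \<longrightarrow> cmod (?t (y - ivec d) - ?t (- ivec d)) < \<tau>"
  proof
    fix d
    have "isCont ?t (- ivec d)" 
      using continuous_on_eq_continuous_at[of UNIV ?t] continuous_tensor by auto
    then obtain e where e: "0 < e" "\<And>x. dist x (- ivec d) < e \<Longrightarrow> dist (?t x) (?t (- ivec d)) < \<tau>"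
      using \<tau> unfolding continuous_at_eps_delta by metis
    show "\<exists>e>0. \<forall>y. norm y < e \<longrightarrow> cmod (?t (y - ivec d) - ?t (- ivec d)) < \<tau>"
      using e(1) e(2)[of "y - ivec d" for y] by (intro exI[of _ e]) (auto simp: dist_norm)
  qed
  then obtain e where e: "\<And>d. 0 < e d" "\<And>d y. norm y < e d \<Longrightarrow> cmod (?t (y - ivec d) - ?t (- ivec d)) < \<tau>"
    by metis
  have finD: "finite ?D" by (rule finite_near_zero)
  define e0 where "e0 = Min (insert 1 (e ` ?D))"
  have e0: "0 < e0" "e0 \<le> 1" "\<And>d. d \<in> ?D \<Longrightarrow> e0 \<le> e d"
    unfolding e0_def using e(1) finD by (auto simp: Min_gr_iff)
  \<comment> \<open>On the cube of side \<open>\<epsilon>\<close> no relevant translate of the scaling function varies by more than \<open>\<tau>\<close>.\<close>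
  define \<epsilon> where "\<epsilon> = e0 / (2 * CARD('n))"
  have \<epsilon>: "0 < \<epsilon>" "\<epsilon> < 1" "CARD('n) * \<epsilon> < e0"
  proof -
    show "0 < \<epsilon>" using e0 by (simp add: \<epsilon>_def)
    show n: "CARD('n) * \<epsilon> < e0" using e0 by (simp add: \<epsilon>_def)
    have "1 * \<epsilon> \<le> CARD('n) * \<epsilon>" using \<open>0 < \<epsilon>\<close> by (intro mult_right_mono) (auto simp: Suc_leI)
    then show "\<epsilon> < 1" using n e0 by simp
  qed
  have cubenorm: "norm y < e0" if "y \<in> cube \<epsilon>" for y :: "real ^ 'n"
  proof -
    have "norm y \<le> (\<Sum>i\<in>UNIV. \<bar>y $ i\<bar>)" by (rule norm_le_l1_cart)
    also have "\<dots> \<le> (\<Sum>i\<in>(UNIV::'n set). \<epsilon>)" using that by (intro sum_mono) (auto simp: mem_cube)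
    finally show ?thesis using \<epsilon> by simp
  qed
  define C where "C = 2 * \<epsilon> powr (- (CARD('n) * recip p))"
  have main: "Lp_norm p (count_space UNIV) c \<le> ennreal C * Lp_norm p lborel (synth ?t c)" if c: "bounded (range c)" for c
  proof -
    let ?g = "synth ?t c"
    obtain S where S: "\<And>k. cmod (c k) \<le> S" using c by (auto simp: bounded_iff)
    have [measurable]: "?g \<in> borel_measurable borel"
      by (intro synth_measurable[OF box_supp_tensor] measurable_tensor)
    have slice: "Lp_norm p (count_space UNIV) c \<le> 2 * Lnorm p (count_space UNIV) (\<lambda>k. ennreal (cmod (?g (0 + 1 *\<^sub>R ivec k + 1 *\<^sub>R y))))"
      if y: "y \<in> cube \<epsilon>" for y
    proof (rule Lnorm_neumann[OF p finite_near_zero _ \<tau>(2) S])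
      show "0 \<le> \<tau>" using \<tau> by simp
      fix k
      have yb: "0 \<le> y $ i \<and> y $ i < 1" for i
      proof -
        have "0 \<le> y $ i" "y $ i \<le> \<epsilon>" using y by (auto simp: mem_cube)
        then show ?thesis using \<epsilon> by linarith
      qed
      have pos: "ivec k + y - ivec (k + d) = y - ivec d" for y :: "real ^ 'n" and d
        by (simp add: ivec_add)
      have gy: "?g (ivec k + y) = (\<Sum>d\<in>?D. c (k + d) * ?t (y - ivec d))"
        unfolding synth_eq_sum[OF box_supp_tensor] vfloor_add_small[OF yb] pos ..
      have "?g (ivec k + 0) = (\<Sum>d\<in>?D. c (k + d) * ?t (0 - ivec d))"
      proof -
        have v0: "vfloor (ivec k + (0 :: real ^ 'n)) = k" by (rule vfloor_add_small) simp
        show ?thesis unfolding synth_eq_sum[OF box_supp_tensor] v0 pos ..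
      qed
      then have g0: "c k = (\<Sum>d\<in>?D. c (k + d) * ?t (- ivec d))" by (simp add: synth_tensor_ivec)
      have "c k = ?g (ivec k + y) - (\<Sum>d\<in>?D. c (k + d) * (?t (y - ivec d) - ?t (- ivec d)))"
        unfolding gy right_diff_distrib sum_subtractf g0[symmetric] by simp
      then have "cmod (c k) = cmod (?g (ivec k + y) - (\<Sum>d\<in>?D. c (k + d) * (?t (y - ivec d) - ?t (- ivec d))))"
        by (rule arg_cong)
      also have "\<dots> \<le> cmod (?g (ivec k + y)) + cmod (\<Sum>d\<in>?D. c (k + d) * (?t (y - ivec d) - ?t (- ivec d)))"
        by (rule norm_triangle_ineq4)
      also have "cmod (\<Sum>d\<in>?D. c (k + d) * (?t (y - ivec d) - ?t (- ivec d))) \<le> (\<Sum>d\<in>?D. \<tau> * cmod (c (k + d)))"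
      proof (rule sum_norm_le)
        fix d assume d: "d \<in> ?D"
        have "norm y < e d" using cubenorm[OF y] e0(3)[OF d] by simp
        from e(2)[OF this] have "cmod (?t (y - ivec d) - ?t (- ivec d)) \<le> \<tau>" by simp
        then show "cmod (c (k + d) * (?t (y - ivec d) - ?t (- ivec d))) \<le> \<tau> * cmod (c (k + d))"
          by (simp add: norm_mult mult.commute[of \<tau>] mult_left_mono)
      qed
      finally have "ennreal (cmod (c k)) \<le> ennreal (cmod (?g (ivec k + y)) + (\<Sum>d\<in>?D. \<tau> * cmod (c (k + d))))"
        by (simp add: ennreal_leI)
      also have "\<dots> = ennreal (cmod (?g (ivec k + y))) + ennreal \<tau> * (\<Sum>d\<in>?D. ennreal (cmod (c (k + d))))"
        using \<tau> by (simp add: ennreal_plus sum_nonneg sum_distrib_left[symmetric] ennreal_mult sum_ennreal)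
      finally show "ennreal (cmod (c k)) \<le> ennreal (cmod (?g (0 + 1 *\<^sub>R ivec k + 1 *\<^sub>R y))) + ennreal \<tau> * (\<Sum>d\<in>?D. ennreal (cmod (c (k + d))))"
        by simp
    qed
    let ?F = "\<lambda>(v, k). ennreal (cmod (?g (0 + 1 *\<^sub>R ivec k + 1 *\<^sub>R v)))"
    have meas: "?F \<in> borel_measurable (unif \<epsilon> \<Otimes>\<^sub>M count_space UNIV)"
      using measurable_compose[OF measurable_lattice_map[of 0 1 1 \<epsilon>], of "\<lambda>x. ennreal (cmod (?g x))"]
      by (simp add: case_prod_beta')
    have "ennreal (1/2) * Lp_norm p (count_space UNIV) c \<le> Lnorm p (unif \<epsilon> \<Otimes>\<^sub>M count_space UNIV) ?F"
    proof (rule Lnorm_pair_ge[OF \<epsilon>(1) p sigma_finite_count_vec meas])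
      fix y :: "real ^ 'n" assume "y \<in> cube \<epsilon>"
      from mult_left_mono[OF slice[OF this], of "ennreal (1/2)"]
      have "ennreal (1/2) * Lp_norm p (count_space UNIV) c \<le> (ennreal (1/2) * 2) * Lnorm p (count_space UNIV) (\<lambda>k. ennreal (cmod (?g (0 + 1 *\<^sub>R ivec k + 1 *\<^sub>R y))))"
        by (simp add: mult.assoc)
      also have "ennreal (1/2) * 2 = 1" by (rule ennreal_half_double)
      finally show "ennreal (1/2) * Lp_norm p (count_space UNIV) c \<le> Lnorm p (count_space UNIV) (\<lambda>k. ?F (y, k))"
        by simp
    qed
    also have "\<dots> \<le> ennreal ((1 * \<epsilon>) powr (- (CARD('n) * recip p))) * Lnorm p lborel (\<lambda>x. ennreal (cmod (?g x)))"
      using \<epsilon> by (intro Lnorm_lattice_cubes p) auto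
    finally have "2 * (ennreal (1/2) * Lp_norm p (count_space UNIV) c) \<le> 2 * (ennreal ((1 * \<epsilon>) powr (- (CARD('n) * recip p))) * Lp_norm p lborel ?g)"
      unfolding Lp_norm_def by (rule mult_left_mono) simp
    moreover have "2 * (ennreal (1/2) * X) = X" for X
      by (simp only: mult.assoc[symmetric] ennreal_half_double mult_1_left)
    moreover have "2 * (ennreal (\<epsilon> powr (- (CARD('n) * recip p))) * X) = ennreal C * X" for X
      by (simp add: C_def ennreal_mult mult.assoc)
    ultimately show ?thesis by simp
  qed
  have "0 < C" using \<epsilon> by (simp add: C_def)
  with main show ?thesis by blast
qed

text \<open>Differences commute with synthesis, so the difference is synthesised from the small function
  \<open>\<Delta>\<^sub>h\<^sup>m \<phi>\<close>; stability leads back from the coefficients to the norm of the function itself. For steps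
  beyond \<open>1\<close> the boundedness of differences suffices.\<close>
lemma bernstein_unit:
  assumes p: "1 \<le> p" and reg: "(tensor \<phi> :: real ^ 'n \<Rightarrow> complex) \<in> C_real r0" "0 < r0"
  shows "\<exists>C>0. \<forall>c h \<tau>. bounded (range c) \<longrightarrow> 0 < \<tau> \<longrightarrow> norm h \<le> \<tau> \<longrightarrow>
    Lp_norm p lborel (diff_op m h (synth (tensor \<phi> :: real ^ 'n \<Rightarrow> complex) c))
      \<le> ennreal (C * min 1 (\<tau> powr min (real m) r0)) * Lp_norm p lborel (synth (tensor \<phi> :: real ^ 'n \<Rightarrow> complex) c)"
proof -
  let ?t = "tensor \<phi> :: real ^ 'n \<Rightarrow> complex"
  let ?\<rho> = "min (real m) r0"
  obtain C1 where C1: "0 < C1" "\<And>c. bounded (range c) \<Longrightarrow>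
    Lp_norm p (count_space UNIV) c \<le> ennreal C1 * Lp_norm p lborel (synth ?t c)" using stability[OF p] by blast
  have "\<exists>C\<ge>0. \<forall>\<tau> h x. 0 < \<tau> \<longrightarrow> \<tau> \<le> 1 \<longrightarrow> norm h \<le> \<tau> \<longrightarrow> cmod (diff_op m h ?t x) \<le> C * \<tau> powr ?\<rho>"
    using difference_bound_tensor[OF reg] unfolding difference_bound_def by (rule spec)
  then obtain C2 where C2: "0 \<le> C2" "\<And>\<tau> h x. 0 < \<tau> \<Longrightarrow> \<tau> \<le> 1 \<Longrightarrow> norm h \<le> \<tau> \<Longrightarrow> cmod (diff_op m h ?t x) \<le> C2 * \<tau> powr ?\<rho>"
    by blast
  let ?D = "near_zero (R + m) :: (int ^ 'n) set"
  define C where "C = C2 * card ?D * C1 + coeff_sum ([:-1, 1:] ^ m) + 1"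
  have nn: "0 \<le> coeff_sum ([:-1, 1:] ^ m)" by (rule coeff_sum_nonneg)
  have "Lp_norm p lborel (diff_op m h (synth ?t c)) \<le> ennreal (C * min 1 (\<tau> powr ?\<rho>)) * Lp_norm p lborel (synth ?t c)"
    if c: "bounded (range c)" and \<tau>: "0 < \<tau>" "norm h \<le> \<tau>" for c h \<tau>
  proof (cases "\<tau> \<le> 1")
    case True
    have "box_supp (R + degree ([:-1, 1::complex:] ^ m)) (diff_op m h ?t)"
      using \<tau> True by (intro box_supp_shift_op box_supp_tensor) auto
    then have bs: "box_supp (R + m) (diff_op m h ?t)" by (simp only: degree_diff_poly)
    have "diff_op m h (synth ?t c) = synth (diff_op m h ?t) c"
      by (rule ext) (rule shift_op_synth[OF box_supp_tensor])
    then have "Lp_norm p lborel (diff_op m h (synth ?t c)) \<le> ennreal ((C2 * \<tau> powr ?\<rho>) * card ?D) * Lp_norm p (count_space UNIV) c"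
      using synth_bound[OF p bs shift_op_measurable[OF measurable_tensor], of "C2 * \<tau> powr ?\<rho>" c] C2 \<tau> True by simp
    also have "\<dots> \<le> ennreal ((C2 * \<tau> powr ?\<rho>) * card ?D) * (ennreal C1 * Lp_norm p lborel (synth ?t c))"
      by (intro mult_left_mono C1(2) c) simp
    also have "\<dots> = ennreal ((C2 * card ?D * C1) * \<tau> powr ?\<rho>) * Lp_norm p lborel (synth ?t c)"
      using C1(1) C2(1) by (subst ennreal_mult_mult) (auto simp: mult_ac)
    also have "\<dots> \<le> ennreal (C * min 1 (\<tau> powr ?\<rho>)) * Lp_norm p lborel (synth ?t c)"
    proof (intro mult_right_mono ennreal_leI)
      have "\<tau> powr ?\<rho> \<le> 1" using \<tau> True reg by (intro powr_le1) auto
      then show "C2 * card ?D * C1 * \<tau> powr ?\<rho> \<le> C * min 1 (\<tau> powr ?\<rho>)"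
        unfolding C_def using nn by (auto intro!: mult_right_mono)
    qed simp
    finally show ?thesis .
  next
    case False
    have "Lp_norm p lborel (diff_op m h (synth ?t c)) \<le> ennreal (coeff_sum ([:-1, 1:] ^ m)) * Lp_norm p lborel (synth ?t c)"
      by (intro Lp_norm_shift_op_le p synth_measurable[OF box_supp_tensor measurable_tensor])
    also have "\<dots> \<le> ennreal (C * min 1 (\<tau> powr ?\<rho>)) * Lp_norm p lborel (synth ?t c)"
    proof (intro mult_right_mono ennreal_leI)
      have "min 1 (\<tau> powr ?\<rho>) = 1" using False reg by (intro min_absorb1 ge_one_powr_ge_zero) auto
      then show "coeff_sum ([:-1, 1:] ^ m) \<le> C * min 1 (\<tau> powr ?\<rho>)"
        unfolding C_def using C1 C2 by simp
    qed simp
    finally show ?thesis .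
  qed
  note main = this
  have "0 < C" unfolding C_def using C1(1) C2(1) nn by (intro add_nonneg_pos add_nonneg_nonneg mult_nonneg_nonneg) auto
  then show ?thesis by (intro exI[of _ C] conjI allI impI main)
qed

text \<open>The estimate on the unit lattice, rescaled by \<open>a\<close>.\<close>
lemma bernstein:
  assumes p: "1 \<le> p" and reg: "(tensor \<phi> :: real ^ 'n \<Rightarrow> complex) \<in> C_real r0" "0 < r0"
  shows "\<exists>C>0. \<forall>c g a t. bounded (range c) \<longrightarrow> 0 < t \<longrightarrow> 0 < a \<longrightarrow>
    g = (\<lambda>x. synth (tensor \<phi> :: real ^ 'n \<Rightarrow> complex) c (a *\<^sub>R x)) \<longrightarrow>
    modulus m p g t \<le> ennreal (C * min 1 ((a * t) powr min (real m) r0)) * Lp_norm p lborel g"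
proof -
  let ?t = "tensor \<phi> :: real ^ 'n \<Rightarrow> complex"
  obtain C where C: "0 < C" "\<And>c h \<tau>. bounded (range c) \<Longrightarrow> 0 < \<tau> \<Longrightarrow> norm h \<le> \<tau> \<Longrightarrow>
    Lp_norm p lborel (diff_op m h (synth ?t c))
      \<le> ennreal (C * min 1 (\<tau> powr min (real m) r0)) * Lp_norm p lborel (synth ?t c)"
    using bernstein_unit[OF p reg] by blast
  have "modulus m p g t \<le> ennreal (C * min 1 ((a * t) powr min (real m) r0)) * Lp_norm p lborel g"
    if c: "bounded (range c)" and t: "0 < t" and a: "0 < a" and g: "g = (\<lambda>x. synth ?t c (a *\<^sub>R x))" for c g a t
  proof (rule modulus_leI)
    fix h :: "real ^ 'n" assume h: "norm h \<le> t"
    have [measurable]: "synth ?t c \<in> borel_measurable borel"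
      by (rule synth_measurable[OF box_supp_tensor measurable_tensor])
    have "diff_op m h g = (\<lambda>x. diff_op m (a *\<^sub>R h) (synth ?t c) (a *\<^sub>R x))"
      unfolding g by (rule ext) (rule shift_op_scale)
    then have "Lp_norm p lborel (diff_op m h g) = ennreal (a powr (- (CARD('n) * recip p))) * Lp_norm p lborel (diff_op m (a *\<^sub>R h) (synth ?t c))"
      using p a by (simp add: Lp_norm_scale shift_op_measurable)
    also have "\<dots> \<le> ennreal (a powr (- (CARD('n) * recip p))) *
       (ennreal (C * min 1 ((a * t) powr min (real m) r0)) * Lp_norm p lborel (synth ?t c))"
      using c t a h by (intro mult_left_mono C(2)) auto
    also have "\<dots> = ennreal (C * min 1 ((a * t) powr min (real m) r0)) *
        (ennreal (a powr (- (CARD('n) * recip p))) * Lp_norm p lborel (synth ?t c))"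
      by (rule mult.left_commute)
    also have "ennreal (a powr (- (CARD('n) * recip p))) * Lp_norm p lborel (synth ?t c) = Lp_norm p lborel g"
      unfolding g using p a by (simp add: Lp_norm_scale)
    finally show "Lp_norm p lborel (diff_op m h g) \<le> ennreal (C * min 1 ((a * t) powr min (real m) r0)) * Lp_norm p lborel g" .
  qed
  with C(1) show ?thesis by blast
qed

end

section \<open>Sampling a continuous function\<close>

text \<open>The set where a continuous function exceeds its essential supremum is open and null, hence empty.\<close>
lemma continuous_le_esssup:
  fixes g :: "real ^ 'n \<Rightarrow> complex"
  assumes "continuous_on UNIV g"
  shows "ennreal (cmod (g x)) \<le> Lp_norm top lborel g"
proof (rule ccontr)
  assume "\<not> ?thesis"
  then have lt: "Lp_norm top lborel g < ennreal (cmod (g x))" by simp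
  then obtain c where c: "Lp_norm top lborel g = ennreal c" "0 \<le> c"
    by (cases "Lp_norm top lborel g") auto
  let ?S = "{y. c < cmod (g y)}"
  have op: "open ?S" using assms by (intro open_Collect_less continuous_intros)
  have "AE y in lborel. ennreal (cmod (g y)) \<le> ennreal c"
    using esssup_AE[of "\<lambda>y. ennreal (cmod (g y))" lborel] c by (simp add: Lp_norm_def Lnorm_infinity)
  then have "AE y in lborel. y \<notin> ?S"
    by eventually_elim (use c in \<open>auto simp: ennreal_le_iff not_less\<close>)
  then have "?S \<in> null_sets lborel"
    using op by (subst (asm) AE_iff_null_sets[symmetric]) auto
  then have "negligible ?S"
    by (simp add: negligible_iff_null_sets null_sets_completionI)
  moreover have "x \<in> ?S" using lt c by (auto simp: ennreal_less_iff)
  ultimately show False using open_not_negligible[OF op] by blast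
qed

text \<open>Two independent small displacements, paired with all lattice points.\<close>
abbreviation triple_measure :: "real \<Rightarrow> ((real ^ 'n) \<times> (real ^ 'n) \<times> (int ^ 'n)) measure" where
  "triple_measure \<epsilon> \<equiv> unif \<epsilon> \<Otimes>\<^sub>M (unif \<epsilon> \<Otimes>\<^sub>M count_space UNIV)"

lemma measurable_triple:
  fixes f :: "int ^ 'n \<Rightarrow> real ^ 'n \<Rightarrow> real ^ 'n \<Rightarrow> ennreal"
  assumes "\<And>k. (\<lambda>z. f k (fst z) (snd z)) \<in> borel_measurable (borel \<Otimes>\<^sub>M borel)"
  shows "(\<lambda>(u, v, k). f k u v) \<in> borel_measurable (triple_measure \<epsilon>)"
proof -
  have "(\<lambda>x :: (real ^ 'n) \<times> (real ^ 'n) \<times> (int ^ 'n). (fst x, fst (snd x))) \<in> measurable (triple_measure \<epsilon>) (borel \<Otimes>\<^sub>M borel)"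
    by measurable
  from measurable_compose[OF this assms]
  have m: "(\<lambda>x. f k (fst x) (fst (snd x))) \<in> borel_measurable (triple_measure \<epsilon>)" for k by simp
  have "(\<lambda>x. f (snd (snd x)) (fst x) (fst (snd x))) \<in> borel_measurable (triple_measure \<epsilon>)"
    by (rule measurable_compose_countable[where g="\<lambda>x. snd (snd x)" and f="\<lambda>k x. f k (fst x) (fst (snd x))", OF m]) measurable
  then show ?thesis by (simp add: case_prod_beta')
qed

lemma sigma_finite_unif_count:
  "0 < \<epsilon> \<Longrightarrow> sigma_finite_measure ((unif \<epsilon> :: (real ^ 'n) measure) \<Otimes>\<^sub>M count_space (UNIV :: (int ^ 'n) set))"
proof -
  assume e: "0 < \<epsilon>"
  interpret B: pair_sigma_finite "unif \<epsilon> :: (real ^ 'n) measure" "count_space (UNIV :: (int ^ 'n) set)"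
    by (rule pair_sigma_finite_unif[OF e sigma_finite_count_vec])
  show ?thesis by (rule B.sigma_finite_measure_axioms)
qed

text \<open>For a fixed first displacement \<open>u\<close>, which only selects the function and the origin, the second one
  sweeps out disjoint cubes around the lattice points.\<close>
lemma triple_first:
  fixes H :: "real ^ 'n \<Rightarrow> real ^ 'n \<Rightarrow> complex"
  assumes "0 < \<epsilon>" "1 \<le> r" "0 < \<kappa>" "\<kappa> * \<epsilon> < \<delta>"
    and meas: "(\<lambda>(u, v, k). ennreal (cmod (H u (a u + \<delta> *\<^sub>R ivec k + \<kappa> *\<^sub>R v)))) \<in> borel_measurable (triple_measure \<epsilon>)"
    and H: "\<And>u. u \<in> cube \<epsilon> \<Longrightarrow> H u \<in> borel_measurable borel" "\<And>u. u \<in> cube \<epsilon> \<Longrightarrow> Lp_norm (ennreal r) lborel (H u) \<le> W"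
  shows "Lnorm (ennreal r) (triple_measure \<epsilon>) (\<lambda>(u, v, k). ennreal (cmod (H u (a u + \<delta> *\<^sub>R ivec k + \<kappa> *\<^sub>R v))))
    \<le> ennreal ((\<kappa> * \<epsilon>) powr (- (CARD('n) * recip (ennreal r)))) * W"
proof (rule Lnorm_pair_le[OF assms(1,2) sigma_finite_unif_count[OF assms(1)] meas])
  fix u :: "real ^ 'n" assume u: "u \<in> cube \<epsilon>"
  have [measurable]: "H u \<in> borel_measurable borel" by (rule H(1)[OF u])
  have "Lnorm (ennreal r) (unif \<epsilon> \<Otimes>\<^sub>M count_space UNIV) (\<lambda>(v, k). ennreal (cmod (H u (a u + \<delta> *\<^sub>R ivec k + \<kappa> *\<^sub>R v))))
    \<le> ennreal ((\<kappa> * \<epsilon>) powr (- (CARD('n) * recip (ennreal r)))) * Lnorm (ennreal r) lborel (\<lambda>x. ennreal (cmod (H u x)))"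
    using assms by (intro Lnorm_lattice_cubes) auto
  also have "\<dots> \<le> ennreal ((\<kappa> * \<epsilon>) powr (- (CARD('n) * recip (ennreal r)))) * W"
    using H(2)[OF u] by (intro mult_left_mono) (auto simp: Lp_norm_def)
  finally show "Lnorm (ennreal r) (unif \<epsilon> \<Otimes>\<^sub>M count_space UNIV)
     (\<lambda>k. (\<lambda>(u, v, k). ennreal (cmod (H u (a u + \<delta> *\<^sub>R ivec k + \<kappa> *\<^sub>R v)))) (u, k)) \<le> ennreal ((\<kappa> * \<epsilon>) powr (- (CARD('n) * recip (ennreal r)))) * W"
    by simp
qed

text \<open>The same with the roles of the two displacements exchanged.\<close>
lemma triple_second:
  fixes H :: "real ^ 'n \<Rightarrow> real ^ 'n \<Rightarrow> complex"
  assumes "0 < \<epsilon>" "1 \<le> r" "0 < \<kappa>" "\<kappa> * \<epsilon> < \<delta>"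
    and meas: "(\<lambda>(u, v, k). ennreal (cmod (H v (a v + \<delta> *\<^sub>R ivec k + \<kappa> *\<^sub>R u)))) \<in> borel_measurable (triple_measure \<epsilon>)"
    and H: "\<And>v. v \<in> cube \<epsilon> \<Longrightarrow> H v \<in> borel_measurable borel" "\<And>v. v \<in> cube \<epsilon> \<Longrightarrow> Lp_norm (ennreal r) lborel (H v) \<le> W"
  shows "Lnorm (ennreal r) (triple_measure \<epsilon>) (\<lambda>(u, v, k). ennreal (cmod (H v (a v + \<delta> *\<^sub>R ivec k + \<kappa> *\<^sub>R u))))
    \<le> ennreal ((\<kappa> * \<epsilon>) powr (- (CARD('n) * recip (ennreal r)))) * W"
proof (rule Lnorm_pair_le_swapped[OF assms(1,2) sigma_finite_count_vec meas])
  fix v :: "real ^ 'n" assume v: "v \<in> cube \<epsilon>"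
  have [measurable]: "H v \<in> borel_measurable borel" by (rule H(1)[OF v])
  have "Lnorm (ennreal r) (unif \<epsilon> \<Otimes>\<^sub>M count_space UNIV) (\<lambda>(u, k). ennreal (cmod (H v (a v + \<delta> *\<^sub>R ivec k + \<kappa> *\<^sub>R u))))
    \<le> ennreal ((\<kappa> * \<epsilon>) powr (- (CARD('n) * recip (ennreal r)))) * Lnorm (ennreal r) lborel (\<lambda>x. ennreal (cmod (H v x)))"
    using assms by (intro Lnorm_lattice_cubes) auto
  also have "\<dots> \<le> ennreal ((\<kappa> * \<epsilon>) powr (- (CARD('n) * recip (ennreal r)))) * W"
    using H(2)[OF v] by (intro mult_left_mono) (auto simp: Lp_norm_def)
  finally show "Lnorm (ennreal r) (unif \<epsilon> \<Otimes>\<^sub>M count_space UNIV)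
     (\<lambda>(u, k). (\<lambda>(u, v, k). ennreal (cmod (H v (a v + \<delta> *\<^sub>R ivec k + \<kappa> *\<^sub>R u)))) (u, v, k)) \<le> ennreal ((\<kappa> * \<epsilon>) powr (- (CARD('n) * recip (ennreal r)))) * W"
    by simp
qed

abbreviation diff_coeff :: "nat \<Rightarrow> nat \<Rightarrow> complex" where
  "diff_coeff M \<equiv> coeff ([:-1, 1:] ^ M)"

text \<open>The change of \<open>\<Delta>\<^sup>M\<close> when its step is doubled. Its constant coefficient is zero, so it does not evaluate
  its argument at the base point.\<close>
definition step_poly :: "nat \<Rightarrow> complex poly" where
  "step_poly M = [:-1, 0, 1:] ^ M - [:-1, 1:] ^ M"

lemma step_poly_coeff_0: "coeff (step_poly M) 0 = 0"
  by (simp add: step_poly_def poly_0_coeff_0[symmetric] poly_power)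

lemma degree_step_poly: "degree (step_poly M) \<le> 2 * M"
proof -
  have "degree ([:-1, 0, 1::complex:] ^ M) \<le> 2 * M"
    using degree_power_le[of "[:-1, 0, 1::complex:]" M] by simp
  then show ?thesis unfolding step_poly_def
    by (intro degree_diff_le) (auto simp: degree_diff_poly)
qed

lemma shift_op_step_poly:
  "shift_op (step_poly M) h f x = diff_op M (2 *\<^sub>R h) f x - diff_op M h f x"
  by (simp only: step_poly_def shift_op_diff shift_op_power_double)

lemma shift_op_step_poly_le:
  "ennreal (cmod (shift_op (step_poly M) h f x)) \<le>
    (\<Sum>l\<in>{1..2 * M}. ennreal (cmod (coeff (step_poly M) l)) * ennreal (cmod (f (x + real l *\<^sub>R h))))"
proof -
  have "shift_op (step_poly M) h f x = (\<Sum>l\<le>2 * M. coeff (step_poly M) l * f (x + real l *\<^sub>R h))"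
    by (rule shift_op_eq[OF degree_step_poly])
  also have "\<dots> = (\<Sum>l\<in>{1..2 * M}. coeff (step_poly M) l * f (x + real l *\<^sub>R h))"
    by (rule sum.mono_neutral_right) (auto simp: step_poly_coeff_0 not_less_eq_eq)
  finally have "cmod (shift_op (step_poly M) h f x) \<le> (\<Sum>l\<in>{1..2 * M}. cmod (coeff (step_poly M) l) * cmod (f (x + real l *\<^sub>R h)))"
    by (simp add: norm_mult[symmetric] norm_sum)
  then have "ennreal (cmod (shift_op (step_poly M) h f x)) \<le> ennreal (\<Sum>l\<in>{1..2 * M}. cmod (coeff (step_poly M) l) * cmod (f (x + real l *\<^sub>R h)))"
    by (rule ennreal_leI)
  also have "\<dots> = (\<Sum>l\<in>{1..2 * M}. ennreal (cmod (coeff (step_poly M) l)) * ennreal (cmod (f (x + real l *\<^sub>R h))))"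
    by (simp add: sum_ennreal[symmetric] ennreal_mult)
  finally show ?thesis .
qed

definition base_pairs :: "nat \<Rightarrow> (nat \<times> nat) set" where
  "base_pairs M = {..M} \<times> {..M} - {(0, 0)}"

text \<open>The mixed differences \<open>e\<^sub>i = \<Delta>\<^sub>u\<^sub>i\<^sup>M \<Delta>\<^sub>v\<^sub>i\<^sup>M g(x)\<close> with \<open>u\<^sub>i = u / 2\<^sup>i\<close>, \<open>v\<^sub>i = v / 2\<^sup>i\<close> tend to zero, and
  \<open>g(x) - e\<^sub>0\<close> and \<open>e\<^sub>i - e\<^sub>i\<^sub>+\<^sub>1\<close> involve no values at the point \<open>x\<close> itself: in each term one of the
  steps moves the point, while the other one is free to serve as the step of a difference.\<close>
lemma sampling_pointwise:
  fixes g :: "real ^ 'n \<Rightarrow> complex"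
  assumes g: "continuous_on UNIV g" and M: "1 \<le> M"
  shows "ennreal (cmod (g x)) \<le>
    (\<Sum>(a, b)\<in>base_pairs M. ennreal (cmod (diff_coeff M a * diff_coeff M b)) * ennreal (cmod (g (x + real a *\<^sub>R u + real b *\<^sub>R v)))) +
    (\<Sum>i. \<Sum>l\<in>{1..2 * M}. ennreal (cmod (coeff (step_poly M) l)) *
      (ennreal (cmod (diff_op M ((1/2) ^ i *\<^sub>R u) g (x + (real l * (1/2) ^ Suc i) *\<^sub>R v))) +
       ennreal (cmod (diff_op M ((1/2) ^ Suc i *\<^sub>R v) g (x + (real l * (1/2) ^ Suc i) *\<^sub>R u)))))"
    (is "_ \<le> ?A + (\<Sum>i. ?B i)")
proof -
  define e where "e i = diff_op M ((1/2) ^ i *\<^sub>R u) (diff_op M ((1/2) ^ i *\<^sub>R v) g) x" for i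
  have expand: "e i = (\<Sum>(a, b)\<in>{..M} \<times> {..M}. diff_coeff M a * diff_coeff M b * g (x + real a *\<^sub>R (1/2) ^ i *\<^sub>R u + real b *\<^sub>R (1/2) ^ i *\<^sub>R v))" for i
    unfolding e_def shift_op_def degree_diff_poly sum_distrib_left sum.cartesian_product[symmetric]
    by (simp add: mult.assoc)
  have c0: "diff_coeff M 0 * diff_coeff M 0 = 1"
    by (simp add: poly_0_coeff_0[symmetric] poly_power power_mult_distrib[symmetric])
  have first: "ennreal (cmod (g x - e 0)) \<le> ?A"
  proof -
    have "e 0 = diff_coeff M 0 * diff_coeff M 0 * g (x + real 0 *\<^sub>R u + real 0 *\<^sub>R v) +
       (\<Sum>(a, b)\<in>base_pairs M. diff_coeff M a * diff_coeff M b * g (x + real a *\<^sub>R u + real b *\<^sub>R v))"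
      unfolding expand base_pairs_def by (subst sum.remove[of _ "(0, 0)"]) auto
    then have "g x - e 0 = - (\<Sum>(a, b)\<in>base_pairs M. diff_coeff M a * diff_coeff M b * g (x + real a *\<^sub>R u + real b *\<^sub>R v))"
      by (simp add: c0)
    then have "cmod (g x - e 0) \<le> (\<Sum>(a, b)\<in>base_pairs M. cmod (diff_coeff M a * diff_coeff M b) * cmod (g (x + real a *\<^sub>R u + real b *\<^sub>R v)))"
      by (simp only: norm_minus_cancel) (rule sum_norm_le, auto simp: norm_mult)
    then have "ennreal (cmod (g x - e 0)) \<le> ennreal (\<Sum>(a, b)\<in>base_pairs M. cmod (diff_coeff M a * diff_coeff M b) * cmod (g (x + real a *\<^sub>R u + real b *\<^sub>R v)))"
      by (rule ennreal_leI)
    also have "\<dots> = ?A"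
      by (subst sum_ennreal[symmetric]) (auto simp: case_prod_beta' ennreal_mult simp del: norm_mult)
    finally show ?thesis .
  qed
  have step: "ennreal (cmod (e i - e (Suc i))) \<le> ?B i" for i
  proof -
    let ?w = "(1/2) ^ Suc i *\<^sub>R u" and ?z = "(1/2) ^ Suc i *\<^sub>R v"
    have dbl: "(1/2) ^ i *\<^sub>R y = 2 *\<^sub>R (1/2) ^ Suc i *\<^sub>R y" for y :: "real ^ 'n" by simp
    have q: "shift_op (step_poly M) ?z g = (\<lambda>y. diff_op M (2 *\<^sub>R ?z) g y - diff_op M ?z g y)"
      by (rule ext) (rule shift_op_step_poly)
    have "e i - e (Suc i) = diff_op M (2 *\<^sub>R ?w) (diff_op M (2 *\<^sub>R ?z) g) x - diff_op M ?w (diff_op M ?z g) x"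
      unfolding e_def dbl ..
    also have "\<dots> = diff_op M (2 *\<^sub>R ?w) (shift_op (step_poly M) ?z g) x + shift_op (step_poly M) ?w (diff_op M ?z g) x"
      unfolding q shift_op_fdiff shift_op_step_poly[of M ?w "diff_op M ?z g"] by simp
    also have "diff_op M (2 *\<^sub>R ?w) (shift_op (step_poly M) ?z g) x = shift_op (step_poly M) ?z (diff_op M (2 *\<^sub>R ?w) g) x"
      by (rule shift_op_commute)
    finally have "cmod (e i - e (Suc i)) \<le> cmod (shift_op (step_poly M) ?z (diff_op M (2 *\<^sub>R ?w) g) x) + cmod (shift_op (step_poly M) ?w (diff_op M ?z g) x)"
      by (simp only: norm_triangle_ineq)
    then have "ennreal (cmod (e i - e (Suc i))) \<le> ennreal (cmod (shift_op (step_poly M) ?z (diff_op M (2 *\<^sub>R ?w) g) x) + cmod (shift_op (step_poly M) ?w (diff_op M ?z g) x))"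
      by (rule ennreal_leI)
    also have "\<dots> = ennreal (cmod (shift_op (step_poly M) ?z (diff_op M (2 *\<^sub>R ?w) g) x)) + ennreal (cmod (shift_op (step_poly M) ?w (diff_op M ?z g) x))"
      by (rule ennreal_plus) auto
    also have "\<dots> \<le> (\<Sum>l\<in>{1..2 * M}. ennreal (cmod (coeff (step_poly M) l)) * ennreal (cmod (diff_op M (2 *\<^sub>R ?w) g (x + real l *\<^sub>R ?z)))) +
      (\<Sum>l\<in>{1..2 * M}. ennreal (cmod (coeff (step_poly M) l)) * ennreal (cmod (diff_op M ?z g (x + real l *\<^sub>R ?w))))"
      by (intro add_mono shift_op_step_poly_le)
    also have "\<dots> = ?B i"
      unfolding dbl[symmetric]
      unfolding sum.distrib[symmetric] distrib_left[symmetric] scaleR_scaleR ..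
    finally show ?thesis .
  qed
  have lim: "e \<longlonglongrightarrow> 0"
  proof -
    have z: "(\<lambda>i. (1/2::real) ^ i) \<longlonglongrightarrow> 0" by (rule LIMSEQ_realpow_zero) auto
    have pt: "(\<lambda>i. x + real a *\<^sub>R (1/2) ^ i *\<^sub>R u + real b *\<^sub>R (1/2) ^ i *\<^sub>R v) \<longlonglongrightarrow> x + real a *\<^sub>R 0 *\<^sub>R u + real b *\<^sub>R 0 *\<^sub>R v" for a b
      by (intro tendsto_add tendsto_scaleR tendsto_const z)
    have gl: "(\<lambda>i. g (x + real a *\<^sub>R (1/2) ^ i *\<^sub>R u + real b *\<^sub>R (1/2) ^ i *\<^sub>R v)) \<longlonglongrightarrow> g (x + real a *\<^sub>R 0 *\<^sub>R u + real b *\<^sub>R 0 *\<^sub>R v)" for a b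
      by (rule isCont_tendsto_compose[OF _ pt]) (use g in \<open>auto simp: continuous_on_eq_continuous_at\<close>)
    have "(\<lambda>i. \<Sum>(a, b)\<in>{..M} \<times> {..M}. diff_coeff M a * diff_coeff M b * g (x + real a *\<^sub>R (1/2) ^ i *\<^sub>R u + real b *\<^sub>R (1/2) ^ i *\<^sub>R v))
      \<longlonglongrightarrow> (\<Sum>(a, b)\<in>{..M} \<times> {..M}. diff_coeff M a * diff_coeff M b * g (x + real a *\<^sub>R 0 *\<^sub>R u + real b *\<^sub>R 0 *\<^sub>R v))"
      unfolding case_prod_beta' by (intro tendsto_sum tendsto_mult tendsto_const gl)
    moreover have "(\<Sum>(a, b)\<in>{..M} \<times> {..M}. diff_coeff M a * diff_coeff M b * g (x + real a *\<^sub>R 0 *\<^sub>R u + real b *\<^sub>R 0 *\<^sub>R v)) = 0"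
    proof -
      have "(\<Sum>b\<le>M. diff_coeff M b) = poly ([:-1, 1::complex:] ^ M) 1"
        by (simp only: poly_altdef degree_diff_poly power_one mult_1_right)
      also have "\<dots> = 0" using M by (simp add: poly_power)
      finally have s: "(\<Sum>b\<le>M. diff_coeff M b) = 0" .
      have "(\<Sum>(a, b)\<in>{..M} \<times> {..M}. diff_coeff M a * diff_coeff M b * g (x + real a *\<^sub>R 0 *\<^sub>R u + real b *\<^sub>R 0 *\<^sub>R v))
        = (\<Sum>a\<le>M. \<Sum>b\<le>M. diff_coeff M a * g x * diff_coeff M b)"
        unfolding sum.cartesian_product[symmetric] by (simp add: mult_ac)
      also have "\<dots> = 0" unfolding sum_distrib_left[symmetric] s by simp
      finally show ?thesis .
    qed
    ultimately show ?thesis unfolding expand[abs_def] by simp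
  qed
  have fin: "ennreal (cmod (g x)) \<le> ?A + (\<Sum>i<N. ?B i) + ennreal (cmod (e N))" for N
  proof (induction N)
    case 0
    have "cmod (g x) \<le> cmod (g x - e 0) + cmod (e 0)"
      using norm_triangle_ineq[of "g x - e 0" "e 0"] by simp
    then have "ennreal (cmod (g x)) \<le> ennreal (cmod (g x - e 0)) + ennreal (cmod (e 0))"
      by (simp add: ennreal_leI flip: ennreal_plus)
    also have "\<dots> \<le> ?A + ennreal (cmod (e 0))" by (intro add_right_mono first)
    finally show ?case by simp
  next
    case (Suc N)
    have "cmod (e N) \<le> cmod (e N - e (Suc N)) + cmod (e (Suc N))"
      using norm_triangle_ineq[of "e N - e (Suc N)" "e (Suc N)"] by simp
    then have "ennreal (cmod (e N)) \<le> ennreal (cmod (e N - e (Suc N))) + ennreal (cmod (e (Suc N)))"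
      by (simp add: ennreal_leI flip: ennreal_plus)
    also have "\<dots> \<le> ?B N + ennreal (cmod (e (Suc N)))" by (intro add_right_mono step)
    finally have "?A + (\<Sum>i<N. ?B i) + ennreal (cmod (e N)) \<le> ?A + (\<Sum>i<N. ?B i) + (?B N + ennreal (cmod (e (Suc N))))"
      by (rule add_left_mono)
    also have "\<dots> = ?A + (\<Sum>i<Suc N. ?B i) + ennreal (cmod (e (Suc N)))"
      by (simp only: sum.lessThan_Suc add.assoc)
    finally show ?case by (rule order_trans[OF Suc])
  qed
  show ?thesis
  proof (rule ennreal_le_epsilon)
    fix \<eta> :: real assume "0 < \<eta>"
    then obtain N where N: "cmod (e N) < \<eta>" using LIMSEQ_D[OF lim, of \<eta>] by auto
    have "?A + (\<Sum>i<N. ?B i) + ennreal (cmod (e N)) \<le> ?A + (\<Sum>i. ?B i) + ennreal \<eta>"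
      using N by (intro add_mono order_refl sum_le_suminf ennreal_leI) auto
    then show "ennreal (cmod (g x)) \<le> ?A + (\<Sum>i. ?B i) + ennreal \<eta>" by (rule order_trans[OF fin])
  qed
qed

text \<open>The pointwise bound is averaged over the two displacements. Moving the lattice points over cubes of
  side about \<open>2\<^sup>-\<^sup>i \<delta>\<close> turns the sums over the lattice into integrals, and the factor \<open>2\<^sup>\<nu>\<^sup>i\<close>, with
  \<open>\<nu> = n / p\<close>, is the price of concentrating on cubes of that size.\<close>
lemma sampling:
  assumes p: "1 \<le> p" and M: "1 \<le> M"
  defines "\<nu> \<equiv> real CARD('n) * recip p"
  shows "\<exists>C>0. \<forall>(g :: real ^ 'n \<Rightarrow> complex) \<delta> a. continuous_on UNIV g \<longrightarrow> 0 < \<delta> \<longrightarrow>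
    Lnorm p (count_space UNIV) (\<lambda>k. ennreal (cmod (g (a + \<delta> *\<^sub>R ivec k)))) \<le>
      ennreal (C * \<delta> powr (- \<nu>)) * (Lp_norm p lborel g + (\<Sum>i. ennreal (2 powr (\<nu> * real i)) * modulus M p g (\<delta> * (1/2) ^ i)))"
  using p
proof (cases p rule: exponent_cases)
  case infinite
  have "Lnorm p (count_space UNIV) (\<lambda>k. ennreal (cmod (g (a + \<delta> *\<^sub>R ivec k)))) \<le>
      ennreal (1 * \<delta> powr (- \<nu>)) * (Lp_norm p lborel g + (\<Sum>i. ennreal (2 powr (\<nu> * real i)) * modulus M p g (\<delta> * (1/2) ^ i)))"
    if "continuous_on UNIV g" "0 < \<delta>" for g :: "real ^ 'n \<Rightarrow> complex" and \<delta> a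
  proof -
    have "Lnorm p (count_space UNIV) (\<lambda>k. ennreal (cmod (g (a + \<delta> *\<^sub>R ivec k)))) \<le> Lp_norm p lborel g"
      unfolding infinite by (subst Lnorm_infinity_le_iff) (auto simp: AE_count_space intro!: continuous_le_esssup that)
    also have "\<dots> \<le> Lp_norm p lborel g + (\<Sum>i. ennreal (2 powr (\<nu> * real i)) * modulus M p g (\<delta> * (1/2) ^ i))"
      by simp
    finally show ?thesis using that infinite by (simp add: \<nu>_def)
  qed
  then show ?thesis by (intro exI[of _ 1]) auto
next
  case (finite r)
  \<comment> \<open>Displacements of size \<open>\<delta> / E\<close> keep the moved cubes disjoint even after multiplication by \<open>M\<close>, and their
    Euclidean norm is at most \<open>\<delta>\<close>.\<close>
  define E where "E = 2 * real CARD('n) * (real M + 1)"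
  have E: "0 < E" by (simp add: E_def)
  define K0 where "K0 = (\<Sum>(a, b)\<in>base_pairs M. cmod (diff_coeff M a * diff_coeff M b))"
  define K1 where "K1 = (\<Sum>l\<in>{1..2 * M}. cmod (coeff (step_poly M) l)) * (2 * 2 powr \<nu>)"
  have K: "0 \<le> K0" "0 \<le> K1" unfolding K0_def K1_def by (auto intro!: sum_nonneg mult_nonneg_nonneg)
  have \<nu>: "0 \<le> \<nu>" using recip_bounds[OF p] by (simp add: \<nu>_def)
  define C where "C = (K0 + K1 + 1) * E powr \<nu>"
  have Cpos: "0 < C" using K E by (simp add: C_def)
  have "Lnorm p (count_space UNIV) (\<lambda>k. ennreal (cmod (g (x0 + \<delta> *\<^sub>R ivec k)))) \<le>
      ennreal (C * \<delta> powr (- \<nu>)) * (Lp_norm p lborel g + (\<Sum>i. ennreal (2 powr (\<nu> * real i)) * modulus M p g (\<delta> * (1/2) ^ i)))"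
    if g: "continuous_on UNIV g" and \<delta>: "0 < \<delta>" for g :: "real ^ 'n \<Rightarrow> complex" and \<delta> x0
  proof -
    define \<epsilon> where "\<epsilon> = \<delta> / E"
    have \<epsilon>: "0 < \<epsilon>" using \<delta> E by (simp add: \<epsilon>_def)
    have fit: "\<kappa> * \<epsilon> < \<delta>" if "\<kappa> \<le> real M" for \<kappa>
    proof -
      have "\<kappa> * \<epsilon> \<le> real M * \<epsilon>" using that \<epsilon> by (intro mult_right_mono) auto
      also have "\<dots> < E * \<epsilon>"
      proof (rule mult_strict_right_mono[OF _ \<epsilon>])
        have "1 \<le> real CARD('n)" by (simp add: Suc_leI)
        then have "1 * (real M + 1) \<le> real CARD('n) * (real M + 1)" by (intro mult_right_mono) auto
        then show "real M < E"
            using of_nat_0_le_iff[of M, where 'a=real] unfolding E_def mult_1_left mult.assoc by linarith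
      qed
      also have "\<dots> = \<delta>" using E by (simp add: \<epsilon>_def)
      finally show ?thesis .
    qed
    have small: "norm u \<le> \<delta>" if "u \<in> cube \<epsilon>" for u :: "real ^ 'n"
    proof -
      have "norm u \<le> (\<Sum>i\<in>UNIV. \<bar>u $ i\<bar>)" by (rule norm_le_l1_cart)
      also have "\<dots> \<le> (\<Sum>i\<in>(UNIV::'n set). \<epsilon>)" using that by (intro sum_mono) (auto simp: mem_cube)
      also have "\<dots> = real CARD('n) * \<epsilon>" by simp
      also have "\<dots> \<le> E * \<epsilon>"
      proof (rule mult_right_mono)
        have "real CARD('n) * 1 \<le> real CARD('n) * (2 * (real M + 1))" by (intro mult_left_mono) auto
        then show "real CARD('n) \<le> E" unfolding E_def by (simp only: mult_1_right mult.assoc mult.left_commute)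
      qed (use \<epsilon> in simp)
      also have "\<dots> = \<delta>" using E by (simp add: \<epsilon>_def)
      finally show ?thesis .
    qed
    have gm [measurable]: "g \<in> borel_measurable borel" by (rule borel_measurable_continuous_onI[OF g])
    let ?P = "triple_measure \<epsilon> :: ((real ^ 'n) \<times> (real ^ 'n) \<times> (int ^ 'n)) measure"
    let ?W = "\<lambda>i. modulus M p g (\<delta> * (1/2) ^ i)"
    define F where "F = (\<lambda>(u :: real ^ 'n, v :: real ^ 'n, k). ennreal (cmod (g (x0 + \<delta> *\<^sub>R ivec k))))"
    define GA where "GA = (\<lambda>(a, b) (u, v, k). ennreal (cmod (g (x0 + \<delta> *\<^sub>R ivec k + real a *\<^sub>R u + real b *\<^sub>R v))))"
    define G1 where "G1 i l = (\<lambda>(u, v, k). ennreal (cmod (diff_op M ((1/2) ^ i *\<^sub>R u) g (x0 + \<delta> *\<^sub>R ivec k + (real l * (1/2) ^ Suc i) *\<^sub>R v))))" for i l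
    define G2 where "G2 i l = (\<lambda>(u, v, k). ennreal (cmod (diff_op M ((1/2) ^ Suc i *\<^sub>R v) g (x0 + \<delta> *\<^sub>R ivec k + (real l * (1/2) ^ Suc i) *\<^sub>R u))))" for i l
    have mF [measurable]: "F \<in> borel_measurable ?P" unfolding F_def by (rule measurable_triple) measurable
    have mGA [measurable]: "GA ab \<in> borel_measurable ?P" for ab
      unfolding GA_def case_prod_beta[of _ ab] by (rule measurable_triple) measurable
    have mG1 [measurable]: "G1 i l \<in> borel_measurable ?P" for i l
      unfolding G1_def shift_op_def by (rule measurable_triple) measurable
    have mG2 [measurable]: "G2 i l \<in> borel_measurable ?P" for i l
      unfolding G2_def shift_op_def by (rule measurable_triple) measurable
    define e where "e = ennreal (\<epsilon> powr (- \<nu>))"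
    have bGA: "Lnorm p ?P (GA ab) \<le> e * Lp_norm p lborel g" if ab: "ab \<in> base_pairs M" for ab
    proof -
      obtain a b where [simp]: "ab = (a, b)" by (cases ab)
      have lea: "a \<le> M" "b \<le> M" and nz: "a \<noteq> 0 \<or> b \<noteq> 0" using ab by (auto simp: base_pairs_def)
      have pow: "ennreal ((\<kappa> * \<epsilon>) powr (- \<nu>)) * X \<le> e * X" if "1 \<le> \<kappa>" for \<kappa> X
      proof -
        have "1 * \<epsilon> \<le> \<kappa> * \<epsilon>" using that \<epsilon> by (intro mult_right_mono) auto
        then have "(\<kappa> * \<epsilon>) powr (- \<nu>) \<le> \<epsilon> powr (- \<nu>)" using \<nu> \<epsilon> by (intro powr_mono2') auto
        then show ?thesis unfolding e_def by (intro mult_right_mono ennreal_leI) auto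
      qed
      show ?thesis
      proof (cases "b = 0")
        case False
        have eq: "GA ab = (\<lambda>(u, v, k). ennreal (cmod ((\<lambda>_. g) u ((\<lambda>u. x0 + real a *\<^sub>R u) u + \<delta> *\<^sub>R ivec k + real b *\<^sub>R v))))"
          by (auto simp: GA_def add_ac)
        have "Lnorm p ?P (GA ab) \<le> ennreal ((real b * \<epsilon>) powr (- \<nu>)) * Lp_norm p lborel g"
          unfolding eq finite(1) \<nu>_def
        proof (rule triple_first[OF \<epsilon> finite(2)])
          show "(\<lambda>(u, v, k). ennreal (cmod ((\<lambda>_. g) u ((\<lambda>u. x0 + real a *\<^sub>R u) u + \<delta> *\<^sub>R ivec k + real b *\<^sub>R v)))) \<in> borel_measurable ?P"
            using mGA[of ab] unfolding eq .
          show "real b * \<epsilon> < \<delta>" using lea by (intro fit) auto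
        qed (use False gm in auto)
        also have "\<dots> \<le> e * Lp_norm p lborel g" by (rule pow) (use False in simp)
        finally show ?thesis .
      next
        case True
        have eq: "GA ab = (\<lambda>(u, v, k). ennreal (cmod ((\<lambda>_. g) v ((\<lambda>_. x0) v + \<delta> *\<^sub>R ivec k + real a *\<^sub>R u))))"
          using True by (auto simp: GA_def)
        have "Lnorm p ?P (GA ab) \<le> ennreal ((real a * \<epsilon>) powr (- \<nu>)) * Lp_norm p lborel g"
          unfolding eq finite(1) \<nu>_def
        proof (rule triple_second[OF \<epsilon> finite(2)])
          show "(\<lambda>(u, v, k). ennreal (cmod ((\<lambda>_. g) v ((\<lambda>_. x0) v + \<delta> *\<^sub>R ivec k + real a *\<^sub>R u)))) \<in> borel_measurable ?P"
            using mGA[of ab] unfolding eq .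
          show "real a * \<epsilon> < \<delta>" using lea by (intro fit) auto
        qed (use True nz gm in auto)
        also have "\<dots> \<le> e * Lp_norm p lborel g" by (rule pow) (use True nz in simp)
        finally show ?thesis .
      qed
    qed
    define h where "h i = ennreal (2 powr (\<nu> * (real i + 1)))" for i
    have powi: "ennreal ((real l * (1/2) ^ Suc i * \<epsilon>) powr (- \<nu>)) * X \<le> h i * e * X" if "1 \<le> l" for l i X
    proof -
      have "1 * ((1/2) ^ Suc i * \<epsilon>) \<le> real l * ((1/2) ^ Suc i * \<epsilon>)" using that \<epsilon> by (intro mult_right_mono) auto
      then have "(real l * ((1/2) ^ Suc i * \<epsilon>)) powr (- \<nu>) \<le> ((1/2) ^ Suc i * \<epsilon>) powr (- \<nu>)" using \<nu> \<epsilon> by (intro powr_mono2') auto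
      also have "\<dots> = ((1/2) ^ Suc i) powr (- \<nu>) * \<epsilon> powr (- \<nu>)" by (rule powr_mult)
      also have "((1/2::real) ^ Suc i) powr (- \<nu>) = 2 powr (\<nu> * (real i + 1))"
      proof -
        have e1: "2 powr (- real (Suc i)) = inverse (2 ^ Suc i :: real)"
          by (subst powr_minus, subst powr_realpow) auto
        have e2: "(1/2::real) ^ Suc i = 2 powr (- real (Suc i))"
          unfolding e1 by (simp only: power_one_over inverse_eq_divide)
        have "- real (Suc i) * - \<nu> = \<nu> * (real i + 1)" by (simp add: algebra_simps)
        then show ?thesis unfolding e2 powr_powr by (rule arg_cong)
      qed
      finally have "ennreal ((real l * (1/2) ^ Suc i * \<epsilon>) powr (- \<nu>)) \<le> h i * e"
        unfolding h_def e_def by (subst ennreal_mult[symmetric]) (auto simp: mult.assoc intro!: ennreal_leI)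
      then show ?thesis by (rule mult_right_mono) simp
    qed
    have fitl: "real l * (1/2) ^ Suc i * \<epsilon> < \<delta>" if "l \<le> 2 * M" for l i
    proof (rule fit)
      have "real l * (1/2) ^ Suc i \<le> real (2 * M) * (1/2)"
        using that power_decreasing[of 1 "Suc i" "1/2::real"] by (intro mult_mono) auto
      then show "real l * (1/2) ^ Suc i \<le> real M" by simp
    qed
    have mg: "diff_op M y g \<in> borel_measurable borel" for y by (rule shift_op_measurable[OF gm])
    have bG1: "Lnorm p ?P (G1 i l) \<le> h i * e * ?W i" if l: "1 \<le> l" "l \<le> 2 * M" for i l
    proof -
      have "Lnorm p ?P (G1 i l) \<le> ennreal ((real l * (1/2) ^ Suc i * \<epsilon>) powr (- \<nu>)) * ?W i"
        unfolding G1_def finite(1) \<nu>_def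
      proof (rule triple_first[where a="\<lambda>_. x0" and H="\<lambda>u. diff_op M ((1/2) ^ i *\<^sub>R u) g", OF \<epsilon> finite(2)])
        show "real l * (1/2) ^ Suc i * \<epsilon> < \<delta>" by (rule fitl) fact
        show "(\<lambda>(u, v, k). ennreal (cmod (diff_op M ((1/2) ^ i *\<^sub>R u) g (x0 + \<delta> *\<^sub>R ivec k + (real l * (1/2) ^ Suc i) *\<^sub>R v)))) \<in> borel_measurable ?P"
          using mG1[of i l] unfolding G1_def .
        fix u :: "real ^ 'n" assume u: "u \<in> cube \<epsilon>"
        show "Lp_norm (ennreal r) lborel (diff_op M ((1/2) ^ i *\<^sub>R u) g) \<le> modulus M (ennreal r) g (\<delta> * (1/2) ^ i)"
          using small[OF u] by (intro modulus_ge) (simp add: mult.commute[of \<delta>])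
      qed (use l mg in auto)
      also have "\<dots> \<le> h i * e * ?W i" by (rule powi) fact
      finally show ?thesis .
    qed
    have bG2: "Lnorm p ?P (G2 i l) \<le> h i * e * ?W i" if l: "1 \<le> l" "l \<le> 2 * M" for i l
    proof -
      have "Lnorm p ?P (G2 i l) \<le> ennreal ((real l * (1/2) ^ Suc i * \<epsilon>) powr (- \<nu>)) * ?W i"
        unfolding G2_def finite(1) \<nu>_def
      proof (rule triple_second[where a="\<lambda>_. x0" and H="\<lambda>v. diff_op M ((1/2) ^ Suc i *\<^sub>R v) g", OF \<epsilon> finite(2)])
        show "real l * (1/2) ^ Suc i * \<epsilon> < \<delta>" by (rule fitl) fact
        show "(\<lambda>(u, v, k). ennreal (cmod (diff_op M ((1/2) ^ Suc i *\<^sub>R v) g (x0 + \<delta> *\<^sub>R ivec k + (real l * (1/2) ^ Suc i) *\<^sub>R u)))) \<in> borel_measurable ?P"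
          using mG2[of i l] unfolding G2_def .
        fix v :: "real ^ 'n" assume v: "v \<in> cube \<epsilon>"
        have "norm ((1/2) ^ Suc i *\<^sub>R v) = (1/2) ^ Suc i * norm v" by simp
        also have "\<dots> \<le> (1/2) ^ i * \<delta>" using small[OF v] by (intro mult_mono power_decreasing) auto
        finally show "Lp_norm (ennreal r) lborel (diff_op M ((1/2) ^ Suc i *\<^sub>R v) g) \<le> modulus M (ennreal r) g (\<delta> * (1/2) ^ i)"
          by (intro modulus_ge) (simp only: mult.commute)
      qed (use l mg in auto)
      also have "\<dots> \<le> h i * e * ?W i" by (rule powi) fact
      finally show ?thesis .
    qed
    have "Lnorm p (count_space UNIV) (\<lambda>k. ennreal (cmod (g (x0 + \<delta> *\<^sub>R ivec k)))) \<le> Lnorm p ?P F"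
    proof (rule Lnorm_pair_ge[OF \<epsilon> p sigma_finite_unif_count[OF \<epsilon>] mF])
      fix u :: "real ^ 'n" assume u: "u \<in> cube \<epsilon>"
      have "(\<lambda>z. F (u, z)) \<in> borel_measurable ((unif \<epsilon> :: (real ^ 'n) measure) \<Otimes>\<^sub>M count_space UNIV)"
        by (rule measurable_compose[OF _ mF]) simp
      then show "Lnorm p (count_space UNIV) (\<lambda>k. ennreal (cmod (g (x0 + \<delta> *\<^sub>R ivec k)))) \<le>
          Lnorm p (unif \<epsilon> \<Otimes>\<^sub>M count_space UNIV) (\<lambda>z. F (u, z))"
        by (rule Lnorm_pair_ge[OF \<epsilon> p sigma_finite_count_vec]) (simp add: F_def)
    qed
    also have "\<dots> \<le> Lnorm p ?P (\<lambda>x. (\<Sum>ab\<in>base_pairs M. ennreal (cmod (diff_coeff M (fst ab) * diff_coeff M (snd ab))) * GA ab x) +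
        (\<Sum>i. \<Sum>l\<in>{1..2 * M}. ennreal (cmod (coeff (step_poly M) l)) * (G1 i l x + G2 i l x)))"
    proof (rule Lnorm_mono[OF p mF])
      fix x :: "(real ^ 'n) \<times> (real ^ 'n) \<times> (int ^ 'n)"
      obtain u v k where x: "x = (u, v, k)" by (cases x)
      show "F x \<le> (\<Sum>ab\<in>base_pairs M. ennreal (cmod (diff_coeff M (fst ab) * diff_coeff M (snd ab))) * GA ab x) +
        (\<Sum>i. \<Sum>l\<in>{1..2 * M}. ennreal (cmod (coeff (step_poly M) l)) * (G1 i l x + G2 i l x))"
        using sampling_pointwise[OF g M, of "x0 + \<delta> *\<^sub>R ivec k" u v]
        unfolding x F_def GA_def G1_def G2_def by (simp only: case_prod_beta' fst_conv snd_conv prod.case)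
    qed
    also have "\<dots> \<le> Lnorm p ?P (\<lambda>x. \<Sum>ab\<in>base_pairs M. ennreal (cmod (diff_coeff M (fst ab) * diff_coeff M (snd ab))) * GA ab x) +
        Lnorm p ?P (\<lambda>x. \<Sum>i. \<Sum>l\<in>{1..2 * M}. ennreal (cmod (coeff (step_poly M) l)) * (G1 i l x + G2 i l x))"
      by (intro Lnorm_add p) measurable
    also have "Lnorm p ?P (\<lambda>x. \<Sum>ab\<in>base_pairs M. ennreal (cmod (diff_coeff M (fst ab) * diff_coeff M (snd ab))) * GA ab x) \<le> ennreal K0 * (e * Lp_norm p lborel g)"
    proof -
      have "Lnorm p ?P (\<lambda>x. \<Sum>ab\<in>base_pairs M. ennreal (cmod (diff_coeff M (fst ab) * diff_coeff M (snd ab))) * GA ab x)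
        \<le> (\<Sum>ab\<in>base_pairs M. Lnorm p ?P (\<lambda>x. ennreal (cmod (diff_coeff M (fst ab) * diff_coeff M (snd ab))) * GA ab x))"
        by (intro Lnorm_sum p) (auto simp: base_pairs_def)
      also have "\<dots> \<le> (\<Sum>ab\<in>base_pairs M. ennreal (cmod (diff_coeff M (fst ab) * diff_coeff M (snd ab))) * (e * Lp_norm p lborel g))"
      proof (rule sum_mono)
        fix ab assume ab: "ab \<in> base_pairs M"
        show "Lnorm p ?P (\<lambda>x. ennreal (cmod (diff_coeff M (fst ab) * diff_coeff M (snd ab))) * GA ab x) \<le>
          ennreal (cmod (diff_coeff M (fst ab) * diff_coeff M (snd ab))) * (e * Lp_norm p lborel g)"
          by (rule order_trans[OF Lnorm_cmult_le[OF p mGA] mult_left_mono[OF bGA[OF ab]]]) simp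
      qed
      also have "\<dots> = ennreal K0 * (e * Lp_norm p lborel g)"
        unfolding K0_def by (simp add: sum_distrib_right[symmetric] sum_ennreal case_prod_beta')
      finally show ?thesis .
    qed
    also have "Lnorm p ?P (\<lambda>x. \<Sum>i. \<Sum>l\<in>{1..2 * M}. ennreal (cmod (coeff (step_poly M) l)) * (G1 i l x + G2 i l x))
       \<le> ennreal K1 * (e * (\<Sum>i. ennreal (2 powr (\<nu> * real i)) * ?W i))"
    proof -
      have i: "Lnorm p ?P (\<lambda>x. \<Sum>l\<in>{1..2 * M}. ennreal (cmod (coeff (step_poly M) l)) * (G1 i l x + G2 i l x)) \<le>
        ennreal K1 * (e * (ennreal (2 powr (\<nu> * real i)) * ?W i))" for i
      proof -
        have "Lnorm p ?P (\<lambda>x. \<Sum>l\<in>{1..2 * M}. ennreal (cmod (coeff (step_poly M) l)) * (G1 i l x + G2 i l x)) \<le>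
          (\<Sum>l\<in>{1..2 * M}. Lnorm p ?P (\<lambda>x. ennreal (cmod (coeff (step_poly M) l)) * (G1 i l x + G2 i l x)))"
          by (intro Lnorm_sum p) auto
        also have "\<dots> \<le> (\<Sum>l\<in>{1..2 * M}. ennreal (cmod (coeff (step_poly M) l)) * (h i * e * ?W i + h i * e * ?W i))"
        proof (rule sum_mono)
          fix l assume l: "l \<in> {1..2 * M}"
          have "Lnorm p ?P (\<lambda>x. ennreal (cmod (coeff (step_poly M) l)) * (G1 i l x + G2 i l x)) \<le>
            ennreal (cmod (coeff (step_poly M) l)) * Lnorm p ?P (\<lambda>x. G1 i l x + G2 i l x)"
            by (intro Lnorm_cmult_le p) measurable
          also have "\<dots> \<le> ennreal (cmod (coeff (step_poly M) l)) * (Lnorm p ?P (G1 i l) + Lnorm p ?P (G2 i l))"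
            by (intro mult_left_mono Lnorm_add p) auto
          also have "\<dots> \<le> ennreal (cmod (coeff (step_poly M) l)) * (h i * e * ?W i + h i * e * ?W i)"
            using l by (intro mult_left_mono add_mono bG1 bG2) auto
          finally show "Lnorm p ?P (\<lambda>x. ennreal (cmod (coeff (step_poly M) l)) * (G1 i l x + G2 i l x)) \<le> \<dots>" .
        qed
        also have "\<dots> = ennreal (\<Sum>l\<in>{1..2 * M}. cmod (coeff (step_poly M) l)) * (2 * h i * (e * ?W i))"
        proof -
          have "h i * e * ?W i + h i * e * ?W i = 2 * h i * (e * ?W i)"
            by (simp only: mult_2 distrib_right mult.assoc)
          then show ?thesis by (simp only: sum_distrib_right[symmetric]) (simp add: sum_ennreal)
        qed
        also have "2 * h i = ennreal (2 * 2 powr \<nu>) * ennreal (2 powr (\<nu> * real i))"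
        proof -
          have "ennreal (2 * 2 powr \<nu>) * ennreal (2 powr (\<nu> * real i)) = ennreal ((2 * 2 powr \<nu>) * 2 powr (\<nu> * real i))"
            by (rule ennreal_mult[symmetric]) auto
          also have "(2 * 2 powr \<nu>) * 2 powr (\<nu> * real i) = 2 * 2 powr (\<nu> * (real i + 1))"
            by (simp add: distrib_left powr_add)
          also have "ennreal (2 * 2 powr (\<nu> * (real i + 1))) = ennreal 2 * h i"
            unfolding h_def by (rule ennreal_mult) auto
          finally show ?thesis unfolding ennreal_numeral by (rule sym)
        qed
        also have "ennreal (\<Sum>l\<in>{1..2 * M}. cmod (coeff (step_poly M) l)) * (ennreal (2 * 2 powr \<nu>) * ennreal (2 powr (\<nu> * real i)) * (e * ?W i))
            = ennreal K1 * (e * (ennreal (2 powr (\<nu> * real i)) * ?W i))"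
        proof -
          have K1e: "ennreal K1 = ennreal (\<Sum>l\<in>{1..2 * M}. cmod (coeff (step_poly M) l)) * ennreal (2 * 2 powr \<nu>)"
            unfolding K1_def by (rule ennreal_mult) (auto intro: sum_nonneg)
          show ?thesis unfolding K1e by (simp only: mult.assoc mult.left_commute)
        qed
        finally show ?thesis .
      qed
      have "Lnorm p ?P (\<lambda>x. \<Sum>i. \<Sum>l\<in>{1..2 * M}. ennreal (cmod (coeff (step_poly M) l)) * (G1 i l x + G2 i l x))
        \<le> (\<Sum>i. Lnorm p ?P (\<lambda>x. \<Sum>l\<in>{1..2 * M}. ennreal (cmod (coeff (step_poly M) l)) * (G1 i l x + G2 i l x)))"
        by (intro Lnorm_suminf p) measurable
      also have "\<dots> \<le> (\<Sum>i. ennreal K1 * (e * (ennreal (2 powr (\<nu> * real i)) * ?W i)))"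
        by (intro suminf_le i) auto
      finally show ?thesis by simp
    qed
    also have "ennreal K0 * (e * Lp_norm p lborel g) + ennreal K1 * (e * (\<Sum>i. ennreal (2 powr (\<nu> * real i)) * ?W i))
       \<le> ennreal (K0 + K1 + 1) * (e * Lp_norm p lborel g) + ennreal (K0 + K1 + 1) * (e * (\<Sum>i. ennreal (2 powr (\<nu> * real i)) * ?W i))"
      using K by (intro add_mono mult_right_mono ennreal_leI) auto
    also have "\<dots> = ennreal (K0 + K1 + 1) * e * (Lp_norm p lborel g + (\<Sum>i. ennreal (2 powr (\<nu> * real i)) * ?W i))"
      by (simp only: distrib_left mult.assoc)
    also have "ennreal (K0 + K1 + 1) * e = ennreal (C * \<delta> powr (- \<nu>))"
    proof -
      have "\<epsilon> powr (- \<nu>) = E powr \<nu> * \<delta> powr (- \<nu>)"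
        unfolding \<epsilon>_def powr_divide powr_minus by (simp add: divide_inverse mult.commute)
      then show ?thesis using K unfolding e_def C_def by (subst ennreal_mult[symmetric]) (auto simp: mult.assoc)
    qed
    finally show ?thesis by (simp add: add_mono)
  qed
  with Cpos show ?thesis by blast
qed

section \<open>Discretising the Besov norm\<close>

text \<open>An upper set of reals is empty, everything, or a ray.\<close>
lemma up_set_borel:
  fixes S :: "real set"
  assumes up: "\<And>x y. x \<in> S \<Longrightarrow> x \<le> y \<Longrightarrow> y \<in> S"
  shows "S \<in> sets borel"
proof (cases "S = {} \<or> \<not> bdd_below S")
  case True
  have "S = UNIV" if nb: "\<not> bdd_below S"
  proof (intro equalityI subsetI)
    fix y
    obtain x where "x \<in> S" "x < y" using nb unfolding bdd_below_def by (meson not_le)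
    then show "y \<in> S" using up[of x y] by simp
  qed simp
  then show ?thesis using True by auto
next
  case False
  then have ne: "S \<noteq> {}" "bdd_below S" by auto
  have "{Inf S<..} \<subseteq> S"
  proof
    fix y assume "y \<in> {Inf S<..}"
    then obtain x where "x \<in> S" "x < y" using cInf_less_iff[OF ne] by auto
    then show "y \<in> S" using up[of x y] by simp
  qed
  moreover have "S \<subseteq> {Inf S..}" using ne by (auto intro: cInf_lower)
  moreover have e: "{Inf S..} = insert (Inf S) {Inf S<..}" by auto
  moreover have "A \<subseteq> S \<Longrightarrow> S \<subseteq> insert x A \<Longrightarrow> S = A \<or> S = insert x A" for A and x :: real by blast
  ultimately have "S = {Inf S<..} \<or> S = {Inf S..}" by metis
  then show ?thesis by (metis atLeast_borel greaterThan_borel)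
qed

lemma measurable_mono_ennreal:
  fixes W :: "real \<Rightarrow> ennreal"
  assumes "\<And>s t. s \<le> t \<Longrightarrow> W s \<le> W t"
  shows "W \<in> borel_measurable borel"
  by (rule borel_measurableI_greater) (auto intro!: up_set_borel intro: assms less_le_trans)

lemma ennreal_le_suminf: "f i \<le> (\<Sum>i. f i :: ennreal)"
  using sum_le_suminf[of f "{i}"] by simp

definition dyadic_interval :: "nat \<Rightarrow> real set" where
  "dyadic_interval i = {(1/2) ^ Suc i..<(1/2) ^ i}"

lemma dyadic_cover:
  assumes "0 < t" "t < (1::real)" shows "\<exists>i. t \<in> dyadic_interval i"
proof -
  define n where "n = (LEAST n. (1/2) ^ n \<le> t)"
  obtain n0 where "(1/2::real) ^ n0 < t" using real_arch_pow_inv[of t "1/2"] assms by auto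
  then have "(1/2::real) ^ n0 \<le> t" by simp
  then have n: "(1/2) ^ n \<le> t" unfolding n_def by (rule LeastI)
  then have "n \<noteq> 0" using assms by (intro notI) auto
  then obtain i where i: "n = Suc i" by (cases n) auto
  have "\<not> (1/2) ^ i \<le> t"
  proof
    assume "(1/2) ^ i \<le> t"
    then have "n \<le> i" unfolding n_def by (rule Least_le)
    then show False using i by simp
  qed
  then show ?thesis using n i unfolding dyadic_interval_def by (intro exI[of _ i]) auto
qed

lemma dyadic_interval_subset: "dyadic_interval i \<subseteq> {0<..<1}"
proof
  fix t assume t: "t \<in> dyadic_interval i"
  have "0 < (1/2::real) ^ Suc i" by simp
  moreover have "(1/2::real) ^ i \<le> 1" by (rule power_le_one) auto
  ultimately show "t \<in> {0<..<1}" using t unfolding dyadic_interval_def by auto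
qed

lemma disjoint_dyadic: "disjoint_family dyadic_interval"
proof -
  have "dyadic_interval i \<inter> dyadic_interval j = {}" if "i < j" for i j
  proof -
    have "(1/2::real) ^ j \<le> (1/2) ^ Suc i" using that by (intro power_decreasing) auto
    then show ?thesis unfolding dyadic_interval_def by auto
  qed
  then show ?thesis unfolding disjoint_family_on_def by (metis inf_commute linorder_neqE_nat)
qed

lemma half_power: "(1/2::real) ^ i = 2 powr (- real i)"
proof -
  have "2 powr (- real i) = inverse (2 ^ i :: real)" by (subst powr_minus, subst powr_realpow) auto
  then show ?thesis by (simp only: power_one_over inverse_eq_divide)
qed

lemma emeasure_dyadic_interval:
  assumes "1 \<le> r"
  shows "emeasure lborel (dyadic_interval i) = ennreal_powr (ennreal (2 powr (- (real i + 1) / r))) r"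
proof -
  have "emeasure lborel (dyadic_interval i) = ennreal ((1/2) ^ i - (1/2) ^ Suc i)"
    unfolding dyadic_interval_def by (subst emeasure_lborel_Ico) (auto simp: power_decreasing)
  also have "(1/2) ^ i - (1/2) ^ Suc i = (1/2::real) ^ Suc i" by simp
  also have "\<dots> = (2 powr (- (real i + 1) / r)) powr r"
  proof -
    have e: "- (real i + 1) / r * r = - real (Suc i)" using assms by simp
    show ?thesis unfolding half_power powr_powr e ..
  qed
  finally show ?thesis by (simp add: ennreal_powr_ennreal)
qed

lemma weight_upper:
  assumes "t \<in> dyadic_interval i" "0 \<le> a"
  shows "t powr (- a) \<le> 2 powr ((real i + 1) * a)"
proof -
  have "t powr (- a) \<le> ((1/2) ^ Suc i) powr (- a)"
    using assms by (intro powr_mono2') (auto simp: dyadic_interval_def)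
  also have "\<dots> = 2 powr ((real i + 1) * a)"
    unfolding half_power powr_powr by (simp add: algebra_simps)
  finally show ?thesis .
qed

lemma weight_lower:
  assumes "t \<in> dyadic_interval i" "0 \<le> a"
  shows "2 powr (real i * a) \<le> t powr (- a)"
proof -
  have "0 < t" using assms(1) dyadic_interval_subset by force
  then have "((1/2) ^ i) powr (- a) \<le> t powr (- a)"
    using assms by (intro powr_mono2') (auto simp: dyadic_interval_def)
  also have "((1/2::real) ^ i) powr (- a) = 2 powr (real i * a)"
    unfolding half_power powr_powr by simp
  finally show ?thesis .
qed

context
  fixes W :: "real \<Rightarrow> ennreal" and q :: ennreal and s :: real
  assumes W: "\<And>x y. x \<le> y \<Longrightarrow> W x \<le> W y" and q: "1 \<le> q" and s: "0 < s"
begin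

lemma measurable_weighted:
  "(\<lambda>t. ennreal (t powr (- s - recip q)) * W t) \<in> borel_measurable (restrict_space lborel {0<..<1})"
proof -
  have [measurable]: "W \<in> borel_measurable borel" by (rule measurable_mono_ennreal[OF W])
  have "(\<lambda>t. ennreal (t powr (- s - recip q)) * W t) \<in> borel_measurable lborel" by measurable
  then show ?thesis by (rule measurable_restrict_space1)
qed

text \<open>On the interval \<open>[2\<^sup>-\<^sup>i\<^sup>-\<^sup>1, 2\<^sup>-\<^sup>i)\<close> the monotone function \<open>W\<close> lies between its values at the end points, the
  weight is constant up to a factor, and the length of the interval accounts for \<open>t\<^sup>-\<^sup>1\<^sup>/\<^sup>q\<close>.\<close>
lemma integral_le_dyadic_sum:
  "Lnorm q (restrict_space lborel {0<..<1}) (\<lambda>t. ennreal (t powr (- s - recip q)) * W t)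
    \<le> ennreal (2 powr s) * Lnorm q (count_space UNIV) (\<lambda>i::nat. ennreal (2 powr (s * real i)) * W ((1/2) ^ i))"
  (is "Lnorm q ?M ?F \<le> ennreal (2 powr s) * Lnorm q _ ?a")
proof -
  have rq: "0 \<le> recip q" using recip_bounds[OF q] by simp
  have pw: "?F t \<le> ennreal (2 powr ((real i + 1) * (s + recip q))) * W ((1/2) ^ i)" if t: "t \<in> dyadic_interval i" for t i
  proof -
    have "t powr (- (s + recip q)) \<le> 2 powr ((real i + 1) * (s + recip q))" using s rq by (intro weight_upper t) auto
    moreover have "- (s + recip q) = - s - recip q" by simp
    ultimately show ?thesis
      using t by (intro mult_mono W ennreal_leI) (auto simp: dyadic_interval_def)
  qed
  from q show ?thesis
  proof (cases q rule: exponent_cases)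
    case infinite
    have "?F t \<le> ennreal (2 powr s) * Lnorm q (count_space UNIV) ?a" if "t \<in> {0<..<1}" for t
    proof -
      obtain i where i: "t \<in> dyadic_interval i" using dyadic_cover[of t] \<open>t \<in> {0<..<1}\<close> by auto
      have "?F t \<le> ennreal (2 powr ((real i + 1) * (s + recip q))) * W ((1/2) ^ i)" by (rule pw[OF i])
      also have "ennreal (2 powr ((real i + 1) * (s + recip q))) = ennreal (2 powr s) * ennreal (2 powr (s * real i))"
        unfolding infinite by (simp add: ennreal_mult[symmetric] powr_add[symmetric] algebra_simps)
      also have "ennreal (2 powr s) * ennreal (2 powr (s * real i)) * W ((1/2) ^ i) = ennreal (2 powr s) * ?a i" by (rule mult.assoc)
      also have "\<dots> \<le> ennreal (2 powr s) * Lnorm q (count_space UNIV) ?a"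
        by (intro mult_left_mono Lnorm_count_ge q) auto
      finally show ?thesis .
    qed
    then show ?thesis
      using measurable_weighted unfolding infinite
      by (subst Lnorm_infinity_le_iff) (auto simp: AE_restrict_space_iff)
  next
    case (finite r)
    let ?c = "\<lambda>i. ennreal_powr (ennreal (2 powr ((real i + 1) * (s + recip q))) * W ((1/2) ^ i)) r"
    have "(\<integral>\<^sup>+t. ennreal_powr (?F t) r \<partial>?M) = (\<integral>\<^sup>+t. ennreal_powr (?F t) r * indicator {0<..<1} t \<partial>lborel)"
      by (rule nn_integral_restrict_space) simp
    also have "\<dots> \<le> (\<integral>\<^sup>+t. (\<Sum>i. ?c i * indicator (dyadic_interval i) t) \<partial>lborel)"
    proof (rule nn_integral_mono)
      fix t
      show "ennreal_powr (?F t) r * indicator {0<..<1} t \<le> (\<Sum>i. ?c i * indicator (dyadic_interval i) t)"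
      proof (cases "t \<in> {0<..<1}")
        case True
        then obtain i where i: "t \<in> dyadic_interval i" using dyadic_cover[of t] by auto
        have "ennreal_powr (?F t) r * indicator {0<..<1} t \<le> ?c i * indicator (dyadic_interval i) t"
          using True i finite pw[OF i] by (auto intro!: ennreal_powr_mono)
        also have "\<dots> \<le> (\<Sum>i. ?c i * indicator (dyadic_interval i) t)"
          by (rule ennreal_le_suminf)
        finally show ?thesis .
      qed simp
    qed
    also have "\<dots> = (\<Sum>i. ?c i * emeasure lborel (dyadic_interval i))"
      by (subst nn_integral_suminf) (auto simp: nn_integral_cmult_indicator dyadic_interval_def)
    also have "(\<lambda>i. ?c i * emeasure lborel (dyadic_interval i)) = (\<lambda>i. ennreal_powr (ennreal (2 powr s)) r * ennreal_powr (?a i) r)"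
    proof
      fix i
      have r: "0 < r" using finite by simp
      have "2 powr ((real i + 1) * (s + recip q)) * 2 powr (- (real i + 1) / r) = 2 powr s * 2 powr (s * real i)"
      proof -
        have "(real i + 1) * (s + recip q) + - (real i + 1) / r = s + s * real i"
          using finite by (simp add: recip_finite field_simps)
        then show ?thesis unfolding powr_add[symmetric] by (rule arg_cong)
      qed
      then have e: "ennreal (2 powr ((real i + 1) * (s + recip q))) * ennreal (2 powr (- (real i + 1) / r)) = ennreal (2 powr s) * ennreal (2 powr (s * real i))"
        by (simp add: ennreal_mult[symmetric])
      have "?c i * emeasure lborel (dyadic_interval i) =
          ennreal_powr ((ennreal (2 powr ((real i + 1) * (s + recip q))) * ennreal (2 powr (- (real i + 1) / r))) * W ((1/2) ^ i)) r"
        unfolding emeasure_dyadic_interval[OF finite(2)] ennreal_powr_mult[OF r, symmetric] by (simp only: mult_ac)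
      also have "\<dots> = ennreal_powr (ennreal (2 powr s) * ?a i) r" unfolding e by (simp only: mult.assoc)
      finally show "?c i * emeasure lborel (dyadic_interval i) = ennreal_powr (ennreal (2 powr s)) r * ennreal_powr (?a i) r"
        unfolding ennreal_powr_mult[OF r] .
    qed
    also have "(\<Sum>i. ennreal_powr (ennreal (2 powr s)) r * ennreal_powr (?a i) r) = (\<integral>\<^sup>+i. ennreal_powr (ennreal (2 powr s) * ?a i) r \<partial>count_space UNIV)"
      using finite by (simp add: nn_integral_count_space_nat ennreal_powr_mult)
    finally have "Lnorm q ?M ?F \<le> Lnorm q (count_space UNIV) (\<lambda>i. ennreal (2 powr s) * ?a i)"
      using finite by (auto simp: Lnorm_finite intro!: ennreal_powr_mono)
    also have "\<dots> \<le> ennreal (2 powr s) * Lnorm q (count_space UNIV) ?a" by (intro Lnorm_cmult_le q) simp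
    finally show ?thesis .
  qed
qed

lemma dyadic_sum_le_integral:
  "Lnorm q (count_space UNIV) (\<lambda>i::nat. ennreal (2 powr (s * real (Suc i))) * W ((1/2) ^ Suc i))
    \<le> ennreal (2 powr (s + recip q)) * Lnorm q (restrict_space lborel {0<..<1}) (\<lambda>t. ennreal (t powr (- s - recip q)) * W t)"
  (is "Lnorm q _ ?a \<le> _ * Lnorm q ?M ?F")
proof -
  have rq: "0 \<le> recip q" using recip_bounds[OF q] by simp
  have pw: "ennreal (2 powr (real i * (s + recip q))) * W ((1/2) ^ Suc i) \<le> ?F t" if t: "t \<in> dyadic_interval i" for t i
  proof -
    have "2 powr (real i * (s + recip q)) \<le> t powr (- (s + recip q))" using s rq by (intro weight_lower t) auto
    moreover have "- (s + recip q) = - s - recip q" by simp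
    ultimately show ?thesis
      using t by (intro mult_mono W ennreal_leI) (auto simp: dyadic_interval_def)
  qed
  from q show ?thesis
  proof (cases q rule: exponent_cases)
    case infinite
    have "?a i \<le> ennreal (2 powr (s + recip q)) * Lnorm q ?M ?F" for i
    proof -
      have "AE t in lborel. t \<in> {0<..<1} \<longrightarrow> ?F t \<le> Lnorm q ?M ?F"
        using esssup_AE[of ?F ?M] unfolding infinite Lnorm_infinity by (subst (asm) AE_restrict_space_iff) auto
      then have ae: "AE t in lborel. t \<in> dyadic_interval i \<longrightarrow> ?F t \<le> Lnorm q ?M ?F"
        by eventually_elim (use dyadic_interval_subset in blast)
      have "\<exists>t\<in>dyadic_interval i. ?F t \<le> Lnorm q ?M ?F"
      proof (rule ccontr)
        assume "\<not> ?thesis"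
        with ae have "AE t in lborel. t \<notin> dyadic_interval i" by (auto elim: eventually_mono)
        then have "emeasure lborel (dyadic_interval i) = 0"
          by (subst (asm) AE_iff_null_sets[symmetric]) (auto simp: dyadic_interval_def)
        then show False unfolding emeasure_dyadic_interval[OF order_refl] by simp
      qed
      then obtain t where t: "t \<in> dyadic_interval i" "?F t \<le> Lnorm q ?M ?F" by blast
      have "?a i = ennreal (2 powr (s + recip q)) * (ennreal (2 powr (real i * (s + recip q))) * W ((1/2) ^ Suc i))"
        unfolding infinite by (simp add: mult.assoc[symmetric] ennreal_mult[symmetric] powr_add[symmetric] algebra_simps)
      also have "\<dots> \<le> ennreal (2 powr (s + recip q)) * Lnorm q ?M ?F"
        by (intro mult_left_mono order_trans[OF pw[OF t(1)] t(2)]) simp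
      finally show ?thesis .
    qed
    then show ?thesis unfolding infinite by (subst Lnorm_infinity_le_iff) (auto simp: AE_count_space)
  next
    case (finite r)
    have r: "0 < r" using finite by simp
    let ?c = "\<lambda>i. ennreal_powr (ennreal (2 powr (real i * (s + recip q))) * W ((1/2) ^ Suc i)) r"
    have term_eq: "ennreal_powr (?a i) r = ennreal_powr (ennreal (2 powr (s + recip q))) r * (?c i * emeasure lborel (dyadic_interval i))" for i
    proof -
      have "2 powr (s + recip q) * (2 powr (real i * (s + recip q)) * 2 powr (- (real i + 1) / r)) = 2 powr (s * real (Suc i))"
      proof -
        have "s + recip q + (real i * (s + recip q) + - (real i + 1) / r) = s * real (Suc i)"
          using finite by (simp add: recip_finite field_simps)
        then show ?thesis unfolding powr_add[symmetric] by (rule arg_cong)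
      qed
      then have e: "ennreal (2 powr (s + recip q)) * (ennreal (2 powr (real i * (s + recip q))) * ennreal (2 powr (- (real i + 1) / r))) = ennreal (2 powr (s * real (Suc i)))"
        by (simp add: ennreal_mult[symmetric])
      show ?thesis
        unfolding emeasure_dyadic_interval[OF finite(2)] ennreal_powr_mult[OF r, symmetric] e[symmetric] by (simp only: mult_ac)
    qed
    have mF: "(\<lambda>t. ennreal_powr (?F t) r * indicator {0<..<1} t) \<in> borel_measurable lborel"
    proof -
      have [measurable]: "W \<in> borel_measurable borel" by (rule measurable_mono_ennreal[OF W])
      show ?thesis by measurable
    qed
    have "(\<Sum>i. ?c i * emeasure lborel (dyadic_interval i)) = (\<integral>\<^sup>+t. (\<Sum>i. ?c i * indicator (dyadic_interval i) t) \<partial>lborel)"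
      by (subst nn_integral_suminf) (auto simp: nn_integral_cmult_indicator dyadic_interval_def)
    also have "\<dots> \<le> (\<integral>\<^sup>+t. ennreal_powr (?F t) r * indicator {0<..<1} t \<partial>lborel)"
    proof (rule nn_integral_mono)
      fix t
      have "(\<Sum>i. ?c i * indicator (dyadic_interval i) t) \<le> (\<Sum>i. ennreal_powr (?F t) r * indicator (dyadic_interval i) t)"
        using pw finite by (intro suminf_le) (auto split: split_indicator intro!: ennreal_powr_mono)
      also have "\<dots> = ennreal_powr (?F t) r * indicator (\<Union>i. dyadic_interval i) t"
        by (simp add: suminf_indicator[OF disjoint_dyadic])
      also have "\<dots> \<le> ennreal_powr (?F t) r * indicator {0<..<1} t"
      proof (cases "t \<in> (\<Union>i. dyadic_interval i)")
        case True
        then have "t \<in> {0<..<1}" using dyadic_interval_subset by blast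
        then show ?thesis using True by simp
      qed simp
      finally show "(\<Sum>i. ?c i * indicator (dyadic_interval i) t) \<le> \<dots>" .
    qed
    also have "\<dots> = (\<integral>\<^sup>+t. ennreal_powr (?F t) r \<partial>?M)"
      by (rule nn_integral_restrict_space[symmetric]) simp
    finally have "(\<integral>\<^sup>+i. ennreal_powr (?a i) r \<partial>count_space UNIV) \<le> ennreal_powr (ennreal (2 powr (s + recip q))) r * (\<integral>\<^sup>+t. ennreal_powr (?F t) r \<partial>?M)"
      unfolding nn_integral_count_space_nat term_eq by (simp add: mult_left_mono)
    then have "Lnorm q (count_space UNIV) ?a \<le> ennreal_powr (ennreal_powr (ennreal (2 powr (s + recip q))) r * (\<integral>\<^sup>+t. ennreal_powr (?F t) r \<partial>?M)) (1/r)"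
      using finite by (auto simp: Lnorm_finite intro!: ennreal_powr_mono)
    also have "\<dots> = ennreal (2 powr (s + recip q)) * Lnorm q ?M ?F"
      using finite by (simp add: ennreal_powr_mult ennreal_powr_powr Lnorm_finite)
    finally show ?thesis .
  qed
qed

end

text \<open>The sequence \<open>2\<^sup>s\<^sup>i \<omega>\<^sup>m\<^sub>p(f; 2\<^sup>-\<^sup>i)\<close> whose \<open>\<ell>\<^sup>q\<close> norm replaces the integral over \<open>t\<close>.\<close>
definition mod_seq :: "nat \<Rightarrow> real \<Rightarrow> ennreal \<Rightarrow> (real ^ 'n \<Rightarrow> complex) \<Rightarrow> int \<Rightarrow> ennreal" where
  "mod_seq m s p f i = ennreal (2 powr (s * of_int i)) * modulus m p f (2 powr (- of_int i))"

lemma mod_seq_nat: "mod_seq m s p f (int i) = ennreal (2 powr (s * real i)) * modulus m p f ((1/2) ^ i)"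
  by (simp add: mod_seq_def half_power)

lemma besov_expr_le_mod_seq:
  assumes "1 \<le> q" "0 < s"
  shows "besov_expr m s p q f \<le> Lp_norm p lborel f + ennreal (2 powr s) * Lnorm q (count_space {0..}) (mod_seq m s p f)"
proof -
  have "Lnorm q (restrict_space lborel {0<..<1}) (\<lambda>t. ennreal (t powr (- s - recip q)) * modulus m p f t)
    \<le> ennreal (2 powr s) * Lnorm q (count_space UNIV) (\<lambda>i. mod_seq m s p f (int i))"
    unfolding mod_seq_nat by (intro integral_le_dyadic_sum modulus_mono assms)
  also have "\<dots> \<le> ennreal (2 powr s) * Lnorm q (count_space {0..}) (mod_seq m s p f)"
    using assms by (intro mult_left_mono Lnorm_count_inj_le) (auto simp: inj_on_def)
  finally show ?thesis unfolding besov_expr_def by (intro add_left_mono)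
qed

lemma Lnorm_point:
  assumes "1 \<le> q" shows "Lnorm q (count_space UNIV) (\<lambda>i. X * indicator {c} i) \<le> X"
  using assms
proof (cases q rule: exponent_cases)
  case infinite
  then show ?thesis by (auto simp: Lnorm_infinity_le_iff AE_count_space split: split_indicator)
next
  case (finite r)
  have "(\<integral>\<^sup>+i. ennreal_powr (X * indicator {c} i) r \<partial>count_space UNIV) = (\<integral>\<^sup>+i. ennreal_powr X r * indicator {c} i \<partial>count_space UNIV)"
    by (intro nn_integral_cong) (auto split: split_indicator)
  also have "\<dots> = ennreal_powr X r" by (subst nn_integral_cmult_indicator) auto
  finally show ?thesis using finite by (simp add: Lnorm_finite_le_iff)
qed

text \<open>For \<open>i \<ge> 1\<close> this is the comparison with the integral; the finitely many terms with \<open>i\<^sub>0 \<le> i \<le> 0\<close> are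
  bounded by the \<open>L\<^sup>p\<close> norm.\<close>
lemma mod_seq_le_besov_expr:
  assumes p: "1 \<le> p" and q: "1 \<le> q" and s: "0 < s" and i0: "i0 \<le> (0::int)"
  shows "\<exists>C>0. \<forall>f :: real ^ 'n \<Rightarrow> complex. f \<in> borel_measurable borel \<longrightarrow>
    Lnorm q (count_space {i0..}) (mod_seq m s p f) \<le> ennreal C * besov_expr m s p q f"
proof -
  define K where "K = coeff_sum ([:-1, 1:] ^ m)"
  have K: "0 \<le> K" unfolding K_def by (rule coeff_sum_nonneg)
  define C where "C = real (card {i0..0}) * K + 2 powr (s + recip q)"
  have C: "0 < C" unfolding C_def using K by (intro add_nonneg_pos) auto
  have "Lnorm q (count_space {i0..}) (mod_seq m s p f) \<le> ennreal C * besov_expr m s p q f"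
    if f: "f \<in> borel_measurable borel" for f :: "real ^ 'n \<Rightarrow> complex"
  proof -
    let ?I = "Lnorm q (restrict_space lborel {0<..<1}) (\<lambda>t. ennreal (t powr (- s - recip q)) * modulus m p f t)"
    have low: "mod_seq m s p f i \<le> ennreal K * Lp_norm p lborel f" if "i \<le> 0" for i
    proof -
      have "2 powr (s * of_int i) \<le> 2 powr 0" using that s by (intro powr_mono) (auto simp: mult_nonneg_nonpos)
      then have "mod_seq m s p f i \<le> 1 * modulus m p f (2 powr (- of_int i))"
        unfolding mod_seq_def by (intro mult_right_mono) auto
      also have "\<dots> \<le> ennreal K * Lp_norm p lborel f" unfolding K_def using modulus_le_norm[OF p f] by simp
      finally show ?thesis .
    qed
    have "Lnorm q (count_space {i0..}) (mod_seq m s p f) = Lnorm q (count_space UNIV) (\<lambda>i. mod_seq m s p f i * indicator {i0..} i)"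
      by (rule Lnorm_count_indicator[OF q])
    also have "\<dots> \<le> Lnorm q (count_space UNIV) (\<lambda>i. mod_seq m s p f i * indicator {1..} i + (\<Sum>c\<in>{i0..0}. (ennreal K * Lp_norm p lborel f) * indicator {c} i))"
    proof (rule Lnorm_mono[OF q])
      fix i
      show "mod_seq m s p f i * indicator {i0..} i \<le> mod_seq m s p f i * indicator {1..} i + (\<Sum>c\<in>{i0..0}. (ennreal K * Lp_norm p lborel f) * indicator {c} i)"
      proof (cases "i \<in> {i0..0}")
        case True
        then have "(ennreal K * Lp_norm p lborel f) * indicator {i} i \<le> (\<Sum>c\<in>{i0..0}. (ennreal K * Lp_norm p lborel f) * indicator {c} i)"
          by (intro member_le_sum) auto
        with low[of i] True have "mod_seq m s p f i \<le> (\<Sum>c\<in>{i0..0}. (ennreal K * Lp_norm p lborel f) * indicator {c} i)" by auto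
        then show ?thesis using True by simp
      qed (auto split: split_indicator)
    qed simp
    also have "\<dots> \<le> Lnorm q (count_space UNIV) (\<lambda>i. mod_seq m s p f i * indicator {1..} i) + Lnorm q (count_space UNIV) (\<lambda>i. \<Sum>c\<in>{i0..0}. (ennreal K * Lp_norm p lborel f) * indicator {c} i)"
      by (intro Lnorm_add q) auto
    also have "Lnorm q (count_space UNIV) (\<lambda>i. \<Sum>c\<in>{i0..0}. (ennreal K * Lp_norm p lborel f) * indicator {c} i) \<le> (\<Sum>c\<in>{i0..0}. ennreal K * Lp_norm p lborel f)"
      by (rule order_trans[OF Lnorm_sum[OF q] sum_mono]) (auto intro: Lnorm_point q)
    also have "\<dots> = ennreal (real (card {i0..0}) * K) * Lp_norm p lborel f"
      using K by (simp add: ennreal_mult mult.assoc ennreal_of_nat_eq_real_of_nat)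
    also have "Lnorm q (count_space UNIV) (\<lambda>i. mod_seq m s p f i * indicator {1..} i) = Lnorm q (count_space {1..}) (mod_seq m s p f)"
      by (rule Lnorm_count_indicator[OF q, symmetric])
    also have "\<dots> \<le> Lnorm q (count_space UNIV) (\<lambda>i. mod_seq m s p f (int (Suc i)))"
    proof -
      have "Lnorm q (count_space {1..}) (\<lambda>i. (\<lambda>n. mod_seq m s p f (int (Suc n))) (nat (i - 1))) \<le> Lnorm q (count_space UNIV) (\<lambda>n. mod_seq m s p f (int (Suc n)))"
        by (rule Lnorm_count_inj_le[OF q]) (auto simp: inj_on_def)
      moreover have "Lnorm q (count_space {1..}) (\<lambda>i. (\<lambda>n. mod_seq m s p f (int (Suc n))) (nat (i - 1))) = Lnorm q (count_space {1..}) (mod_seq m s p f)"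
        by (rule Lnorm_cong[OF _ q]) auto
      ultimately show ?thesis by simp
    qed
    also have "\<dots> \<le> ennreal (2 powr (s + recip q)) * ?I"
      unfolding mod_seq_nat by (intro dyadic_sum_le_integral modulus_mono q s)
    finally have "Lnorm q (count_space {i0..}) (mod_seq m s p f) \<le> ennreal (2 powr (s + recip q)) * ?I + ennreal (real (card {i0..0}) * K) * Lp_norm p lborel f"
      by (simp add: add_mono)
    also have "\<dots> \<le> ennreal C * ?I + ennreal C * Lp_norm p lborel f"
      unfolding C_def using K by (intro add_mono mult_right_mono ennreal_leI) auto
    also have "\<dots> = ennreal C * besov_expr m s p q f"
      unfolding besov_expr_def by (simp add: distrib_left add.commute)
    finally show ?thesis .
  qed
  with C show ?thesis by blast
qed

text \<open>Marchaud's inequality in sequence form is \<open>a\<^sub>i \<le> \<theta> a\<^sub>i\<^sub>-\<^sub>1 + C b\<^sub>i\<close> with \<open>\<theta> = 2\<^sup>s\<^sup>-\<^sup>m < 1\<close>. Unrolled, it bounds \<open>a\<close>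
  by a convolution of \<open>b\<close> with a geometric sequence.\<close>
lemma mod_seq_lower_order:
  assumes p: "1 \<le> p" and q: "1 \<le> q" and s: "s < real m" "0 < s"
  shows "\<exists>C>0. \<forall>f :: real ^ 'n \<Rightarrow> complex. f \<in> borel_measurable borel \<longrightarrow>
    Lnorm q (count_space {i0..}) (mod_seq m s p f) \<le>
      ennreal C * (Lp_norm p lborel f + Lnorm q (count_space {i0..}) (mod_seq (Suc m) s p f))"
proof -
  obtain C1 where C1: "0 \<le> C1" "\<And>(f :: real ^ 'n \<Rightarrow> complex) t. f \<in> borel_measurable borel \<Longrightarrow>
    modulus m p f t \<le> ennreal (2 powr (- real m)) * modulus m p f (2 * t) + ennreal C1 * modulus (Suc m) p f t"
    using modulus_marchaud[of m thesis] p by blast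
  define \<gamma> where "\<gamma> = real m - s"
  have \<gamma>: "0 < \<gamma>" using s by (simp add: \<gamma>_def)
  obtain C2 where C2: "0 < C2" "\<And>b. Lnorm q (count_space UNIV) (\<lambda>i. \<integral>\<^sup>+j. geom_kernel \<gamma> (i - j) * b j \<partial>count_space UNIV)
      \<le> ennreal C2 * Lnorm q (count_space (UNIV::int set)) b"
    using geom_convolution[OF \<gamma>, of thesis] q by blast
  define K where "K = coeff_sum ([:-1, 1:] ^ m) * 2 powr (s * of_int i0)"
  have K: "0 \<le> K" unfolding K_def using coeff_sum_nonneg by simp
  define C where "C = C2 * (C1 + K + 1)"
  have C: "0 < C" unfolding C_def using C1 C2 K by simp
  have "Lnorm q (count_space {i0..}) (mod_seq m s p f) \<le>
      ennreal C * (Lp_norm p lborel f + Lnorm q (count_space {i0..}) (mod_seq (Suc m) s p f))"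
    if f: "f \<in> borel_measurable borel" for f :: "real ^ 'n \<Rightarrow> complex"
  proof -
    let ?a = "mod_seq m s p f" and ?b = "mod_seq (Suc m) s p f"
    define B where "B j = ennreal C1 * (?b j * indicator {i0..} j) + (ennreal K * Lp_norm p lborel f) * indicator {i0} j" for j
    have g0: "geom_kernel \<gamma> 0 = 1" by (simp add: geom_kernel_def)
    have base: "?a i0 \<le> ennreal K * Lp_norm p lborel f"
    proof -
      have "?a i0 \<le> ennreal (2 powr (s * of_int i0)) * (ennreal (coeff_sum ([:-1, 1:] ^ m)) * Lp_norm p lborel f)"
        unfolding mod_seq_def by (intro mult_left_mono modulus_le_norm p f) simp
      then show ?thesis unfolding K_def
        using coeff_sum_nonneg by (simp add: ennreal_mult mult_ac)
    qed
    have rec: "?a (i + 1) \<le> ennreal (2 powr (- \<gamma>)) * ?a i + ennreal C1 * ?b (i + 1)" for i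
    proof -
      have t: "2 * 2 powr (- of_int (i + 1)) = (2 powr (- of_int i) :: real)"
      proof -
        have "2 * 2 powr (- of_int (i + 1)) = (2 powr 1 * 2 powr (- of_int (i + 1)) :: real)" by simp
        also have "\<dots> = 2 powr (- of_int i)" unfolding powr_add[symmetric] by simp
        finally show ?thesis .
      qed
      have w: "2 powr (s * of_int (i + 1)) * 2 powr (- real m) = 2 powr (- \<gamma>) * 2 powr (s * of_int i)"
        unfolding powr_add[symmetric] by (simp add: \<gamma>_def algebra_simps)
      have "?a (i + 1) \<le> ennreal (2 powr (s * of_int (i + 1))) * (ennreal (2 powr (- real m)) * modulus m p f (2 powr (- of_int i)) + ennreal C1 * modulus (Suc m) p f (2 powr (- of_int (i + 1))))"
        unfolding mod_seq_def using C1(2)[OF f, of "2 powr (- of_int (i + 1))"] unfolding t by (intro mult_left_mono) auto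
      also have "\<dots> = (ennreal (2 powr (s * of_int (i + 1))) * ennreal (2 powr (- real m))) * modulus m p f (2 powr (- of_int i)) + ennreal C1 * ?b (i + 1)"
        unfolding mod_seq_def by (simp only: distrib_left mult_ac)
      also have "ennreal (2 powr (s * of_int (i + 1))) * ennreal (2 powr (- real m)) = ennreal (2 powr (- \<gamma>)) * ennreal (2 powr (s * of_int i))"
        using w by (simp add: ennreal_mult[symmetric])
      finally show ?thesis unfolding mod_seq_def by (simp only: mult.assoc)
    qed
    have step: "?a i \<le> (\<Sum>j\<in>{i0..i}. geom_kernel \<gamma> (i - j) * B j)" if "i0 \<le> i" for i
      using that
    proof (induction i rule: int_ge_induct)
      case base
      then show ?case using \<open>?a i0 \<le> _\<close> by (simp add: g0 B_def add_increasing)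
    next
      case (step i)
      have "?a (i + 1) \<le> ennreal (2 powr (- \<gamma>)) * (\<Sum>j\<in>{i0..i}. geom_kernel \<gamma> (i - j) * B j) + B (i + 1)"
      proof (rule order_trans[OF rec], intro add_mono mult_left_mono step.IH)
        show "ennreal C1 * ?b (i + 1) \<le> B (i + 1)" using step by (simp add: B_def)
      qed simp
      also have "ennreal (2 powr (- \<gamma>)) * (\<Sum>j\<in>{i0..i}. geom_kernel \<gamma> (i - j) * B j) = (\<Sum>j\<in>{i0..i}. geom_kernel \<gamma> (i + 1 - j) * B j)"
        unfolding sum_distrib_left
      proof (intro sum.cong refl)
        fix j assume j: "j \<in> {i0..i}"
        have "2 powr (- \<gamma>) * 2 powr (- \<gamma> * \<bar>of_int (i - j)\<bar>) = 2 powr (- \<gamma> * \<bar>of_int (i + 1 - j)\<bar>)"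
          unfolding powr_add[symmetric] using j by (simp add: algebra_simps)
        then have "ennreal (2 powr (- \<gamma>)) * geom_kernel \<gamma> (i - j) = geom_kernel \<gamma> (i + 1 - j)"
          unfolding geom_kernel_def by (simp only: ennreal_mult[symmetric] powr_ge_zero)
        then show "ennreal (2 powr (- \<gamma>)) * (geom_kernel \<gamma> (i - j) * B j) = geom_kernel \<gamma> (i + 1 - j) * B j"
          by (simp only: mult.assoc[symmetric])
      qed
      also have "(\<Sum>j\<in>{i0..i}. geom_kernel \<gamma> (i + 1 - j) * B j) + B (i + 1) = (\<Sum>j\<in>{i0..i + 1}. geom_kernel \<gamma> (i + 1 - j) * B j)"
      proof -
        have "{i0..i + 1} = insert (i + 1) {i0..i}" using step by auto
        then show ?thesis by (simp add: g0 add.commute)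
      qed
      finally show ?case .
    qed
    have conv: "?a i * indicator {i0..} i \<le> (\<integral>\<^sup>+j. geom_kernel \<gamma> (i - j) * B j \<partial>count_space UNIV)" for i
    proof (cases "i0 \<le> i")
      case True
      have "(\<Sum>j\<in>{i0..i}. geom_kernel \<gamma> (i - j) * B j) = (\<integral>\<^sup>+j. geom_kernel \<gamma> (i - j) * B j \<partial>count_space {i0..i})"
        by (simp add: nn_integral_count_space_finite)
      also have "\<dots> = (\<integral>\<^sup>+j. geom_kernel \<gamma> (i - j) * B j * indicator {i0..i} j \<partial>count_space UNIV)"
        by (subst nn_integral_count_space_indicator) auto
      also have "\<dots> \<le> (\<integral>\<^sup>+j. geom_kernel \<gamma> (i - j) * B j \<partial>count_space UNIV)"
        by (intro nn_integral_mono) (auto split: split_indicator)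
      finally show ?thesis using step[OF True] True by simp
    qed simp
    have "Lnorm q (count_space {i0..}) ?a = Lnorm q (count_space UNIV) (\<lambda>i. ?a i * indicator {i0..} i)"
      by (rule Lnorm_count_indicator[OF q])
    also have "\<dots> \<le> Lnorm q (count_space UNIV) (\<lambda>i. \<integral>\<^sup>+j. geom_kernel \<gamma> (i - j) * B j \<partial>count_space UNIV)"
      by (intro Lnorm_mono q conv) simp
    also have "\<dots> \<le> ennreal C2 * Lnorm q (count_space UNIV) B" by (rule C2)
    also have "Lnorm q (count_space UNIV) B \<le> ennreal C1 * Lnorm q (count_space {i0..}) ?b + ennreal K * Lp_norm p lborel f"
    proof -
      have "Lnorm q (count_space UNIV) B \<le> Lnorm q (count_space UNIV) (\<lambda>j. ennreal C1 * (?b j * indicator {i0..} j)) +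
          Lnorm q (count_space UNIV) (\<lambda>j. (ennreal K * Lp_norm p lborel f) * indicator {i0} j)"
        unfolding B_def by (intro Lnorm_add q) auto
      also have "\<dots> \<le> ennreal C1 * Lnorm q (count_space {i0..}) ?b + ennreal K * Lp_norm p lborel f"
        unfolding Lnorm_count_indicator[OF q, of "{i0..}"] by (intro add_mono Lnorm_cmult_le Lnorm_point q) simp
      finally show ?thesis .
    qed
    also have "ennreal C1 * Lnorm q (count_space {i0..}) ?b + ennreal K * Lp_norm p lborel f \<le> ennreal (C1 + K + 1) * Lnorm q (count_space {i0..}) ?b + ennreal (C1 + K + 1) * Lp_norm p lborel f"
      using C1 K by (intro add_mono mult_right_mono ennreal_leI) auto
    also have "\<dots> = ennreal (C1 + K + 1) * (Lp_norm p lborel f + Lnorm q (count_space {i0..}) ?b)"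
      by (simp add: distrib_left add.commute)
    also have "ennreal C2 * (ennreal (C1 + K + 1) * (Lp_norm p lborel f + Lnorm q (count_space {i0..}) ?b)) = ennreal C * (Lp_norm p lborel f + Lnorm q (count_space {i0..}) ?b)"
      unfolding C_def using C1 C2 K by (intro ennreal_mult_mult) auto
    finally show ?thesis by (simp add: mult_left_mono)
  qed
  with C show ?thesis by blast
qed

section \<open>The inequalities between the Besov, interpolation and wavelet expressions\<close>

lemma two_powi: "(2::real) powi j = 2 powr of_int j"
  by (simp add: powr_real_of_int')

lemma geometric_sum_ennreal:
  assumes "0 < \<gamma>"
  obtains G where "0 < G" "(\<Sum>i. ennreal (2 powr (- \<gamma> * real i))) = ennreal G"
proof -
  define \<theta> where "\<theta> = 2 powr (- \<gamma>)"
  have t: "0 < \<theta>" "\<theta> < 1" using assms by (auto simp: \<theta>_def powr_less_one)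
  have e: "2 powr (- \<gamma> * real i) = \<theta> ^ i" for i
    by (simp add: \<theta>_def powr_realpow[symmetric] powr_powr)
  have "(\<Sum>i. ennreal (2 powr (- \<gamma> * real i))) = ennreal (1 / (1 - \<theta>))"
    unfolding e using t by (simp add: suminf_ennreal2 summable_geometric suminf_geometric)
  then show thesis using t by (intro that[of "1 / (1 - \<theta>)"]) auto
qed

lemma Lnorm_finite_times_le:
  assumes p: "1 \<le> p" and J: "finite J"
  shows "Lp_norm p (count_space (J \<times> UNIV)) (\<lambda>(s, k). F s k) \<le>
    ennreal (real (card J) + 1) * (\<Sum>s\<in>J. Lp_norm p (count_space UNIV) (F s))"
proof -
  have "Lp_norm p (count_space (J \<times> UNIV)) (\<lambda>(s, k). F s k) \<le>
      Lnorm p (count_space (J \<times> UNIV)) (\<lambda>z. (\<lambda>k. \<Sum>s\<in>J. ennreal (cmod (F s k))) (snd z))"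
    unfolding Lp_norm_def
  proof (rule Lnorm_mono[OF p])
    fix z assume "z \<in> space (count_space (J \<times> (UNIV :: 'b set)))"
    then show "ennreal (cmod (case z of (s, k) \<Rightarrow> F s k)) \<le> (\<Sum>s\<in>J. ennreal (cmod (F s (snd z))))"
      using member_le_sum[of "fst z" J "\<lambda>s. ennreal (cmod (F s (snd z)))"] J by (auto simp: case_prod_beta')
  qed simp
  also have "\<dots> \<le> ennreal ((real (card J) + 1) powr recip p) * Lnorm p (count_space UNIV) (\<lambda>k. \<Sum>s\<in>J. ennreal (cmod (F s k)))"
  proof (rule Lnorm_comp_le[OF p])
    fix A :: "'b set"
    show "emeasure (count_space (J \<times> UNIV)) (snd -` A \<inter> space (count_space (J \<times> UNIV))) \<le> ennreal (real (card J) + 1) * emeasure (count_space UNIV) A"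
    proof (cases "finite A")
      case True
      have e: "snd -` A \<inter> space (count_space (J \<times> UNIV)) = J \<times> A" by auto
      have "emeasure (count_space (J \<times> UNIV)) (J \<times> A) = ennreal (real (card J) * real (card A))"
        using J True by (subst emeasure_count_space_finite) (auto simp: card_cartesian_product ennreal_of_nat_eq_real_of_nat)
      also have "\<dots> \<le> ennreal ((real (card J) + 1) * real (card A))"
        by (intro ennreal_leI mult_right_mono) auto
      also have "\<dots> = ennreal (real (card J) + 1) * emeasure (count_space UNIV) A"
        using True by (subst ennreal_mult) (auto simp: ennreal_of_nat_eq_real_of_nat)
      finally show ?thesis unfolding e .
    qed (simp add: ennreal_mult_top)
  qed auto
  also have "\<dots> \<le> ennreal (real (card J) + 1) * (\<Sum>s\<in>J. Lp_norm p (count_space UNIV) (F s))"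
  proof (intro mult_mono ennreal_leI)
    have "(real (card J) + 1) powr recip p \<le> (real (card J) + 1) powr 1"
      using recip_bounds[OF p] by (intro powr_mono) auto
    then show "(real (card J) + 1) powr recip p \<le> real (card J) + 1" by simp
    show "Lnorm p (count_space UNIV) (\<lambda>k. \<Sum>s\<in>J. ennreal (cmod (F s k))) \<le> (\<Sum>s\<in>J. Lp_norm p (count_space UNIV) (F s))"
      unfolding Lp_norm_def using J by (intro Lnorm_sum p) auto
  qed auto
  finally show ?thesis .
qed

text \<open>Raising the order of the differences costs a constant; lowering it step by step is Marchaud's
  inequality, as long as the order stays above \<open>s\<close>.\<close>
lemma mod_seq_le_besov_expr_any_order:
  assumes p: "1 \<le> p" and q: "1 \<le> q" and s: "0 < s" "s < real M" and i0: "i0 \<le> (0::int)"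
  shows "\<exists>C>0. \<forall>f :: real ^ 'n \<Rightarrow> complex. f \<in> borel_measurable borel \<longrightarrow>
    Lnorm q (count_space {i0..}) (mod_seq M s p f) \<le> ennreal C * besov_expr m s p q f"
proof (cases "M \<le> m")
  case True
  then show ?thesis
  proof (induction M rule: inc_induct)
    case base
    show ?case by (rule mod_seq_le_besov_expr[OF p q s(1) i0])
  next
    case (step k)
    obtain C1 where C1: "0 < C1" "\<And>f :: real ^ 'n \<Rightarrow> complex. f \<in> borel_measurable borel \<Longrightarrow>
      Lnorm q (count_space {i0..}) (mod_seq (Suc k) s p f) \<le> ennreal C1 * besov_expr m s p q f"
      using step.IH by blast
    have "s < real k" using s(2) step.hyps(1) by linarith
    then obtain C2 where C2: "0 < C2" "\<And>f :: real ^ 'n \<Rightarrow> complex. f \<in> borel_measurable borel \<Longrightarrow>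
      Lnorm q (count_space {i0..}) (mod_seq k s p f) \<le>
      ennreal C2 * (Lp_norm p lborel f + Lnorm q (count_space {i0..}) (mod_seq (Suc k) s p f))"
      using mod_seq_lower_order[OF p q _ s(1), of k i0] by blast
    have "Lnorm q (count_space {i0..}) (mod_seq k s p f) \<le> ennreal (C2 * (1 + C1)) * besov_expr m s p q f"
      if f: "f \<in> borel_measurable borel" for f :: "real ^ 'n \<Rightarrow> complex"
    proof -
      have "Lnorm q (count_space {i0..}) (mod_seq k s p f) \<le> ennreal C2 * (Lp_norm p lborel f + Lnorm q (count_space {i0..}) (mod_seq (Suc k) s p f))"
        by (rule C2(2)[OF f])
      also have "\<dots> \<le> ennreal C2 * (ennreal 1 * besov_expr m s p q f + ennreal C1 * besov_expr m s p q f)"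
        by (intro mult_left_mono add_mono C1(2)[OF f]) (simp_all add: besov_expr_def)
      also have "\<dots> = ennreal C2 * (ennreal (1 + C1) * besov_expr m s p q f)"
        using C1(1) by (simp only: distrib_right[symmetric] ennreal_plus[symmetric] zero_le_one less_imp_le)
      also have "\<dots> = ennreal (C2 * (1 + C1)) * besov_expr m s p q f"
        using C1(1) C2(1) by (intro ennreal_mult_mult) auto
      finally show ?thesis .
    qed
    moreover have "0 < C2 * (1 + C1)" using C1(1) C2(1) by simp
    ultimately show ?case by blast
  qed
next
  case False
  define k where "k = M - m"
  have M: "M = k + m" using False by (simp add: k_def)
  obtain C1 where C1: "0 < C1" "\<And>f :: real ^ 'n \<Rightarrow> complex. f \<in> borel_measurable borel \<Longrightarrow>
      Lnorm q (count_space {i0..}) (mod_seq m s p f) \<le> ennreal C1 * besov_expr m s p q f"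
    using mod_seq_le_besov_expr[OF p q s(1) i0] by blast
  define K where "K = coeff_sum ([:-1, 1:] ^ k) + 1"
  have K: "0 < K" unfolding K_def using coeff_sum_nonneg by (intro add_nonneg_pos) auto
  have "Lnorm q (count_space {i0..}) (mod_seq M s p f) \<le> ennreal (K * C1) * besov_expr m s p q f"
    if f: "f \<in> borel_measurable borel" for f :: "real ^ 'n \<Rightarrow> complex"
  proof -
    have pw: "mod_seq M s p f i \<le> ennreal K * mod_seq m s p f i" for i
    proof -
      have "modulus M p f t \<le> ennreal K * modulus m p f t" for t
      proof -
        have "modulus M p f t \<le> ennreal (coeff_sum ([:-1, 1:] ^ k)) * modulus m p f t"
          unfolding M by (rule modulus_add_order[OF p f])
        also have "\<dots> \<le> ennreal K * modulus m p f t"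
          unfolding K_def by (intro mult_right_mono ennreal_leI) auto
        finally show ?thesis .
      qed
      then have "mod_seq M s p f i \<le> ennreal (2 powr (s * of_int i)) * (ennreal K * modulus m p f (2 powr (- of_int i)))"
        unfolding mod_seq_def by (intro mult_left_mono) auto
      then show ?thesis unfolding mod_seq_def by (simp only: mult.left_commute)
    qed
    have "Lnorm q (count_space {i0..}) (mod_seq M s p f) \<le> Lnorm q (count_space {i0..}) (\<lambda>i. ennreal K * mod_seq m s p f i)"
      by (intro Lnorm_mono q pw) simp
    also have "\<dots> \<le> ennreal K * Lnorm q (count_space {i0..}) (mod_seq m s p f)"
      by (intro Lnorm_cmult_le q) simp
    also have "\<dots> \<le> ennreal K * (ennreal C1 * besov_expr m s p q f)"
      by (intro mult_left_mono C1(2)[OF f]) simp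
    also have "\<dots> = ennreal (K * C1) * besov_expr m s p q f"
      using K C1(1) by (intro ennreal_mult_mult) auto
    finally show ?thesis .
  qed
  moreover have "0 < K * C1" using K C1(1) by simp
  ultimately show ?thesis by blast
qed

lemma suminf_int_shift:
  "(\<Sum>l. g (j0 + int l)) = (\<integral>\<^sup>+j. g j * indicator {j0..} j \<partial>count_space (UNIV::int set))"
proof -
  have "(\<integral>\<^sup>+j. g j * indicator {j0..} j \<partial>count_space UNIV) = (\<integral>\<^sup>+j. g j \<partial>count_space {j0..})"
    by (subst nn_integral_count_space_indicator[symmetric]) auto
  also have "\<dots> = (\<integral>\<^sup>+l. g (j0 + int l) \<partial>count_space UNIV)"
    by (intro nn_integral_bij_count_space[symmetric] bij_betwI[where g="\<lambda>j. nat (j - j0)"]) auto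
  finally show ?thesis by (simp add: nn_integral_count_space_nat)
qed

context scaling
begin

lemma P_op_measurable [measurable]: "P_op \<phi> j f \<in> borel_measurable borel"
proof -
  have [measurable]: "synth (tensor \<phi>) (\<lambda>k. f (dyadic j k)) \<in> borel_measurable borel"
    by (rule synth_measurable[OF box_supp_tensor measurable_tensor])
  show ?thesis unfolding P_op_eq_synth[abs_def] by measurable
qed

lemma Q_op_measurable [measurable]: "Q_op \<phi> j f \<in> borel_measurable borel"
  unfolding Q_op_def[abs_def] by measurable

text \<open>Exact reconstruction of \<open>P\<^sub>j\<^sub>0 f\<close> and \<open>Q\<^sub>j f\<close> from the coefficients, and boundedness of synthesis;
  rescaling from the unit lattice to level \<open>j\<close> produces the factor \<open>2\<^sup>-\<^sup>j\<^sup>n\<^sup>/\<^sup>p\<close> that separates the two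
  weights.\<close>
lemma norm_i_le_norm_w:
  assumes p: "1 \<le> p" and q: "1 \<le> q"
  shows "\<exists>C>0. \<forall>f :: real ^ 'n \<Rightarrow> complex. norm_i \<phi> p q \<sigma> j0 f \<le> ennreal C * norm_w \<phi> p q \<sigma> j0 f"
proof -
  define \<nu> where "\<nu> = real CARD('n) * recip p"
  let ?J = "J_plus :: (nat ^ 'n) set"
  obtain B where B: "0 < B" "\<And>s y. cmod (Psi s (y :: real ^ 'n)) \<le> B" using bounded_Psi by auto
  define D where "D = B * card (near_zero R :: (int ^ 'n) set)"
  have D: "0 \<le> D" using B(1) by (simp add: D_def)
  have synth: "Lp_norm p lborel (\<lambda>x. synth (Psi s) c (2 powi j *\<^sub>R x)) \<le> ennreal (2 powr (- \<nu> * of_int j) * D) * Lp_norm p (count_space UNIV) c"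
    for s :: "nat ^ 'n" and c j
  proof -
    have "Lp_norm p lborel (\<lambda>x. synth (Psi s) c (2 powi j *\<^sub>R x)) = ennreal ((2 powi j) powr (- (CARD('n) * recip p))) * Lp_norm p lborel (synth (Psi s) c)"
      by (intro Lp_norm_scale p synth_measurable[OF box_supp_Psi] measurable_Psi) simp
    also have "(2 powi j) powr (- (CARD('n) * recip p)) = 2 powr (- \<nu> * of_int j)"
      by (simp add: two_powi powr_powr \<nu>_def mult_ac)
    also have "ennreal (2 powr (- \<nu> * of_int j)) * Lp_norm p lborel (synth (Psi s) c) \<le> ennreal (2 powr (- \<nu> * of_int j)) * (ennreal D * Lp_norm p (count_space UNIV) c)"
      unfolding D_def using B by (intro mult_left_mono synth_bound p box_supp_Psi) auto
    also have "\<dots> = ennreal (2 powr (- \<nu> * of_int j) * D) * Lp_norm p (count_space UNIV) c"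
      using D by (intro ennreal_mult_mult) auto
    finally show ?thesis .
  qed
  define C1 where "C1 = 2 powr (- \<nu> * of_int j0) * D"
  define C2 where "C2 = real (card ?J) * D"
  define C where "C = C1 + C2 + 1"
  have C12: "0 \<le> C1" "0 \<le> C2" using D by (auto simp: C1_def C2_def)
  have "norm_i \<phi> p q \<sigma> j0 f \<le> ennreal C * norm_w \<phi> p q \<sigma> j0 f" for f :: "real ^ 'n \<Rightarrow> complex"
  proof -
    have P: "Lp_norm p lborel (P_op \<phi> j0 f) \<le> ennreal C1 * Lp_norm p (count_space UNIV) (\<lambda>k. dual_scaling j0 k f)"
      using synth[of 0 "\<lambda>k. f (dyadic j0 k)" j0]
      unfolding P_op_eq_synth[abs_def] Psi_0 C1_def dual_scaling_def .
    let ?w = "\<lambda>j. Lp_norm p (count_space (?J \<times> UNIV)) (\<lambda>(s, k). dual_wavelet \<phi> s j k f)"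
    have Q: "ennreal (2 powr (of_int j * \<sigma>)) * Lp_norm p lborel (Q_op \<phi> j f) \<le>
        ennreal C2 * (ennreal (2 powr ((\<sigma> - real CARD('n) * recip p) * of_int j)) * ?w j)" for j
    proof -
      have m: "(\<lambda>x. synth (Psi s) (\<lambda>k. dual_wavelet \<phi> s j k f) (2 powi j *\<^sub>R x)) \<in> borel_measurable lborel" for s :: "nat ^ 'n"
      proof -
        have [measurable]: "synth (Psi s) (\<lambda>k. dual_wavelet \<phi> s j k f) \<in> borel_measurable borel"
          by (rule synth_measurable[OF box_supp_Psi measurable_Psi])
        show ?thesis by measurable
      qed
      have "Lp_norm p lborel (Q_op \<phi> j f) \<le> (\<Sum>s\<in>?J. Lp_norm p lborel (\<lambda>x. synth (Psi s) (\<lambda>k. dual_wavelet \<phi> s j k f) (2 powi j *\<^sub>R x)))"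
        unfolding Q_op_wavelets[abs_def] by (intro Lp_norm_sum p finite_J_plus m)
      also have "\<dots> \<le> (\<Sum>s\<in>?J. ennreal (2 powr (- \<nu> * of_int j) * D) * ?w j)"
      proof (rule sum_mono)
        fix s assume s: "s \<in> ?J"
        have "Lp_norm p (count_space UNIV) (\<lambda>k. dual_wavelet \<phi> s j k f) \<le> ?w j"
          unfolding Lp_norm_def
          using Lnorm_count_inj_le[OF p, of "\<lambda>k. (s, k)" UNIV "?J \<times> UNIV" "\<lambda>z. ennreal (cmod (case z of (s, k) \<Rightarrow> dual_wavelet \<phi> s j k f))"] s
          by (auto simp: inj_on_def)
        then show "Lp_norm p lborel (\<lambda>x. synth (Psi s) (\<lambda>k. dual_wavelet \<phi> s j k f) (2 powi j *\<^sub>R x)) \<le> ennreal (2 powr (- \<nu> * of_int j) * D) * ?w j"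
          by (intro order_trans[OF synth] mult_left_mono) auto
      qed
      also have "\<dots> = ennreal (real (card ?J)) * (ennreal (2 powr (- \<nu> * of_int j) * D) * ?w j)"
        by (simp add: ennreal_of_nat_eq_real_of_nat)
      finally have "ennreal (2 powr (of_int j * \<sigma>)) * Lp_norm p lborel (Q_op \<phi> j f) \<le> ennreal (2 powr (of_int j * \<sigma>)) * (ennreal (real (card ?J)) * (ennreal (2 powr (- \<nu> * of_int j) * D) * ?w j))"
        by (rule mult_left_mono) simp
      also have "\<dots> = ennreal (2 powr (of_int j * \<sigma>) * (real (card ?J) * (2 powr (- \<nu> * of_int j) * D))) * ?w j"
        using D by (simp only: ennreal_mult_mult mult_nonneg_nonneg powr_ge_zero of_nat_0_le_iff)
      also have "2 powr (of_int j * \<sigma>) * (real (card ?J) * (2 powr (- \<nu> * of_int j) * D)) = C2 * 2 powr ((\<sigma> - \<nu>) * of_int j)"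
      proof -
        have "2 powr ((\<sigma> - \<nu>) * of_int j) = 2 powr (of_int j * \<sigma>) * 2 powr (- \<nu> * of_int j)"
          unfolding powr_add[symmetric] by (simp add: algebra_simps)
        then show ?thesis unfolding C2_def by (simp only: mult_ac)
      qed
      also have "ennreal (C2 * 2 powr ((\<sigma> - \<nu>) * of_int j)) * ?w j = ennreal C2 * (ennreal (2 powr ((\<sigma> - real CARD('n) * recip p) * of_int j)) * ?w j)"
        using C12 unfolding \<nu>_def by (intro ennreal_mult_mult[symmetric]) auto
      finally show ?thesis .
    qed
    let ?S = "Lnorm q (count_space {j0..}) (\<lambda>j. ennreal (2 powr ((\<sigma> - real CARD('n) * recip p) * of_int j)) * ?w j)"
    have "Lnorm q (count_space {j0..}) (\<lambda>j. ennreal (2 powr (of_int j * \<sigma>)) * Lp_norm p lborel (Q_op \<phi> j f)) \<le>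
      Lnorm q (count_space {j0..}) (\<lambda>j. ennreal C2 * (ennreal (2 powr ((\<sigma> - real CARD('n) * recip p) * of_int j)) * ?w j))"
      by (intro Lnorm_mono q Q) simp
    also have "\<dots> \<le> ennreal C2 * ?S" by (intro Lnorm_cmult_le q) simp
    finally have "norm_i \<phi> p q \<sigma> j0 f \<le> ennreal C1 * Lp_norm p (count_space UNIV) (\<lambda>k. dual_scaling j0 k f) + ennreal C2 * ?S"
      unfolding norm_i_def by (intro add_mono P)
    also have "\<dots> \<le> ennreal C * Lp_norm p (count_space UNIV) (\<lambda>k. dual_scaling j0 k f) + ennreal C * ?S"
      unfolding C_def using C12 by (intro add_mono mult_right_mono ennreal_leI) auto
    also have "\<dots> = ennreal C * norm_w \<phi> p q \<sigma> j0 f"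
      unfolding norm_w_def by (simp only: distrib_left)
    finally show ?thesis .
  qed
  moreover have "0 < C" unfolding C_def using C12 by simp
  ultimately show ?thesis by blast
qed

text \<open>The coefficients sample \<open>M\<close>-th differences of \<open>f\<close> with step about \<open>2\<^sup>-\<^sup>j\<close> on translates of the lattice
  \<open>2\<^sup>-\<^sup>j \<int>\<^sup>n\<close>. The norm of such a difference is a modulus of \<open>f\<close>, and its own moduli are not larger than
  those of \<open>f\<close>, up to a constant.\<close>
lemma dual_wavelet_le_moduli:
  assumes p: "1 \<le> p" and M: "1 \<le> M" and fac: "filter_poly = [:-1, 1:] ^ M * rr" and s: "s \<in> (J_plus :: (nat ^ 'n) set)"
  defines "\<nu> \<equiv> real CARD('n) * recip p"
  shows "\<exists>C>0. \<forall>(f :: real ^ 'n \<Rightarrow> complex) j. continuous_on UNIV f \<longrightarrow>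
    Lp_norm p (count_space UNIV) (\<lambda>k. dual_wavelet \<phi> s j k f) \<le>
      ennreal (C * 2 powr (\<nu> * of_int j)) * (\<Sum>i. ennreal (2 powr (\<nu> * real i)) * modulus M p f (2 powr (- of_int (j + int i))))"
proof -
  obtain F c i0 where F: "finite F" and dw: "\<And>j k f. dual_wavelet \<phi> s j k f =
    (\<Sum>L\<in>F. c L * diff_op M (dyadic (j + 1) (axis i0 1)) f (dyadic (j + 1) (\<chi> i. 2 * k $ i + L $ i)))"
    by (rule dual_wavelet_differences[OF fac s], rule that)
  obtain C0 where C0: "0 < C0" "\<And>(g :: real ^ 'n \<Rightarrow> complex) \<delta> a. continuous_on UNIV g \<Longrightarrow> 0 < \<delta> \<Longrightarrow>
    Lnorm p (count_space UNIV) (\<lambda>k. ennreal (cmod (g (a + \<delta> *\<^sub>R ivec k)))) \<le>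
      ennreal (C0 * \<delta> powr (- \<nu>)) * (Lp_norm p lborel g + (\<Sum>i. ennreal (2 powr (\<nu> * real i)) * modulus M p g (\<delta> * (1/2) ^ i)))"
    using sampling[OF p M, where 'n='n] unfolding \<nu>_def by blast
  define K where "K = coeff_sum ([:-1, 1:] ^ M)"
  have K: "0 \<le> K" unfolding K_def by (rule coeff_sum_nonneg)
  define S where "S = (\<Sum>L\<in>F. cmod (c L))"
  have S: "0 \<le> S" unfolding S_def by (intro sum_nonneg) auto
  define C where "C = S * (C0 * (1 + K)) + 1"
  have "Lp_norm p (count_space UNIV) (\<lambda>k. dual_wavelet \<phi> s j k f) \<le>
      ennreal (C * 2 powr (\<nu> * of_int j)) * (\<Sum>i. ennreal (2 powr (\<nu> * real i)) * modulus M p f (2 powr (- of_int (j + int i))))"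
    if f: "continuous_on UNIV f" for f :: "real ^ 'n \<Rightarrow> complex" and j
  proof -
    let ?W = "\<Sum>i. ennreal (2 powr (\<nu> * real i)) * modulus M p f (2 powr (- of_int (j + int i)))"
    define h where "h = dyadic (j + 1) (axis i0 1 :: int ^ 'n)"
    define \<delta> where "\<delta> = 1 / (2::real) powi j"
    have \<delta>: "0 < \<delta>" by (simp add: \<delta>_def)
    have fm: "f \<in> borel_measurable borel" by (rule borel_measurable_continuous_onI[OF f])
    have sc: "\<delta> * (1/2) ^ i = 2 powr (- of_int (j + int i))" for i
      unfolding \<delta>_def two_powi half_power powr_minus_divide[symmetric] powr_add[symmetric] by simp
    have hn: "norm h \<le> 2 powr (- of_int j)"
    proof -
      have "ivec (axis i0 1) = (axis i0 1 :: real ^ 'n)" by (simp add: vec_eq_iff axis_def)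
      then have "norm h = 1 / 2 powi (j + 1)" by (simp add: h_def dyadic_eq)
      also have "\<dots> = 2 powr (- of_int (j + 1))" unfolding two_powi powr_minus_divide ..
      also have "\<dots> \<le> 2 powr (- of_int j)" by (intro powr_mono) auto
      finally show ?thesis .
    qed
    let ?g = "diff_op M h f"
    have gc: "continuous_on UNIV ?g" by (rule shift_op_continuous[OF f])
    have samp: "Lnorm p (count_space UNIV) (\<lambda>k. ennreal (cmod (?g (a + \<delta> *\<^sub>R ivec k)))) \<le> ennreal (C0 * (1 + K) * 2 powr (\<nu> * of_int j)) * ?W" for a
    proof -
      have "Lp_norm p lborel ?g \<le> ennreal (2 powr (\<nu> * real 0)) * modulus M p f (2 powr (- of_int (j + int 0)))"
        using hn by (simp add: modulus_ge)
      also have "\<dots> \<le> ?W" by (rule ennreal_le_suminf)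
      finally have 1: "Lp_norm p lborel ?g \<le> ennreal 1 * ?W" by simp
      have "(\<Sum>i. ennreal (2 powr (\<nu> * real i)) * modulus M p ?g (\<delta> * (1/2) ^ i)) \<le> (\<Sum>i. ennreal K * (ennreal (2 powr (\<nu> * real i)) * modulus M p f (2 powr (- of_int (j + int i)))))"
      proof (rule suminf_le)
        fix i
        have "modulus M p ?g (\<delta> * (1/2) ^ i) \<le> ennreal K * modulus M p f (2 powr (- of_int (j + int i)))"
          unfolding sc K_def by (rule modulus_shift_op[OF p fm])
        then have "ennreal (2 powr (\<nu> * real i)) * modulus M p ?g (\<delta> * (1/2) ^ i) \<le> ennreal (2 powr (\<nu> * real i)) * (ennreal K * modulus M p f (2 powr (- of_int (j + int i))))"
          by (rule mult_left_mono) simp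
        then show "ennreal (2 powr (\<nu> * real i)) * modulus M p ?g (\<delta> * (1/2) ^ i) \<le> ennreal K * (ennreal (2 powr (\<nu> * real i)) * modulus M p f (2 powr (- of_int (j + int i))))"
          by (simp only: mult.left_commute)
      qed auto
      also have "\<dots> = ennreal K * ?W" by simp
      finally have 2: "(\<Sum>i. ennreal (2 powr (\<nu> * real i)) * modulus M p ?g (\<delta> * (1/2) ^ i)) \<le> ennreal K * ?W" .
      have "Lnorm p (count_space UNIV) (\<lambda>k. ennreal (cmod (?g (a + \<delta> *\<^sub>R ivec k)))) \<le> ennreal (C0 * \<delta> powr (- \<nu>)) * (ennreal 1 * ?W + ennreal K * ?W)"
        by (rule order_trans[OF C0(2)[OF gc \<delta>] mult_left_mono[OF add_mono[OF 1 2]]]) simp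
      also have "ennreal 1 * ?W + ennreal K * ?W = ennreal (1 + K) * ?W"
        using K by (simp only: distrib_right[symmetric] ennreal_plus[symmetric] zero_le_one)
      also have "ennreal (C0 * \<delta> powr (- \<nu>)) * (ennreal (1 + K) * ?W) = ennreal (C0 * \<delta> powr (- \<nu>) * (1 + K)) * ?W"
        using C0(1) K by (intro ennreal_mult_mult) auto
      also have "C0 * \<delta> powr (- \<nu>) * (1 + K) = C0 * (1 + K) * 2 powr (\<nu> * of_int j)"
      proof -
        have "\<delta> = 2 powr (- of_int j)" unfolding \<delta>_def two_powi powr_minus_divide ..
        then have "\<delta> powr (- \<nu>) = 2 powr (\<nu> * of_int j)" by (simp add: powr_powr mult.commute)
        then show ?thesis by simp
      qed
      finally show ?thesis .
    qed
    have pts: "dyadic (j + 1) (\<chi> i. 2 * k $ i + L $ i) = dyadic (j + 1) L + \<delta> *\<^sub>R ivec k" for k L :: "int ^ 'n"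
    proof -
      have "(\<chi> i. 2 * k $ i + L $ i) = L + (\<chi> i. 2 * k $ i)" by (simp add: vec_eq_iff)
      then show ?thesis by (simp add: dyadic_add dyadic_double) (simp add: dyadic_eq \<delta>_def)
    qed
    have "Lp_norm p (count_space UNIV) (\<lambda>k. dual_wavelet \<phi> s j k f) \<le> (\<Sum>L\<in>F. Lp_norm p (count_space UNIV) (\<lambda>k. c L * ?g (dyadic (j + 1) L + \<delta> *\<^sub>R ivec k)))"
      unfolding dw pts h_def[symmetric] by (intro Lp_norm_sum p F) simp
    also have "\<dots> \<le> (\<Sum>L\<in>F. ennreal (cmod (c L)) * (ennreal (C0 * (1 + K) * 2 powr (\<nu> * of_int j)) * ?W))"
    proof (rule sum_mono)
      fix L
      have "Lp_norm p (count_space UNIV) (\<lambda>k. c L * ?g (dyadic (j + 1) L + \<delta> *\<^sub>R ivec k)) = ennreal (cmod (c L)) * Lp_norm p (count_space UNIV) (\<lambda>k. ?g (dyadic (j + 1) L + \<delta> *\<^sub>R ivec k))"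
        by (rule Lp_norm_cmult[OF p]) simp
      also have "\<dots> \<le> ennreal (cmod (c L)) * (ennreal (C0 * (1 + K) * 2 powr (\<nu> * of_int j)) * ?W)"
        unfolding Lp_norm_def by (intro mult_left_mono samp) simp
      finally show "Lp_norm p (count_space UNIV) (\<lambda>k. c L * ?g (dyadic (j + 1) L + \<delta> *\<^sub>R ivec k)) \<le> \<dots>" .
    qed
    also have "\<dots> = ennreal S * (ennreal (C0 * (1 + K) * 2 powr (\<nu> * of_int j)) * ?W)"
      unfolding S_def by (simp only: sum_distrib_right[symmetric]) (simp add: sum_ennreal)
    also have "\<dots> = ennreal (S * (C0 * (1 + K) * 2 powr (\<nu> * of_int j))) * ?W"
      using S C0(1) K by (intro ennreal_mult_mult) auto
    also have "\<dots> \<le> ennreal (C * 2 powr (\<nu> * of_int j)) * ?W"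
      unfolding C_def by (intro mult_right_mono ennreal_leI) (auto simp: algebra_simps)
    finally show ?thesis .
  qed
  moreover have "0 < C" unfolding C_def using S C0(1) K by (intro add_nonneg_pos) auto
  ultimately show ?thesis by blast
qed

text \<open>With \<open>a\<^sub>i = 2\<^sup>\<sigma>\<^sup>i \<omega>\<^sup>M\<^sub>p(f; 2\<^sup>-\<^sup>i)\<close> and \<open>\<nu> = n / p\<close>, the weighted coefficients of level \<open>j\<close> are bounded by
  \<open>\<Sum>\<^sub>i 2\<^sup>-\<^sup>(\<^sup>\<sigma>\<^sup>-\<^sup>\<nu>\<^sup>)\<^sup>i a\<^sub>j\<^sub>+\<^sub>i\<close>, a superposition of shifts of \<open>a\<close> with summable weights.\<close>
lemma norm_w_le_besov_expr:
  assumes p: "1 \<le> p" and q: "1 \<le> q" and \<sigma>: "0 < \<sigma>" "real CARD('n) * recip p < \<sigma>" "\<sigma> < real M"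
    and fac: "filter_poly = [:-1, 1:] ^ M * rr"
  shows "\<exists>C>0. \<forall>f :: real ^ 'n \<Rightarrow> complex. continuous_on UNIV f \<longrightarrow>
    norm_w \<phi> p q \<sigma> j0 f \<le> ennreal C * besov_expr m \<sigma> p q f"
proof -
  define \<nu> where "\<nu> = real CARD('n) * recip p"
  define i0 where "i0 = min j0 0"
  have M: "1 \<le> M" using \<sigma> by (cases M) auto
  have \<gamma>: "0 < \<sigma> - \<nu>" using \<sigma> by (simp add: \<nu>_def)
  let ?J = "J_plus :: (nat ^ 'n) set"
  obtain G where G: "0 < G" "(\<Sum>i. ennreal (2 powr (- (\<sigma> - \<nu>) * real i))) = ennreal G"
    using geometric_sum_ennreal[OF \<gamma>] by metis
  obtain C0 where C0: "0 < C0" "\<And>(g :: real ^ 'n \<Rightarrow> complex) \<delta> a. continuous_on UNIV g \<Longrightarrow> 0 < \<delta> \<Longrightarrow>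
    Lnorm p (count_space UNIV) (\<lambda>k. ennreal (cmod (g (a + \<delta> *\<^sub>R ivec k)))) \<le>
      ennreal (C0 * \<delta> powr (- \<nu>)) * (Lp_norm p lborel g + (\<Sum>i. ennreal (2 powr (\<nu> * real i)) * modulus M p g (\<delta> * (1/2) ^ i)))"
    using sampling[OF p M, where 'n='n] unfolding \<nu>_def by blast
  have "\<forall>s\<in>?J. \<exists>C>0. \<forall>(f :: real ^ 'n \<Rightarrow> complex) j. continuous_on UNIV f \<longrightarrow>
    Lp_norm p (count_space UNIV) (\<lambda>k. dual_wavelet \<phi> s j k f) \<le>
      ennreal (C * 2 powr (\<nu> * of_int j)) * (\<Sum>i. ennreal (2 powr (\<nu> * real i)) * modulus M p f (2 powr (- of_int (j + int i))))"
    unfolding \<nu>_def using dual_wavelet_le_moduli[OF p M fac] by blast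
  then obtain Cs where Cs: "\<And>s. s \<in> ?J \<Longrightarrow> 0 < Cs s" "\<And>s (f :: real ^ 'n \<Rightarrow> complex) j. s \<in> ?J \<Longrightarrow> continuous_on UNIV f \<Longrightarrow>
    Lp_norm p (count_space UNIV) (\<lambda>k. dual_wavelet \<phi> s j k f) \<le>
      ennreal (Cs s * 2 powr (\<nu> * of_int j)) * (\<Sum>i. ennreal (2 powr (\<nu> * real i)) * modulus M p f (2 powr (- of_int (j + int i))))"
    unfolding bchoice_iff by blast
  obtain C3 where C3: "0 < C3" "\<And>f :: real ^ 'n \<Rightarrow> complex. f \<in> borel_measurable borel \<Longrightarrow>
    Lnorm q (count_space {i0..}) (mod_seq M \<sigma> p f) \<le> ennreal C3 * besov_expr m \<sigma> p q f"
    using mod_seq_le_besov_expr_any_order[OF p q \<sigma>(1,3), of i0] by (auto simp: i0_def)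
  define S where "S = (real (card ?J) + 1) * (\<Sum>s\<in>?J. Cs s)"
  have S: "0 \<le> S" unfolding S_def using Cs(1) by (intro mult_nonneg_nonneg sum_nonneg) (auto simp: less_imp_le)
  define A where "A = C0 * 2 powr (\<nu> * of_int j0)"
  have A: "0 \<le> A" using C0(1) by (simp add: A_def)
  define A2 where "A2 = 2 powr (- \<sigma> * of_int j0) * G * C3"
  have A2: "0 \<le> A2" using G(1) C3(1) by (simp add: A2_def)
  define C where "C = A * (1 + A2) + S * G * C3 + 1"
  have "norm_w \<phi> p q \<sigma> j0 f \<le> ennreal C * besov_expr m \<sigma> p q f" if f: "continuous_on UNIV f" for f :: "real ^ 'n \<Rightarrow> complex"
  proof -
    have fm: "f \<in> borel_measurable borel" by (rule borel_measurable_continuous_onI[OF f])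
    let ?b = "besov_expr m \<sigma> p q f"
    let ?Y = "Lnorm q (count_space {i0..}) (mod_seq M \<sigma> p f)"
    have Y: "?Y \<le> ennreal C3 * ?b" by (rule C3(2)[OF fm])
    have Lpb: "Lp_norm p lborel f \<le> ?b" by (simp add: besov_expr_def)
    have shift: "ennreal (2 powr (\<nu> * real i)) * modulus M p f (2 powr (- of_int (j + int i))) =
        ennreal (2 powr (- \<sigma> * of_int j)) * (ennreal (2 powr (- (\<sigma> - \<nu>) * real i)) * mod_seq M \<sigma> p f (j + int i))" for j i
    proof -
      have "2 powr (- \<sigma> * of_int j) * (2 powr (- (\<sigma> - \<nu>) * real i) * 2 powr (\<sigma> * of_int (j + int i))) = 2 powr (\<nu> * real i)"
        unfolding powr_add[symmetric] by (simp add: algebra_simps)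
      then show ?thesis unfolding mod_seq_def
        by (subst ennreal_mult_mult, simp, simp, subst ennreal_mult_mult) (auto simp: mult.assoc)
    qed
    have first: "Lp_norm p (count_space UNIV) (\<lambda>k. dual_scaling j0 k f) \<le> ennreal (A * (1 + A2)) * ?b"
    proof -
      define \<delta> where "\<delta> = 1 / (2::real) powi j0"
      have \<delta>2: "\<delta> = 2 powr (- of_int j0)" unfolding \<delta>_def two_powi powr_minus_divide ..
      have \<delta>: "0 < \<delta>" by (simp add: \<delta>_def)
      have sc: "\<delta> * (1/2) ^ i = 2 powr (- of_int (j0 + int i))" for i
        unfolding \<delta>2 half_power powr_add[symmetric] by simp
      have "Lp_norm p (count_space UNIV) (\<lambda>k. dual_scaling j0 k f) = Lnorm p (count_space UNIV) (\<lambda>k. ennreal (cmod (f (0 + \<delta> *\<^sub>R ivec k))))"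
        by (simp add: Lp_norm_def dual_scaling_def dyadic_eq \<delta>_def)
      also have "\<dots> \<le> ennreal (C0 * \<delta> powr (- \<nu>)) * (Lp_norm p lborel f + (\<Sum>i. ennreal (2 powr (\<nu> * real i)) * modulus M p f (\<delta> * (1/2) ^ i)))"
        by (rule C0(2)[OF f \<delta>])
      also have "C0 * \<delta> powr (- \<nu>) = A" unfolding A_def \<delta>2 by (simp add: powr_powr mult.commute)
      also have "(\<Sum>i. ennreal (2 powr (\<nu> * real i)) * modulus M p f (\<delta> * (1/2) ^ i)) \<le> ennreal A2 * ?b"
      proof -
        have "(\<Sum>i. ennreal (2 powr (\<nu> * real i)) * modulus M p f (\<delta> * (1/2) ^ i)) \<le> (\<Sum>i. ennreal (2 powr (- \<sigma> * of_int j0)) * (ennreal (2 powr (- (\<sigma> - \<nu>) * real i)) * ?Y))"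
          unfolding sc shift by (intro suminf_le mult_left_mono Lnorm_count_ge q) (auto simp: i0_def)
        also have "\<dots> = ennreal (2 powr (- \<sigma> * of_int j0)) * (ennreal G * ?Y)"
          by (simp only: ennreal_suminf_cmult ennreal_suminf_multc G(2))
        also have "\<dots> \<le> ennreal (2 powr (- \<sigma> * of_int j0)) * (ennreal G * (ennreal C3 * ?b))"
          by (intro mult_left_mono Y) auto
        also have "\<dots> = ennreal A2 * ?b"
          unfolding A2_def using G(1) C3(1) by (simp add: ennreal_mult_mult mult.assoc)
        finally show ?thesis .
      qed
      also have "ennreal A * (Lp_norm p lborel f + ennreal A2 * ?b) \<le> ennreal A * (ennreal 1 * ?b + ennreal A2 * ?b)"
        using Lpb by (intro mult_left_mono add_mono) auto
      also have "\<dots> = ennreal A * (ennreal (1 + A2) * ?b)"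
        using A2 by (simp only: distrib_right[symmetric] ennreal_plus[symmetric] zero_le_one)
      also have "\<dots> = ennreal (A * (1 + A2)) * ?b" using A A2 by (intro ennreal_mult_mult) auto
      finally show ?thesis by (simp add: mult_left_mono add_mono)
    qed
    have wav: "ennreal (2 powr ((\<sigma> - real CARD('n) * recip p) * of_int j)) * Lp_norm p (count_space (?J \<times> UNIV)) (\<lambda>(s, k). dual_wavelet \<phi> s j k f)
        \<le> ennreal S * (\<Sum>i. ennreal (2 powr (- (\<sigma> - \<nu>) * real i)) * mod_seq M \<sigma> p f (j + int i))" for j
    proof -
      let ?T = "\<Sum>i. ennreal (2 powr (- (\<sigma> - \<nu>) * real i)) * mod_seq M \<sigma> p f (j + int i)"
      have T: "(\<Sum>i. ennreal (2 powr (\<nu> * real i)) * modulus M p f (2 powr (- of_int (j + int i)))) = ennreal (2 powr (- \<sigma> * of_int j)) * ?T"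
        unfolding shift by (rule ennreal_suminf_cmult)
      have "Lp_norm p (count_space (?J \<times> UNIV)) (\<lambda>(s, k). dual_wavelet \<phi> s j k f) \<le>
        ennreal (real (card ?J) + 1) * (\<Sum>s\<in>?J. Lp_norm p (count_space UNIV) (\<lambda>k. dual_wavelet \<phi> s j k f))"
        by (rule Lnorm_finite_times_le[OF p finite_J_plus])
      also have "\<dots> \<le> ennreal (real (card ?J) + 1) * (\<Sum>s\<in>?J. ennreal (Cs s) * (ennreal (2 powr (\<nu> * of_int j)) * (ennreal (2 powr (- \<sigma> * of_int j)) * ?T)))"
      proof (intro mult_left_mono sum_mono)
        fix s assume s: "s \<in> ?J"
        have "Lp_norm p (count_space UNIV) (\<lambda>k. dual_wavelet \<phi> s j k f) \<le> ennreal (Cs s * 2 powr (\<nu> * of_int j)) * (ennreal (2 powr (- \<sigma> * of_int j)) * ?T)"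
          unfolding T[symmetric] by (rule Cs(2)[OF s f])
        then show "Lp_norm p (count_space UNIV) (\<lambda>k. dual_wavelet \<phi> s j k f) \<le> ennreal (Cs s) * (ennreal (2 powr (\<nu> * of_int j)) * (ennreal (2 powr (- \<sigma> * of_int j)) * ?T))"
          using Cs(1)[OF s] by (simp add: ennreal_mult mult.assoc)
      qed simp
      also have "\<dots> = ennreal (real (card ?J) + 1) * (ennreal (\<Sum>s\<in>?J. Cs s) * (ennreal (2 powr (\<nu> * of_int j)) * (ennreal (2 powr (- \<sigma> * of_int j)) * ?T)))"
        using Cs(1) by (simp only: sum_distrib_right[symmetric]) (simp add: sum_ennreal less_imp_le)
      also have "\<dots> = ennreal S * (ennreal (2 powr (\<nu> * of_int j)) * (ennreal (2 powr (- \<sigma> * of_int j)) * ?T))"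
        unfolding S_def using Cs(1) by (intro ennreal_mult_mult sum_nonneg) (auto simp: less_imp_le)
      finally have "ennreal (2 powr ((\<sigma> - \<nu>) * of_int j)) * Lp_norm p (count_space (?J \<times> UNIV)) (\<lambda>(s, k). dual_wavelet \<phi> s j k f)
          \<le> ennreal (2 powr ((\<sigma> - \<nu>) * of_int j)) * (ennreal S * (ennreal (2 powr (\<nu> * of_int j)) * (ennreal (2 powr (- \<sigma> * of_int j)) * ?T)))"
        by (rule mult_left_mono) simp
      also have "\<dots> = ennreal S * (ennreal (2 powr ((\<sigma> - \<nu>) * of_int j)) * (ennreal (2 powr (\<nu> * of_int j)) * (ennreal (2 powr (- \<sigma> * of_int j)) * ?T)))"
        by (rule mult.left_commute)
      also have "ennreal (2 powr ((\<sigma> - \<nu>) * of_int j)) * (ennreal (2 powr (\<nu> * of_int j)) * (ennreal (2 powr (- \<sigma> * of_int j)) * ?T)) = ?T"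
      proof -
        have "2 powr ((\<sigma> - \<nu>) * of_int j) * (2 powr (\<nu> * of_int j) * 2 powr (- \<sigma> * of_int j)) = 1"
          unfolding powr_add[symmetric] by (simp add: algebra_simps)
        then show ?thesis
          by (simp only: ennreal_mult_mult powr_ge_zero mult_nonneg_nonneg) (simp add: mult.assoc)
      qed
      finally show ?thesis unfolding \<nu>_def .
    qed
    have "Lnorm q (count_space {j0..}) (\<lambda>j. ennreal (2 powr ((\<sigma> - real CARD('n) * recip p) * of_int j)) * Lp_norm p (count_space (?J \<times> UNIV)) (\<lambda>(s, k). dual_wavelet \<phi> s j k f))
       \<le> Lnorm q (count_space {j0..}) (\<lambda>j. ennreal S * (\<Sum>i. ennreal (2 powr (- (\<sigma> - \<nu>) * real i)) * mod_seq M \<sigma> p f (j + int i)))"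
      by (intro Lnorm_mono q wav) simp
    also have "\<dots> \<le> ennreal S * Lnorm q (count_space {j0..}) (\<lambda>j. \<Sum>i. ennreal (2 powr (- (\<sigma> - \<nu>) * real i)) * mod_seq M \<sigma> p f (j + int i))"
      by (intro Lnorm_cmult_le q) simp
    also have "\<dots> \<le> ennreal S * (\<Sum>i. ennreal (2 powr (- (\<sigma> - \<nu>) * real i)) * ?Y)"
    proof (intro mult_left_mono order_trans[OF Lnorm_suminf[OF q]] suminf_le)
      fix i
      have "Lnorm q (count_space {j0..}) (\<lambda>j. ennreal (2 powr (- (\<sigma> - \<nu>) * real i)) * mod_seq M \<sigma> p f (j + int i)) \<le>
          ennreal (2 powr (- (\<sigma> - \<nu>) * real i)) * Lnorm q (count_space {j0..}) (\<lambda>j. mod_seq M \<sigma> p f (j + int i))"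
        by (intro Lnorm_cmult_le q) simp
      also have "\<dots> \<le> ennreal (2 powr (- (\<sigma> - \<nu>) * real i)) * ?Y"
        by (intro mult_left_mono Lnorm_count_inj_le q) (auto simp: inj_on_def i0_def)
      finally show "Lnorm q (count_space {j0..}) (\<lambda>j. ennreal (2 powr (- (\<sigma> - \<nu>) * real i)) * mod_seq M \<sigma> p f (j + int i)) \<le> \<dots>" .
    qed auto
    also have "\<dots> = ennreal S * (ennreal G * ?Y)" by (simp only: ennreal_suminf_multc G(2))
    also have "\<dots> \<le> ennreal S * (ennreal G * (ennreal C3 * ?b))" by (intro mult_left_mono Y) auto
    also have "\<dots> = ennreal (S * G * C3) * ?b"
      using S G(1) C3(1) by (simp add: ennreal_mult_mult mult.assoc)
    finally have "norm_w \<phi> p q \<sigma> j0 f \<le> ennreal (A * (1 + A2)) * ?b + ennreal (S * G * C3) * ?b"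
      unfolding norm_w_def by (rule add_mono[OF first])
    also have "\<dots> = ennreal (A * (1 + A2) + S * G * C3) * ?b"
    proof -
      have "0 \<le> A * (1 + A2)" "0 \<le> S * G * C3" using A A2 S G(1) C3(1) by auto
      then show ?thesis by (simp only: distrib_right[symmetric] ennreal_plus[symmetric])
    qed
    also have "\<dots> \<le> ennreal C * ?b" unfolding C_def by (intro mult_right_mono ennreal_leI) auto
    finally show ?thesis .
  qed
  moreover have "0 < C" unfolding C_def using A A2 S G(1) C3(1) by (intro add_nonneg_pos add_nonneg_nonneg) auto
  ultimately show ?thesis by blast
qed

text \<open>The series \<open>f = P\<^sub>j\<^sub>0 f + \<Sum> Q\<^sub>j f\<close>, whose partial sums are \<open>P\<^sub>j f\<close>, after any polynomial in a translation.\<close>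
lemma shift_op_multiscale:
  fixes f :: "real ^ 'n \<Rightarrow> complex"
  assumes "continuous_on UNIV f"
  shows "ennreal (cmod (shift_op P h f x)) \<le> ennreal (cmod (shift_op P h (P_op \<phi> j0 f) x)) +
    (\<Sum>l. ennreal (cmod (shift_op P h (Q_op \<phi> (j0 + int l) f) x)))" (is "_ \<le> ?A + (\<Sum>l. ?B l)")
proof -
  have tel: "shift_op P h (P_op \<phi> (j0 + int N) f) x = shift_op P h (P_op \<phi> j0 f) x + (\<Sum>l<N. shift_op P h (Q_op \<phi> (j0 + int l) f) x)" for N
  proof (induction N)
    case (Suc N)
    have "shift_op P h (P_op \<phi> (j0 + int (Suc N)) f) x = shift_op P h (P_op \<phi> (j0 + int N) f) x + shift_op P h (Q_op \<phi> (j0 + int N) f) x"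
    proof -
      have "P_op \<phi> (j0 + int (Suc N)) f = (\<lambda>x. P_op \<phi> (j0 + int N) f x + Q_op \<phi> (j0 + int N) f x)"
        by (auto simp: Q_op_def add_ac)
      then show ?thesis by (simp only: shift_op_fadd)
    qed
    then show ?case using Suc by simp
  qed simp
  have bd: "ennreal (cmod (shift_op P h (P_op \<phi> (j0 + int N) f) x)) \<le> ?A + (\<Sum>l. ?B l)" for N
  proof -
    have "cmod (shift_op P h (P_op \<phi> (j0 + int N) f) x) \<le> cmod (shift_op P h (P_op \<phi> j0 f) x) + (\<Sum>l<N. cmod (shift_op P h (Q_op \<phi> (j0 + int l) f) x))"
      unfolding tel by (rule order_trans[OF norm_triangle_ineq add_left_mono[OF norm_sum]])
    then have "ennreal (cmod (shift_op P h (P_op \<phi> (j0 + int N) f) x)) \<le> ennreal (cmod (shift_op P h (P_op \<phi> j0 f) x) + (\<Sum>l<N. cmod (shift_op P h (Q_op \<phi> (j0 + int l) f) x)))"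
      by (rule ennreal_leI)
    also have "\<dots> = ?A + (\<Sum>l<N. ?B l)" by (simp add: sum_nonneg sum_ennreal)
    also have "\<dots> \<le> ?A + (\<Sum>l. ?B l)" by (intro add_left_mono sum_le_suminf) auto
    finally show ?thesis .
  qed
  have "(\<lambda>N. shift_op P h (P_op \<phi> (j0 + int N) f) x) \<longlonglongrightarrow> shift_op P h f x"
    unfolding shift_op_def by (intro tendsto_sum tendsto_mult tendsto_const P_op_tendsto assms)
  then have "(\<lambda>N. ennreal (cmod (shift_op P h (P_op \<phi> (j0 + int N) f) x))) \<longlonglongrightarrow> ennreal (cmod (shift_op P h f x))"
    by (intro tendsto_ennrealI tendsto_norm)
  then show ?thesis by (rule LIMSEQ_le_const2) (use bd in blast)
qed

lemma Lp_norm_multiscale: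
  fixes f :: "real ^ 'n \<Rightarrow> complex"
  assumes p: "1 \<le> p" and f: "continuous_on UNIV f"
  shows "Lp_norm p lborel (shift_op P h f) \<le> Lp_norm p lborel (shift_op P h (P_op \<phi> j0 f)) +
    (\<Sum>l. Lp_norm p lborel (shift_op P h (Q_op \<phi> (j0 + int l) f)))"
proof -
  have [measurable]: "f \<in> borel_measurable borel" by (rule borel_measurable_continuous_onI[OF f])
  have "Lp_norm p lborel (shift_op P h f) \<le> Lnorm p lborel (\<lambda>x. ennreal (cmod (shift_op P h (P_op \<phi> j0 f) x)) +
    (\<Sum>l. ennreal (cmod (shift_op P h (Q_op \<phi> (j0 + int l) f) x))))"
    unfolding Lp_norm_def by (intro Lnorm_mono p shift_op_multiscale f) measurable
  also have "\<dots> \<le> Lnorm p lborel (\<lambda>x. ennreal (cmod (shift_op P h (P_op \<phi> j0 f) x))) +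
    Lnorm p lborel (\<lambda>x. \<Sum>l. ennreal (cmod (shift_op P h (Q_op \<phi> (j0 + int l) f) x)))"
    by (intro Lnorm_add p) measurable
  also have "\<dots> \<le> Lp_norm p lborel (shift_op P h (P_op \<phi> j0 f)) + (\<Sum>l. Lp_norm p lborel (shift_op P h (Q_op \<phi> (j0 + int l) f)))"
    unfolding Lp_norm_def by (intro add_left_mono Lnorm_suminf p) measurable
  finally show ?thesis .
qed

lemma bounded_P_op:
  fixes f :: "real ^ 'n \<Rightarrow> complex"
  assumes "bounded (range f)" shows "\<exists>S. \<forall>x. cmod (P_op \<phi> j f x) \<le> S"
proof -
  obtain B where B: "0 < B" "\<And>s y. cmod (Psi s (y :: real ^ 'n)) \<le> B" using bounded_Psi by auto
  have Bt: "cmod (tensor \<phi> (y :: real ^ 'n)) \<le> B" for y using B(2)[of 0 y] by (simp add: Psi_0)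
  obtain S where S: "0 < S" "\<And>x. cmod (f x) \<le> S" using assms by (auto simp: bounded_pos)
  have "cmod (P_op \<phi> j f x) \<le> (\<Sum>d\<in>(near_zero R :: (int ^ 'n) set). S * B)" for x
    unfolding P_op_eq_synth synth_eq_sum[OF box_supp_tensor]
    by (intro sum_norm_le) (auto simp: norm_mult intro!: mult_mono S Bt less_imp_le[OF S(1)])
  then show ?thesis by blast
qed

text \<open>By Bernstein's inequality the modulus at scale \<open>2\<^sup>-\<^sup>i\<close> of a detail of level \<open>j\<close> is at most a multiple of
  \<open>min 1 2\<^sup>\<rho>\<^sup>(\<^sup>j\<^sup>-\<^sup>i\<^sup>)\<close> times its norm, where \<open>\<rho> = min m r\<^sub>0 > \<sigma>\<close>. Relative to the weights \<open>2\<^sup>\<sigma>\<^sup>i\<close> and \<open>2\<^sup>\<sigma>\<^sup>j\<close> this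
  decays geometrically in \<open>|i - j|\<close>: for \<open>i < j\<close> because \<open>\<sigma> > 0\<close>, for \<open>i > j\<close> because \<open>\<sigma> < \<rho>\<close>.\<close>
lemma besov_expr_le_norm_i:
  assumes p: "1 \<le> p" and q: "1 \<le> q" and \<sigma>: "0 < \<sigma>" "\<sigma> < r0" "\<sigma> < real m" "0 < r0"
    and reg: "(tensor \<phi> :: real ^ 'n \<Rightarrow> complex) \<in> C_real r0"
  shows "\<exists>C>0. \<forall>f :: real ^ 'n \<Rightarrow> complex. f \<in> C_u \<longrightarrow> besov_expr m \<sigma> p q f \<le> ennreal C * norm_i \<phi> p q \<sigma> j0 f"
proof -
  define \<rho> where "\<rho> = min (real m) r0"
  define \<gamma> where "\<gamma> = min \<sigma> (\<rho> - \<sigma>)"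
  have \<rho>: "\<sigma> < \<rho>" "0 < \<rho>" using \<sigma> by (auto simp: \<rho>_def)
  have \<gamma>: "0 < \<gamma>" "\<gamma> \<le> \<sigma>" "\<gamma> \<le> \<rho> - \<sigma>" using \<sigma> \<rho> by (auto simp: \<gamma>_def)
  obtain C1 where C1: "0 < C1" "\<And>c g a t. bounded (range c) \<Longrightarrow> 0 < t \<Longrightarrow> 0 < a \<Longrightarrow>
    g = (\<lambda>x. synth (tensor \<phi> :: real ^ 'n \<Rightarrow> complex) c (a *\<^sub>R x)) \<Longrightarrow>
    modulus m p g t \<le> ennreal (C1 * min 1 ((a * t) powr \<rho>)) * Lp_norm p lborel g"
    using bernstein[OF p reg \<sigma>(4), of m] unfolding \<rho>_def by blast
  obtain C2 where C2: "0 < C2" "\<And>b. Lnorm q (count_space UNIV) (\<lambda>i. \<integral>\<^sup>+j. geom_kernel \<gamma> (i - j) * b j \<partial>count_space UNIV)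
      \<le> ennreal C2 * Lnorm q (count_space (UNIV::int set)) b"
    using geom_convolution[OF \<gamma>(1), of thesis] q by blast
  obtain G where G: "0 < G" "(\<Sum>i. ennreal (2 powr (- \<sigma> * real i))) = ennreal G"
    using geometric_sum_ennreal[OF \<sigma>(1)] by metis
  \<comment> \<open>The Bernstein factor at scale \<open>2\<^sup>-\<^sup>i\<close> for a function of level at most \<open>j + 1\<close>.\<close>
  have kernel: "2 powr (\<sigma> * of_int i) * min 1 ((2 powr of_int (j + 1) * 2 powr (- of_int i)) powr \<rho>)
     \<le> 2 powr \<rho> * (2 powr (- \<gamma> * \<bar>of_int (i - j)\<bar>) * 2 powr (of_int j * \<sigma>))" for i j :: int
  proof (cases "i \<le> j")
    case True
    have "2 powr (\<sigma> * of_int i) * min 1 ((2 powr of_int (j + 1) * 2 powr (- of_int i)) powr \<rho>) \<le> 2 powr (\<sigma> * of_int i) * 1"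
      by (intro mult_left_mono) auto
    also have "\<dots> = 2 powr (- \<sigma> * \<bar>of_int (i - j)\<bar>) * 2 powr (of_int j * \<sigma>)"
      unfolding powr_add[symmetric] using True by (simp add: algebra_simps)
    also have "\<dots> \<le> 2 powr (- \<gamma> * \<bar>of_int (i - j)\<bar>) * 2 powr (of_int j * \<sigma>)"
      using \<gamma> by (intro mult_right_mono powr_mono) auto
    also have "\<dots> \<le> 2 powr \<rho> * (2 powr (- \<gamma> * \<bar>of_int (i - j)\<bar>) * 2 powr (of_int j * \<sigma>))"
    proof -
      have "1 \<le> 2 powr \<rho>" using \<rho> by (intro ge_one_powr_ge_zero) auto
      then have "1 * (2 powr (- \<gamma> * \<bar>of_int (i - j)\<bar>) * 2 powr (of_int j * \<sigma>)) \<le> 2 powr \<rho> * (2 powr (- \<gamma> * \<bar>of_int (i - j)\<bar>) * 2 powr (of_int j * \<sigma>))"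
        by (rule mult_right_mono) simp
      then show ?thesis by (simp only: mult_1_left)
    qed
    finally show ?thesis .
  next
    case False
    have "2 powr (\<sigma> * of_int i) * min 1 ((2 powr of_int (j + 1) * 2 powr (- of_int i)) powr \<rho>) \<le>
        2 powr (\<sigma> * of_int i) * (2 powr of_int (j + 1) * 2 powr (- of_int i)) powr \<rho>"
      by (intro mult_left_mono) auto
    also have "\<dots> = 2 powr \<rho> * (2 powr (- (\<rho> - \<sigma>) * \<bar>of_int (i - j)\<bar>) * 2 powr (of_int j * \<sigma>))"
      unfolding powr_add[symmetric] powr_powr using False by (simp add: algebra_simps)
    also have "\<dots> \<le> 2 powr \<rho> * (2 powr (- \<gamma> * \<bar>of_int (i - j)\<bar>) * 2 powr (of_int j * \<sigma>))"
      using \<gamma> by (intro mult_left_mono mult_right_mono powr_mono) auto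
    finally show ?thesis .
  qed
  define C3 where "C3 = C1 * 2 powr \<rho>"
  have C3: "0 < C3" using C1(1) by (simp add: C3_def)
  \<comment> \<open>\<open>E\<close> is the weight of level \<open>j\<^sub>0\<close>: \<open>P\<^sub>j\<^sub>0 f\<close> is treated like one more detail of that level.\<close>
  define E where "E = 2 powr (of_int j0 * \<sigma>)"
  have E: "0 < E" by (simp add: E_def)
  define D where "D = 2 powr \<sigma> * (C3 * C2)"
  have D: "0 < D" using C3 C2(1) by (simp add: D_def)
  define C where "C = 1 + inverse E * G + D + D * E"
  have Cpos: "0 < C" unfolding C_def using E G(1) D by (intro add_pos_pos) auto
  have "besov_expr m \<sigma> p q f \<le> ennreal C * norm_i \<phi> p q \<sigma> j0 f" if f: "f \<in> C_u" for f :: "real ^ 'n \<Rightarrow> complex"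
  proof -
    have fb: "bounded (range f)" and fc: "continuous_on UNIV f"
      using f by (auto simp: C_u_def uniformly_continuous_imp_continuous)
    let ?X = "Lp_norm p lborel (P_op \<phi> j0 f)"
    let ?L = "\<lambda>j. Lp_norm p lborel (Q_op \<phi> j f)"
    define Y where "Y = Lnorm q (count_space {j0..}) (\<lambda>j. ennreal (2 powr (of_int j * \<sigma>)) * ?L j)"
    have ni: "norm_i \<phi> p q \<sigma> j0 f = ?X + Y" by (simp add: norm_i_def Y_def)
    have modP: "modulus m p (P_op \<phi> j0 f) t \<le> ennreal (C1 * min 1 ((2 powr of_int (j0 + 1) * t) powr \<rho>)) * ?X" if t: "0 < t" for t
    proof -
      have "bounded (range (\<lambda>k. f (dyadic j0 k)))" by (rule bounded_subset[OF fb]) auto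
      then have "modulus m p (P_op \<phi> j0 f) t \<le> ennreal (C1 * min 1 ((2 powi j0 * t) powr \<rho>)) * ?X"
        by (rule C1(2)[OF _ t]) (auto simp: P_op_eq_synth)
      also have "\<dots> \<le> ennreal (C1 * min 1 ((2 powr of_int (j0 + 1) * t) powr \<rho>)) * ?X"
        unfolding two_powi using C1(1) t \<rho>
        by (intro mult_right_mono ennreal_leI mult_left_mono min.mono powr_mono2) auto
      finally show ?thesis .
    qed
    have modQ: "modulus m p (Q_op \<phi> j f) t \<le> ennreal (C1 * min 1 ((2 powr of_int (j + 1) * t) powr \<rho>)) * ?L j" if t: "0 < t" for t j
    proof -
      obtain S where S: "\<And>x. cmod (P_op \<phi> j f x) \<le> S" using bounded_P_op[OF fb] by blast
      obtain S' where S': "\<And>x. cmod (f x) \<le> S'" using fb by (auto simp: bounded_iff)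
      have "bounded (range (\<lambda>K. f (dyadic (j + 1) K) - P_op \<phi> j f (dyadic (j + 1) K)))"
        unfolding bounded_iff by (intro exI[of _ "S' + S"]) (auto intro!: norm_triangle_le_diff add_mono S S')
      then have "modulus m p (Q_op \<phi> j f) t \<le> ennreal (C1 * min 1 ((2 powi (j + 1) * t) powr \<rho>)) * ?L j"
        by (rule C1(2)[OF _ t]) (auto simp: Q_op_eq_synth)
      then show ?thesis unfolding two_powi .
    qed
    define b where "b j = ennreal (2 powr (of_int j * \<sigma>)) * ?L j * indicator {j0..} j + (ennreal E * ?X) * indicator {j0} j" for j
    have kern2: "ennreal (2 powr (\<sigma> * of_int i)) * (ennreal (C1 * min 1 ((2 powr of_int (j + 1) * 2 powr (- of_int i)) powr \<rho>)) * Z)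
        \<le> ennreal C3 * (geom_kernel \<gamma> (i - j) * (ennreal (2 powr (of_int j * \<sigma>)) * Z))" for i j Z
    proof -
      have "ennreal (2 powr (\<sigma> * of_int i)) * (ennreal (C1 * min 1 ((2 powr of_int (j + 1) * 2 powr (- of_int i)) powr \<rho>)) * Z) =
          ennreal (2 powr (\<sigma> * of_int i) * (C1 * min 1 ((2 powr of_int (j + 1) * 2 powr (- of_int i)) powr \<rho>))) * Z"
        using C1(1) by (intro ennreal_mult_mult) auto
      also have "\<dots> \<le> ennreal (C3 * (2 powr (- \<gamma> * \<bar>of_int (i - j)\<bar>) * 2 powr (of_int j * \<sigma>))) * Z"
      proof (intro mult_right_mono ennreal_leI)
        show "2 powr (\<sigma> * of_int i) * (C1 * min 1 ((2 powr of_int (j + 1) * 2 powr (- of_int i)) powr \<rho>)) \<le> C3 * (2 powr (- \<gamma> * \<bar>of_int (i - j)\<bar>) * 2 powr (of_int j * \<sigma>))"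
        proof -
          have "C1 * (2 powr (\<sigma> * of_int i) * min 1 ((2 powr of_int (j + 1) * 2 powr (- of_int i)) powr \<rho>)) \<le>
              C1 * (2 powr \<rho> * (2 powr (- \<gamma> * \<bar>of_int (i - j)\<bar>) * 2 powr (of_int j * \<sigma>)))"
            by (rule mult_left_mono[OF kernel]) (use C1(1) in simp)
          then show ?thesis unfolding C3_def by (simp only: mult.assoc mult.left_commute)
        qed
      qed simp
      also have "\<dots> = ennreal C3 * (geom_kernel \<gamma> (i - j) * (ennreal (2 powr (of_int j * \<sigma>)) * Z))"
        unfolding geom_kernel_def
        by (simp only: ennreal_mult_mult powr_ge_zero mult_nonneg_nonneg less_imp_le[OF C3])
      finally show ?thesis .
    qed
    have seq: "mod_seq m \<sigma> p f i \<le> ennreal C3 * (\<integral>\<^sup>+j. geom_kernel \<gamma> (i - j) * b j \<partial>count_space UNIV)" for i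
    proof -
      let ?t = "2 powr (- of_int i) :: real"
      let ?k = "\<lambda>j. geom_kernel \<gamma> (i - j) * (ennreal (2 powr (of_int j * \<sigma>)) * ?L j)"
      have "modulus m p f ?t \<le> modulus m p (P_op \<phi> j0 f) ?t + (\<Sum>l. modulus m p (Q_op \<phi> (j0 + int l) f) ?t)"
      proof (rule modulus_leI)
        fix h :: "real ^ 'n" assume h: "norm h \<le> ?t"
        show "Lp_norm p lborel (diff_op m h f) \<le> modulus m p (P_op \<phi> j0 f) ?t + (\<Sum>l. modulus m p (Q_op \<phi> (j0 + int l) f) ?t)"
          by (rule order_trans[OF Lp_norm_multiscale[OF p fc, of "[:-1, 1:] ^ m" h j0]])
            (intro add_mono suminf_le modulus_ge h summableI)
      qed
      also have "\<dots> \<le> ennreal (C1 * min 1 ((2 powr of_int (j0 + 1) * ?t) powr \<rho>)) * ?X +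
          (\<Sum>l. ennreal (C1 * min 1 ((2 powr of_int (j0 + int l + 1) * ?t) powr \<rho>)) * ?L (j0 + int l))"
        by (intro add_mono suminf_le modP modQ) auto
      finally have "mod_seq m \<sigma> p f i \<le> ennreal (2 powr (\<sigma> * of_int i)) * (ennreal (C1 * min 1 ((2 powr of_int (j0 + 1) * ?t) powr \<rho>)) * ?X +
          (\<Sum>l. ennreal (C1 * min 1 ((2 powr of_int (j0 + int l + 1) * ?t) powr \<rho>)) * ?L (j0 + int l)))"
        unfolding mod_seq_def by (rule mult_left_mono) simp
      also have "\<dots> = ennreal (2 powr (\<sigma> * of_int i)) * (ennreal (C1 * min 1 ((2 powr of_int (j0 + 1) * ?t) powr \<rho>)) * ?X) +
          (\<Sum>l. ennreal (2 powr (\<sigma> * of_int i)) * (ennreal (C1 * min 1 ((2 powr of_int (j0 + int l + 1) * ?t) powr \<rho>)) * ?L (j0 + int l)))"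
        by (simp only: distrib_left ennreal_suminf_cmult)
      also have "\<dots> \<le> ennreal C3 * (geom_kernel \<gamma> (i - j0) * (ennreal (2 powr (of_int j0 * \<sigma>)) * ?X)) + (\<Sum>l. ennreal C3 * ?k (j0 + int l))"
        by (intro add_mono suminf_le kern2) auto
      also have "(\<Sum>l. ennreal C3 * ?k (j0 + int l)) = ennreal C3 * (\<integral>\<^sup>+j. ?k j * indicator {j0..} j \<partial>count_space UNIV)"
        unfolding ennreal_suminf_cmult suminf_int_shift[of ?k j0, symmetric] ..
      also have "geom_kernel \<gamma> (i - j0) * (ennreal (2 powr (of_int j0 * \<sigma>)) * ?X) =
          (\<integral>\<^sup>+j. geom_kernel \<gamma> (i - j0) * (ennreal E * ?X) * indicator {j0} j \<partial>count_space UNIV)"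
        by (subst nn_integral_cmult_indicator) (auto simp: E_def)
      also have "ennreal C3 * (\<integral>\<^sup>+j. geom_kernel \<gamma> (i - j0) * (ennreal E * ?X) * indicator {j0} j \<partial>count_space UNIV) + ennreal C3 * (\<integral>\<^sup>+j. ?k j * indicator {j0..} j \<partial>count_space UNIV)
          = ennreal C3 * (\<integral>\<^sup>+j. geom_kernel \<gamma> (i - j0) * (ennreal E * ?X) * indicator {j0} j + ?k j * indicator {j0..} j \<partial>count_space UNIV)"
        by (subst nn_integral_add) (auto simp: distrib_left)
      also have "(\<lambda>j. geom_kernel \<gamma> (i - j0) * (ennreal E * ?X) * indicator {j0} j + ?k j * indicator {j0..} j) = (\<lambda>j. geom_kernel \<gamma> (i - j) * b j)"
      proof
        fix j
        have "geom_kernel \<gamma> (i - j0) * (ennreal E * ?X) * indicator {j0} j = geom_kernel \<gamma> (i - j) * ((ennreal E * ?X) * indicator {j0} j)"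
          by (cases "j = j0") auto
        then show "geom_kernel \<gamma> (i - j0) * (ennreal E * ?X) * indicator {j0} j + ?k j * indicator {j0..} j = geom_kernel \<gamma> (i - j) * b j"
          unfolding b_def distrib_left by (simp only: mult.assoc add.commute)
      qed
      finally show ?thesis .
    qed
    have bnorm: "Lnorm q (count_space UNIV) b \<le> Y + ennreal E * ?X"
    proof -
      have "Lnorm q (count_space UNIV) b \<le> Lnorm q (count_space UNIV) (\<lambda>j. ennreal (2 powr (of_int j * \<sigma>)) * ?L j * indicator {j0..} j) +
          Lnorm q (count_space UNIV) (\<lambda>j. (ennreal E * ?X) * indicator {j0} j)"
        unfolding b_def by (intro Lnorm_add q) auto
      also have "\<dots> \<le> Y + ennreal E * ?X"
        unfolding Y_def Lnorm_count_indicator[OF q, of "{j0..}"] by (intro add_mono order_refl Lnorm_point q)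
      finally show ?thesis .
    qed
    have "Lnorm q (count_space {0..}) (mod_seq m \<sigma> p f) \<le> Lnorm q (count_space UNIV) (mod_seq m \<sigma> p f)"
      using Lnorm_count_inj_le[OF q, of "\<lambda>i. i" "{0..}" UNIV "mod_seq m \<sigma> p f"] by simp
    also have "\<dots> \<le> Lnorm q (count_space UNIV) (\<lambda>i. ennreal C3 * (\<integral>\<^sup>+j. geom_kernel \<gamma> (i - j) * b j \<partial>count_space UNIV))"
      by (intro Lnorm_mono q seq) simp
    also have "\<dots> \<le> ennreal C3 * Lnorm q (count_space UNIV) (\<lambda>i. \<integral>\<^sup>+j. geom_kernel \<gamma> (i - j) * b j \<partial>count_space UNIV)"
      by (intro Lnorm_cmult_le q) simp
    also have "\<dots> \<le> ennreal C3 * (ennreal C2 * (Y + ennreal E * ?X))"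
      by (intro mult_left_mono order_trans[OF C2(2) mult_left_mono[OF bnorm]]) auto
    finally have seqn: "ennreal (2 powr \<sigma>) * Lnorm q (count_space {0..}) (mod_seq m \<sigma> p f) \<le> ennreal (2 powr \<sigma>) * (ennreal C3 * (ennreal C2 * (Y + ennreal E * ?X)))"
      by (rule mult_left_mono) simp
    also have "\<dots> = ennreal D * (Y + ennreal E * ?X)"
      unfolding D_def using C3 C2(1) by (simp add: ennreal_mult_mult)
    also have "\<dots> = ennreal D * Y + ennreal (D * E) * ?X"
      using D E by (simp only: distrib_left ennreal_mult_mult less_imp_le)
    finally have part2: "ennreal (2 powr \<sigma>) * Lnorm q (count_space {0..}) (mod_seq m \<sigma> p f) \<le> ennreal D * Y + ennreal (D * E) * ?X" .
    have "Lp_norm p lborel f \<le> ?X + (\<Sum>l. ?L (j0 + int l))"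
      using Lp_norm_multiscale[OF p fc, of 1 0 j0] by simp
    also have "(\<Sum>l. ?L (j0 + int l)) \<le> (\<Sum>l. ennreal (inverse E) * (ennreal (2 powr (- \<sigma> * real l)) * Y))"
    proof (rule suminf_le)
      fix l
      have "ennreal (2 powr (of_int (j0 + int l) * \<sigma>)) * ?L (j0 + int l) \<le> Y"
        unfolding Y_def by (rule Lnorm_count_ge[OF q, of "j0 + int l" "{j0..}" "\<lambda>j. ennreal (2 powr (of_int j * \<sigma>)) * ?L j"]) simp
      then have "ennreal (inverse E) * (ennreal (2 powr (- \<sigma> * real l)) * (ennreal (2 powr (of_int (j0 + int l) * \<sigma>)) * ?L (j0 + int l))) \<le> ennreal (inverse E) * (ennreal (2 powr (- \<sigma> * real l)) * Y)"
        by (intro mult_left_mono) auto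
      moreover have "ennreal (inverse E) * (ennreal (2 powr (- \<sigma> * real l)) * (ennreal (2 powr (of_int (j0 + int l) * \<sigma>)) * Z)) = Z" for Z
      proof -
        have "inverse E * (2 powr (- \<sigma> * real l) * 2 powr (of_int (j0 + int l) * \<sigma>)) = 1"
          unfolding E_def powr_minus[symmetric] powr_add[symmetric] by (simp add: algebra_simps)
        moreover have "ennreal (inverse E) * (ennreal (2 powr (- \<sigma> * real l)) * (ennreal (2 powr (of_int (j0 + int l) * \<sigma>)) * Z)) =
            ennreal (inverse E * (2 powr (- \<sigma> * real l) * 2 powr (of_int (j0 + int l) * \<sigma>))) * Z"
          using E by (simp add: ennreal_mult_mult mult.assoc)
        ultimately show ?thesis by simp
      qed
      ultimately show "?L (j0 + int l) \<le> ennreal (inverse E) * (ennreal (2 powr (- \<sigma> * real l)) * Y)" by simp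
    qed auto
    also have "\<dots> = ennreal (inverse E) * (ennreal G * Y)"
      by (simp only: ennreal_suminf_cmult ennreal_suminf_multc G(2))
    also have "\<dots> = ennreal (inverse E * G) * Y" using E G(1) by (intro ennreal_mult_mult) auto
    finally have part1: "Lp_norm p lborel f \<le> ?X + ennreal (inverse E * G) * Y" by (simp add: add_left_mono)
    have "besov_expr m \<sigma> p q f \<le> (?X + ennreal (inverse E * G) * Y) + (ennreal D * Y + ennreal (D * E) * ?X)"
      by (rule order_trans[OF besov_expr_le_mod_seq[OF q \<sigma>(1)] add_mono[OF part1 part2]])
    also have "\<dots> = (ennreal 1 * ?X + ennreal (D * E) * ?X) + (ennreal (inverse E * G) * Y + ennreal D * Y)"
      by (simp add: add_ac)
    also have "\<dots> = ennreal (1 + D * E) * ?X + ennreal (inverse E * G + D) * Y"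
    proof -
      have "0 \<le> D * E" "0 \<le> inverse E * G" "0 \<le> D" using D E G(1) by auto
      then show ?thesis by (simp only: distrib_right[symmetric] ennreal_plus[symmetric] zero_le_one)
    qed
    also have "\<dots> \<le> ennreal C * ?X + ennreal C * Y"
    proof -
      have "0 \<le> D * E" "0 \<le> inverse E * G" using D E G(1) by auto
      then have "1 + D * E \<le> C" "inverse E * G + D \<le> C" unfolding C_def using D by linarith+
      then show ?thesis by (intro add_mono[of "ennreal (1 + D * E) * ?X"] mult_right_mono ennreal_leI) auto
    qed
    also have "\<dots> = ennreal C * norm_i \<phi> p q \<sigma> j0 f" unfolding ni by (simp only: distrib_left)
    finally show ?thesis .
  qed
  with Cpos show ?thesis by blast
qed

end

section \<open>The equivalence theorem\<close>

lemma ext_seminorm_on_Lp_norm: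
  assumes "1 \<le> p" and "\<And>f. f \<in> E \<Longrightarrow> L f \<in> borel_measurable M"
    and "\<And>f g x. f \<in> E \<Longrightarrow> g \<in> E \<Longrightarrow> L (\<lambda>x. f x + g x) x = L f x + L g x"
    and "\<And>c f x. f \<in> E \<Longrightarrow> L (\<lambda>x. c * f x) x = c * L f x"
  shows "ext_seminorm_on E (\<lambda>f. Lp_norm p M (L f))"
proof -
  have "L (\<lambda>x. f x + g x) = (\<lambda>x. L f x + L g x)" if "f \<in> E" "g \<in> E" for f g
    using assms(3) that by auto
  moreover have "L (\<lambda>x. c * f x) = (\<lambda>x. c * L f x)" if "f \<in> E" for c f
    using assms(4) that by auto
  ultimately show ?thesis
    unfolding ext_seminorm_on_def using assms(1,2) by (simp add: Lp_norm_add Lp_norm_cmult)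
qed

lemma ext_seminorm_on_add:
  assumes "ext_seminorm_on E N" "ext_seminorm_on E N'"
  shows "ext_seminorm_on E (\<lambda>f. N f + N' f)"
  unfolding ext_seminorm_on_def
proof (intro conjI ballI allI)
  fix f g assume "f \<in> E" "g \<in> E"
  then have "N (\<lambda>x. f x + g x) + N' (\<lambda>x. f x + g x) \<le> (N f + N g) + (N' f + N' g)"
    using assms unfolding ext_seminorm_on_def by (intro add_mono) auto
  then show "N (\<lambda>x. f x + g x) + N' (\<lambda>x. f x + g x) \<le> N f + N' f + (N g + N' g)"
    by (simp only: add_ac)
next
  fix c f assume "f \<in> E"
  then show "N (\<lambda>x. c * f x) + N' (\<lambda>x. c * f x) = ennreal (cmod c) * (N f + N' f)"
    using assms unfolding ext_seminorm_on_def by (simp add: distrib_left)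
qed

lemma ext_seminorm_on_lq:
  assumes q: "1 \<le> q" and N: "\<And>j. ext_seminorm_on E (N j)"
  shows "ext_seminorm_on E (\<lambda>f. Lnorm q (count_space A) (\<lambda>j. w j * N j f))"
  unfolding ext_seminorm_on_def
proof (intro conjI ballI allI)
  fix f g assume fg: "f \<in> E" "g \<in> E"
  have "Lnorm q (count_space A) (\<lambda>j. w j * N j (\<lambda>x. f x + g x)) \<le>
      Lnorm q (count_space A) (\<lambda>j. w j * N j f + w j * N j g)"
  proof (intro Lnorm_mono q)
    fix j
    have "N j (\<lambda>x. f x + g x) \<le> N j f + N j g" using N fg unfolding ext_seminorm_on_def by auto
    then show "w j * N j (\<lambda>x. f x + g x) \<le> w j * N j f + w j * N j g"
      unfolding distrib_left[symmetric] by (rule mult_left_mono) simp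
  qed simp
  also have "\<dots> \<le> Lnorm q (count_space A) (\<lambda>j. w j * N j f) + Lnorm q (count_space A) (\<lambda>j. w j * N j g)"
    by (intro Lnorm_add q) auto
  finally show "Lnorm q (count_space A) (\<lambda>j. w j * N j (\<lambda>x. f x + g x)) \<le>
    Lnorm q (count_space A) (\<lambda>j. w j * N j f) + Lnorm q (count_space A) (\<lambda>j. w j * N j g)" .
next
  fix c f assume f: "f \<in> E"
  have "w j * N j (\<lambda>x. c * f x) = ennreal (cmod c) * (w j * N j f)" for j
    using N f unfolding ext_seminorm_on_def by (simp add: mult.left_commute)
  then show "Lnorm q (count_space A) (\<lambda>j. w j * N j (\<lambda>x. c * f x)) =
      ennreal (cmod c) * Lnorm q (count_space A) (\<lambda>j. w j * N j f)"
    by (simp add: Lnorm_cmult q)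
qed

lemma C_u_continuous: "f \<in> C_u \<Longrightarrow> continuous_on UNIV f"
  unfolding C_u_def by (auto intro: uniformly_continuous_imp_continuous)

lemma fun_subspace_C_u: "fun_subspace (C_u :: (real ^ 'n \<Rightarrow> complex) set)"
  unfolding fun_subspace_def
proof (intro conjI ballI allI)
  show "(\<lambda>x. 0) \<in> (C_u :: (real ^ 'n \<Rightarrow> complex) set)"
    by (auto simp: C_u_def intro: uniformly_continuous_on_const)
next
  fix f g :: "real ^ 'n \<Rightarrow> complex" assume "f \<in> C_u" "g \<in> C_u"
  then show "(\<lambda>x. f x + g x) \<in> C_u"
    unfolding C_u_def by (auto intro!: bounded_plus_comp uniformly_continuous_on_add)
next
  fix c and f :: "real ^ 'n \<Rightarrow> complex" assume "f \<in> C_u"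
  then show "(\<lambda>x. c * f x) \<in> C_u"
    unfolding C_u_def
    by (auto intro!: bounded_linear.uniformly_continuous_on[OF bounded_linear_mult_right]
      bounded_linear_image[OF _ bounded_linear_mult_right, of "range f" c, unfolded image_image])
qed

text \<open>A continuous function that vanishes almost everywhere vanishes, so on continuous functions the
  \<open>L\<^sup>p\<close> part of the Besov expression alone is already definite.\<close>
lemma continuous_Lp_norm_eq_0:
  fixes f :: "real ^ 'n \<Rightarrow> complex"
  assumes p: "1 \<le> p" and f: "continuous_on UNIV f" and 0: "Lp_norm p lborel f = 0"
  shows "f = (\<lambda>x. 0)"
proof -
  have [measurable]: "f \<in> borel_measurable borel" using f by (rule borel_measurable_continuous_onI)
  have "Lp_norm top lborel f \<le> 0"
    using p
  proof (cases p rule: exponent_cases)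
    case infinite
    then show ?thesis using 0 by simp
  next
    case (finite r)
    have "(\<integral>\<^sup>+x. ennreal (cmod (f x)) \<partial>lborel) = 0 \<or> (AE x in lborel. ennreal_powr (ennreal (cmod (f x))) r = 0)"
    proof -
      have "ennreal_powr (\<integral>\<^sup>+x. ennreal_powr (ennreal (cmod (f x))) r \<partial>lborel) (1/r) = 0"
        using 0 finite by (simp add: Lp_norm_def Lnorm_finite)
      then have "ennreal_powr (ennreal_powr (\<integral>\<^sup>+x. ennreal_powr (ennreal (cmod (f x))) r \<partial>lborel) (1/r)) r = 0"
        by simp
      then have "(\<integral>\<^sup>+x. ennreal_powr (ennreal (cmod (f x))) r \<partial>lborel) = 0"
        using finite(2) by (simp add: ennreal_powr_powr)
      then show ?thesis by (subst (asm) nn_integral_0_iff_AE) auto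
    qed
    then have "AE x in lborel. ennreal (cmod (f x)) = 0"
    proof
      assume "(\<integral>\<^sup>+x. ennreal (cmod (f x)) \<partial>lborel) = 0"
      then show ?thesis by (subst (asm) nn_integral_0_iff_AE) auto
    next
      assume "AE x in lborel. ennreal_powr (ennreal (cmod (f x))) r = 0"
      then show ?thesis by eventually_elim (simp add: ennreal_powr_ennreal)
    qed
    then have "AE x in lborel. ennreal (cmod (f x)) \<le> 0" by eventually_elim simp
    then show ?thesis unfolding Lp_norm_def by (subst Lnorm_infinity_le_iff) auto
  qed
  then have "ennreal (cmod (f x)) \<le> 0" for x
    using continuous_le_esssup[OF f, of x] by (rule order_trans[rotated])
  then show ?thesis by (auto simp: ennreal_eq_0_iff)
qed

text \<open>Everything follows formally from a two-sided estimate by the Besov expression: such an \<open>N\<close> is finite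
  exactly on the Besov functions, and it inherits definiteness.\<close>
lemma equivalent_characterizes:
  fixes N besov_norm :: "(real ^ 'n \<Rightarrow> complex) \<Rightarrow> ennreal"
  assumes p: "1 \<le> p" and semi: "ext_seminorm_on C_u N"
    and upper: "0 < C" "\<And>f. f \<in> C_u \<Longrightarrow> N f \<le> ennreal C * besov_expr m \<sigma> p q f"
    and lower: "0 < D" "\<And>f. f \<in> C_u \<Longrightarrow> besov_expr m \<sigma> p q f \<le> ennreal D * N f"
    and besov: "is_besov_norm m \<sigma> p q besov_norm"
    and B: "B = besov_space m \<sigma> p q \<inter> C_u"
  shows "equivalent_on B besov_norm N" "characterizes N B C_u"
proof -
  have B_iff: "f \<in> B \<longleftrightarrow> f \<in> C_u \<and> N f < \<infinity>" for f
  proof -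
    have "besov_expr m \<sigma> p q f < \<infinity> \<longleftrightarrow> N f < \<infinity>" if "f \<in> C_u"
      using upper(2)[OF that] lower(2)[OF that]
      by (auto intro: le_less_trans simp: ennreal_mult_less_top)
    then show ?thesis
      unfolding B besov_space_def by (auto intro: borel_measurable_continuous_onI C_u_continuous)
  qed
  have definite: "f = (\<lambda>x. 0)" if f: "f \<in> C_u" and 0: "N f = 0" for f
  proof (rule continuous_Lp_norm_eq_0[OF p C_u_continuous[OF f]])
    have "besov_expr m \<sigma> p q f = 0" using lower(2)[OF f] 0 by simp
    then show "Lp_norm p lborel f = 0" by (simp add: besov_expr_def)
  qed
  have "fun_subspace B"
    unfolding fun_subspace_def
  proof (intro conjI ballI allI)
    have z: "(\<lambda>x. 0) \<in> (C_u :: (real ^ 'n \<Rightarrow> complex) set)" using fun_subspace_C_u[where 'n='n] by (simp add: fun_subspace_def)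
    have "N (\<lambda>x. 0 * 0) = ennreal (cmod 0) * N (\<lambda>x. 0)"
      by (rule semi[unfolded ext_seminorm_on_def, THEN conjunct2, rule_format, OF z])
    then show "(\<lambda>x. 0) \<in> B" using z by (simp add: B_iff)
  next
    fix f g assume "f \<in> B" "g \<in> B"
    moreover from this have "N (\<lambda>x. f x + g x) \<le> N f + N g" using semi by (auto simp: ext_seminorm_on_def B_iff)
    ultimately show "(\<lambda>x. f x + g x) \<in> B"
      using fun_subspace_C_u[where 'n='n] by (auto simp: fun_subspace_def B_iff intro: le_less_trans)
  next
    fix c f assume f: "f \<in> B"
    moreover from this have "N (\<lambda>x. c * f x) = ennreal (cmod c) * N f" using semi by (auto simp: ext_seminorm_on_def B_iff)
    ultimately show "(\<lambda>x. c * f x) \<in> B"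
      using fun_subspace_C_u[where 'n='n] by (auto simp: fun_subspace_def B_iff ennreal_mult_less_top)
  qed
  moreover have "N f = \<infinity>" if "f \<in> C_u - B" for f
    using that top.not_eq_extremum[of "N f"] by (auto simp: B_iff)
  ultimately show "characterizes N B C_u"
    unfolding characterizes_def ext_norm_on_def using semi definite by (auto simp: B_iff)
  obtain a A where a: "0 < a" "0 < A" and aA: "\<And>f. f \<in> besov_space m \<sigma> p q \<Longrightarrow>
      ennreal a * besov_expr m \<sigma> p q f \<le> besov_norm f \<and> besov_norm f \<le> ennreal A * besov_expr m \<sigma> p q f"
    using besov unfolding is_besov_norm_def equivalent_on_def by blast
  show "equivalent_on B besov_norm N"
    unfolding equivalent_on_def
  proof (rule exI[of _ "1 / (A * D)"], intro conjI, goal_cases)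
    case 2
    have "ennreal (1 / (A * D)) * besov_norm f \<le> N f \<and> N f \<le> ennreal (C / a) * besov_norm f"
      if f: "f \<in> B" for f
    proof
      have fB: "f \<in> besov_space m \<sigma> p q" "f \<in> C_u" using f B by auto
      have "besov_norm f \<le> ennreal A * (ennreal D * N f)"
        by (rule order_trans[OF conjunct2[OF aA[OF fB(1)]] mult_left_mono[OF lower(2)[OF fB(2)]]]) simp
      then have "ennreal (1 / (A * D)) * besov_norm f \<le> ennreal (1 / (A * D)) * (ennreal A * (ennreal D * N f))"
        by (rule mult_left_mono) simp
      also have "\<dots> = (ennreal (1 / (A * D)) * (ennreal A * ennreal D)) * N f" by (simp only: mult.assoc)
      also have "ennreal (1 / (A * D)) * (ennreal A * ennreal D) = 1"
        using a lower(1) by (simp flip: ennreal_mult)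
      finally show "ennreal (1 / (A * D)) * besov_norm f \<le> N f" by simp
      have "N f \<le> ennreal C * besov_expr m \<sigma> p q f" by (rule upper(2)[OF fB(2)])
      also have "ennreal C = ennreal (C / a) * ennreal a"
        using a upper(1) by (simp flip: ennreal_mult)
      also have "ennreal (C / a) * ennreal a * besov_expr m \<sigma> p q f = ennreal (C / a) * (ennreal a * besov_expr m \<sigma> p q f)"
        by (rule mult.assoc)
      also have "\<dots> \<le> ennreal (C / a) * besov_norm f"
        using aA[OF fB(1)] by (intro mult_left_mono) auto
      finally show "N f \<le> ennreal (C / a) * besov_norm f" .
    qed
    moreover have "0 < C / a" using a upper(1) by simp
    ultimately show ?case by blast
  qed (use a lower(1) in auto)
qed

context scaling
begin

lemma P_op_add: "P_op \<phi> j (\<lambda>x. f x + g x) x = P_op \<phi> j f x + P_op \<phi> j g x"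
  by (simp only: P_op_eq_synth synth_add[OF box_supp_tensor])

lemma P_op_cmult: "P_op \<phi> j (\<lambda>x. c * f x) x = c * P_op \<phi> j f x"
  by (simp only: P_op_eq_synth synth_cmult)

lemma ext_seminorm_on_norm_i:
  assumes "1 \<le> p" "1 \<le> q"
  shows "ext_seminorm_on (E :: (real ^ 'n \<Rightarrow> complex) set) (norm_i \<phi> p q \<sigma> j0)"
proof -
  have "ext_seminorm_on E (\<lambda>f. Lp_norm p lborel (P_op \<phi> j f))" for j
    by (rule ext_seminorm_on_Lp_norm) (auto simp: assms P_op_add P_op_cmult)
  moreover have "ext_seminorm_on E (\<lambda>f. Lp_norm p lborel (Q_op \<phi> j f))" for j
    by (rule ext_seminorm_on_Lp_norm)
      (auto simp: assms Q_op_measurable, auto simp: Q_op_def P_op_add P_op_cmult algebra_simps)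
  ultimately show ?thesis
    unfolding norm_i_def[abs_def] by (intro ext_seminorm_on_add ext_seminorm_on_lq assms)
qed

lemma dual_wavelet_eq_sum:
  "dual_wavelet \<phi> s j k f = (\<Sum>l | dual_filter_tensor \<phi> s l \<noteq> 0.
    dual_filter_tensor \<phi> s l * f (dyadic (j + 1) (\<chi> i. 2 * k $ i + l $ i)))"
  unfolding dual_wavelet_def by (rule infsum_finite_support[OF finite_dual_filter_tensor]) simp

lemma dual_wavelet_add: "dual_wavelet \<phi> s j k (\<lambda>x. f x + g x) = dual_wavelet \<phi> s j k f + dual_wavelet \<phi> s j k g"
  by (simp only: dual_wavelet_eq_sum distrib_left sum.distrib)

lemma dual_wavelet_cmult: "dual_wavelet \<phi> s j k (\<lambda>x. c * f x) = c * dual_wavelet \<phi> s j k f"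
  by (simp only: dual_wavelet_eq_sum sum_distrib_left mult.left_commute[of _ c])

lemma ext_seminorm_on_norm_w:
  assumes "1 \<le> p" "1 \<le> q"
  shows "ext_seminorm_on (E :: (real ^ 'n \<Rightarrow> complex) set) (norm_w \<phi> p q \<sigma> j0)"
proof -
  have "ext_seminorm_on E (\<lambda>f. Lp_norm p (count_space UNIV) (\<lambda>k. dual_scaling j k f))" for j
    by (rule ext_seminorm_on_Lp_norm) (auto simp: assms dual_scaling_def)
  moreover have "ext_seminorm_on E (\<lambda>f. Lp_norm p (count_space (J_plus \<times> UNIV)) (\<lambda>(s, k). dual_wavelet \<phi> s j k f))" for j
    by (rule ext_seminorm_on_Lp_norm) (auto simp: assms dual_wavelet_add dual_wavelet_cmult)
  ultimately show ?thesis
    unfolding norm_w_def[abs_def] by (intro ext_seminorm_on_add ext_seminorm_on_lq assms)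
qed

end

lemma scaling_exists:
  assumes "interpolating_scaling \<phi>"
  obtains R where "scaling \<phi> R"
proof -
  have "compact (closure {x. \<phi> x \<noteq> 0})"
    using assms unfolding interpolating_scaling_def by (elim conjE)
  then have "bounded (closure {x. \<phi> x \<noteq> 0})" by (rule compact_imp_bounded)
  then obtain b where b: "\<And>x. x \<in> closure {x. \<phi> x \<noteq> 0} \<Longrightarrow> \<bar>x\<bar> \<le> b"
    unfolding bounded_iff real_norm_def by (elim exE) (rule that, erule bspec)
  have "\<bar>x\<bar> < real (nat \<lceil>b\<rceil> + 1)" if "\<phi> x \<noteq> 0" for x
  proof -
    have "x \<in> closure {x. \<phi> x \<noteq> 0}" using that by (intro subsetD[OF closure_subset]) simp
    then have "\<bar>x\<bar> \<le> b" by (rule b)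
    then show ?thesis using real_nat_ceiling_ge[of b] by linarith
  qed
  then have "scaling \<phi> (nat \<lceil>b\<rceil> + 1)" by (rule scaling.intro[OF assms])
  then show ?thesis by (rule that)
qed

theorem theorem9p34:
  fixes \<phi> :: "real \<Rightarrow> complex"
    and p q :: ennreal
    and \<sigma> r0 :: real
    and j0 :: int
    and m :: nat
    and besov_norm :: "(real ^ 'n \<Rightarrow> complex) \<Rightarrow> ennreal"
    and B :: "(real ^ 'n \<Rightarrow> complex) set"
  assumes "1 \<le> p" and "1 \<le> q" and "0 < \<sigma>" and "0 < r0"
    and "real CARD('n) * recip p < \<sigma>" and "\<sigma> < r0"
    and "interpolating_scaling \<phi>"
    and "(tensor \<phi> :: real ^ 'n \<Rightarrow> complex) \<in> C_real r0"
    and "\<sigma> < real m"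
    and "is_besov_norm m \<sigma> p q besov_norm"
    and "B = besov_space m \<sigma> p q \<inter> C_u"
  shows "equivalent_on B besov_norm (norm_i \<phi> p q \<sigma> j0) \<and>
    equivalent_on B besov_norm (norm_w \<phi> p q \<sigma> j0) \<and>
    characterizes (norm_i \<phi> p q \<sigma> j0) B C_u \<and>
    characterizes (norm_w \<phi> p q \<sigma> j0) B C_u"
proof -
  obtain R where "scaling \<phi> R" using scaling_exists \<open>interpolating_scaling \<phi>\<close> by blast
  then interpret scaling \<phi> R .
  note p = \<open>1 \<le> p\<close> and q = \<open>1 \<le> q\<close>
  define N where "N = nat \<lfloor>r0\<rfloor>"
  obtain u H where u: "u 0 = \<phi>" "\<And>b z. b < N \<Longrightarrow> (u b has_vector_derivative u (Suc b) z) (at z)"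
    "\<And>b. b \<le> N \<Longrightarrow> continuous_on UNIV (u b)"
    using regularity[OF assms(8) \<open>0 < r0\<close> N_def] by blast
  obtain rr where rr: "filter_poly = [:-1, 1:] ^ Suc N * rr"
    by (rule vanishing_moments[of u N, OF u(1,2) u(3)[OF order_refl]])
  have M: "\<sigma> < real (Suc N)"
    using \<open>\<sigma> < r0\<close> \<open>0 < r0\<close> unfolding N_def by linarith
  obtain C1 where C1: "0 < C1" "\<And>f :: real ^ 'n \<Rightarrow> complex. f \<in> C_u \<Longrightarrow>
      norm_w \<phi> p q \<sigma> j0 f \<le> ennreal C1 * besov_expr m \<sigma> p q f"
    using norm_w_le_besov_expr[OF p q \<open>0 < \<sigma>\<close> assms(5) M rr, of j0 m] C_u_continuous by blast
  obtain C2 where C2: "0 < C2" "\<And>f :: real ^ 'n \<Rightarrow> complex.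
      norm_i \<phi> p q \<sigma> j0 f \<le> ennreal C2 * norm_w \<phi> p q \<sigma> j0 f"
    using norm_i_le_norm_w[OF p q, of \<sigma> j0] by blast
  obtain C3 where C3: "0 < C3" "\<And>f :: real ^ 'n \<Rightarrow> complex. f \<in> C_u \<Longrightarrow>
      besov_expr m \<sigma> p q f \<le> ennreal C3 * norm_i \<phi> p q \<sigma> j0 f"
    using besov_expr_le_norm_i[OF p q \<open>0 < \<sigma>\<close> \<open>\<sigma> < r0\<close> \<open>\<sigma> < real m\<close> \<open>0 < r0\<close> assms(8), of j0] by blast
  have i: "norm_i \<phi> p q \<sigma> j0 f \<le> ennreal (C2 * C1) * besov_expr m \<sigma> p q f"
    if "f \<in> C_u" for f :: "real ^ 'n \<Rightarrow> complex"
    using order_trans[OF C2(2) mult_left_mono[OF C1(2)[OF that]]] C1(1) C2(1)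
    by (simp add: ennreal_mult mult.assoc)
  have w: "besov_expr m \<sigma> p q f \<le> ennreal (C3 * C2) * norm_w \<phi> p q \<sigma> j0 f"
    if "f \<in> C_u" for f :: "real ^ 'n \<Rightarrow> complex"
    using order_trans[OF C3(2)[OF that] mult_left_mono[OF C2(2)]] C2(1) C3(1)
    by (simp add: ennreal_mult mult.assoc)
  note general = equivalent_characterizes[OF p _ _ _ _ _ assms(10,11)]
  show ?thesis
    using general[OF ext_seminorm_on_norm_i[OF p q] _ i C3]
      general[OF ext_seminorm_on_norm_w[OF p q] C1 _ w] C1(1) C2(1) C3(1) by simp
qed

end
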